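(* Let $M$ be a closed oriented manifold. (1) If $M$ is universally enlargeable, then $M$ is macroscopically large, i.e. $[\widetilde M]_X\neq 0$ in $HX_*(\widetilde M;\mathbb{Q})$. (2) If $M$ is macroscopically large, then $M$ is essential in rational homology, i.e. $c_*([M])\neq 0$ in $H_*(B\pi_1(M);\mathbb{Q})$, where $c\colon M\to B\pi_1(M)$ is the classifying map of the universal covering of $M$.
   Context: Manifolds are connected and smooth; $\widetilde M\to M$ denotes the universal covering. Fix a Riemannian metric on $M$; all covering spaces of $M$ carry the pullback metric. Universally enlargeable: a closed oriented manifold $M$ of dimension $n$ is universally enlargeable if for every $\epsilon>0$ there is an $\epsilon$-contracting (i.e. $\epsilon$-Lipschitz) map $f_\epsilon\colon\widetilde M\to (S^n,g_{can})$ to the $n$-sphere with its canonical metric, which is constant outside a compact set and is of nonzero degree. (This does not depend on the metric on $M$, which is only required to be independent of $\epsilon$.) Locally finite homology: for a topological space $X$, $H^{lf}_*(X;\mathbb{Q})$ is the homology of the complex of infinite rational linear combinations of singular simplices such that each compact set in $X$ is met by only finitely many simplices. It is functorial for proper continuous maps. Coarse homology: for a proper metric space $X$, a coarsening sequence is a sequence $\mathfrak{U}_1,\mathfrak{U}_2,\dots$ of locally finite open covers of $X$ for which there are numbers $R_i\to\infty$ such that every member of $\mathfrak{U}_i$ has diameter at most $R_i$ and $\mathfrak{U}_{i+1}$ has Lebesgue number at least $R_i$; choosing for each member of $\mathfrak{U}_i$ a member of $\mathfrak{U}_{i+1}$ containing it gives proper simplicial maps $|\mathfrak{U}_i|\to|\mathfrak{U}_{i+1}|$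 of geometric realizations of nerves. Then $HX_*(X;\mathbb{Q}):=\varinjlim_i H^{lf}_*(|\mathfrak{U}_i|;\mathbb{Q})$, which is independent of choices. Coarse fundamental class: fix a triangulation of $M$. The sum of all lifts to $\widetilde M$ (with induced orientations) of the $n$-simplices of $M$ defines the locally finite fundamental class $[\widetilde M]_{lf}\in H^{lf}_n(\widetilde M;\mathbb{Q})$. Let $d$ be the maximal diameter of simplices; the balls of radius $2d$ around the vertices of $\widetilde M$ form an open cover $\mathfrak{U}$, which can be used as a member of a coarsening sequence, and sending each vertex to its ball gives a simplicial map $\widetilde M\to|\mathfrak{U}|$. The image of $[\widetilde M]_{lf}$ under $H^{lf}_n(\widetilde M)\to H^{lf}_n(|\mathfrak{U}|)\to HX_n(\widetilde M)$ is the coarse fundamental class $[\widetilde M]_X$. $M$ is called macroscopically large if $[\widetilde M]_X\ne 0\in HX_n(\widetilde M;\mathbb{Q})$. *)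

theory Defs
  imports "HOL-Analysis.Analysis" "HOL-Homology.Homology" "HOL-Algebra.Group_Action" "HOL-Algebra.Generated_Groups"
begin

section \<open>Smooth manifolds and Riemannian metrics\<close>

text \<open>
  Model space is \<open>Euclidean_space n\<close>, i.e. functions \<open>nat \<Rightarrow> real\<close> vanishing from index \<open>n\<close> on, so that
  the dimension \<open>n\<close> is a number and charts, spheres and simplices live in one type.
\<close>

definition coord_deriv :: "nat \<Rightarrow> ((nat \<Rightarrow> real) \<Rightarrow> real) \<Rightarrow> (nat \<Rightarrow> real) \<Rightarrow> real" where
  "coord_deriv i f x = deriv (\<lambda>t. f (x(i := t))) (x i)"

primrec Ck_on :: "nat \<Rightarrow> nat \<Rightarrow> (nat \<Rightarrow> real) set \<Rightarrow> ((nat \<Rightarrow> real) \<Rightarrow> real) \<Rightarrow> bool" where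
  "Ck_on n 0 W f \<longleftrightarrow> continuous_map (subtopology (Euclidean_space n) W) euclideanreal f"
| "Ck_on n (Suc k) W f \<longleftrightarrow>
     continuous_map (subtopology (Euclidean_space n) W) euclideanreal f \<and>
     (\<forall>i<n. (\<forall>x\<in>W. (\<lambda>t. f (x(i := t))) differentiable (at (x i))) \<and> Ck_on n k W (coord_deriv i f))"

definition smooth_fun :: "nat \<Rightarrow> (nat \<Rightarrow> real) set \<Rightarrow> ((nat \<Rightarrow> real) \<Rightarrow> real) \<Rightarrow> bool" where
  "smooth_fun n W f \<longleftrightarrow> (\<forall>k. Ck_on n k W f)"

text \<open>A chart is a pair of its domain and its coordinate map.\<close>

type_synonym 'a chart = "'a set \<times> ('a \<Rightarrow> nat \<Rightarrow> real)"

definition smooth_atlas :: "nat \<Rightarrow> 'a topology \<Rightarrow> 'a chart set \<Rightarrow> bool" where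
  "smooth_atlas n X A \<longleftrightarrow>
     (\<Union>(U, \<phi>)\<in>A. U) = topspace X \<and>
     (\<forall>(U, \<phi>)\<in>A. openin X U \<and> openin (Euclidean_space n) (\<phi> ` U) \<and>
        homeomorphic_map (subtopology X U) (subtopology (Euclidean_space n) (\<phi> ` U)) \<phi>) \<and>
     (\<forall>(U, \<phi>)\<in>A. \<forall>(V, \<psi>)\<in>A. \<forall>k<n. smooth_fun n (\<phi> ` (U \<inter> V)) (\<lambda>y. \<psi> (inv_into U \<phi> y) k))"

text \<open>
  An orientation is a locally consistent choice of generators of the local homology groups
  \<open>H\<^sub>n(X, X - {x}; \<int>)\<close>.
\<close>

abbreviation local_homology :: "nat \<Rightarrow> 'a topology \<Rightarrow> 'a \<Rightarrow> 'a chain set monoid" where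
  "local_homology n X x \<equiv> relative_homology_group (int n) X (topspace X - {x})"

definition orientation :: "nat \<Rightarrow> 'a topology \<Rightarrow> ('a \<Rightarrow> 'a chain set) \<Rightarrow> bool" where
  "orientation n X \<omega> \<longleftrightarrow>
     (\<forall>x\<in>topspace X.
        \<omega> x \<in> carrier (local_homology n X x) \<and>
        generate (local_homology n X x) {\<omega> x} = carrier (local_homology n X x) \<and>
        (\<exists>U. openin X U \<and> x \<in> U \<and>
          (\<exists>\<alpha>\<in>carrier (relative_homology_group (int n) X (topspace X - U)).
             \<forall>y\<in>U. hom_induced (int n) X (topspace X - U) X (topspace X - {y}) id \<alpha> = \<omega> y)))"

definition closed_oriented_manifold ::
    "nat \<Rightarrow> 'a::topological_space set \<Rightarrow> 'a chart set \<Rightarrow> ('a \<Rightarrow> 'a chain set) \<Rightarrow> bool" where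
  "closed_oriented_manifold n M A \<omega> \<longleftrightarrow>
     M \<noteq> {} \<and> connected M \<and> compact M \<and>
     Hausdorff_space (top_of_set M) \<and> second_countable (top_of_set M) \<and>
     smooth_atlas n (top_of_set M) A \<and> orientation n (top_of_set M) \<omega>"

text \<open>
  A Riemannian metric is given by its coefficients \<open>g c x i j = g\<^sub>x(\<partial>\<^sub>i, \<partial>\<^sub>j)\<close> in each chart \<open>c\<close>
  at the point \<open>x\<close> of the chart domain.
\<close>

definition riemannian_metric ::
    "nat \<Rightarrow> 'a chart set \<Rightarrow> ('a chart \<Rightarrow> 'a \<Rightarrow> nat \<Rightarrow> nat \<Rightarrow> real) \<Rightarrow> bool" where
  "riemannian_metric n A g \<longleftrightarrow>
     (\<forall>(U, \<phi>)\<in>A.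
        (\<forall>i<n. \<forall>j<n. smooth_fun n (\<phi> ` U) (\<lambda>y. g (U, \<phi>) (inv_into U \<phi> y) i j)) \<and>
        (\<forall>x\<in>U. (\<forall>i<n. \<forall>j<n. g (U, \<phi>) x i j = g (U, \<phi>) x j i) \<and>
          (\<forall>v. (\<exists>i<n. v i \<noteq> 0) \<longrightarrow> (\<Sum>i<n. \<Sum>j<n. g (U, \<phi>) x i j * v i * v j) > 0))) \<and>
     (\<forall>(U, \<phi>)\<in>A. \<forall>(V, \<psi>)\<in>A. \<forall>x\<in>U \<inter> V. \<forall>i<n. \<forall>j<n.
        (let J = (\<lambda>k i. coord_deriv i (\<lambda>y. \<psi> (inv_into U \<phi> y) k) (\<phi> x)) in
         g (U, \<phi>) x i j = (\<Sum>k<n. \<Sum>l<n. J k i * J l j * g (V, \<psi>) x k l)))"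

text \<open>
  \<open>\<gamma>\<close> is piecewise \<open>C\<^sup>1\<close> on \<open>[0,1]\<close> and has length \<open>L\<close>: there is a subdivision such that the \<open>k\<close>-th piece lies
  in the chart \<open>c k\<close> and is \<open>C\<^sup>1\<close> there up to its end points, with velocity \<open>v k\<close>.
\<close>

definition has_length ::
    "nat \<Rightarrow> 'a chart set \<Rightarrow> ('a chart \<Rightarrow> 'a \<Rightarrow> nat \<Rightarrow> nat \<Rightarrow> real) \<Rightarrow> (real \<Rightarrow> 'a) \<Rightarrow> real \<Rightarrow> bool" where
  "has_length n A g \<gamma> L \<longleftrightarrow>
     (\<exists>(m::nat) (t::nat \<Rightarrow> real) c (v::nat \<Rightarrow> nat \<Rightarrow> real \<Rightarrow> real).
        t 0 = 0 \<and> t m = 1 \<and>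
        (\<forall>k<m. t k < t (Suc k) \<and> c k \<in> A \<and> \<gamma> ` {t k..t (Suc k)} \<subseteq> fst (c k) \<and>
          (\<forall>i<n. continuous_on {t k..t (Suc k)} (v k i) \<and>
            (\<forall>s\<in>{t k..t (Suc k)}.
               ((\<lambda>r. snd (c k) (\<gamma> r) i) has_real_derivative v k i s) (at s within {t k..t (Suc k)})))) \<and>
        L = (\<Sum>k<m. integral {t k..t (Suc k)}
               (\<lambda>s. sqrt (\<Sum>i<n. \<Sum>j<n. g (c k) (\<gamma> s) i j * v k i s * v k j s))))"

text \<open>
  Distance of the pullback metric on a covering \<open>p\<close>: the length of a path in the covering space with respect
  to the pullback metric is the length of its projection.
\<close>

definition riem_dist ::
    "nat \<Rightarrow> 'a chart set \<Rightarrow> ('a chart \<Rightarrow> 'a \<Rightarrow> nat \<Rightarrow> nat \<Rightarrow> real) \<Rightarrow>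
     'b::topological_space set \<Rightarrow> ('b \<Rightarrow> 'a) \<Rightarrow> 'b \<Rightarrow> 'b \<Rightarrow> real" where
  "riem_dist n A g Mt p x y =
     Inf {L. \<exists>\<gamma>. path \<gamma> \<and> path_image \<gamma> \<subseteq> Mt \<and> pathstart \<gamma> = x \<and> pathfinish \<gamma> = y \<and>
               has_length n A g (p \<circ> \<gamma>) L}"

definition universal_covering ::
    "'b::topological_space set \<Rightarrow> ('b \<Rightarrow> 'a::topological_space) \<Rightarrow> 'a set \<Rightarrow> bool" where
  "universal_covering Mt p M \<longleftrightarrow> covering_space Mt p M \<and> simply_connected Mt"


section \<open>Degree and universal enlargeability\<close>

text \<open>The orientation of the covering space for which \<open>p\<close> preserves orientations.\<close>

definition lift_orientation ::
    "nat \<Rightarrow> 'b topology \<Rightarrow> ('b \<Rightarrow> 'a) \<Rightarrow> 'a topology \<Rightarrow> ('a \<Rightarrow> 'a chain set) \<Rightarrow> 'b \<Rightarrow> 'b chain set" where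
  "lift_orientation n Y p X \<omega> x =
     (THE \<alpha>. \<exists>U \<beta>. openin Y U \<and> x \<in> U \<and> inj_on p U \<and>
        \<beta> \<in> carrier (local_homology n (subtopology Y U) x) \<and>
        hom_induced (int n) (subtopology Y U) (topspace (subtopology Y U) - {x}) Y (topspace Y - {x}) id \<beta> = \<alpha> \<and>
        hom_induced (int n) (subtopology Y U) (topspace (subtopology Y U) - {x})
          X (topspace X - {p x}) p \<beta> = \<omega> (p x))"

text \<open>
  Degree of a map to the sphere that is equal to a constant \<open>a\<close> outside a compact set \<open>K\<close>: with
  \<open>\<mu> \<in> H\<^sub>n(X, X - K)\<close> the orientation class along \<open>K\<close>, the image of \<open>\<mu>\<close> in \<open>H\<^sub>n(S\<^sup>n, a)\<close>, which is
  \<open>H\<^sub>n(S\<^sup>n)\<close> for \<open>n > 0\<close>, is \<open>k\<close> times a generator. Its sign depends on the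
  choice of generator (orientation of the sphere).
\<close>

definition has_degree ::
    "nat \<Rightarrow> 'b topology \<Rightarrow> ('b \<Rightarrow> 'b chain set) \<Rightarrow> ('b \<Rightarrow> nat \<Rightarrow> real) \<Rightarrow> int \<Rightarrow> bool" where
  "has_degree n X \<omega> f k \<longleftrightarrow>
     (\<exists>K a \<mu> s. compactin X K \<and> a \<in> topspace (nsphere n) \<and> (\<forall>x\<in>topspace X - K. f x = a) \<and>
        \<mu> \<in> carrier (relative_homology_group (int n) X (topspace X - K)) \<and>
        (\<forall>x\<in>K. hom_induced (int n) X (topspace X - K) X (topspace X - {x}) id \<mu> = \<omega> x) \<and>
        s \<in> carrier (relative_homology_group (int n) (nsphere n) {a}) \<and>
        generate (relative_homology_group (int n) (nsphere n) {a}) {s}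
          = carrier (relative_homology_group (int n) (nsphere n) {a}) \<and>
        hom_induced (int n) X (topspace X - K) (nsphere n) {a} f \<mu>
          = s [^]\<^bsub>relative_homology_group (int n) (nsphere n) {a}\<^esub> k)"

text \<open>The distance on the unit sphere induced by the canonical Riemannian metric is the angle.\<close>

definition sphere_dist :: "nat \<Rightarrow> (nat \<Rightarrow> real) \<Rightarrow> (nat \<Rightarrow> real) \<Rightarrow> real" where
  "sphere_dist n x y = arccos (\<Sum>i\<le>n. x i * y i)"

definition universally_enlargeable ::
    "nat \<Rightarrow> 'a::topological_space set \<Rightarrow> 'a chart set \<Rightarrow> ('a \<Rightarrow> 'a chain set) \<Rightarrow>
     ('a chart \<Rightarrow> 'a \<Rightarrow> nat \<Rightarrow> nat \<Rightarrow> real) \<Rightarrow> 'b::topological_space set \<Rightarrow> ('b \<Rightarrow> 'a) \<Rightarrow> bool" where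
  "universally_enlargeable n M A \<omega> g Mt p \<longleftrightarrow>
     (\<forall>\<epsilon>>0. \<exists>f.
        continuous_map (top_of_set Mt) (nsphere n) f \<and>
        (\<forall>x\<in>Mt. \<forall>y\<in>Mt. sphere_dist n (f x) (f y) \<le> \<epsilon> * riem_dist n A g Mt p x y) \<and>
        (\<exists>K a. compact K \<and> K \<subseteq> Mt \<and> (\<forall>x\<in>Mt - K. f x = a)) \<and>
        (\<exists>k. k \<noteq> 0 \<and>
           has_degree n (top_of_set Mt) (lift_orientation n (top_of_set Mt) p (top_of_set M) \<omega>) f k))"


section \<open>Rational singular homology and locally finite homology\<close>

type_synonym 'a qchain = "((nat \<Rightarrow> real) \<Rightarrow> 'a) \<Rightarrow> rat"

definition finite_chains :: "'a topology \<Rightarrow> nat \<Rightarrow> 'a qchain set" where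
  "finite_chains X p = {c. (\<forall>\<sigma>. c \<sigma> \<noteq> 0 \<longrightarrow> singular_simplex p X \<sigma>) \<and> finite {\<sigma>. c \<sigma> \<noteq> 0}}"

definition lf_chains :: "'a topology \<Rightarrow> nat \<Rightarrow> 'a qchain set" where
  "lf_chains X p = {c. (\<forall>\<sigma>. c \<sigma> \<noteq> 0 \<longrightarrow> singular_simplex p X \<sigma>) \<and>
     (\<forall>K. compactin X K \<longrightarrow> finite {\<sigma>. c \<sigma> \<noteq> 0 \<and> \<sigma> ` standard_simplex p \<inter> K \<noteq> {}})}"

text \<open>
  The inner sums are finite for locally finite chains, since the simplices involved meet a common point.
\<close>

definition qboundary :: "nat \<Rightarrow> 'a qchain \<Rightarrow> 'a qchain" where
  "qboundary p c =
     (if p = 0 then (\<lambda>_. 0)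
      else (\<lambda>\<tau>. \<Sum>k\<le>p. \<Sum>\<sigma> | c \<sigma> \<noteq> 0 \<and> singular_face p k \<sigma> = \<tau>. (- 1) ^ k * c \<sigma>))"

definition qpush :: "nat \<Rightarrow> ('a \<Rightarrow> 'b) \<Rightarrow> 'a qchain \<Rightarrow> 'b qchain" where
  "qpush p f c = (\<lambda>\<tau>. \<Sum>\<sigma> | c \<sigma> \<noteq> 0 \<and> simplex_map p f \<sigma> = \<tau>. c \<sigma>)"

text \<open>Homology of a complex \<open>C\<close> of rational singular chains; \<open>C\<close> is one of the two complexes above.\<close>

definition qcycle_group :: "(nat \<Rightarrow> 'a qchain set) \<Rightarrow> nat \<Rightarrow> 'a qchain monoid" where
  "qcycle_group C p =
     \<lparr>carrier = {c \<in> C p. qboundary p c = (\<lambda>_. 0)}, mult = (\<lambda>a b \<sigma>. a \<sigma> + b \<sigma>), one = (\<lambda>_. 0)\<rparr>"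

definition qhomology_group :: "(nat \<Rightarrow> 'a qchain set) \<Rightarrow> nat \<Rightarrow> 'a qchain set monoid" where
  "qhomology_group C p = qcycle_group C p Mod (qboundary (Suc p) ` C (Suc p))"

definition qhomology_class :: "(nat \<Rightarrow> 'a qchain set) \<Rightarrow> nat \<Rightarrow> 'a qchain \<Rightarrow> 'a qchain set" where
  "qhomology_class C p c = (qboundary (Suc p) ` C (Suc p)) #>\<^bsub>qcycle_group C p\<^esub> c"

text \<open>
  The map induced on homology classes, into the homology of the complex \<open>D\<close>; all members of the union coincide.
\<close>

definition qhomology_map ::
    "nat \<Rightarrow> (nat \<Rightarrow> 'b qchain set) \<Rightarrow> ('a \<Rightarrow> 'b) \<Rightarrow> 'a qchain set \<Rightarrow> 'b qchain set" where
  "qhomology_map p D f \<xi> = (\<Union>c\<in>\<xi>. qhomology_class D p (qpush p f c))"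


section \<open>Simplicial complexes, nerves and coarse homology\<close>

definition simplicial_complex :: "'v set set \<Rightarrow> bool" where
  "simplicial_complex K \<longleftrightarrow>
     (\<forall>s\<in>K. finite s \<and> s \<noteq> {}) \<and> (\<forall>s\<in>K. \<forall>t. t \<subseteq> s \<and> t \<noteq> {} \<longrightarrow> t \<in> K)"

text \<open>Points of the geometric realization are given by their barycentric coordinates.\<close>

definition simplex_points :: "'v set \<Rightarrow> ('v \<Rightarrow> real) set" where
  "simplex_points s = {w. (\<forall>v. 0 \<le> w v) \<and> (\<forall>v. v \<notin> s \<longrightarrow> w v = 0) \<and> sum w s = 1}"

definition vertex :: "'v \<Rightarrow> 'v \<Rightarrow> real" where
  "vertex v = (\<lambda>u. if u = v then 1 else 0)"

abbreviation simplex_top :: "'v set \<Rightarrow> ('v \<Rightarrow> real) topology" where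
  "simplex_top s \<equiv> subtopology (powertop_real UNIV) (simplex_points s)"

text \<open>The realization carries the weak topology of its closed simplices.\<close>

definition realization :: "'v set set \<Rightarrow> ('v \<Rightarrow> real) topology" where
  "realization K = topology (\<lambda>V. V \<subseteq> (\<Union>s\<in>K. simplex_points s) \<and>
     (\<forall>s\<in>K. openin (simplex_top s) (V \<inter> simplex_points s)))"

lemma openin_realization:
  "openin (realization K) V \<longleftrightarrow>
     V \<subseteq> (\<Union>s\<in>K. simplex_points s) \<and> (\<forall>s\<in>K. openin (simplex_top s) (V \<inter> simplex_points s))"
proof -
  have "istopology (\<lambda>V. V \<subseteq> (\<Union>s\<in>K. simplex_points s) \<and>
     (\<forall>s\<in>K. openin (simplex_top s) (V \<inter> simplex_points s)))"
    unfolding istopology_def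
  proof (intro conjI allI impI ballI)
    fix S T :: "('a \<Rightarrow> real) set" and s
    assume "S \<subseteq> (\<Union>s\<in>K. simplex_points s) \<and> (\<forall>s\<in>K. openin (simplex_top s) (S \<inter> simplex_points s))"
      "T \<subseteq> (\<Union>s\<in>K. simplex_points s) \<and> (\<forall>s\<in>K. openin (simplex_top s) (T \<inter> simplex_points s))"
      "s \<in> K"
    then have "openin (simplex_top s) ((S \<inter> simplex_points s) \<inter> (T \<inter> simplex_points s))"
      by blast
    moreover have "(S \<inter> simplex_points s) \<inter> (T \<inter> simplex_points s) = S \<inter> T \<inter> simplex_points s"
      by blast
    ultimately show "openin (simplex_top s) (S \<inter> T \<inter> simplex_points s)" by simp
  next
    fix \<K> :: "('a \<Rightarrow> real) set set" and s
    assume *: "\<forall>V\<in>\<K>. V \<subseteq> (\<Union>s\<in>K. simplex_points s) \<and>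
        (\<forall>s\<in>K. openin (simplex_top s) (V \<inter> simplex_points s))" and "s \<in> K"
    then have "openin (simplex_top s) (\<Union>V\<in>\<K>. V \<inter> simplex_points s)"
      by blast
    then show "openin (simplex_top s) (\<Union>\<K> \<inter> simplex_points s)"
      by (simp add: Int_commute Int_Union)
  qed blast+
  then show ?thesis
    by (simp add: realization_def)
qed

lemma topspace_realization: "topspace (realization K) = (\<Union>s\<in>K. simplex_points s)"
proof -
  have "(\<Union>s\<in>K. simplex_points s) \<inter> simplex_points s = simplex_points s" if "s \<in> K" for s
    using that by blast
  moreover have "openin (simplex_top s) (simplex_points s)" for s :: "'a set"
    using openin_topspace [of "simplex_top s"] by simp
  ultimately have "openin (realization K) (\<Union>s\<in>K. simplex_points s)"
    unfolding openin_realization by simp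
  then show ?thesis
    by (meson openin_realization openin_subset openin_topspace subset_antisym)
qed

text \<open>The affine extension of a map of vertices.\<close>

definition simplicial_map :: "('v \<Rightarrow> 'u) \<Rightarrow> ('v \<Rightarrow> real) \<Rightarrow> 'u \<Rightarrow> real" where
  "simplicial_map r w = (\<lambda>u. \<Sum>v | w v \<noteq> 0 \<and> r v = u. w v)"

definition nerve :: "'b set set \<Rightarrow> 'b set set set" where
  "nerve \<U> = {s. finite s \<and> s \<noteq> {} \<and> s \<subseteq> \<U> \<and> \<Inter>s \<noteq> {}}"

text \<open>
  ``Lebesgue number at least \<open>R\<close>'' is read as: every set of diameter at most \<open>R\<close> is contained in a member.
\<close>

definition coarsening_sequence :: "'b topology \<Rightarrow> ('b \<Rightarrow> 'b \<Rightarrow> real) \<Rightarrow> (nat \<Rightarrow> 'b set set) \<Rightarrow> bool" where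
  "coarsening_sequence X d \<U> \<longleftrightarrow>
     (\<forall>i. (\<forall>V\<in>\<U> i. openin X V) \<and> \<Union>(\<U> i) = topspace X \<and> locally_finite_in X (\<U> i)) \<and>
     (\<exists>R. filterlim R at_top sequentially \<and>
        (\<forall>i. (\<forall>V\<in>\<U> i. \<forall>x\<in>V. \<forall>y\<in>V. d x y \<le> R i) \<and>
          (\<forall>S. S \<subseteq> topspace X \<and> (\<forall>x\<in>S. \<forall>y\<in>S. d x y \<le> R i) \<longrightarrow> (\<exists>V\<in>\<U> (Suc i). S \<subseteq> V))))"

definition refinement_maps :: "(nat \<Rightarrow> 'b set set) \<Rightarrow> (nat \<Rightarrow> 'b set \<Rightarrow> 'b set) \<Rightarrow> bool" where
  "refinement_maps \<U> r \<longleftrightarrow> (\<forall>i. \<forall>V\<in>\<U> i. r i V \<in> \<U> (Suc i) \<and> V \<subseteq> r i V)"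

text \<open>Direct limit of a sequence of groups \<open>G i\<close> with bonding maps \<open>\<phi> i\<close> from \<open>G i\<close> to \<open>G (Suc i)\<close>.\<close>

definition bonding :: "(nat \<Rightarrow> 'g \<Rightarrow> 'g) \<Rightarrow> nat \<Rightarrow> nat \<Rightarrow> 'g \<Rightarrow> 'g" where
  "bonding \<phi> i k = fold \<phi> [i..<k]"

definition direct_limit_class ::
    "(nat \<Rightarrow> 'g monoid) \<Rightarrow> (nat \<Rightarrow> 'g \<Rightarrow> 'g) \<Rightarrow> nat \<Rightarrow> 'g \<Rightarrow> (nat \<times> 'g) set" where
  "direct_limit_class G \<phi> i x =
     {(j, y). y \<in> carrier (G j) \<and> (\<exists>k. i \<le> k \<and> j \<le> k \<and> bonding \<phi> i k x = bonding \<phi> j k y)}"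

definition direct_limit :: "(nat \<Rightarrow> 'g monoid) \<Rightarrow> (nat \<Rightarrow> 'g \<Rightarrow> 'g) \<Rightarrow> (nat \<times> 'g) set monoid" where
  "direct_limit G \<phi> =
     \<lparr>carrier = {direct_limit_class G \<phi> i x | i x. x \<in> carrier (G i)},
      mult = (\<lambda>\<xi> \<eta>. \<Union>(i, x)\<in>\<xi>. \<Union>(j, y)\<in>\<eta>.
        direct_limit_class G \<phi> (max i j)
          (bonding \<phi> i (max i j) x \<otimes>\<^bsub>G (max i j)\<^esub> bonding \<phi> j (max i j) y)),
      one = direct_limit_class G \<phi> 0 \<one>\<^bsub>G 0\<^esub>\<rparr>"

abbreviation nerve_homology :: "(nat \<Rightarrow> 'b set set) \<Rightarrow> nat \<Rightarrow> nat \<Rightarrow> ('b set \<Rightarrow> real) qchain set monoid" where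
  "nerve_homology \<U> p i \<equiv> qhomology_group (lf_chains (realization (nerve (\<U> i)))) p"

abbreviation nerve_bonding ::
    "(nat \<Rightarrow> 'b set set) \<Rightarrow> (nat \<Rightarrow> 'b set \<Rightarrow> 'b set) \<Rightarrow> nat \<Rightarrow> nat \<Rightarrow>
     ('b set \<Rightarrow> real) qchain set \<Rightarrow> ('b set \<Rightarrow> real) qchain set" where
  "nerve_bonding \<U> r p i \<equiv>
     qhomology_map p (lf_chains (realization (nerve (\<U> (Suc i))))) (simplicial_map (r i))"

definition coarse_homology_group ::
    "(nat \<Rightarrow> 'b set set) \<Rightarrow> (nat \<Rightarrow> 'b set \<Rightarrow> 'b set) \<Rightarrow> nat \<Rightarrow>
     (nat \<times> ('b set \<Rightarrow> real) qchain set) set monoid" where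
  "coarse_homology_group \<U> r p = direct_limit (nerve_homology \<U> p) (nerve_bonding \<U> r p)"


section \<open>Triangulations and fundamental classes\<close>

definition triangulation_of ::
    "'v set set \<Rightarrow> (('v \<Rightarrow> real) \<Rightarrow> 'a) \<Rightarrow> 'a topology \<Rightarrow> bool" where
  "triangulation_of K h X \<longleftrightarrow> simplicial_complex K \<and> homeomorphic_map (realization K) X h"

text \<open>
  An \<open>n\<close>-simplex of the triangulation as singular simplex. The linear order of the vertex type, used for all
  simplices, makes the common faces of adjacent simplices agree as singular simplices.
\<close>

definition ordered_simplex ::
    "nat \<Rightarrow> (('v::linorder \<Rightarrow> real) \<Rightarrow> 'a) \<Rightarrow> 'v set \<Rightarrow> (nat \<Rightarrow> real) \<Rightarrow> 'a" where
  "ordered_simplex n h s =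
     (\<lambda>t\<in>standard_simplex n. h (\<lambda>v. \<Sum>i | i \<le> n \<and> sorted_list_of_set s ! i = v. t i))"

text \<open>The sign (\<open>1\<close> or \<open>-1\<close>) comparing the vertex order of an \<open>n\<close>-simplex with the orientation.\<close>

definition simplex_sign ::
    "nat \<Rightarrow> 'a topology \<Rightarrow> ('a \<Rightarrow> 'a chain set) \<Rightarrow> (('v::linorder \<Rightarrow> real) \<Rightarrow> 'a) \<Rightarrow> 'v set \<Rightarrow> int" where
  "simplex_sign n X \<omega> h s =
     (THE e. \<forall>t\<in>standard_simplex n. (\<forall>i\<le>n. 0 < t i) \<longrightarrow>
        (let x = ordered_simplex n h s t in
         homologous_rel_set n X (topspace X - {x}) (frag_of (ordered_simplex n h s))
           = \<omega> x [^]\<^bsub>local_homology n X x\<^esub> e))"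

text \<open>
  The sum of all lifts along \<open>p\<close> of the oriented \<open>n\<close>-simplices of the triangulation \<open>(K, h)\<close> of \<open>X\<close>:
  the coefficient of \<open>\<tau>\<close> is the sign of the simplex of which \<open>\<tau>\<close> is a lift.
  For \<open>p = id\<close> it is the fundamental cycle of \<open>X\<close> itself.
\<close>

definition fundamental_chain ::
    "nat \<Rightarrow> 'a topology \<Rightarrow> ('a \<Rightarrow> 'a chain set) \<Rightarrow> 'v::linorder set set \<Rightarrow> (('v \<Rightarrow> real) \<Rightarrow> 'a) \<Rightarrow>
     'b topology \<Rightarrow> ('b \<Rightarrow> 'a) \<Rightarrow> 'b qchain" where
  "fundamental_chain n X \<omega> K h Y p =
     (\<lambda>\<tau>. \<Sum>s | s \<in> K \<and> card s = Suc n \<and> singular_simplex n Y \<tau> \<and> simplex_map n p \<tau> = ordered_simplex n h s.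
        of_int (simplex_sign n X \<omega> h s))"

definition fundamental_class ::
    "nat \<Rightarrow> 'a topology \<Rightarrow> ('a \<Rightarrow> 'a chain set) \<Rightarrow> 'v::linorder set set \<Rightarrow> (('v \<Rightarrow> real) \<Rightarrow> 'a) \<Rightarrow>
     'a qchain set" where
  "fundamental_class n X \<omega> K h =
     qhomology_class (finite_chains X) n (fundamental_chain n X \<omega> K h X id)"

definition lf_fundamental_class ::
    "nat \<Rightarrow> 'a topology \<Rightarrow> ('a \<Rightarrow> 'a chain set) \<Rightarrow> 'v::linorder set set \<Rightarrow> (('v \<Rightarrow> real) \<Rightarrow> 'a) \<Rightarrow>
     'b topology \<Rightarrow> ('b \<Rightarrow> 'a) \<Rightarrow> 'b qchain set" where
  "lf_fundamental_class n X \<omega> K h Y p =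
     qhomology_class (lf_chains Y) n (fundamental_chain n X \<omega> K h Y p)"

text \<open>The triangulation of the covering space: closed simplices of all dimensions and vertices.\<close>

definition lifted_simplices ::
    "'v set set \<Rightarrow> (('v \<Rightarrow> real) \<Rightarrow> 'a) \<Rightarrow> 'b topology \<Rightarrow> ('b \<Rightarrow> 'a) \<Rightarrow> ('v set \<times> (('v \<Rightarrow> real) \<Rightarrow> 'b)) set" where
  "lifted_simplices K h Y p =
     {(s, \<tau>). s \<in> K \<and> continuous_map (simplex_top s) Y \<tau> \<and> (\<forall>w\<in>simplex_points s. p (\<tau> w) = h w)}"

definition lifted_vertices ::
    "'v set set \<Rightarrow> (('v \<Rightarrow> real) \<Rightarrow> 'a) \<Rightarrow> 'b topology \<Rightarrow> ('b \<Rightarrow> 'a) \<Rightarrow> 'b set" where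
  "lifted_vertices K h Y p = {x \<in> topspace Y. \<exists>v. {v} \<in> K \<and> p x = h (vertex v)}"

text \<open>Barycentric coordinates of a point of the covering space, with respect to \<open>lifted_vertices\<close>.\<close>

definition lifted_coords ::
    "'v set set \<Rightarrow> (('v \<Rightarrow> real) \<Rightarrow> 'a) \<Rightarrow> 'b topology \<Rightarrow> ('b \<Rightarrow> 'a) \<Rightarrow> 'b \<Rightarrow> 'b \<Rightarrow> real" where
  "lifted_coords K h Y p x =
     (THE b. \<exists>(s, \<tau>)\<in>lifted_simplices K h Y p. \<exists>w\<in>simplex_points s.
        \<tau> w = x \<and> b = simplicial_map (\<lambda>v. \<tau> (vertex v)) w)"

text \<open>The maximal diameter of the simplices of the covering space.\<close>

definition mesh ::
    "'v set set \<Rightarrow> (('v \<Rightarrow> real) \<Rightarrow> 'a) \<Rightarrow> 'b topology \<Rightarrow> ('b \<Rightarrow> 'a) \<Rightarrow> ('b \<Rightarrow> 'b \<Rightarrow> real) \<Rightarrow> real" where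
  "mesh K h Y p d =
     Sup {d (\<tau> w) (\<tau> w') | s \<tau> w w'.
       (s, \<tau>) \<in> lifted_simplices K h Y p \<and> w \<in> simplex_points s \<and> w' \<in> simplex_points s}"

definition vertex_ball ::
    "'v set set \<Rightarrow> (('v \<Rightarrow> real) \<Rightarrow> 'a) \<Rightarrow> 'b topology \<Rightarrow> ('b \<Rightarrow> 'a) \<Rightarrow> ('b \<Rightarrow> 'b \<Rightarrow> real) \<Rightarrow> 'b \<Rightarrow> 'b set" where
  "vertex_ball K h Y p d x = {y \<in> topspace Y. d x y < 2 * mesh K h Y p d}"

definition ball_cover ::
    "'v set set \<Rightarrow> (('v \<Rightarrow> real) \<Rightarrow> 'a) \<Rightarrow> 'b topology \<Rightarrow> ('b \<Rightarrow> 'a) \<Rightarrow> ('b \<Rightarrow> 'b \<Rightarrow> real) \<Rightarrow> 'b set set" where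
  "ball_cover K h Y p d = vertex_ball K h Y p d ` lifted_vertices K h Y p"

definition to_nerve ::
    "'v set set \<Rightarrow> (('v \<Rightarrow> real) \<Rightarrow> 'a) \<Rightarrow> 'b topology \<Rightarrow> ('b \<Rightarrow> 'a) \<Rightarrow> ('b \<Rightarrow> 'b \<Rightarrow> real) \<Rightarrow>
     'b \<Rightarrow> 'b set \<Rightarrow> real" where
  "to_nerve K h Y p d x = simplicial_map (vertex_ball K h Y p d) (lifted_coords K h Y p x)"

text \<open>Here \<open>m\<close> is the index of the ball cover in the coarsening sequence \<open>\<U>\<close>.\<close>

definition coarse_fundamental_class ::
    "nat \<Rightarrow> 'a topology \<Rightarrow> ('a \<Rightarrow> 'a chain set) \<Rightarrow> 'v::linorder set set \<Rightarrow> (('v \<Rightarrow> real) \<Rightarrow> 'a) \<Rightarrow>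
     'b topology \<Rightarrow> ('b \<Rightarrow> 'a) \<Rightarrow> ('b \<Rightarrow> 'b \<Rightarrow> real) \<Rightarrow>
     (nat \<Rightarrow> 'b set set) \<Rightarrow> (nat \<Rightarrow> 'b set \<Rightarrow> 'b set) \<Rightarrow> nat \<Rightarrow>
     (nat \<times> ('b set \<Rightarrow> real) qchain set) set" where
  "coarse_fundamental_class n X \<omega> K h Y p d \<U> r m =
     direct_limit_class (nerve_homology \<U> n) (nerve_bonding \<U> r n) m
       (qhomology_map n (lf_chains (realization (nerve (\<U> m)))) (to_nerve K h Y p d)
         (lf_fundamental_class n X \<omega> K h Y p))"

definition macroscopically_large ::
    "nat \<Rightarrow> 'a topology \<Rightarrow> ('a \<Rightarrow> 'a chain set) \<Rightarrow> 'v::linorder set set \<Rightarrow> (('v \<Rightarrow> real) \<Rightarrow> 'a) \<Rightarrow>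
     'b topology \<Rightarrow> ('b \<Rightarrow> 'a) \<Rightarrow> ('b \<Rightarrow> 'b \<Rightarrow> real) \<Rightarrow>
     (nat \<Rightarrow> 'b set set) \<Rightarrow> (nat \<Rightarrow> 'b set \<Rightarrow> 'b set) \<Rightarrow> nat \<Rightarrow> bool" where
  "macroscopically_large n X \<omega> K h Y p d \<U> r m \<longleftrightarrow>
     coarse_fundamental_class n X \<omega> K h Y p d \<U> r m \<noteq> \<one>\<^bsub>coarse_homology_group \<U> r n\<^esub>"


section \<open>Classifying spaces\<close>

definition fundamental_group :: "'a::topological_space set \<Rightarrow> 'a \<Rightarrow> (real \<Rightarrow> 'a) set monoid" where
  "fundamental_group M x0 =
     \<lparr>carrier = {{\<delta>. homotopic_paths M \<gamma> \<delta>} | \<gamma>.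
        path \<gamma> \<and> path_image \<gamma> \<subseteq> M \<and> pathstart \<gamma> = x0 \<and> pathfinish \<gamma> = x0},
      mult = (\<lambda>\<xi> \<eta>. \<Union>\<gamma>\<in>\<xi>. \<Union>\<delta>\<in>\<eta>. {\<epsilon>. homotopic_paths M (\<gamma> +++ \<delta>) \<epsilon>}),
      one = {\<delta>. homotopic_paths M (\<lambda>_. x0) \<delta>}\<rparr>"

text \<open>
  Principal bundle with discrete structure group: a covering on which \<open>G\<close> acts by homeomorphisms, freely and
  transitively on each fibre. Translating the sheets over an evenly covered set gives the local trivializations.
\<close>

definition principal_bundle ::
    "('g, 'c) monoid_scheme \<Rightarrow> 'e::topological_space set \<Rightarrow> ('e \<Rightarrow> 'f::topological_space) \<Rightarrow> 'f set \<Rightarrow>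
     ('g \<Rightarrow> 'e \<Rightarrow> 'e) \<Rightarrow> bool" where
  "principal_bundle G E q B \<rho> \<longleftrightarrow>
     covering_space E q B \<and> group_action G E \<rho> \<and>
     (\<forall>a\<in>carrier G. continuous_on E (\<rho> a) \<and> (\<forall>x\<in>E. q (\<rho> a x) = q x)) \<and>
     (\<forall>x\<in>E. \<forall>y\<in>E. q x = q y \<longrightarrow> (\<exists>!a. a \<in> carrier G \<and> \<rho> a x = y))"

text \<open>\<open>E\<close> plays the role of \<open>EG\<close> and \<open>B\<close> of \<open>BG\<close>.\<close>

definition classifying_space ::
    "('g, 'c) monoid_scheme \<Rightarrow> 'e::topological_space set \<Rightarrow> ('e \<Rightarrow> 'f::topological_space) \<Rightarrow> 'f set \<Rightarrow>
     ('g \<Rightarrow> 'e \<Rightarrow> 'e) \<Rightarrow> bool" where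
  "classifying_space G E q B \<rho> \<longleftrightarrow> principal_bundle G E q B \<rho> \<and> E \<noteq> {} \<and> contractible E"

text \<open>
  \<open>c\<close> is covered by an equivariant map, i.e. the pullback along \<open>c\<close> of the universal bundle is isomorphic to the
  given bundle \<open>(Mt, p, M, \<theta>)\<close>.
\<close>

definition classifying_map ::
    "('g, 'c) monoid_scheme \<Rightarrow>
     'b::topological_space set \<Rightarrow> ('b \<Rightarrow> 'a::topological_space) \<Rightarrow> 'a set \<Rightarrow> ('g \<Rightarrow> 'b \<Rightarrow> 'b) \<Rightarrow>
     'e::topological_space set \<Rightarrow> ('e \<Rightarrow> 'f::topological_space) \<Rightarrow> 'f set \<Rightarrow> ('g \<Rightarrow> 'e \<Rightarrow> 'e) \<Rightarrow>
     ('a \<Rightarrow> 'f) \<Rightarrow> bool" where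
  "classifying_map G Mt p M \<theta> E q B \<rho> c \<longleftrightarrow>
     continuous_map (top_of_set M) (top_of_set B) c \<and>
     (\<exists>C. continuous_map (top_of_set Mt) (top_of_set E) C \<and>
        (\<forall>x\<in>Mt. q (C x) = c (p x)) \<and>
        (\<forall>a\<in>carrier G. \<forall>x\<in>Mt. C (\<theta> a x) = \<rho> a (C x)))"

end

(*
The lift of the fundamental cycle to the universal covering is pushed to the nerve of the k-th cover by sending a vertex
to the ball around it and then to a member of the k-th cover. The class of M vanishes in coarse homology if and only if
this locally finite cycle bounds in the nerve of the k-th cover for some k.

(1) Suppose that it bounds, and let R bound the diameters of the members of the k-th cover. A map f from the covering
space to the n-sphere with small Lipschitz constant varies little on sets of diameter 2R, hence it is homotopic to a map
which factors through the nerve: send a member of the cover to the value of f at one of its points and interpolate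
linearly. The homotopy keeps the complement of a compact set away from a point y outside all linear spans of
at most n of these finitely many values. Then y is only hit in the interiors of n-simplices, where local orientation
classes count the degree, whereas the bounding chain in the nerve shows that a nonzero multiple of the degree is zero.

(2) Suppose that the class of M vanishes in the homology of the base B of a universal principal bundle E. A finite chain
bounding in B has an infinite transfer to E, which bounds the image of the lifted cycle. Since the group acts on the
covering space by isometries, the vertices of E can be sent equivariantly to one orbit in the covering space; each simplex
of the transfer then has diameter at most a constant that depends on the finite chain only, so that the transfer becomes
a locally finite chain in the nerve of a sufficiently coarse cover. A prism operator compares the two cycles in the nerve.
*)
theory Submission
  imports Defs
begin

text \<open>The triangulation is merely a homeomorphism from a realization, without any
  combinatorial manifold condition. That its dimension is at most n, that its open n-simplices are
  open in M and that the signs cancel along every (n-1)-face therefore has to come from topology: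
  from charts and invariance of domain, and from pushing a local orientation class off a face in
  barycentric coordinates. Chains in a nerve are locally finite only because bounded sets of the
  covering are relatively compact. This form of the Hopf-Rinow theorem is derived from compactness
  of M: a path that leaves a small chart box uses up a length bounded below. In the second part the
  map to the nerve is given on vertices and has no continuity in between, hence chains are pushed
  along arbitrary maps of simplices, subject to finiteness of fibres. In the first part orientations
  and degrees live in integral homology, while the bounding chain is infinite and rational; near the
  preimages of y only finitely many of its simplices matter, and their common denominator is the
  multiple that annihilates the degree.\<close>

abbreviation (input) "stds == standard_simplex"
abbreviation (input) "spts == simplex_points"
abbreviation (input) "rbd == singular_relboundary"
abbreviation (input) "rcy == singular_relcycle"
abbreviation (input) "hcl == homologous_rel_set"
abbreviation (input) "ssx == singular_simplex"
abbreviation (input) "sfc == singular_face"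
abbreviation (input) "smp == simplex_map"
abbreviation (input) "spm == simplicial_map"
abbreviation (input) "cmp == continuous_map"
abbreviation (input) "con == continuous_on"
abbreviation (input) "tos == top_of_set"
abbreviation (input) "fcm == frag_cmul"
abbreviation (input) "fof == frag_of"
abbreviation (input) "rlz == realization"
abbreviation (input) "qbd == qboundary"
abbreviation (input) "lfc == lf_chains"
abbreviation (input) "tps == topspace"
abbreviation (input) "sbt == subtopology"
abbreviation (input) "opi == openin"
abbreviation (input) "pim == path_image"
abbreviation (input) "lst == sorted_list_of_set"
abbreviation (input) "vx == vertex"
abbreviation (input) "sfce == simplical_face"
abbreviation (input) "osx == ordered_simplex"
abbreviation (input) "cbd == chain_boundary"
abbreviation (input) "qhc == qhomology_class"
abbreviation (input) "qhg == qhomology_group"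
abbreviation (input) "eur == euclideanreal"
abbreviation (input) "orsx == oriented_simplex"

section \<open>Lifting simplices along a covering\<close>

lemma cov_sheet:
 assumes "covering_space C p S" "x : S"
 obtains T V where "x : T" "opi (tos S) T" "\<Union>V = C Int p -` T"
  "!!u. u : V ==> opi (tos C) u" "pairwise disjnt V"
  "!!u. u : V ==> EX q. homeomorphism u T p q"
 using assms unfolding covering_space_def by metis

lemma covering_space_inj_nhd:
 assumes "covering_space C p S" "e : C"
 obtains U where "opi (tos C) U" "e : U" "inj_on p U"
proof -
 obtain T u q where "e : T" "opi (tos C) T" "homeomorphism T u p q"
  using covering_space_local_homeomorphism[OF assms] by metis
 thus ?thesis
  by (metis that homeomorphism_apply1 inj_onI)
qed

lemma open_preim:
 assumes "con T g" "g : T \<rightarrow> C" "opi (tos C) u"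
 shows "opi (tos T) (T Int g -` u)"
 using assms continuous_openin_preimage by blast

lemma continuous_on_openin_local:
 assumes "!!x. x : D ==> EX W. opi (tos D) W & x : W & con W g"
 shows "con D g"
 unfolding continuous_on_topological
proof (intro ballI allI impI)
 fix x B assume x: "x : D" and B: "open B" "g x : B"
 obtain W where W: "opi (tos D) W" "x : W" "con W g" using assms x by blast
 obtain N where N: "open N" "W = D Int N" using W(1) by (auto simp: openin_open)
 obtain A where "open A" "x : A" "ALL y:W. y : A --> g y : B"
  using W(2,3) B unfolding continuous_on_topological by blast
 thus "EX A. open A & x : A & (ALL y:D. y : A --> g y : B)"
  using N W(2) by (intro exI[of _ "A Int N"]) (simp add: open_Int)
qed

text \<open>Both the set of agreement and its complement are open: near a point of agreement both
  lifts run in one sheet, near any other point in two disjoint sheets. The second half replaces the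
  usual appeal to a Hausdorff total space.\<close>

lemma covering_lift_unique:
 fixes g1 g2 :: "'a::topological_space => 'b::topological_space"
 assumes cov: "covering_space C p S"
  and g1: "con T g1" "g1 : T \<rightarrow> C" and g2: "con T g2" "g2 : T \<rightarrow> C"
  and eq: "!!x. x : T ==> p (g1 x) = p (g2 x)"
  and T: "connected T" "a : T" "g1 a = g2 a" and x: "x : T"
 shows "g1 x = g2 x"
proof -
 define A where "A = {z : T. g1 z = g2 z}"
 define B where "B = {z : T. g1 z ~= g2 z}"
 have oA: "opi (tos T) A"
 proof (subst openin_subopen, intro ballI)
  fix z assume z: "z : A"
  hence "g1 z : C" using g1(2) by (auto simp: A_def Pi_iff)
  then obtain U where U: "opi (tos C) U" "g1 z : U" "inj_on p U"
   using covering_space_inj_nhd[OF cov] by metis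
  have "opi (tos T) ((T Int g1 -` U) Int (T Int g2 -` U))"
   by (intro openin_Int open_preim[OF g1 U(1)] open_preim[OF g2 U(1)])
  moreover have "z : (T Int g1 -` U) Int (T Int g2 -` U)" using z U by (auto simp: A_def)
  moreover have "(T Int g1 -` U) Int (T Int g2 -` U) <= A"
   using eq U(3) by (auto simp: A_def inj_on_def)
  ultimately show "EX W. opi (tos T) W & z : W & W <= A" by blast
 qed
 have oB: "opi (tos T) B"
 proof (subst openin_subopen, intro ballI)
  fix z assume z: "z : B"
  hence c: "g1 z : C" "g2 z : C" "z : T" using g1(2) g2(2) by (auto simp: B_def Pi_iff)
  hence "p (g1 z) : S" using covering_space_imp_surjective[OF cov] by blast
  then obtain W V where W: "p (g1 z) : W" "opi (tos S) W" "\<Union>V = C Int p -` W"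
   "!!u. u : V ==> opi (tos C) u" "pairwise disjnt V"
   "!!u. u : V ==> EX q. homeomorphism u W p q"
   using cov_sheet[OF cov] by metis
  obtain u1 u2 where u: "u1 : V" "g1 z : u1" "u2 : V" "g2 z : u2"
   using W(1,3) c eq by (metis IntI UnionE vimageI)
  have "u1 ~= u2"
  proof
   assume "u1 = u2"
   hence "g1 z = g2 z"
    using W(6)[OF u(1)] u(2,4) eq[OF c(3)] by (metis homeomorphism_apply1)
   thus False using z by (simp add: B_def)
  qed
  hence dj: "u1 Int u2 = {}" using W(5) u by (auto simp: pairwise_def disjnt_def)
  have "opi (tos T) ((T Int g1 -` u1) Int (T Int g2 -` u2))"
   by (intro openin_Int open_preim[OF g1 W(4)[OF u(1)]]
     open_preim[OF g2 W(4)[OF u(3)]])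
  moreover have "z : (T Int g1 -` u1) Int (T Int g2 -` u2)" using c u by auto
  moreover have "(T Int g1 -` u1) Int (T Int g2 -` u2) <= B" using dj by (auto simp: B_def)
  ultimately show "EX W. opi (tos T) W & z : W & W <= B" by blast
 qed
 have "A ~= {}" "T <= A Un B" "A Int B = {}" using T by (auto simp: A_def B_def)
 hence "B = {}" using T(1) oA oB unfolding connected_openin by blast
 thus ?thesis using x by (auto simp: B_def)
qed

text \<open>
 A lift of the contraction of \<open>D\<close> to \<open>a\<close> is continued along the unit interval, locally in \<open>D\<close>.
\<close>

lemma covering_lift_star:
 fixes f :: "('i => real) => 'a::topological_space" and C :: "'b::topological_space set"
 assumes cov: "covering_space C p S"
  and a: "a : D" and star: "!!x t. x : D ==> t : {0..1} ==> (%i. a i + t * (x i - a i)) : D"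
  and f: "con D f" "f : D \<rightarrow> S" and e: "e : C" "p e = f a"
 obtains g where "con D g" "g : D \<rightarrow> C" "g a = e" "!!x. x : D ==> p (g x) = f x"
proof -
 define H where "H = (%(t::real, x). f (%i. a i + t * (x i - a i)))"
 have Hc: "con ({0..1} \<times> D) H"
 proof -
  have "con ({0..1} \<times> D) (f o (%z i. a i + fst z * (snd z i - a i)))"
  proof (rule continuous_on_compose)
   show "con ({0..1} \<times> D) (%z i. a i + fst z * (snd z i - a i))"
   proof (rule continuous_on_coordinatewise_then_product)
    fix i
    have "con ({0..1} \<times> D) (%z. snd z i)"
     by (rule continuous_on_product_then_coordinatewise[OF continuous_on_snd[OF continuous_on_id]])
    thus "con ({0..1} \<times> D) (%z. a i + fst z * (snd z i - a i))"
     by (intro continuous_on_add continuous_on_mult continuous_on_diff continuous_on_const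
       continuous_on_fst continuous_on_id)
   qed
   show "con ((%z i. a i + fst z * (snd z i - a i)) ` ({0..1} \<times> D)) f"
    by (rule continuous_on_subset[OF f(1)]) (use star in auto)
  qed
  thus ?thesis by (simp add: H_def o_def case_prod_beta)
 qed
 have HS: "H : {0..1} \<times> D \<rightarrow> S" using star f(2) by (auto simp: H_def Pi_iff)
 \<comment> \<open>A partial lift of the contraction, up to time t and over a neighbourhood W. The
   contraction starts constantly at \<open>f a\<close>, hence all partial lifts start at e, and for
   \<open>t = 0\<close> the constant map e is one.\<close>
 define lift where "lift t W L \<longleftrightarrow> opi (tos D) W & con ({0..t} \<times> W) L &
  L : {0..t} \<times> W \<rightarrow> C & (ALL z:{0..t} \<times> W. p (L z) = H z) & (ALL x:W. L (0, x) = e)" for t W L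
 have one: "EX W L. x0 : W & lift 1 W L" if x0: "x0 : D" for x0
 proof -
  \<comment> \<open>Prepares connected induction on the unit interval: near t0 a lift up to one time
    yields a lift up to any other. For a shorter time this is a restriction, for a longer one a
    sheet is needed.\<close>
  have step: "EX I. opi (tos {0..1}) I & t0 : I &
   (ALL t:I. ALL t':I. (EX W L. x0 : W & lift t W L) --> (EX W L. x0 : W & lift t' W L))"
   if t0: "t0 : {0..1}" for t0 :: real
  proof -
   have "H (t0, x0) : S" using HS t0 x0 by auto
   then obtain T V where T: "H (t0, x0) : T" "opi (tos S) T" "\<Union>V = C Int p -` T"
    "!!u. u : V ==> opi (tos C) u" "pairwise disjnt V"
    "!!u. u : V ==> EX q. homeomorphism u T p q"
    using cov_sheet[OF cov] by metis
   have "opi (tos ({0..1} \<times> D)) ({0..1} \<times> D Int H -` T)"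
    by (rule open_preim[OF Hc HS T(2)])
   then obtain A0 where A0: "open A0" "{0..1} \<times> D Int H -` T = {0..1} \<times> D Int A0"
    by (auto simp: openin_open)
   have "(t0, x0) : A0" using A0(2) T(1) t0 x0 by blast
   then obtain I0 W0 where IW: "open I0" "open W0" "t0 : I0" "x0 : W0" "I0 \<times> W0 <= A0"
    using A0(1) by (metis open_prod_elim mem_Times_iff fst_conv snd_conv)
   obtain r where r: "r > 0" "ball t0 r <= I0"
    using IW by (metis open_contains_ball)
   have small: "H (t, x) : T" if "t : {0..1} Int ball t0 r" "x : D Int W0" for t x
    using that r IW A0 by blast
   have ext: "EX W L. x0 : W & lift t' W L"
    if tt: "t : {0..1} Int ball t0 r" "t' : {0..1} Int ball t0 r" and WL: "x0 : W" "lift t W L" for t t' W L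
   proof (cases "t' <= t")
    case True
    hence "lift t' W L" using WL(2) tt unfolding lift_def
     by (auto intro: continuous_on_subset)
    thus ?thesis using WL by blast
   next
    case False
    have Lx: "L (t, x0) : C" "p (L (t, x0)) : T"
     using WL tt small[OF tt(1), of x0] x0 IW by (auto simp: lift_def Pi_iff)
    then obtain u where u: "u : V" "L (t, x0) : u" using T(3) by blast
    obtain q where q: "homeomorphism u T p q" using T(6)[OF u(1)] by blast
    \<comment> \<open>Over W1 the lift at time t lies in the single sheet u, so that from t on the
      inverse q of p on u continues it; both descriptions agree at time t.\<close>
    define W1 where "W1 = W Int W0 Int {x : W. L (t, x) : u}"
    have ct: "con W (%x. L (t, x))"
    proof (rule continuous_on_compose2[of "{0..t} \<times> W" L])
     show "con ({0..t} \<times> W) L" using WL(2) by (simp add: lift_def)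
    qed (use tt in \<open>auto intro!: continuous_on_Pair continuous_on_const continuous_on_id\<close>)
    have WD: "W <= D" using WL(2) unfolding lift_def by (meson openin_imp_subset)
    have "opi (tos W) (W Int (%x. L (t, x)) -` u)"
     using WL(2) tt by (intro open_preim[OF ct _ T(4)[OF u(1)]]) (auto simp: lift_def Pi_iff)
    hence o1: "opi (tos D) (W Int (%x. L (t, x)) -` u)"
     using WL(2) unfolding lift_def by (metis openin_trans)
    have o2: "opi (tos D) (D Int W0)" using IW(2) by (simp add: openin_open_Int)
    have W1: "opi (tos D) W1" "W1 <= W" "W1 <= W0" "W1 <= D" "x0 : W1"
    proof -
     have "W1 = (W Int (%x. L (t, x)) -` u) Int (D Int W0)" using WD by (auto simp: W1_def)
     thus "opi (tos D) W1" using o1 o2 by (simp add: openin_Int)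
    qed (use WD WL u IW in \<open>auto simp: W1_def\<close>)
    have inT: "H (s, x) : T" if "s : {t..t'}" "x : W1" for s x
    proof (rule small)
     have "s : ball t0 r"
      using that tt(1,2) by (auto simp: dist_real_def abs_le_iff abs_less_iff)
     thus "s : {0..1} Int ball t0 r" using tt that by auto
    qed (use that W1 in auto)
    define L' where "L' = (%z. if fst z <= t then L z else q (H z))"
    have glue: "L z = q (H z)" if "z : {t} \<times> W1" for z
    proof -
     obtain x where z: "z = (t, x)" "x : W1" using \<open>z \<in> {t} \<times> W1\<close> by auto
     have "L z : u" using z by (auto simp: W1_def)
     moreover have "p (L z) = H z" using WL(2) z W1 tt by (auto simp: lift_def)
     ultimately show ?thesis using q by (metis homeomorphism_apply1)
    qed
    have c': "con ({0..t'} \<times> W1) L'"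
    proof -
     have "{0..t'} \<times> W1 = ({0..t} \<times> W1) Un ({t..t'} \<times> W1)" using False tt by auto
     moreover have "con (({0..t} \<times> W1) Un ({t..t'} \<times> W1)) L'"
      unfolding L'_def
     proof (rule continuous_on_cases_local)
      show "closedin (tos ({0..t} \<times> W1 Un {t..t'} \<times> W1)) ({0..t} \<times> W1)"
       unfolding closedin_closed
       by (rule exI[of _ "{0..t} \<times> UNIV"]) (auto intro: closed_Times)
      show "closedin (tos ({0..t} \<times> W1 Un {t..t'} \<times> W1)) ({t..t'} \<times> W1)"
       unfolding closedin_closed
       by (rule exI[of _ "{t..t'} \<times> UNIV"]) (use tt in \<open>auto intro: closed_Times\<close>)
      show "con ({0..t} \<times> W1) L"
       using WL(2) W1(2) unfolding lift_def by (auto intro: continuous_on_subset)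
      have "con T q" using q by (simp add: homeomorphism_def)
      moreover have "con ({t..t'} \<times> W1) H"
       by (rule continuous_on_subset[OF Hc]) (use tt W1 in auto)
      ultimately show "con ({t..t'} \<times> W1) (%z. q (H z))"
       by (rule continuous_on_compose2) (use inT in auto)
     qed (use glue in \<open>auto\<close>)
     ultimately show ?thesis by simp
    qed
    have qT: "q y : C & p (q y) = y" if "y : T" for y
     using q that openin_imp_subset[OF T(4)[OF u(1)]]
     by (metis homeomorphism_apply2 homeomorphism_image2 imageI subsetD)
    have L'p: "L' z : C & p (L' z) = H z" if z: "z : {0..t'} \<times> W1" for z
    proof (cases "fst z <= t")
     case True
     hence "z : {0..t} \<times> W" using z W1(2) by auto
     thus ?thesis using WL(2) True by (auto simp: L'_def lift_def Pi_iff)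
    next
     case False
     hence "H z : T" using z inT[of "fst z" "snd z"] by auto
     thus ?thesis using qT False by (simp add: L'_def)
    qed
    have "lift t' W1 L'"
     unfolding lift_def
    proof (intro conjI)
     show "L' : {0..t'} \<times> W1 \<rightarrow> C" "ALL z:{0..t'} \<times> W1. p (L' z) = H z"
      using L'p by blast+
     have "0 <= t" using tt by simp
     thus "ALL x:W1. L' (0, x) = e"
      using WL(2) W1(2) by (auto simp: L'_def lift_def)
    qed (use W1 c' in auto)
    thus ?thesis using W1 by blast
   qed
   show ?thesis
   proof (intro exI conjI)
    show "opi (tos {0..1}) ({0..1} Int ball t0 r)" by (simp add: openin_open_Int)
    show "t0 : {0..1} Int ball t0 r" using t0 r by simp
    show "ALL t:{0..1} Int ball t0 r. ALL t':{0..1} Int ball t0 r.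
      (EX W L. x0 : W & lift t W L) --> (EX W L. x0 : W & lift t' W L)"
     using ext by metis
   qed
  qed
  have l0: "EX W L. x0 : W & lift 0 W L"
  proof (intro exI conjI)
   show "x0 : D" by fact
   show "lift 0 D (%_. e)" using e by (auto simp: lift_def H_def)
  qed
  show ?thesis
   by (rule connected_induction_simple[of "{0..1::real}" 0 1 "%t. EX W L. x0 : W & lift t W L"])
    (simp, simp, simp, rule l0, rule step)
 qed
 then obtain W L where WL: "!!x. x : D ==> x : W x & lift 1 (W x) (L x)" by metis
 define g where "g x = L x (1, x)" for x
 \<comment> \<open>Unique lifting along the path from \<open>(0, y)\<close> to
   \<open>(1, y)\<close>, both lifts starting at e.\<close>
 have agree: "L x (1, y) = L x' (1, y)" if "x : D" "x' : D" "y : W x" "y : W x'" for x x' y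
 proof (rule covering_lift_unique[OF cov, where T="{0..1}" and ?g1.0="%t. L x (t, y)" and ?g2.0="%t. L x' (t, y)" and a=0])
  have "con {0..1} (%t. L z (t, y))" if "z : D" "y : W z" for z
  proof (rule continuous_on_compose2[of "{0..1} \<times> W z" "L z"])
   show "con ({0..1} \<times> W z) (L z)" using WL that by (simp add: lift_def)
  qed (use that in \<open>auto intro!: continuous_on_Pair continuous_on_const continuous_on_id\<close>)
  thus "con {0..1} (%t. L x (t, y))" "con {0..1} (%t. L x' (t, y))"
   using that by auto
 next
  have z: "0 : {0..1::real}" "1 : {0..1::real}" by auto
  show "L x (0, y) = L x' (0, y)" using WL[OF that(1)] WL[OF that(2)] that by (simp add: lift_def)
  show "(%t. L x (t, y)) : {0..1} \<rightarrow> C" "(%t. L x' (t, y)) : {0..1} \<rightarrow> C"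
   using WL[OF that(1)] WL[OF that(2)] that by (auto simp: lift_def Pi_iff)
  show "p (L x (t, y)) = p (L x' (t, y))" if "t : {0..1}" for t
   using WL[OF \<open>x \<in> D\<close>] WL[OF \<open>x' \<in> D\<close>] \<open>y \<in> W x\<close> \<open>y \<in> W x'\<close> that by (simp add: lift_def)
 qed auto
 show thesis
 proof
  show "con D g"
  proof (rule continuous_on_openin_local, intro exI conjI)
   fix x assume x: "x : D"
   thus "opi (tos D) (W x)" "x : W x" using WL by (auto simp: lift_def)
   hence "W x <= D" by (meson openin_imp_subset)
   have "con (W x) (%y. L x (1, y))"
   proof (rule continuous_on_compose2[of "{0..1} \<times> W x" "L x"])
    show "con ({0..1} \<times> W x) (L x)" using WL[OF x] by (simp add: lift_def)
   qed (auto intro!: continuous_on_Pair continuous_on_const continuous_on_id)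
   moreover have "L x (1, y) = g y" if "y : W x" for y
    using agree[of x y y] x \<open>W x \<subseteq> D\<close> WL that unfolding g_def by blast
   ultimately show "con (W x) g"
    using continuous_on_cong[of "W x" "W x" "%y. L x (1, y)" g] by simp
  qed
  show "g : D \<rightarrow> C" using WL by (auto simp: g_def lift_def Pi_iff)
  have "a : W a" "lift 1 (W a) (L a)" using WL[OF a] by auto
  have "con {0..1} (%t. L a (t, a))"
  proof (rule continuous_on_compose2[of "{0..1} \<times> W a" "L a"])
   show "con ({0..1} \<times> W a) (L a)" using WL[OF a] by (simp add: lift_def)
  qed (use WL[OF a] in \<open>auto intro!: continuous_on_Pair continuous_on_const continuous_on_id\<close>)
  note cont = this
  have "L a (1, a) = e"
  proof (rule covering_lift_unique[OF cov, where T="{0..1}" and ?g1.0="%t. L a (t, a)" and ?g2.0="%t. e" and a=0])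
   show "(%t. L a (t, a)) : {0..1} \<rightarrow> C" "L a (0, a) = e"
    "!!t. t : {0..1} ==> p (L a (t, a)) = p e"
    using \<open>a \<in> W a\<close> \<open>lift 1 (W a) (L a)\<close> e by (auto simp: lift_def H_def Pi_iff)
  qed (use cont e in auto)
  thus "g a = e" by (simp add: g_def)
  show "p (g x) = f x" if "x : D" for x
   using WL[OF that] by (auto simp: g_def lift_def H_def)
 qed
qed

lemma power_eucl: "powertop_real UNIV = (euclidean :: ('i => real) topology)"
 by (simp add: euclidean_product_topology)

lemma starlike_connected:
 fixes D :: "('i => real) set"
 assumes a: "a : D" and star: "!!x t. x : D ==> t : {0..1} ==> (%i. a i + t * (x i - a i)) : D"
 shows "connected D"
proof -
 define seg where "seg x = (%t i. a i + t * (x i - a i)) ` {0..1::real}" for x :: "'i => real"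
 have "connected (seg x)" for x
  unfolding seg_def
  by (intro connected_continuous_image continuous_on_coordinatewise_then_product continuous_intros) auto
 moreover have "D = \<Union>(seg ` D)"
 proof
  show "D <= \<Union>(seg ` D)"
  proof
   fix x assume "x : D"
   moreover have "x = (%i. a i + 1 * (x i - a i))" by simp
   hence "x : seg x" unfolding seg_def by (rule image_eqI) simp
   ultimately show "x : \<Union>(seg ` D)" by blast
  qed
 qed (use star in \<open>auto simp: seg_def\<close>)
 moreover have "a : seg x" for x
  unfolding seg_def by (rule image_eqI[of _ _ 0]) auto
 moreover have "connected (\<Union>(seg ` D))"
 proof (rule connected_Union)
  show "\<Inter>(seg ` D) ~= {}" using calculation(3) by blast
 qed (use calculation(1) in blast)
 ultimately show ?thesis by simp
qed

lemma standard_simplex_star: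
 assumes "a : stds n" "x : stds n" "t : {0..1}"
 shows "(%i. a i + t * (x i - a i)) : stds n"
proof -
 have "(%i. a i + t * (x i - a i)) = (%i. (1 - t) * a i + t * x i)" by (auto simp: algebra_simps)
 thus ?thesis using convex_standard_simplex[of a n x t] assms by simp
qed

lemma simplex_points_star:
 assumes "a : spts s" "x : spts s" "t : {0..1}"
 shows "(%i. a i + t * (x i - a i)) : spts s"
proof -
 have "a i + t * (x i - a i) = (1 - t) * a i + t * x i" for i by (simp add: algebra_simps)
 thus ?thesis
  using assms by (simp add: simplex_points_def sum.distrib flip: sum_distrib_left)
qed

lemma connected_standard_simplex: "connected (stds n)"
 using nonempty_standard_simplex[of n] standard_simplex_star starlike_connected by blast

lemma vx_spts: "finite s ==> v : s ==> vx v : spts s"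
 by (auto simp: simplex_points_def vertex_def)

lemma connected_simplex_points: "connected (spts s)"
proof (cases "spts s = {}")
 case False
 thus ?thesis using simplex_points_star starlike_connected by blast
qed simp

lemma cmp_stop:
 "cmp (simplex_top s) (tos Y) f \<longleftrightarrow> con (spts s) f & f : spts s \<rightarrow> Y"
 by (auto simp: power_eucl continuous_map_in_subtopology)

lemma ssx_iff:
 "ssx n (tos S) f \<longleftrightarrow>
  con (stds n) f & f : stds n \<rightarrow> S & f : extensional (stds n)"
 by (auto simp: singular_simplex_def power_eucl continuous_map_in_subtopology)

lemma singular_simplex_lift:
 assumes cov: "covering_space C p S" and f: "ssx n (tos S) f"
  and b: "b : stds n" and e: "e : C" "p e = f b"
 obtains g where "ssx n (tos C) g" "smp n p g = f" "g b = e"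
proof -
 obtain g where g: "con (stds n) g" "g : stds n \<rightarrow> C" "g b = e"
  "!!x. x : stds n ==> p (g x) = f x"
 proof (rule covering_lift_star[where C=C and p=p and S=S and a=b and D="stds n" and f=f and e=e])
  show "con (stds n) f" "f : stds n \<rightarrow> S"
   using f by (auto simp: ssx_iff)
 qed (use assms standard_simplex_star in auto)
 show thesis
 proof
  show "ssx n (tos C) (restrict g (stds n))"
   using g unfolding ssx_iff by (auto intro: continuous_on_eq)
  show "smp n p (restrict g (stds n)) = f"
   using f g unfolding ssx_iff by (auto simp: simplex_map_def fun_eq_iff extensional_def)
 qed (use g b in auto)
qed

lemma ssx_unique:
 assumes cov: "covering_space C p S" and f: "ssx n (tos C) f" "ssx n (tos C) g"
  and eq: "smp n p f = smp n p g" and b: "b : stds n" "f b = g b"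
 shows "f = g"
proof
 fix x
 show "f x = g x"
 proof (cases "x : stds n")
  case True
  show ?thesis
  proof (rule covering_lift_unique[where T="stds n" and a=b and p=p])
   show "p (f y) = p (g y)" if "y : stds n" for y
    using fun_cong[OF eq, of y] that by (simp add: simplex_map_def)
  qed (use cov b True f connected_standard_simplex in \<open>auto simp: ssx_iff\<close>)
 next
  case False
  thus ?thesis using f by (auto simp: ssx_iff extensional_def)
 qed
qed

lemma simplex_points_lift_unique:
 assumes cov: "covering_space C p S"
  and f: "con (spts s) f" "f : spts s \<rightarrow> C"
  and g: "con (spts s) g" "g : spts s \<rightarrow> C"
  and eq: "!!w. w : spts s ==> p (f w) = p (g w)"
  and b: "b : spts s" "f b = g b" and w: "w : spts s"
 shows "f w = g w"
 by (rule covering_lift_unique[where T="spts s" and a=b and p=p and ?g1.0=f and ?g2.0=g])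
  (use assms connected_simplex_points in auto)

lemma simplex_points_lift:
 assumes cov: "covering_space C p S" and f: "con (spts s) f" "f : spts s \<rightarrow> S"
  and b: "b : spts s" and e: "e : C" "p e = f b"
 obtains g where "con (spts s) g" "g : spts s \<rightarrow> C" "g b = e"
  "!!w. w : spts s ==> p (g w) = f w"
 using covering_lift_star[where C=C and p=p and S=S and a=b and D="spts s" and f=f and e=e]
  assms simplex_points_star[OF b] by blast

section \<open>Pushing forward infinite chains, and transfer\<close>

text \<open>The map Q of simplices is arbitrary. Induced maps, faces and reassignments of vertices
  are all of this form, and \<open>gpush_gpush\<close> composes them without regard to their
  kind.\<close>

definition gpush :: "('s => 't) => ('s => rat) => 't => rat" where
 "gpush Q c = (%T. SUM S | c S ~= 0 & Q S = T. c S)"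

text \<open>The sums in \<open>gpush\<close> are over these sets; over an infinite one the sum would
  be 0 by convention, and additivity would fail.\<close>

definition fib_finite :: "('s => 't) => ('s => rat) => bool" where
 "fib_finite Q c \<longleftrightarrow> (ALL T. finite {S. c S ~= 0 & Q S = T})"

lemma gpush_on_superset:
 assumes "finite A" "{S. c S ~= 0 & Q S = T} <= A"
 shows "gpush Q c T = (SUM S:A. if Q S = T then c S else 0)"
 unfolding gpush_def
 by (rule sum.mono_neutral_cong_left) (use assms in auto)

lemma gpush_nonzero: "gpush Q c T ~= 0 ==> EX S. c S ~= 0 & Q S = T"
 unfolding gpush_def by (metis (mono_tags, lifting) mem_Collect_eq sum.neutral)

lemma smp_apply: "t : stds n ==> smp n f S t = f (S t)"
 by (simp add: simplex_map_def)

lemma gpush_cong: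
 assumes "!!S. c S ~= 0 ==> Q S = B S"
 shows "gpush Q c = gpush B c"
proof
 fix T
 have "{S. c S ~= 0 & Q S = T} = {S. c S ~= 0 & B S = T}" using assms by auto
 thus "gpush Q c T = gpush B c T" by (simp add: gpush_def)
qed

lemma gpush_zero [simp]: "gpush Q (%_. 0) = (%_. 0)"
 by (simp add: gpush_def)

lemma gpush_add:
 assumes "fib_finite Q a" "fib_finite Q b"
 shows "gpush Q (%S. a S + b S) = (%T. gpush Q a T + gpush Q b T)"
proof
 fix T
 define A where "A = {S. a S ~= 0 & Q S = T} Un {S. b S ~= 0 & Q S = T}"
 have "finite A" using assms by (auto simp: A_def fib_finite_def)
 note A = gpush_on_superset[OF this, where Q=Q and T=T]
 have "gpush Q (%S. a S + b S) T = (SUM S:A. if Q S = T then a S + b S else 0)"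
  by (rule A) (auto simp: A_def)
 moreover have "gpush Q a T = (SUM S:A. if Q S = T then a S else 0)"
  by (rule A) (auto simp: A_def)
 moreover have "gpush Q b T = (SUM S:A. if Q S = T then b S else 0)"
  by (rule A) (auto simp: A_def)
 ultimately show "gpush Q (%S. a S + b S) T = gpush Q a T + gpush Q b T"
  by (simp add: sum.distrib[symmetric] if_distrib[of "%x. x + _"] cong: if_cong)
qed

lemma gpush_scale: "gpush Q (%S. k * a S) = (%T. k * gpush Q a T)"
 by (cases "k = 0") (auto simp: gpush_def sum_distrib_left)

lemma fib_finite_zero [simp]: "fib_finite Q (%_. 0)"
 by (simp add: fib_finite_def)

lemma fib_finite_add:
 assumes "fib_finite Q a" "fib_finite Q b" shows "fib_finite Q (%S. a S + b S)"
 unfolding fib_finite_def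
proof
 fix T
 have "finite ({S. a S ~= 0 & Q S = T} Un {S. b S ~= 0 & Q S = T})" using assms by (auto simp: fib_finite_def)
 thus "finite {S. a S + b S ~= 0 & Q S = T}" by (rule rev_finite_subset) auto
qed

lemma fib_finite_scale: "fib_finite Q a ==> fib_finite Q (%S. k * a S)"
 by (cases "k = 0") (auto simp: fib_finite_def)

lemma gpush_sum:
 assumes "finite I" "!!i. i : I ==> fib_finite Q (a i)"
 shows "gpush Q (%S. SUM i:I. a i S) = (%T. SUM i:I. gpush Q (a i) T) & fib_finite Q (%S. SUM i:I. a i S)"
 using assms
proof (induction I rule: finite_induct)
 case (insert i I)
 hence "fib_finite Q (a i)" "fib_finite Q (%S. SUM i:I. a i S)"
  "gpush Q (%S. SUM i:I. a i S) = (%T. SUM i:I. gpush Q (a i) T)" by auto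
 thus ?case using insert.hyps by (simp add: gpush_add fib_finite_add)
qed simp

lemma gpush_gpush:
 assumes fin: "!!T. finite {S. c S ~= 0 & P (Q S) = T}"
 shows "gpush P (gpush Q c) = gpush (%S. P (Q S)) c"
proof
 fix T
 define A where "A = {S. c S ~= 0 & P (Q S) = T}"
 have A: "finite A" using fin by (simp add: A_def)
 have "gpush P (gpush Q c) T = (SUM R:Q ` A. if P R = T then gpush Q c R else 0)"
 proof (rule gpush_on_superset)
  show "{R. gpush Q c R ~= 0 & P R = T} <= Q ` A"
   using gpush_nonzero[of Q c] by (fastforce simp: A_def)
 qed (use A in simp)
 also have "... = (SUM R:Q ` A. sum c {S : A. Q S = R})"
 proof (rule sum.cong[OF refl])
  fix R assume "R : Q ` A"
  hence "P R = T" by (auto simp: A_def)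
  moreover from this have "{S. c S ~= 0 & Q S = R} = {S : A. Q S = R}" by (auto simp: A_def)
  ultimately show "(if P R = T then gpush Q c R else 0) = sum c {S : A. Q S = R}"
   by (simp add: gpush_def)
 qed
 also have "... = sum c A" by (rule sum.image_gen[OF A, symmetric])
 finally show "gpush P (gpush Q c) T = gpush (%S. P (Q S)) c T" by (simp add: gpush_def A_def)
qed

lemma fib_finite_gpush:
 assumes fin: "!!T. finite {S. c S ~= 0 & P (Q S) = T}"
 shows "fib_finite P (gpush Q c)"
 unfolding fib_finite_def
proof
 fix T
 have "{R. gpush Q c R ~= 0 & P R = T} <= Q ` {S. c S ~= 0 & P (Q S) = T}"
  using gpush_nonzero[of Q c] by fastforce
 thus "finite {R. gpush Q c R ~= 0 & P R = T}" using fin finite_subset by blast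
qed

lemma qpush_gpush: "qpush p f = gpush (smp p f)"
 by (simp add: fun_eq_iff qpush_def gpush_def)

lemma qbd_faces:
 "qbd p c = (if p = 0 then (%_. 0) else (%T. SUM k<=p. (- 1) ^ k * gpush (sfc p k) c T))"
 by (simp add: fun_eq_iff qboundary_def gpush_def sum_distrib_left)

text \<open>The criterion for a map given simplex by simplex to commute with the boundary: Q acts in
  degree p, B in degree \<open>p - 1\<close>, and faces intertwine them. Finiteness of the fibres of
  the composite covers both orders of pushing.\<close>

lemma qboundary_gpush:
 assumes face: "!!S k. c S ~= 0 ==> k <= p ==> sfc p k (Q S) = B (sfc p k S)"
  and fin: "!!k T. k <= p ==> finite {S. c S ~= 0 & B (sfc p k S) = T}"
 shows "qbd p (gpush Q c) = gpush B (qbd p c)"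
proof (cases "p = 0")
 case False
 have eq: "gpush (sfc p k) (gpush Q c) = gpush B (gpush (sfc p k) c)"
  and ff: "fib_finite B (%T. (- 1) ^ k * gpush (sfc p k) c T)" if "k <= p" for k
 proof -
  have "{S. c S ~= 0 & sfc p k (Q S) = T} = {S. c S ~= 0 & B (sfc p k S) = T}" for T
   using face that by auto
  hence "gpush (sfc p k) (gpush Q c) = gpush (%S. sfc p k (Q S)) c"
   using fin that gpush_gpush[of c "sfc p k" Q] by simp
  also have "... = gpush (%S. B (sfc p k S)) c" by (rule gpush_cong) (use face that in auto)
  also have "... = gpush B (gpush (sfc p k) c)" by (rule gpush_gpush[symmetric]) (rule fin[OF that])
  finally show "gpush (sfc p k) (gpush Q c) = gpush B (gpush (sfc p k) c)" .
  show "fib_finite B (%T. (- 1) ^ k * gpush (sfc p k) c T)"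
   by (intro fib_finite_scale fib_finite_gpush fin that)
 qed
 have "gpush B (%T. SUM k<=p. (- 1) ^ k * gpush (sfc p k) c T) =
  (%T. SUM k<=p. gpush B (%T. (- 1) ^ k * gpush (sfc p k) c T) T)"
  using gpush_sum[of "{..p}" B "%k T. (- 1) ^ k * gpush (sfc p k) c T"] ff by simp
 also have "... = (%T. SUM k<=p. (- 1) ^ k * gpush (sfc p k) (gpush Q c) T)"
  by (intro ext sum.cong) (simp_all add: eq gpush_scale)
 finally show ?thesis using False by (simp add: qbd_faces)
qed (simp add: qbd_faces)

lemma qboundary_add:
 assumes "!!k. k <= p ==> fib_finite (sfc p k) a" "!!k. k <= p ==> fib_finite (sfc p k) b"
 shows "qbd p (%S. a S + b S) = (%T. qbd p a T + qbd p b T)"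
 using assms by (auto simp: qbd_faces gpush_add ring_distribs sum.distrib)

lemma qboundary_scale: "qbd p (%S. k * a S) = (%T. k * qbd p a T)"
 by (auto simp: qbd_faces gpush_scale sum_distrib_left mult.left_commute)

lemma compact_ssx:
 assumes "ssx p X S" shows "compactin X (S ` stds p)"
proof (rule image_compactin)
 show "compactin (sbt (powertop_real UNIV) (stds p)) (stds p)"
  using compactin_standard_simplex by (simp add: compactin_subtopology)
qed (use assms in \<open>simp add: singular_simplex_def\<close>)

lemma sfc_image:
 assumes "1 <= p" "k <= p"
 shows "sfc p k S ` stds (p - Suc 0) <= S ` stds p"
 using simplical_face_in_standard_simplex[OF assms] by (auto simp: singular_face_def)

lemma sfc_smp:
 assumes "1 <= p" "k <= p"
 shows "sfc p k (smp p f c) = smp (p - Suc 0) f (sfc p k c)"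
 using singular_face_simplex_map[OF assms, of f c] by (auto simp: simplex_map_def singular_face_def)

lemma lf_zero [simp]: "(%_. 0) : lfc X p"
 by (simp add: lf_chains_def)

lemma lf_add:
 assumes "a : lfc X p" "b : lfc X p" shows "(%S. a S + b S) : lfc X p"
proof -
 have "finite {S. a S + b S ~= 0 & S ` stds p Int K ~= {}}" if "compactin X K" for K
 proof -
  have "finite ({S. a S ~= 0 & S ` stds p Int K ~= {}} Un {S. b S ~= 0 & S ` stds p Int K ~= {}})"
   using assms that by (simp add: lf_chains_def)
  thus ?thesis by (rule rev_finite_subset) auto
 qed
 moreover have "ssx p X S" if "a S + b S ~= 0" for S
  using assms that by (cases "a S = 0") (auto simp: lf_chains_def)
 ultimately show ?thesis by (simp add: lf_chains_def)
qed

lemma lf_scale: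
 assumes "a : lfc X p" shows "(%S. k * a S) : lfc X p"
 using assms by (cases "k = 0") (auto simp: lf_chains_def)

lemma lf_sum:
 assumes "finite I" "!!i. i : I ==> a i : lfc X p" shows "(%S. SUM i:I. a i S) : lfc X p"
 using assms by (induction I rule: finite_induct) (auto intro: lf_add)

text \<open>Local finiteness of the image is a property of the family \<open>T S\<close>, however it
  was obtained from the simplices S. Finite fibres follow, because a simplex of Y has a compact
  image, which it meets itself.\<close>

lemma lf_gpush:
 assumes simp: "!!S. c S ~= 0 ==> ssx q Y (T S)"
  and fin: "!!Q. compactin Y Q ==> finite {S. c S ~= 0 & T S ` stds q Int Q ~= {}}"
 shows "gpush T c : lfc Y q" "fib_finite T c"
proof -
 have "finite {t. gpush T c t ~= 0 & t ` stds q Int Q ~= {}}" if "compactin Y Q" for Q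
 proof -
  have "{t. gpush T c t ~= 0 & t ` stds q Int Q ~= {}} <=
   T ` {S. c S ~= 0 & T S ` stds q Int Q ~= {}}"
   using gpush_nonzero[of T c] by fastforce
  thus ?thesis using fin[OF that] finite_subset by blast
 qed
 moreover have "ssx q Y t" if "gpush T c t ~= 0" for t
  using gpush_nonzero[OF that] simp by auto
 ultimately show "gpush T c : lfc Y q" by (simp add: lf_chains_def)
 show "fib_finite T c" unfolding fib_finite_def
 proof
  fix t
  show "finite {S. c S ~= 0 & T S = t}"
  proof (cases "ssx q Y t")
   case True
   show ?thesis
    by (rule finite_subset[OF _ fin[OF compact_ssx[OF True]]])
     (use nonempty_standard_simplex[of q] in auto)
  next
   case False
   hence "{S. c S ~= 0 & T S = t} = {}" using simp by auto
   thus ?thesis by (simp only: finite.emptyI)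
  qed
 qed
qed

lemma lf_gpush_face:
 assumes c: "c : lfc X p" and "1 <= p" "k <= p"
 shows "gpush (sfc p k) c : lfc X (p - Suc 0)" "fib_finite (sfc p k) c"
proof -
 have 1: "ssx (p - Suc 0) X (sfc p k S)" if "c S ~= 0" for S
  using c that assms by (auto simp: lf_chains_def intro: singular_simplex_singular_face)
 have 2: "finite {S. c S ~= 0 & sfc p k S ` stds (p - Suc 0) Int Q ~= {}}"
  if "compactin X Q" for Q
 proof (rule finite_subset)
  show "finite {S. c S ~= 0 & S ` stds p Int Q ~= {}}" using c that by (simp add: lf_chains_def)
  show "{S. c S ~= 0 & sfc p k S ` stds (p - Suc 0) Int Q ~= {}}
    <= {S. c S ~= 0 & S ` stds p Int Q ~= {}}"
  proof (intro Collect_mono impI conjI)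
   fix S assume "c S ~= 0 & sfc p k S ` stds (p - Suc 0) Int Q ~= {}"
   thus "S ` stds p Int Q ~= {}" "c S ~= 0"
    using sfc_image[OF assms(2,3), of S] by blast+
  qed
 qed
 show "gpush (sfc p k) c : lfc X (p - Suc 0)" "fib_finite (sfc p k) c"
  using lf_gpush[of c "p - Suc 0" X "sfc p k", OF 1 2] by blast+
qed

lemma lf_boundary:
 assumes "c : lfc X (Suc p)" shows "qbd (Suc p) c : lfc X p"
proof -
 have "(%T. SUM k<=Suc p. (- 1) ^ k * gpush (sfc (Suc p) k) c T) : lfc X p"
  using lf_gpush_face(1)[OF assms] by (intro lf_sum lf_scale) auto
 thus ?thesis by (simp add: qbd_faces)
qed

lemma lf_qboundary_add:
 assumes "a : lfc X p" "b : lfc X p"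
 shows "qbd p (%S. a S + b S) = (%T. qbd p a T + qbd p b T)"
proof (cases "p = 0")
 case False
 thus ?thesis using lf_gpush_face(2)[OF assms(1)] lf_gpush_face(2)[OF assms(2)] by (intro qboundary_add) auto
qed (simp add: qboundary_def)

text \<open>The preimage of a compact set is only asked to lie in a compact set. Local finiteness of
  pushed chains requires no more, and it can be checked by exhibiting a large compact set.\<close>

definition lf_proper :: "'a topology => 'b topology => ('a => 'b) => bool" where
 "lf_proper X Y f \<longleftrightarrow> cmp X Y f &
  (ALL Q. compactin Y Q --> (EX Q'. compactin X Q' & {x : tps X. f x : Q} <= Q'))"

lemma lf_push:
 assumes f: "lf_proper X Y f" and c: "c : lfc X p"
 shows "qpush p f c : lfc Y p" "fib_finite (smp p f) c"
proof -
 have 1: "ssx p Y (smp p f S)" if "c S ~= 0" for S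
  using c f that by (auto simp: lf_chains_def lf_proper_def intro: singular_simplex_simplex_map)
 have 2: "finite {S. c S ~= 0 & smp p f S ` stds p Int Q ~= {}}" if Q: "compactin Y Q" for Q
 proof -
  obtain Q' where Q': "compactin X Q'" "{x : tps X. f x : Q} <= Q'"
   using f Q by (auto simp: lf_proper_def)
  have fin: "finite {S. c S ~= 0 & S ` stds p Int Q' ~= {}}" using c Q' by (simp add: lf_chains_def)
  have "S ` stds p Int Q' ~= {}"
   if s: "c S ~= 0" "smp p f S ` stds p Int Q ~= {}" for S
  proof -
   obtain t where t: "t : stds p" "f (S t) : Q" using s(2) by (auto simp: simplex_map_def)
   have "ssx p X S" using c s by (simp add: lf_chains_def)
   hence "S t : tps X"
    using compact_ssx compactin_subset_topspace t(1) by blast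
   thus ?thesis using t Q'(2) by blast
  qed
  thus ?thesis by (intro finite_subset[OF _ fin]) blast
 qed
 show "qpush p f c : lfc Y p" "fib_finite (smp p f) c"
  using lf_gpush[of c p Y "smp p f", OF 1 2] by (auto simp: qpush_gpush)
qed

lemma lf_push_boundary:
 assumes f: "lf_proper X Y f" and c: "c : lfc X p"
 shows "qbd p (qpush p f c) = qpush (p - Suc 0) f (qbd p c)"
proof (cases "p = 0")
 case False
 have sing: "sfc p k (smp p f S) = smp (p - Suc 0) f (sfc p k S)"
  if "k <= p" for k S
  using that False by (simp add: sfc_smp)
 have "fib_finite (sfc p k) (qpush p f c)" if "k <= p" for k
  using lf_gpush_face(2)[OF lf_push(1)[OF f c]] False that by simp
 have fin: "finite {S. c S ~= 0 & smp (p - Suc 0) f (sfc p k S) = T}" if k: "k <= p" for k T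
 proof -
  have c1: "gpush (sfc p k) c : lfc X (p - Suc 0)" "fib_finite (sfc p k) c"
   using lf_gpush_face[OF c _ k] False by auto
  show ?thesis
  proof (cases "ssx (p - Suc 0) Y T")
   case True
   obtain Q' where Q': "compactin X Q'" "{x : tps X. f x : T ` stds (p - Suc 0)} <= Q'"
    using f compact_ssx[OF True] by (auto simp: lf_proper_def)
   have "{S. c S ~= 0 & smp (p - Suc 0) f (sfc p k S) = T} <=
    {S. c S ~= 0 & S ` stds p Int Q' ~= {}}"
   proof clarsimp
    fix S assume s: "c S ~= 0" "T = smp (p - Suc 0) f (sfc p k S)"
     "S ` stds p Int Q' = {}"
    obtain t where t: "t : stds (p - Suc 0)" using nonempty_standard_simplex by blast
    have x: "sfc p k S t : S ` stds p"
     using sfc_image[of p k S] t False k by auto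
    have "ssx p X S" using c s by (simp add: lf_chains_def)
    hence "sfc p k S t : tps X"
     using compact_ssx compactin_subset_topspace x by blast
    moreover have "f (sfc p k S t) = T t" using t s(2) by (simp add: simplex_map_def)
    ultimately have "sfc p k S t : Q'" using Q'(2) t by auto
    thus False using s(3) x by blast
   qed
   thus ?thesis using c Q'(1) by (auto simp: lf_chains_def intro: finite_subset)
  next
   case F: False
   have "ssx (p - Suc 0) Y (smp (p - Suc 0) f (sfc p k S))" if "c S ~= 0" for S
    using c f that k False
    by (intro singular_simplex_simplex_map[where X=X] singular_simplex_singular_face)
     (auto simp: lf_chains_def lf_proper_def)
   hence "{S. c S ~= 0 & smp (p - Suc 0) f (sfc p k S) = T} = {}" using F by blast
   thus ?thesis by (simp only: finite.emptyI)
  qed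
 qed
 show ?thesis
  unfolding qpush_gpush by (rule qboundary_gpush) (use sing fin in auto)
qed (simp add: qboundary_def qpush_gpush)

lemma qhomology_class_eq:
 "qhc C p z = {(%S. b S + z S) | b. b : qbd (Suc p) ` C (Suc p)}"
 by (auto simp: qhomology_class_def r_coset_def qcycle_group_def)

lemma one_qhomology_group: "\<one>\<^bsub>qhg C p\<^esub> = qbd (Suc p) ` C (Suc p)"
 by (simp add: qhomology_group_def FactGroup_def)

lemma qboundary_zero [simp]: "qbd p (%_. 0) = (%_. 0)"
 by (simp add: qboundary_def)

lemma qhomology_class_zero: "qhc C p (%_. 0) = \<one>\<^bsub>qhg C p\<^esub>"
 by (auto simp: qhomology_class_eq one_qhomology_group)

lemma qhomology_class_boundary:
 assumes "b : qbd (Suc p) ` lfc X (Suc p)"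
 shows "qhc (lfc X) p (%S. b S + z S) = qhc (lfc X) p z"
proof -
 obtain e where e: "e : lfc X (Suc p)" "b = qbd (Suc p) e" using assms by blast
 have *: "(%S. b1 S + k * b S) : qbd (Suc p) ` lfc X (Suc p)"
  if b1: "b1 : qbd (Suc p) ` lfc X (Suc p)" for b1 k
 proof -
  obtain e1 where e1: "e1 : lfc X (Suc p)" "b1 = qbd (Suc p) e1" using b1 by blast
  have "(%S. b1 S + k * b S) = qbd (Suc p) (%S. e1 S + k * e S)"
   using e e1 by (simp add: lf_qboundary_add lf_scale qboundary_scale)
  thus ?thesis using e1(1) e(1) by (simp add: lf_add lf_scale)
 qed
 show ?thesis
  unfolding qhomology_class_eq
 proof (intro equalityI subsetI; clarify)
  fix b1 assume "b1 : lfc X (Suc p)"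
  thus "EX b'. (%S. qbd (Suc p) b1 S + (b S + z S)) = (%S. b' S + z S) & b' : qbd (Suc p) ` lfc X (Suc p)"
   using *[of "qbd (Suc p) b1" 1] by (intro exI[of _ "%S. qbd (Suc p) b1 S + 1 * b S"]) (auto simp: algebra_simps)
 next
  fix b1 assume "b1 : lfc X (Suc p)"
  thus "EX b'. (%S. qbd (Suc p) b1 S + z S) = (%S. b' S + (b S + z S)) & b' : qbd (Suc p) ` lfc X (Suc p)"
   using *[of "qbd (Suc p) b1" "-1"] by (intro exI[of _ "%S. qbd (Suc p) b1 S + -1 * b S"]) (auto simp: algebra_simps)
 qed
qed

lemma qhomology_map_class:
 assumes f: "lf_proper X Y f" and z: "z : lfc X p"
 shows "qhomology_map p (lfc Y) f (qhc (lfc X) p z) = qhc (lfc Y) p (qpush p f z)"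
proof -
 have "qhc (lfc Y) p (qpush p f c) = qhc (lfc Y) p (qpush p f z)"
  if c: "c : qhc (lfc X) p z" for c
 proof -
  obtain a where a: "a : lfc X (Suc p)" "c = (%S. qbd (Suc p) a S + z S)"
   using c unfolding qhomology_class_eq by blast
  have "qpush p f c = (%S. qpush p f (qbd (Suc p) a) S + qpush p f z S)"
   unfolding a(2) qpush_gpush using lf_push(2)[OF f lf_boundary[OF a(1)]] lf_push(2)[OF f z] by (rule gpush_add)
  moreover have "qpush p f (qbd (Suc p) a) = qbd (Suc p) (qpush (Suc p) f a)"
   using lf_push_boundary[OF f a(1)] by simp
  ultimately show ?thesis
   using qhomology_class_boundary[of "qbd (Suc p) (qpush (Suc p) f a)" p Y "qpush p f z"] lf_push(1)[OF f a(1)]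
   by simp
 qed
 moreover have "z : qhc (lfc X) p z"
 proof -
  have "z = (%S. (%_. 0) S + z S)" "(%_. 0) : qbd (Suc p) ` lfc X (Suc p)"
   by (auto intro!: image_eqI[of _ _ "%_. 0"])
  thus ?thesis unfolding qhomology_class_eq by (intro CollectI exI[of _ "%_. 0"] conjI)
 qed
 ultimately show ?thesis unfolding qhomology_map_def by blast
qed

lemma qhomology_map_one:
 assumes f: "lf_proper X Y f"
 shows "qhomology_map p (lfc Y) f \<one>\<^bsub>qhg (lfc X) p\<^esub> = \<one>\<^bsub>qhg (lfc Y) p\<^esub>"
 using qhomology_map_class[OF f lf_zero, of p] by (simp add: qpush_gpush qhomology_class_zero)

definition transfer :: "nat => 'b::topological_space set => ('b => 'a) => 'a qchain => 'b qchain" where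
 "transfer n C p c = (%T. if ssx n (tos C) T then c (smp n p T) else 0)"

text \<open>Unique lifting, in the form of the second hypothesis, matches the simplices over c that
  B sends to T with the simplices of c that F sends to the projection of T; the two sums have equal
  terms.\<close>

lemma transfer_gpush:
 assumes B: "!!S. ssx n (tos C) S ==> ssx m (tos E) (B S) & smp m q (B S) = F (smp n p S)"
  and lift: "!!S T. c S ~= 0 ==> ssx m (tos E) T ==> F S = smp m q T ==>
   EX! Z. ssx n (tos C) Z & smp n p Z = S & B Z = T"
 shows "gpush B (transfer n C p c) = transfer m E q (gpush F c)"
proof
 fix T
 let ?L = "{S. transfer n C p c S ~= 0 & B S = T}" and ?R = "{S. c S ~= 0 & F S = smp m q T}"
 have L: "S : ?L \<longleftrightarrow> ssx n (tos C) S & c (smp n p S) ~= 0 & B S = T" for S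
  by (auto simp: transfer_def)
 show "gpush B (transfer n C p c) T = transfer m E q (gpush F c) T"
 proof (cases "ssx m (tos E) T")
  case True
  have R: "smp n p S : ?R" if "S : ?L" for S using that B[of S] unfolding L by auto
  have "bij_betw (smp n p) ?L ?R"
   unfolding bij_betw_def
  proof (intro conjI inj_onI equalityI subsetI)
   fix S G assume s: "S : ?L" "G : ?L" "smp n p S = smp n p G"
   thus "S = G" using lift[OF _ True, of "smp n p S"] R[OF s(1)] unfolding L mem_Collect_eq by metis
  next
   fix S assume s: "S : ?R"
   then obtain Z where "ssx n (tos C) Z" "smp n p Z = S" "B Z = T" using lift[OF _ True, of S] by blast
   thus "S : smp n p ` ?L" using s unfolding mem_Collect_eq by (intro image_eqI[of _ _ Z]) (auto simp: transfer_def)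
  qed (use R in blast)
  hence "(SUM S:?L. c (smp n p S)) = (SUM S:?R. c S)" by (rule sum.reindex_bij_betw)
  moreover have "(SUM S:?L. transfer n C p c S) = (SUM S:?L. c (smp n p S))"
   by (rule sum.cong) (auto simp: transfer_def split: if_splits)
  ultimately show ?thesis using True by (simp add: gpush_def transfer_def[of m])
 next
  case False
  hence "?L = {}" using L B by blast
  thus ?thesis using False by (simp only: gpush_def transfer_def[of m] sum.empty if_False)
 qed
qed

text \<open>A lift of a simplex is determined by any one of its faces, and every lift of a face
  extends to a lift of the simplex. A single point v of the face controls both statements.\<close>

lemma transfer_boundary:
 assumes cov: "covering_space C p S" and c: "!!Z. c Z ~= 0 ==> ssx (Suc n) (tos S) Z"
 shows "qbd (Suc n) (transfer (Suc n) C p c) = transfer n C p (qbd (Suc n) c)"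
proof -
 obtain v where v: "v : stds n" using nonempty_standard_simplex by blast
 have push: "gpush (sfc (Suc n) k) (transfer (Suc n) C p c) = transfer n C p (gpush (sfc (Suc n) k) c)"
  if k: "k <= Suc n" for k
 proof (rule transfer_gpush)
  have vk: "sfce k v : stds (Suc n)" using simplical_face_in_standard_simplex[of "Suc n" k v] k v by simp
  have fv: "sfc (Suc n) k Z v = Z (sfce k v)" for Z :: "_ => 'z"
   using v by (simp add: singular_face_def)
  have fm: "smp n p (sfc (Suc n) k Z) = sfc (Suc n) k (smp (Suc n) p Z)" for Z
   using sfc_smp[of "Suc n" k p Z] k by simp
  show sf: "ssx n (tos C) (sfc (Suc n) k Z) & smp n p (sfc (Suc n) k Z) = sfc (Suc n) k (smp (Suc n) p Z)"
   if "ssx (Suc n) (tos C) Z" for Z using singular_simplex_singular_face[OF that, of k] k fm by simp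
  fix Z T assume s: "c Z ~= 0" and T: "ssx n (tos C) T" and e: "sfc (Suc n) k Z = smp n p T"
  have "T v : C" using T v by (auto simp: ssx_iff)
  moreover have "p (T v) = Z (sfce k v)" using fun_cong[OF e, of v] fv[of Z] smp_apply[OF v, of p T] by simp
  ultimately obtain R where R: "ssx (Suc n) (tos C) R" "smp (Suc n) p R = Z" "R (sfce k v) = T v"
   using singular_simplex_lift[OF cov c[OF s] vk] by blast
  have "sfc (Suc n) k R = T"
   using sf[OF R(1)] R(2,3) fv[of R] e by (intro ssx_unique[OF cov _ T _ v]) auto
  moreover have "B = R" if "ssx (Suc n) (tos C) B" "smp (Suc n) p B = Z" "sfc (Suc n) k B = T" for B
   using that fv[of B] R by (intro ssx_unique[OF cov _ R(1) _ vk]) auto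
  ultimately show "EX! R. ssx (Suc n) (tos C) R & smp (Suc n) p R = Z & sfc (Suc n) k R = T"
   using R by blast
 qed
 show ?thesis
 proof
  fix T
  have "(SUM k<=Suc n. (-1) ^ k * gpush (sfc (Suc n) k) (transfer (Suc n) C p c) T)
   = (SUM k<=Suc n. (-1) ^ k * transfer n C p (gpush (sfc (Suc n) k) c) T)"
   by (intro sum.cong refl) (simp add: push)
  thus "qbd (Suc n) (transfer (Suc n) C p c) T = transfer n C p (qbd (Suc n) c) T"
   by (simp add: qbd_faces transfer_def[of n])
 qed
qed

text \<open>The hypothesis \<open>fib\<close> says that the square formed by F, f, p and q is a
  pullback on points. So a simplex of E over the image of Z corresponds to exactly one lift of
  Z.\<close>

lemma transfer_push:
 assumes covC: "covering_space C p S" and covE: "covering_space E q B"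
  and F: "con C F" "F : C \<rightarrow> E" and f: "con S f" "f : S \<rightarrow> B"
  and qF: "!!x. x : C ==> q (F x) = f (p x)"
  and fib: "!!e y. e : E ==> y : S ==> q e = f y ==> EX! x. x : C & p x = y & F x = e"
  and c: "!!Z. c Z ~= 0 ==> ssx n (tos S) Z"
 shows "qpush n F (transfer n C p c) = transfer n E q (qpush n f c)"
 unfolding qpush_gpush
proof (rule transfer_gpush)
 obtain v where v: "v : stds n" using nonempty_standard_simplex by blast
 have cF: "cmp (tos C) (tos E) F" using F by auto
 show sF: "ssx n (tos E) (smp n F Z) & smp n q (smp n F Z) = smp n f (smp n p Z)"
  if "ssx n (tos C) Z" for Z
  using that qF singular_simplex_simplex_map[OF that cF] by (auto simp: simplex_map_def ssx_iff fun_eq_iff Pi_iff)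
 fix Z T assume s: "c Z ~= 0" and T: "ssx n (tos E) T" and e: "smp n f Z = smp n q T"
 have tv: "T v : E" "Z v : S" "q (T v) = f (Z v)"
  using T c[OF s] v fun_cong[OF e, of v] by (auto simp: ssx_iff smp_apply[OF v])
 then obtain x where x: "x : C" "p x = Z v" "F x = T v" using fib by metis
 obtain R where R: "ssx n (tos C) R" "smp n p R = Z" "R v = x"
  using singular_simplex_lift[OF covC c[OF s] v x(1,2)] by blast
 have "smp n F R = T"
  using sF[OF R(1)] R e x by (intro ssx_unique[OF covE _ T _ v]) (auto simp: smp_apply[OF v])
 moreover have "G = R" if r: "ssx n (tos C) G" "smp n p G = Z" "smp n F G = T" for G
 proof (rule ssx_unique[OF covC r(1) R(1) _ v])
  have "G v : C" using r(1) v by (auto simp: ssx_iff)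
  moreover have "p (G v) = Z v" "F (G v) = T v" using r(2,3) smp_apply[OF v] by metis+
  ultimately show "G v = R v" using fib[OF tv] x R(3) by blast
 qed (simp add: r(2) R(2))
 ultimately show "EX! R. ssx n (tos C) R & smp n p R = Z & smp n F R = T" using R by blast
qed

section \<open>Realizations of simplicial complexes\<close>

text \<open>The affine singular simplex with i-th vertex \<open>vs i\<close>. Vertices may coincide,
  in which case their coordinates are added up; such degenerate simplices arise from refinement
  maps.\<close>

definition aff :: "nat => (nat => 'u) => (nat => real) => 'u => real" where
 "aff n vs = (\<lambda>t\<in>stds n. %u. SUM i | i <= n & vs i = u. t i)"

lemma vx_stds: "i <= n ==> vx i : stds n"
 unfolding vertex_def using basis_in_standard_simplex[of i n] by (simp add: eq_commute[of i])

lemma ordered_simplex_aff: "osx n h s = smp n h (aff n (%i. lst s ! i))"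
 by (auto simp: ordered_simplex_def simplex_map_def aff_def fun_eq_iff)

lemma simplicial_complexD:
 assumes "simplicial_complex K" "s : K" "t <= s" "t ~= {}" shows "t : K"
proof -
 from assms(1) have "ALL s:K. ALL t. t <= s & t ~= {} --> t : K" unfolding simplicial_complex_def by (rule conjunct2)
 thus ?thesis using assms(2-4) by simp
qed

lemma aff_apply: "t : stds n ==> aff n vs t u = (SUM i<=n. if vs i = u then t i else 0)"
 by (simp add: aff_def sum.inter_filter[symmetric])

lemma aff_in_spts:
 assumes "t : stds n" "vs ` {..n} <= s" "finite s"
 shows "aff n vs t : spts s"
proof -
 have t: "!!i. 0 <= t i" "(SUM i<=n. t i) = 1" using assms(1) by (auto simp: standard_simplex_def)
 have "(SUM u:s. SUM i<=n. if vs i = u then t i else 0) = (SUM i<=n. SUM u:s. if vs i = u then t i else 0)"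
  by (rule sum.swap)
 also have "... = (SUM i<=n. t i)" using assms(2,3) by (intro sum.cong) auto
 finally show ?thesis
  using assms t unfolding simplex_points_def by (auto simp: aff_apply intro!: sum_nonneg sum.neutral)
qed

lemma aff_vertex:
 assumes "i <= n" shows "aff n vs (vx i) = vx (vs i)"
proof
 fix u
 have "(SUM j<=n. if vs j = u then vx i j else (0::real)) = (SUM j<=n. if j = i then (if vs i = u then 1 else 0) else 0)"
  by (intro sum.cong) (auto simp: vertex_def)
 thus "aff n vs (vx i) u = vx (vs i) u"
  using assms by (simp add: aff_apply vx_stds) (simp add: vertex_def)
qed

lemma continuous_map_aff:
 assumes "vs ` {..n} <= s" "finite s"
 shows "cmp (sbt (powertop_real UNIV) (stds n)) (simplex_top s) (aff n vs)"
proof -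
 have "con (stds n) (%t u. SUM i<=n. if vs i = u then t i else 0)"
 proof (intro continuous_on_coordinatewise_then_product continuous_on_sum)
  fix u i
  have "con (stds n) (%t. t i)"
   by (rule continuous_on_product_then_coordinatewise[OF continuous_on_id])
  thus "con (stds n) (%t. if vs i = u then t i else 0)"
   by (cases "vs i = u") auto
 qed
 hence "con (stds n) (aff n vs)"
  by (rule continuous_on_eq) (simp add: aff_apply fun_eq_iff)
 thus ?thesis
  using aff_in_spts[OF _ assms] unfolding power_eucl
  by (auto simp: continuous_map_in_subtopology)
qed

lemma aff_surj:
 assumes "bij_betw vs {..n} s" "w : spts s"
 shows "(%i. if i <= n then w (vs i) else 0) : stds n"
  "aff n vs (%i. if i <= n then w (vs i) else 0) = w"
proof -
 let ?t = "%i. if i <= n then w (vs i) else 0"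
 have fin: "finite s" using assms(1) bij_betw_finite by blast
 have w: "!!v. 0 <= w v" "sum w s = 1" "!!v. v ~: s ==> w v = 0" using assms(2) by (auto simp: simplex_points_def)
 have "(SUM i<=n. w (vs i)) = sum w s" by (rule sum.reindex_bij_betw[OF assms(1)])
 moreover from this have "w (vs i) <= 1" if "i <= n" for i
  using w fin assms(1) that member_le_sum[of "vs i" s w] by (auto simp: bij_betw_def)
 ultimately show t: "?t : stds n" using w by (auto simp: standard_simplex_def)
 show "aff n vs ?t = w"
 proof
  fix u
  have "aff n vs ?t u = (SUM i<=n. if vs i = u then w (vs i) else 0)"
   unfolding aff_apply[OF t] by (intro sum.cong) auto
  also have "... = (SUM v:s. if v = u then w v else 0)"
   by (rule sum.reindex_bij_betw[OF assms(1)])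
  also have "... = w u" using fin w by (simp add: sum.delta)
  finally show "aff n vs ?t u = w u" .
 qed
qed

lemma enum_bij:
 fixes s :: "'v::linorder set"
 assumes "finite s" "card s = Suc n" shows "bij_betw (%i. lst s ! i) {..n} s"
 using bij_betw_nth[of "lst s" "{..n}" s] assms by (auto simp: lessThan_Suc_atMost)

lemma ex_enum:
 fixes s :: "'v set"
 assumes "finite s" "s ~= {}" obtains n :: nat and vs :: "nat => 'v" where "bij_betw vs {..n} s"
proof -
 obtain vs where "bij_betw vs {..<card s} s" using assms(1) ex_bij_betw_nat_finite[OF assms(1)] by (auto simp: atLeast0LessThan)
 moreover have "{..<card s} = {..card s - 1}" using assms by (metis card_gt_0_iff lessThan_Suc_atMost Suc_pred')
 ultimately have "bij_betw vs {..card s - 1} s" by simp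
 thus ?thesis by (rule that)
qed

lemma compact_spts:
 assumes "finite s" "s ~= {}" shows "compactin (simplex_top s) (spts s)"
proof -
 obtain n :: nat and vs where vs: "bij_betw vs {..n} s" using ex_enum[OF assms] by metis
 have "aff n vs ` stds n = spts s"
 proof
  show "spts s <= aff n vs ` stds n" using aff_surj[OF vs] by force
  show "aff n vs ` stds n <= spts s"
   using aff_in_spts[of _ n vs s] vs assms by (auto simp: bij_betw_def)
 qed
 moreover have "compactin (simplex_top s) (aff n vs ` stds n)"
 proof (rule image_compactin)
  show "cmp (sbt (powertop_real UNIV) (stds n)) (simplex_top s) (aff n vs)"
   using continuous_map_aff[of vs n s] vs assms by (auto simp: bij_betw_def)
  show "compactin (sbt (powertop_real UNIV) (stds n)) (stds n)"
   using compactin_standard_simplex by (simp add: compactin_subtopology)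
 qed
 ultimately show ?thesis by simp
qed

lemma cmp_from_rlz:
 assumes "!!s. s : K ==> cmp (simplex_top s) Y f"
 shows "cmp (rlz K) Y f"
 unfolding continuous_map
proof (intro conjI allI impI)
 show "f ` tps (rlz K) <= tps Y"
  using assms by (fastforce simp: topspace_realization continuous_map)
 fix U assume U: "opi Y U"
 show "opi (rlz K) {x : tps (rlz K). f x : U}"
  unfolding openin_realization
 proof (intro conjI ballI)
  fix s assume s: "s : K"
  hence "opi (simplex_top s) {x : tps (simplex_top s). f x : U}"
   using assms[OF s] U by (simp add: continuous_map)
  moreover have "{x : tps (rlz K). f x : U} Int spts s = {x : tps (simplex_top s). f x : U}"
   using s by (auto simp: topspace_realization)
  ultimately show "opi (simplex_top s) ({x : tps (rlz K). f x : U} Int spts s)" by simp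
 qed (auto simp: topspace_realization)
qed

lemma cmp_into_rlz:
 assumes "s : K" "cmp X (simplex_top s) f"
 shows "cmp X (rlz K) f"
proof -
 have "cmp (simplex_top s) (rlz K) id"
  unfolding continuous_map
 proof (intro conjI allI impI)
  fix U assume "opi (rlz K) U"
  hence "opi (simplex_top s) (U Int spts s)" using assms(1) by (simp add: openin_realization)
  moreover have "{x : tps (simplex_top s). id x : U} = U Int spts s" by auto
  ultimately show "opi (simplex_top s) {x : tps (simplex_top s). id x : U}" by simp
 qed (use assms(1) in \<open>auto simp: topspace_realization\<close>)
 thus ?thesis using continuous_map_compose[OF assms(2), of "rlz K" id] by simp
qed

lemma cmp_simplex_rlz:
 "s : K ==> cmp (simplex_top s) (rlz K) (%x. x)"
 by (rule cmp_into_rlz[where s=s]) auto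

lemma compact_spts_rlz:
 assumes "simplicial_complex K" "s : K" shows "compactin (rlz K) (spts s)"
 using image_compactin[OF compact_spts cmp_simplex_rlz[OF assms(2)]] assms
 by (simp add: simplicial_complex_def)

lemma ssx_aff:
 assumes "simplicial_complex N" "vs ` {..n} : N" shows "ssx n (rlz N) (aff n vs)"
 unfolding singular_simplex_def
proof
 show "cmp (sbt (powertop_real UNIV) (stds n)) (rlz N) (aff n vs)"
  using assms by (intro cmp_into_rlz[OF assms(2)] continuous_map_aff) (auto simp: simplicial_complex_def)
qed (simp add: aff_def)

lemma singular_face_aff:
 assumes "1 <= p" "k <= p"
 shows "sfc p k (aff p vs) = aff (p - Suc 0) (%j. if j < k then vs j else vs (Suc j))"
proof
 fix t
 show "sfc p k (aff p vs) t = aff (p - Suc 0) (%j. if j < k then vs j else vs (Suc j)) t"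
 proof (cases "t : stds (p - Suc 0)")
  case True
  have "(SUM i<=p. if vs i = u then sfce k t i else 0) =
   (SUM j<=p - Suc 0. if (if j < k then vs j else vs (Suc j)) = u then t j else 0)" for u
  proof -
   have "(SUM i<=p. if vs i = u then sfce k t i else 0) =
    (SUM i<=p. if i < k then (if vs i = u then t i else 0) else if i = k then 0 else (if vs i = u then t (i - Suc 0) else 0))"
    by (intro sum.cong) (auto simp: simplical_face_def)
   also have "... = (SUM j<=p - Suc 0. if j < k then (if vs j = u then t j else 0) else (if vs (Suc j) = u then t j else 0))"
    using sum.zero_middle[OF assms, of "%i. if vs i = u then t i else 0" "%i. if vs (Suc i) = u then t i else 0"]
    by (simp add: if_distrib cong: if_cong)
   also have "... = (SUM j<=p - Suc 0. if (if j < k then vs j else vs (Suc j)) = u then t j else 0)"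
    by (intro sum.cong) auto
   finally show ?thesis .
  qed
  thus ?thesis
   using True simplical_face_in_standard_simplex[OF assms True]
   by (simp add: singular_face_def aff_apply fun_eq_iff)
 qed (simp_all add: singular_face_def aff_def)
qed

lemma spm_apply:
 assumes "finite s" "!!v. v ~: s ==> w v = 0"
 shows "spm r w u = (SUM v:s. if r v = u then w v else 0)"
 unfolding simplicial_map_def
 by (rule sum.mono_neutral_cong_left) (use assms in auto)

lemma spm_in_spts:
 assumes "finite s" "w : spts s"
 shows "spm r w : spts (r ` s)"
proof -
 have w: "!!v. 0 <= w v" "sum w s = 1" "!!v. v ~: s ==> w v = 0" using assms(2) by (auto simp: simplex_points_def)
 have "(SUM u:r ` s. SUM v:s. if r v = u then w v else 0) = (SUM v:s. SUM u:r ` s. if r v = u then w v else 0)"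
  by (rule sum.swap)
 also have "... = sum w s" using assms(1) by (intro sum.cong) auto
 finally show ?thesis
  using w assms(1) spm_apply[OF assms(1) w(3), where r=r]
  unfolding simplex_points_def by (auto intro!: sum_nonneg sum.neutral)
qed

lemma simplicial_map_pos:
 assumes "finite s" "w : spts s" "w v ~= 0"
 shows "spm r w (r v) > 0"
proof -
 have w: "!!v. 0 <= w v" "!!v. v ~: s ==> w v = 0" using assms(2) by (auto simp: simplex_points_def)
 have "w v <= (SUM v':s. if r v' = r v then w v' else 0)"
 proof -
  have "(if r v = r v then w v else 0) <= (SUM v':s. if r v' = r v then w v' else 0)"
   by (rule member_le_sum) (use w(1) w(2)[of v] assms(1,3) in auto)
  thus ?thesis by simp
 qed
 thus ?thesis using spm_apply[OF assms(1) w(2), where r=r and u="r v"] w(1)[of v] assms(3) by simp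
qed

lemma cmp_spm_simplex:
 assumes "finite s" shows "cmp (simplex_top s) (simplex_top (r ` s)) (spm r)"
proof -
 have "con (spts s) (%w u. SUM v:s. if r v = u then w v else 0)"
 proof (intro continuous_on_coordinatewise_then_product continuous_on_sum)
  fix u v
  have "con (spts s) (%w. w v)"
   by (rule continuous_on_product_then_coordinatewise[OF continuous_on_id])
  thus "con (spts s) (%w. if r v = u then w v else 0)"
   by (cases "r v = u") auto
 qed
 moreover have "(SUM v:s. if r v = u then w v else 0) = spm r w u" if "w : spts s" for w u
  using that assms by (intro spm_apply[symmetric]) (auto simp: simplex_points_def)
 ultimately have "con (spts s) (spm r)"
  by (auto intro: continuous_on_eq)
 thus ?thesis
  unfolding power_eucl using spm_in_spts[OF assms]
  by (auto simp: continuous_map_in_subtopology)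
qed

lemma simplicial_map_aff:
 assumes "t : stds n"
 shows "spm r (aff n vs t) = aff n (%i. r (vs i)) t"
proof
 fix u
 have pts: "aff n vs t : spts (vs ` {..n})" using assms by (intro aff_in_spts) auto
 have "spm r (aff n vs t) u = (SUM v:vs ` {..n}. if r v = u then aff n vs t v else 0)"
  using pts by (intro spm_apply) (auto simp: simplex_points_def)
 also have "... = (SUM v:vs ` {..n}. SUM i<=n. if vs i = v & r (vs i) = u then t i else 0)"
 proof (intro sum.cong refl)
  fix v
  have "(SUM i<=n. if vs i = v & r (vs i) = u then t i else 0) = (SUM i<=n. if r v = u then (if vs i = v then t i else 0) else 0)"
   by (intro sum.cong) auto
  thus "(if r v = u then aff n vs t v else 0) = (SUM i<=n. if vs i = v & r (vs i) = u then t i else 0)"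
   by (simp add: aff_apply[OF assms])
 qed
 also have "... = (SUM i<=n. SUM v:vs ` {..n}. if vs i = v & r (vs i) = u then t i else 0)"
  by (rule sum.swap)
 also have "... = (SUM i<=n. if r (vs i) = u then t i else 0)"
  by (intro sum.cong) (auto simp: if_distrib cong: if_cong)
 finally show "spm r (aff n vs t) u = aff n (%i. r (vs i)) t u" using assms by (simp add: aff_apply)
qed

lemma smp_spm_aff: "smp n (spm r) (aff n vs) = aff n (%i. r (vs i))"
 by (auto simp: simplex_map_def fun_eq_iff simplicial_map_aff) (auto simp: aff_def)

lemma continuous_map_simplicial_map:
 assumes "simplicial_complex K" "!!s. s : K ==> r ` s : L"
 shows "cmp (rlz K) (rlz L) (spm r)"
proof (rule cmp_from_rlz)
 fix s assume s: "s : K"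
 hence "finite s" using assms(1) by (simp add: simplicial_complex_def)
 thus "cmp (simplex_top s) (rlz L) (spm r)"
  by (rule cmp_into_rlz[OF assms(2)[OF s] cmp_spm_simplex])
qed

text \<open>In the weak topology closedness is tested on closed simplices, and these are T1
  spaces.\<close>

lemma openin_realization_discrete:
 assumes K: "simplicial_complex K" and A: "!!s. s : K ==> finite (A Int spts s)"
 shows "opi (rlz K) (tps (rlz K) - A)"
 unfolding openin_realization
proof (intro conjI ballI)
 fix s assume s: "s : K"
 have "t1_space (simplex_top s)"
  using Hausdorff_imp_t1_space[OF Hausdorff_space_euclidean[where 'a=real]]
  by (intro t1_space_subtopology) (simp add: t1_space_product_topology)
 hence "closedin (simplex_top s) (A Int spts s)"
  using A[OF s] unfolding t1_space_closedin_finite by auto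
 hence "opi (simplex_top s) (spts s - (A Int spts s))"
  by (simp add: closedin_def)
 moreover have "(tps (rlz K) - A) Int spts s = spts s - (A Int spts s)"
  using s by (auto simp: topspace_realization)
 ultimately show "opi (simplex_top s) ((tps (rlz K) - A) Int spts s)" by simp
qed (auto simp: topspace_realization)

text \<open>
 A compact set meets the interiors of finitely many simplices: otherwise it would contain an infinite
 closed discrete set.
\<close>

lemma compact_rlz_finite:
 assumes K: "simplicial_complex K" and Q: "compactin (rlz K) Q"
 shows "finite {v. EX w:Q. w v ~= 0}"
proof -
 let ?V = "{v. EX w:Q. w v ~= 0}"
 have "ALL v:?V. EX w. w : Q & w v ~= 0" by blast
 from bchoice[OF this] obtain p where p: "!!v. v : ?V ==> p v : Q & p v v ~= 0" by blast
 define P where "P = p ` ?V"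
 have QK: "Q <= tps (rlz K)" using Q compactin_subset_topspace by blast
 have PQ: "P <= Q" using p by (auto simp: P_def)
 have supp: "finite {v. w v ~= 0}" if "w : Q" for w
 proof -
  have "w : (UN s:K. spts s)" using that QK by (auto simp: topspace_realization)
  then obtain s where "s : K" "w : spts s" by blast
  thus ?thesis using K by (rule_tac finite_subset[of _ s]) (auto simp: simplex_points_def simplicial_complex_def)
 qed
 have fin: "finite (P Int spts s)" if "s : K" for s
 proof (rule finite_subset)
  show "P Int spts s <= p ` s"
  proof
   fix w assume "w : P Int spts s"
   then obtain v where v: "v : ?V" "w = p v" "p v : spts s" by (auto simp only: P_def)
   hence "v : s" using p[OF v(1)] unfolding simplex_points_def by blast
   thus "w : p ` s" using v(2) by blast
  qed
  show "finite (p ` s)" using K that by (simp add: simplicial_complex_def)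
 qed
 \<comment> \<open>\<open>U x\<close> contains no point of P except possibly x, so a finite subcover
   of Q by such sets makes P finite. Each point of P has finite support, and these supports exhaust
   the vertices in question.\<close>
 define U where "U x = tps (rlz K) - (P - {x})" for x
 have U: "opi (rlz K) (U x)" for x
  unfolding U_def
 proof (rule openin_realization_discrete[OF K])
  fix s assume "s : K"
  show "finite ((P - {x}) Int spts s)" by (rule finite_subset[OF _ fin[OF \<open>s \<in> K\<close>]]) blast
 qed
 have QU: "Q <= \<Union>(U ` Q)" using QK by (auto simp: U_def)
 have "EX B. finite B & B <= U ` Q & Q <= \<Union>B"
  by (rule compactinD[OF Q _ QU]) (use U in auto)
 then obtain B where F: "finite B" "B <= U ` Q" "Q <= \<Union>B" by blast
 obtain Q0 where Q0: "finite Q0" "B = U ` Q0" using finite_subset_image[OF F(1,2)] by blast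
 have "P <= Q0"
 proof
  fix x assume x: "x : P"
  then obtain y where "y : Q0" "x : U y" using F(3) PQ Q0(2) by blast
  thus "x : Q0" using x by (auto simp: U_def)
 qed
 hence "finite P" using Q0(1) finite_subset by blast
 hence "finite (UN w:P. {v. w v ~= 0})" using supp PQ by blast
 moreover have "?V <= (UN w:P. {v. w v ~= 0})"
 proof
  fix v assume "v : ?V"
  thus "v : (UN w:P. {v. w v ~= 0})" using p[of v] unfolding P_def by blast
 qed
 ultimately show ?thesis by (rule rev_finite_subset)
qed

text \<open>Finitely many vertices occur in Q and finitely many vertices of K are sent to them; the
  preimage lies in the simplices spanned by these. Weights only add up under the map, so a vertex
  with positive weight cannot disappear.\<close>

lemma lf_proper_simplicial_map:
 assumes K: "simplicial_complex K" and L: "simplicial_complex L" and r: "!!s. s : K ==> r ` s : L"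
  and fin: "!!u. finite {v. {v} : K & r v = u}"
 shows "lf_proper (rlz K) (rlz L) (spm r)"
 unfolding lf_proper_def
proof (intro conjI allI impI)
 show "cmp (rlz K) (rlz L) (spm r)"
  by (rule continuous_map_simplicial_map[OF K r])
 fix Q assume Q: "compactin (rlz L) Q"
 define W where "W = {u. EX w:Q. w u ~= 0}"
 have fW: "finite W" unfolding W_def by (rule compact_rlz_finite[OF L Q])
 define W' where "W' = (UN u:W. {v. {v} : K & r v = u})"
 have fW': "finite W'" unfolding W'_def using fW fin by blast
 define S where "S = {s : K. s <= W'}"
 have "finite S" unfolding S_def using fW' by (auto intro: finite_subset[of _ "Pow W'"])
 hence "compactin (rlz K) (UN s:S. spts s)"
  by (intro compactin_Union) (auto simp: S_def intro: compact_spts_rlz[OF K])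
 moreover have "{x : tps (rlz K). spm r x : Q} <= (UN s:S. spts s)"
 proof safe
  fix w assume w: "w : tps (rlz K)" "spm r w : Q"
  then obtain s where s: "s : K" "w : spts s" by (auto simp: topspace_realization)
  have fs: "finite s" using K s by (simp add: simplicial_complex_def)
  define s' where "s' = {v : s. w v ~= 0}"
  have w1: "!!v. 0 <= w v" "sum w s = 1" "!!v. v ~: s ==> w v = 0" using s(2) by (auto simp: simplex_points_def)
  have "sum w s' = sum w s" unfolding s'_def using fs by (intro sum.mono_neutral_left) auto
  hence ws': "w : spts s'" using w1 by (auto simp: simplex_points_def s'_def)
  have "s' ~= {}" using \<open>sum w s' = sum w s\<close> w1 by auto
  hence "s' : K" by (intro simplicial_complexD[OF K s(1)]) (auto simp: s'_def)
  moreover have "s' <= W'"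
  proof
   fix v assume v: "v : s'"
   hence "spm r w (r v) ~= 0" using simplicial_map_pos[OF fs s(2), of v r] by (auto simp: s'_def)
   hence "r v : W" using w(2) by (auto simp: W_def)
   moreover have "{v} : K" using v by (intro simplicial_complexD[OF K s(1)]) (auto simp: s'_def)
   ultimately show "v : W'" by (auto simp: W'_def)
  qed
  ultimately show "w : (UN s:S. spts s)" using ws' by (auto simp: S_def)
 qed
 ultimately show "EX Q'. compactin (rlz K) Q' & {x : tps (rlz K). spm r x : Q} <= Q'"
  by blast
qed

text \<open>Together with \<open>compact_rlz_finite\<close> this turns local finiteness of affine
  chains into a count of vertices.\<close>

lemma aff_meets:
 assumes "aff n vs ` stds n Int Q ~= {}"
 shows "EX i<=n. vs i : {v. EX w:Q. w v ~= 0}"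
proof -
 obtain t where t: "t : stds n" "aff n vs t : Q" using assms by blast
 have t1: "!!i. 0 <= t i" "(SUM i<=n. t i) = 1" using t(1) by (auto simp: standard_simplex_def)
 obtain i where i: "i <= n" "t i ~= 0" using t1(2) by (metis (no_types, lifting) atMost_iff sum.neutral zero_neq_one)
 have "t i <= (SUM j<=n. if vs j = vs i then t j else 0)"
  using member_le_sum[of i "{..n}" "%j. if vs j = vs i then t j else 0"] t1 i by auto
 hence "aff n vs t (vs i) > 0" using t1(1)[of i] i unfolding aff_apply[OF t(1)] by linarith
 hence "vs i : {v. EX w:Q. w v ~= 0}" using t(2) by (metis (mono_tags, lifting) less_irrefl mem_Collect_eq)
 thus ?thesis using i(1) by blast
qed

lemma cplx_nerve: "simplicial_complex (nerve \<U>)"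
 unfolding simplicial_complex_def
proof (intro conjI ballI allI impI)
 fix s t assume s: "s : nerve \<U>" and t: "t <= s & t ~= {}"
 hence "finite t" "\<Inter>s <= \<Inter>t" using finite_subset by (auto simp: nerve_def)
 thus "t : nerve \<U>" using s t by (auto simp: nerve_def)
qed (auto simp: nerve_def)

section \<open>Lengths of paths and properness of the lifted metric\<close>

lemma compact_open_cover:
 assumes "compact C" "C <= S" "!!U. U : N ==> opi (tos S) U" "C <= \<Union>N"
 obtains B where "B <= N" "finite B" "C <= \<Union>B"
proof -
 have "compactin (tos S) C" using assms by (simp add: compactin_subtopology)
 thus thesis using that assms(3,4) unfolding compactin_def by meson
qed

section \<open>Coordinate boxes and continuously differentiable functions\<close>

lemma Eucl_tos: "Euclidean_space n = tos {y. ALL i>=n. y i = 0}"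
 unfolding Euclidean_space_def power_eucl ..

lemma open_fun_box:
 fixes w :: "'i => real"
 assumes "open V" "w : V"
 obtains I r where "finite I" "r > 0" "{z. ALL i:I. \<bar>z i - w i\<bar> < r} <= V"
proof -
 have "opi (powertop_real UNIV) V" using assms(1) by (simp add: power_eucl)
 then obtain U where U: "finite {i. U i ~= (UNIV :: real set)}" "!!i. open (U i)" "w : Pi\<^sub>E UNIV U" "Pi\<^sub>E UNIV U <= V"
  using assms(2) by (auto simp: openin_product_topology_alt)
 have "EX r>0. ball (w i) r <= U i" for i
  using U(2)[of i] PiE_mem[OF U(3), of i] open_contains_ball by blast
 then obtain r where r: "!!i. r i > 0" "!!i. ball (w i) (r i) <= U i" by metis
 define I where "I = {i. U i ~= UNIV}"
 define R where "R = Min (insert 1 (r ` I))"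
 have R: "R > 0" using U(1) r(1) by (auto simp: R_def I_def)
 have "z : V" if z: "ALL i:I. \<bar>z i - w i\<bar> < R" for z
 proof -
  have "z i : U i" for i
  proof (cases "i : I")
   case True
   hence "R <= r i" using U(1) by (auto simp: R_def I_def)
   hence "z i : ball (w i) (r i)" using z True by (fastforce simp: dist_real_def)
   thus ?thesis using r(2) by blast
  qed (auto simp: I_def)
  thus ?thesis using U(4) by (auto simp: PiE_UNIV_domain)
 qed
 thus thesis using that[of I R] U(1) R by (auto simp: I_def)
qed

lemma Euclidean_space_box:
 assumes W: "opi (Euclidean_space n) W" and x: "x : W"
 obtains r where "r > 0" "!!z. (ALL i<n. \<bar>z i - x i\<bar> < r) ==> (ALL i>=n. z i = 0) ==> z : W"
proof -
 obtain T where T: "open T" "W = {y. ALL i>=n. y i = 0} Int T"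
  using W unfolding Eucl_tos openin_open by blast
 have xT: "x : T" using T(2) x by blast
 obtain I r where I: "r > 0" "{z. ALL i:I. \<bar>z i - x i\<bar> < r} <= T" by (rule open_fun_box[OF T(1) xT]) blast
 show thesis
 proof (rule that[OF I(1)])
  fix z assume z: "ALL i<n. \<bar>z i - x i\<bar> < r" "ALL i>=n. z i = 0"
  have "\<bar>z i - x i\<bar> < r" for i using z x I(1) T(2) by (cases "i < n") auto
  thus "z : W" using I(2) z(2) T(2) by blast
 qed
qed

lemma mean_value_between:
 fixes f f' :: "real => real"
 assumes "!!x. min a b <= x ==> x <= max a b ==> (f has_real_derivative f' x) (at x)"
 obtains B where "min a b <= B" "B <= max a b" "f b - f a = f' B * (b - a)"
proof (cases a b rule: linorder_cases)
 case less
 then obtain z where "a < z" "z < b" "f b - f a = (b - a) * f' z"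
  using MVT2[of a b f f'] assms by auto
 thus ?thesis using that[of z] less by (simp add: mult.commute)
next
 case greater
 then obtain z where "b < z" "z < a" "f a - f b = (a - b) * f' z"
  using MVT2[of b a f f'] assms by auto
 thus ?thesis using that[of z] greater by (simp add: algebra_simps)
qed (use that[of a] in auto)

text \<open>\<open>Ck_on\<close> provides partial derivatives only. The increment is split into
  steps along the coordinate axes; the mean value theorem applies to each, and continuity of the
  partial derivatives compares the intermediate values with those at x.\<close>

lemma Ck_on_increment:
 assumes W: "opi (Euclidean_space n) W" and f: "Ck_on n (Suc 0) W f" and x: "x : W" and e: "e > 0"
 shows "EX r>0. ALL z. (ALL i<n. \<bar>z i - x i\<bar> < r) --> (ALL i>=n. z i = 0) -->
   z : W & (EX D. (ALL i<n. \<bar>D i - coord_deriv i f x\<bar> <= e) & f z - f x = (SUM i<n. D i * (z i - x i)))"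
proof -
 have cd: "cmp (sbt (Euclidean_space n) W) eur (coord_deriv i f)" if "i < n" for i
  using f that by simp
 have WE: "W <= tps (Euclidean_space n)" using W openin_subset by blast
 have xz: "x i = 0" if "i >= n" for i using x WE that by (auto simp: topspace_Euclidean_space)
 define V where "V i = {z : W. \<bar>coord_deriv i f z - coord_deriv i f x\<bar> < e}" for i
 have oV: "opi (Euclidean_space n) (V i)" if "i < n" for i
 proof -
  have "opi (sbt (Euclidean_space n) W) {z : tps (sbt (Euclidean_space n) W). coord_deriv i f z : ball (coord_deriv i f x) e}"
   using cd[OF that] by (intro openin_continuous_map_preimage) auto
  moreover have "{z : tps (sbt (Euclidean_space n) W). coord_deriv i f z : ball (coord_deriv i f x) e} = V i"
   using WE by (auto simp: V_def dist_real_def abs_minus_commute)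
  ultimately show ?thesis using W by (simp add: openin_open_subtopology)
 qed
 have "opi (Euclidean_space n) (W Int \<Inter>(V ` {..<n}))"
 proof (cases "n = 0")
  case False
  thus ?thesis using W oV by (intro openin_Int openin_Inter) auto
 qed (use W in simp)
 moreover have "x : W Int \<Inter>(V ` {..<n})" using x e by (auto simp: V_def)
 ultimately obtain r where r: "r > 0"
  "!!z. (ALL i<n. \<bar>z i - x i\<bar> < r) ==> (ALL i>=n. z i = 0) ==> z : W Int \<Inter>(V ` {..<n})"
  using Euclidean_space_box by metis
 show ?thesis
 proof (intro exI[of _ r] conjI allI impI)
  fix z assume z: "ALL i<n. \<bar>z i - x i\<bar> < r" "ALL i>=n. z i = 0"
  \<comment> \<open>The corners of the polygon from x to z that changes one coordinate at a
    time.\<close>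
  define Z where "Z k = (%i. if i < k then z i else x i)" for k
  have "EX d. \<bar>d - coord_deriv k f x\<bar> <= e & f (Z (Suc k)) - f (Z k) = d * (z k - x k)" if k: "k < n" for k
  proof -
   have inV: "(Z k)(k := t) : W Int \<Inter>(V ` {..<n})" if "min (x k) (z k) <= t" "t <= max (x k) (z k)" for t
   proof (rule r(2))
    have "\<bar>t - x k\<bar> <= \<bar>z k - x k\<bar>" using that by (auto simp: min_def max_def split: if_splits)
    hence "\<bar>t - x k\<bar> < r" using z(1) k by (meson le_less_trans)
    thus "ALL i<n. \<bar>((Z k)(k := t)) i - x i\<bar> < r" using z r(1) by (auto simp: Z_def)
    show "ALL i>=n. ((Z k)(k := t)) i = 0" using k xz by (auto simp: Z_def)
   qed
   have der: "((%t. f ((Z k)(k := t))) has_real_derivative coord_deriv k f ((Z k)(k := t))) (at t)"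
    if "min (x k) (z k) <= t" "t <= max (x k) (z k)" for t
   proof -
    have "(Z k)(k := t) : W" using inV[OF that] by blast
    moreover have "ALL x:W. (%s. f (x(k := s))) differentiable (at (x k))" using f k by simp
    ultimately have "(%s. f (((Z k)(k := t))(k := s))) differentiable (at (((Z k)(k := t)) k))"
     by (rule bspec[rotated])
    hence "(%s. f ((Z k)(k := s))) differentiable (at t)" by simp
    thus ?thesis
     by (simp add: coord_deriv_def DERIV_deriv_iff_real_differentiable)
   qed
   obtain B where B: "min (x k) (z k) <= B" "B <= max (x k) (z k)"
    "f ((Z k)(k := z k)) - f ((Z k)(k := x k)) = coord_deriv k f ((Z k)(k := B)) * (z k - x k)"
    using mean_value_between[of "x k" "z k" "%t. f ((Z k)(k := t))" "%t. coord_deriv k f ((Z k)(k := t))"] der by blast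
   have "(Z k)(k := B) : V k" using inV[OF B(1,2)] k by blast
   hence "\<bar>coord_deriv k f ((Z k)(k := B)) - coord_deriv k f x\<bar> <= e" by (simp add: V_def)
   moreover have "(Z k)(k := z k) = Z (Suc k)" "(Z k)(k := x k) = Z k" by (auto simp: Z_def fun_eq_iff)
   ultimately show ?thesis using B(3) by (intro exI[of _ "coord_deriv k f ((Z k)(k := B))"]) simp
  qed
  then obtain D where D: "!!k. k < n ==> \<bar>D k - coord_deriv k f x\<bar> <= e"
   "!!k. k < n ==> f (Z (Suc k)) - f (Z k) = D k * (z k - x k)" by metis
  have "(SUM k<n. f (Z (Suc k)) - f (Z k)) = f (Z n) - f (Z 0)"
   by (rule sum_lessThan_telescope)
  moreover have "Z n = z" "Z 0 = x" using z xz by (auto simp: Z_def fun_eq_iff)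
  ultimately have "f z - f x = (SUM k<n. D k * (z k - x k))" using D(2) by simp
  thus "z : W" "EX D. (ALL i<n. \<bar>D i - coord_deriv i f x\<bar> <= e) & f z - f x = (SUM i<n. D i * (z i - x i))"
   using r(2)[OF z] D(1) by blast+
 qed (fact r(1))
qed

text \<open>The derivative is taken within S because velocities at the end points of a piece of a
  path are one-sided.\<close>

lemma Ck_on_chain_rule:
 assumes W: "opi (Euclidean_space n) W" and f: "Ck_on n (Suc 0) W f"
  and y: "!!T. T : S ==> y T : W" and s: "s : S"
  and v: "!!i. i < n ==> ((%T. y T i) has_real_derivative v i) (at s within S)"
 shows "((%T. f (y T)) has_real_derivative (SUM i<n. coord_deriv i f (y s) * v i)) (at s within S)"
proof -
 let ?c = "%i. coord_deriv i f (y s)"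
 let ?q = "%i T. (y T i - y s i) / (T - s)"
 have q: "(?q i \<longlongrightarrow> v i) (at s within S)" if "i < n" for i
  using v[OF that] by (simp add: has_field_derivative_iff)
 have yc: "((%T. y T i) \<longlongrightarrow> y s i) (at s within S)" if "i < n" for i
  using DERIV_continuous[OF v[OF that]] by (simp add: continuous_within)
 have "((%T. (f (y T) - f (y s)) / (T - s) - (SUM i<n. ?c i * ?q i T)) \<longlongrightarrow> 0) (at s within S)"
 proof (rule tendstoI)
  fix e :: real assume e: "e > 0"
  \<comment> \<open>The difference quotients are eventually below |v i| + 1, while the coefficients
    are off by at most \<open>e / B\<close>. The extra summand 1 makes the resulting estimate strict
    and keeps B positive for n = 0.\<close>
  define B where "B = (SUM i<n. \<bar>v i\<bar> + 1) + 1"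
  have B: "B > 0" unfolding B_def by (intro add_nonneg_pos sum_nonneg) auto
  obtain r where r: "r > 0"
   "ALL z. (ALL i<n. \<bar>z i - y s i\<bar> < r) --> (ALL i>=n. z i = 0) -->
    z : W & (EX D. (ALL i<n. \<bar>D i - ?c i\<bar> <= e / B) & f z - f (y s) = (SUM i<n. D i * (z i - y s i)))"
   using Ck_on_increment[OF W f y[OF s] divide_pos_pos[OF e B]] by blast
  have "eventually (%T. ALL i<n. \<bar>?q i T\<bar> < \<bar>v i\<bar> + 1) (at s within S)"
  proof -
   have "eventually (%T. \<bar>?q i T\<bar> < \<bar>v i\<bar> + 1) (at s within S)" if "i < n" for i
   proof (rule eventually_mono)
    show "eventually (%T. dist (?q i T) (v i) < 1) (at s within S)" using tendstoD[OF q[OF that], of 1] by simp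
   qed (unfold dist_real_def, linarith)
   hence "eventually (%T. ALL i:{..<n}. \<bar>?q i T\<bar> < \<bar>v i\<bar> + 1) (at s within S)"
    by (intro eventually_ball_finite) auto
   thus ?thesis by (rule eventually_mono) auto
  qed
  moreover have "eventually (%T. ALL i<n. \<bar>y T i - y s i\<bar> < r) (at s within S)"
  proof -
   have "eventually (%T. \<bar>y T i - y s i\<bar> < r) (at s within S)" if "i < n" for i
    using tendstoD[OF yc[OF that] r(1)] by (rule eventually_mono) (auto simp: dist_real_def)
   hence "eventually (%T. ALL i:{..<n}. \<bar>y T i - y s i\<bar> < r) (at s within S)"
    by (intro eventually_ball_finite) auto
   thus ?thesis by (rule eventually_mono) auto
  qed
  moreover have "eventually (%T. T : S & T ~= s) (at s within S)"
   by (simp add: eventually_at_filter)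
  ultimately show "eventually (%T. dist ((f (y T) - f (y s)) / (T - s) - (SUM i<n. ?c i * ?q i T)) 0 < e) (at s within S)"
  proof eventually_elim
   case (elim T)
   have "y T : tps (Euclidean_space n)" using elim y W openin_subset by blast
   then obtain D where D: "ALL i<n. \<bar>D i - ?c i\<bar> <= e / B" "f (y T) - f (y s) = (SUM i<n. D i * (y T i - y s i))"
    using r(2)[rule_format, of "y T"] elim by (auto simp: topspace_Euclidean_space)
   have "(f (y T) - f (y s)) / (T - s) - (SUM i<n. ?c i * ?q i T) = (SUM i<n. (D i - ?c i) * ?q i T)"
    unfolding D(2) sum_divide_distrib sum_subtractf[symmetric]
    by (intro sum.cong refl) (metis left_diff_distrib times_divide_eq_right)
   also have "\<bar>...\<bar> <= (SUM i<n. e / B * (\<bar>v i\<bar> + 1))"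
   proof (rule order_trans[OF sum_abs sum_mono])
    fix i assume "i : {..<n}"
    hence i: "i < n" by simp
    hence "\<bar>D i - ?c i\<bar> <= e / B" "\<bar>?q i T\<bar> <= \<bar>v i\<bar> + 1" using D(1) elim by (auto intro: less_imp_le)
    thus "\<bar>(D i - ?c i) * ?q i T\<bar> <= e / B * (\<bar>v i\<bar> + 1)"
     unfolding abs_mult using e B by (intro mult_mono) auto
   qed
   also have "... = e / B * (B - 1)" by (simp add: B_def sum_distrib_left)
   also have "... < e" using e B by (simp add: field_simps)
   finally show ?case by (simp add: dist_real_def)
  qed
 qed
 moreover have "((%T. SUM i<n. ?c i * ?q i T) \<longlongrightarrow> (SUM i<n. ?c i * v i)) (at s within S)"
  by (intro tendsto_sum tendsto_mult tendsto_const q) auto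
 ultimately have "((%T. (f (y T) - f (y s)) / (T - s)) \<longlongrightarrow> (SUM i<n. ?c i * v i)) (at s within S)"
  using tendsto_add by fastforce
 thus ?thesis by (simp add: has_field_derivative_iff)
qed

lemma compact_box: "compact {y :: nat => real. (ALL i<n. \<bar>y i - a i\<bar> <= r) & (ALL i>=n. y i = 0)}"
proof -
 have "{y :: nat => real. (ALL i<n. \<bar>y i - a i\<bar> <= r) & (ALL i>=n. y i = 0)}
  = Pi\<^sub>E UNIV (%i. if i < n then {a i - r..a i + r} else {0})" (is "?L = ?R")
 by (auto simp: PiE_UNIV_domain Pi_iff abs_le_iff algebra_simps split: if_splits)
 moreover have "compactin (powertop_real UNIV) ?R"
  unfolding compactin_PiE by simp
 ultimately show ?thesis by (simp add: power_eucl)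
qed

section \<open>Norms and lengths in coordinates\<close>

definition quad :: "nat => (nat => nat => real) => (nat => real) => real" where
 "quad n G v = (SUM i<n. SUM j<n. G i j * v i * v j)"

lemma quad_scale: "quad n G (%i. k * v i) = k\<^sup>2 * quad n G v"
 by (simp add: quad_def sum_distrib_left power2_eq_square algebra_simps)

lemma quad_cong: "(!!i. i < n ==> v i = w i) ==> quad n G v = quad n G w"
 unfolding quad_def by (intro sum.cong) auto

lemma continuous_coordinate: "con S (%y :: 'i => real. y i)"
 by (rule continuous_on_product_then_coordinatewise[OF continuous_on_id])

text \<open>The form attains a positive minimum on the product of B with the unit sphere S of the
  maximum norm, and homogeneity extends this lower bound to all vectors. The upper bound adds up
  bounds of the coefficients on B.\<close>

lemma quad_bounds:
 fixes G :: "'x::topological_space => nat => nat => real"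
 assumes B: "compact B" and G: "!!i j. i < n ==> j < n ==> con B (%y. G y i j)"
  and pos: "!!y v. y : B ==> EX i<n. v i ~= 0 ==> quad n (G y) v > 0"
 shows "EX c C. c > 0 & C > 0 &
  (ALL y:B. ALL v. ALL j<n. c * \<bar>v j\<bar> <= sqrt (quad n (G y) v)) &
  (ALL y:B. ALL v m. (ALL j<n. \<bar>v j\<bar> <= m) & m >= 0 --> sqrt (quad n (G y) v) <= C * m)"
proof -
 define S where "S = {v :: nat => real. (ALL i<n. \<bar>v i - 0\<bar> <= 1) & (ALL i>=n. v i = 0)} Int (\<Union>j<n. {v. \<bar>v j\<bar> = 1})"
 have "closed {v :: nat => real. \<bar>v j\<bar> = 1}" for j
  using closed_Collect_eq[of "%v :: nat => real. \<bar>v j\<bar>" "%_. 1"] continuous_coordinate[of UNIV j]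
  by (simp add: continuous_on_rabs)
 hence S: "compact S" unfolding S_def by (intro compact_Int_closed compact_box[of n "%_. 0" 1, simplified] closed_UN) (simp_all add: compact_box[of n "%_. 0" 1, simplified])
 have BS: "compact (B \<times> S)" using B S by (rule compact_Times)
 have cont: "con (B \<times> S) (%z. quad n (G (fst z)) (snd z))"
  unfolding quad_def
 proof (intro continuous_on_sum continuous_on_mult)
  fix i j assume ij: "i : {..<n}" "j : {..<n}"
  show "con (B \<times> S) (%z. G (fst z) i j)"
   using ij by (intro continuous_on_compose2[OF G] continuous_on_fst continuous_on_id) auto
  show "con (B \<times> S) (%z. snd z i)"
   by (rule continuous_on_product_then_coordinatewise[OF continuous_on_snd[OF continuous_on_id]])
  show "con (B \<times> S) (%z. snd z j)"
   by (rule continuous_on_product_then_coordinatewise[OF continuous_on_snd[OF continuous_on_id]])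
 qed
 have lower: "EX c0>0. ALL z:B \<times> S. c0 <= quad n (G (fst z)) (snd z)"
 proof (cases "B \<times> S = {}")
  case False
  obtain z where z: "z : B \<times> S" "!!z'. z' : B \<times> S ==> quad n (G (fst z)) (snd z) <= quad n (G (fst z')) (snd z')"
   using continuous_attains_inf[OF BS False cont] by blast
  have "quad n (G (fst z)) (snd z) > 0"
  proof (rule pos)
   show "fst z : B" using z by auto
   have "snd z : (\<Union>j<n. {v. \<bar>v j\<bar> = 1})" using z(1) by (auto simp: S_def)
   then obtain j where "j < n" "\<bar>snd z j\<bar> = 1" by blast
   thus "EX i<n. snd z i ~= 0" by (intro exI[of _ j]) auto
  qed
  thus ?thesis using z(2) by blast
 qed (auto intro: exI[of _ 1])
 then obtain c0 where c0: "c0 > 0" "!!y v. y : B ==> v : S ==> c0 <= quad n (G y) v" by fastforce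
 have "EX b. ALL y:B. \<bar>G y i j\<bar> <= b" if "i < n" "j < n" for i j
  using compact_continuous_image[OF G[OF that] B] compact_imp_bounded bounded_iff
  by (metis imageI real_norm_def)
 then obtain b where b: "!!i j y. i < n ==> j < n ==> y : B ==> \<bar>G y i j\<bar> <= b i j" by metis
 define C0 where "C0 = (SUM i<n. SUM j<n. \<bar>b i j\<bar>) + 1"
 have C0: "C0 > 0" unfolding C0_def by (intro add_nonneg_pos sum_nonneg) auto
 show ?thesis
 proof (rule exI[of _ "sqrt c0"], rule exI[of _ "sqrt C0"], intro conjI ballI allI impI)
  show "sqrt c0 > 0" using c0 by auto
  show "sqrt C0 > 0" using C0 by auto
 next
  fix y and v :: "nat => real" and j assume y: "y : B" and j: "j < n"
  define m where "m = Max ((%i. \<bar>v i\<bar>) ` {..<n})"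
  have m: "\<bar>v i\<bar> <= m" if "i < n" for i using that by (auto simp: m_def)
  have "m : (%i. \<bar>v i\<bar>) ` {..<n}" unfolding m_def using j by (intro Max_in) auto
  then obtain k where k: "k < n" "\<bar>v k\<bar> = m" by auto
  show "sqrt c0 * \<bar>v j\<bar> <= sqrt (quad n (G y) v)"
  proof (cases "m = 0")
   case True
   hence "!!i. i < n ==> v i = 0" using m by fastforce
   hence "quad n (G y) v = 0" "v j = 0" using j by (auto simp: quad_def)
   thus ?thesis by simp
  next
   case False
   hence m0: "m > 0" using m[OF j] by linarith
   define w where "w = (%i. if i < n then v i / m else 0)"
   have "w : S" unfolding S_def using m0 m k by (auto simp: w_def intro!: bexI[of _ k])
   hence "c0 <= quad n (G y) w" using c0 y by blast
   also have "quad n (G y) w = quad n (G y) (%i. (1 / m) * v i)" by (rule quad_cong) (simp add: w_def)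
   also have "... = quad n (G y) v / m\<^sup>2" unfolding quad_scale by (simp add: power_divide)
   finally have "c0 * m\<^sup>2 <= quad n (G y) v" using m0 by (simp add: field_simps)
   hence "sqrt (c0 * m\<^sup>2) <= sqrt (quad n (G y) v)" by simp
   hence "sqrt c0 * m <= sqrt (quad n (G y) v)" using m0 by (simp add: real_sqrt_mult)
   moreover have "sqrt c0 * \<bar>v j\<bar> <= sqrt c0 * m" using m[OF j] c0 by (intro mult_left_mono) auto
   ultimately show ?thesis by linarith
  qed
 next
  fix y and v :: "nat => real" and m :: real
  assume y: "y : B" and "(ALL j<n. \<bar>v j\<bar> <= m) & m >= 0"
  hence m: "!!j. j < n ==> \<bar>v j\<bar> <= m" "m >= 0" by auto
  have "quad n (G y) v <= (SUM i<n. SUM j<n. \<bar>b i j\<bar> * m\<^sup>2)"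
   unfolding quad_def
  proof (intro sum_mono)
   fix i j assume "i : {..<n}" "j : {..<n}"
   hence ij: "i < n" "j < n" by auto
   have "\<bar>G y i j * v i * v j\<bar> = \<bar>G y i j\<bar> * (\<bar>v i\<bar> * \<bar>v j\<bar>)" by (simp add: abs_mult)
   also have "... <= \<bar>b i j\<bar> * (m * m)"
   proof (intro mult_mono)
    show "\<bar>G y i j\<bar> <= \<bar>b i j\<bar>" using b[OF ij y] by linarith
   qed (use m ij in auto)
   finally show "G y i j * v i * v j <= \<bar>b i j\<bar> * m\<^sup>2" by (simp add: power2_eq_square)
  qed
  also have "... <= C0 * m\<^sup>2" by (simp add: C0_def sum_distrib_right[symmetric] distrib_right)
  finally have "sqrt (quad n (G y) v) <= sqrt (C0 * m\<^sup>2)" by simp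
  thus "sqrt (quad n (G y) v) <= sqrt C0 * m" using m(2) by (simp add: real_sqrt_mult)
 qed
qed

lemma joinpaths_left: "t : {0..1/2} ==> (B +++ C) t = B (2 * t)"
 by (simp add: joinpaths_def)

lemma joinpaths_right:
 assumes "pathfinish C = pathstart B" "t : {1/2..1}" shows "(C +++ B) t = B (2 * t - 1)"
proof (cases "t = 1/2")
 case True
 show ?thesis using assms(1) unfolding True by (simp add: joinpaths_def pathfinish_def pathstart_def)
qed (use assms in \<open>auto simp: joinpaths_def\<close>)

text \<open>The substitution behind concatenation of paths: \<open>e = 0\<close> and
  \<open>e = 1\<close> give the first and the second half of the unit interval. The speed doubles
  while the parameter interval is halved.\<close>

lemma rescale_piece:
 fixes a b e :: real
 assumes ab: "a <= b" and eq: "!!r. r : {(a + e) / 2..(b + e) / 2} ==> d r = c (2 * r - e)"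
  and v: "!!i. i < n ==> con {a..b} (v i) &
   (ALL s:{a..b}. ((%r. F (c r) i) has_real_derivative v i s) (at s within {a..b}))"
  and int: "(%s. sqrt (quad n (G (c s)) (%i. v i s))) integrable_on {a..b}"
 shows "!!i. i < n ==> con {(a + e) / 2..(b + e) / 2} (%s. 2 * v i (2 * s - e)) &
   (ALL s:{(a + e) / 2..(b + e) / 2}. ((%r. F (d r) i) has_real_derivative 2 * v i (2 * s - e)) (at s within {(a + e) / 2..(b + e) / 2}))"
  "integral {(a + e) / 2..(b + e) / 2} (%s. sqrt (quad n (G (d s)) (%i. 2 * v i (2 * s - e)))) =
  integral {a..b} (%s. sqrt (quad n (G (c s)) (%i. v i s)))"
proof -
 let ?I = "{(a + e) / 2..(b + e) / 2}"
 have im: "2 * r - e : {a..b}" if "r : ?I" for r using that by (auto simp: field_simps)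
 have im': "(%r. 2 * r - e) ` ?I <= {a..b}" using im by blast
 show "con ?I (%s. 2 * v i (2 * s - e)) &
   (ALL s:?I. ((%r. F (d r) i) has_real_derivative 2 * v i (2 * s - e)) (at s within ?I))" if i: "i < n" for i
 proof (intro conjI ballI)
  have "con {a..b} (v i)" using v[OF i] by blast
  hence "con ?I (%s. v i (2 * s - e))"
   by (rule continuous_on_compose2) (use im' in \<open>auto intro!: continuous_intros\<close>)
  thus "con ?I (%s. 2 * v i (2 * s - e))" by (intro continuous_on_mult continuous_on_const)
 next
  fix s assume s: "s : ?I"
  have "((%r. F (c r) i) has_real_derivative v i (2 * s - e)) (at (2 * s - e) within {a..b})"
   using v[OF i] im[OF s] by blast
  hence "((%r. F (c r) i) has_real_derivative v i (2 * s - e)) (at (2 * s - e) within (%r. 2 * r - e) ` ?I)"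
   by (rule DERIV_subset) (rule im')
  moreover have "((%r. 2 * r - e) has_real_derivative 2) (at s within ?I)"
   by (auto intro!: derivative_eq_intros)
  ultimately have "((%r. F (c r) i) o (%r. 2 * r - e) has_real_derivative v i (2 * s - e) * 2) (at s within ?I)"
   by (rule DERIV_image_chain)
  hence D: "((%r. F (c (2 * r - e)) i) has_real_derivative 2 * v i (2 * s - e)) (at s within ?I)"
   by (simp add: o_def mult.commute)
  show "((%r. F (d r) i) has_real_derivative 2 * v i (2 * s - e)) (at s within ?I)"
   by (rule has_field_derivative_transform_within[OF D zero_less_one s]) (simp add: eq)
 qed
 let ?f = "%s. sqrt (quad n (G (c s)) (%i. v i s))"
 have "(?f has_integral integral {a..b} ?f) (cbox a b)" using int by (simp add: integrable_integral)
 from has_integral_affinity[OF this, of 2 "- e"]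
 have "((%x. ?f (2 * x - e)) has_integral (integral {a..b} ?f / 2)) ((%x. (1 / 2) * x + e / 2) ` {a..b})"
  by simp
 moreover have "(%x. (1 / 2) * x + e / 2) ` {a..b} = ?I"
  unfolding image_affinity_atLeastAtMost using ab by (simp add: add_divide_distrib)
 ultimately have "((%x. ?f (2 * x - e)) has_integral (integral {a..b} ?f / 2)) ?I" by simp
 hence I: "((%x. 2 * ?f (2 * x - e)) has_integral (2 * (integral {a..b} ?f / 2))) ?I" by (rule has_integral_mult_right)
 have "sqrt (quad n (G (d s)) (%i. 2 * v i (2 * s - e))) = 2 * ?f (2 * s - e)" if "s : ?I" for s
  using eq[OF that] by (simp add: quad_scale real_sqrt_mult)
 hence "((%s. sqrt (quad n (G (d s)) (%i. 2 * v i (2 * s - e)))) has_integral (2 * (integral {a..b} ?f / 2))) ?I"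
  by (rule has_integral_eq[OF _ I, OF sym])
 thus "integral ?I (%s. sqrt (quad n (G (d s)) (%i. 2 * v i (2 * s - e)))) = integral {a..b} ?f"
  using integral_unique by force
qed

section \<open>Distance on a covering of a compact Riemannian manifold\<close>

locale riem_cover =
 fixes n :: nat and M :: "'a::topological_space set" and A :: "'a chart set"
  and g :: "'a chart => 'a => nat => nat => real"
  and Mt :: "'b::topological_space set" and p :: "'b => 'a"
 assumes compact_M: "compact M" and Hausdorff_M: "Hausdorff_space (tos M)"
  and atlas: "smooth_atlas n (tos M) A" and metric: "riemannian_metric n A g"
  and cov: "covering_space Mt p M" and conn: "connected Mt"
begin

lemma p_cont: "con Mt p" and p_img: "x : Mt ==> p x : M"
 using cov covering_space_imp_continuous covering_space_imp_surjective by blast+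

lemma chart:
 assumes "(U, F) : A"
 shows chart_open: "opi (tos M) U" and chart_image_open: "opi (Euclidean_space n) (F ` U)"
  and chart_inj: "inj_on F U" and chart_cont: "con U F"
  and chart_inv_cont: "con (F ` U) (inv_into U F)" and chart_subset: "U <= M"
proof -
 have "ALL (U, F):A. opi (tos M) U & opi (Euclidean_space n) (F ` U) &
    homeomorphic_map (sbt (tos M) U) (sbt (Euclidean_space n) (F ` U)) F"
  using atlas by (simp add: smooth_atlas_def)
 from bspec[OF this assms]
 have o: "opi (tos M) U" "opi (Euclidean_space n) (F ` U)"
  and h: "homeomorphic_map (sbt (tos M) U) (sbt (Euclidean_space n) (F ` U)) F"
  by auto
 show "opi (tos M) U" "opi (Euclidean_space n) (F ` U)" by fact+
 show UM: "U <= M" using o(1) by (rule openin_imp_subset)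
 have im: "F ` U <= {y. ALL i>=n. y i = 0}"
  using openin_subset[OF o(2)] by (auto simp: topspace_Euclidean_space)
 have "homeomorphic_map (tos U) (tos (F ` U)) F"
  using h UM im by (simp add: Eucl_tos subtopology_subtopology Int_absorb1)
 then obtain q where q: "homeomorphic_maps (tos U) (tos (F ` U)) F q"
  by (auto simp: homeomorphic_map_maps)
 hence c: "con U F" "con (F ` U) q" and l: "!!x. x : U ==> q (F x) = x"
  by (auto simp: homeomorphic_maps_def)
 show "con U F" by fact
 show inj: "inj_on F U" using l by (metis inj_onI)
 show "con (F ` U) (inv_into U F)"
  using c(2) by (rule continuous_on_eq) (use l inj in auto)
qed

lemma ex_chart: "z : M ==> EX U F. (U, F) : A & z : U"
 using atlas by (auto simp: smooth_atlas_def)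

lemma smooth_fun_continuous:
 assumes "smooth_fun n W f" "opi (Euclidean_space n) W" shows "con W f"
proof -
 have "Ck_on n 0 W f" using assms(1) unfolding smooth_fun_def by (rule spec)
 moreover have "W <= {y. ALL i>=n. y i = 0}" using openin_subset[OF assms(2)] by (auto simp: topspace_Euclidean_space)
 ultimately show ?thesis
  by (simp add: Eucl_tos subtopology_subtopology Int_absorb1)
qed

lemma
 assumes "(U, F) : A"
 shows metric_cont: "!!i j. i < n ==> j < n ==> con (F ` U) (%y. g (U, F) (inv_into U F y) i j)"
  and metric_pos: "!!x v. x : U ==> EX i<n. v i ~= 0 ==> quad n (g (U, F) x) v > 0"
proof -
 from metric have "ALL (U, F):A.
    (ALL i<n. ALL j<n. smooth_fun n (F ` U) (%y. g (U, F) (inv_into U F y) i j)) &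
    (ALL x:U. (ALL i<n. ALL j<n. g (U, F) x i j = g (U, F) x j i) &
     (ALL v. (EX i<n. v i ~= 0) --> (SUM i<n. SUM j<n. g (U, F) x i j * v i * v j) > 0))"
  by (simp add: riemannian_metric_def)
 note m = bspec[OF this assms, unfolded prod.case]
 show "con (F ` U) (%y. g (U, F) (inv_into U F y) i j)" if "i < n" "j < n" for i j
  using m that by (intro smooth_fun_continuous chart_image_open[OF assms]) blast
 show "quad n (g (U, F) x) v > 0" if "x : U" "EX i<n. v i ~= 0" for x v
  using m that unfolding quad_def by blast
qed

lemma quad_nonneg:
 assumes "(U, F) : A" "x : U" shows "quad n (g (U, F) x) v >= 0"
proof (cases "EX i<n. v i ~= 0")
 case True
 thus ?thesis using metric_pos[OF assms] by (auto intro: less_imp_le)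
qed (auto simp: quad_def)

lemma speed_continuous:
 assumes c: "(U, F) : A" and W: "con S W" "W ` S <= U"
  and v: "!!i. i < n ==> con S (v i)"
 shows "con S (%s. sqrt (quad n (g (U, F) (W s)) (%i. v i s)))"
proof -
 have G: "con S (%s. g (U, F) (W s) i j)" if "i < n" "j < n" for i j
 proof -
  have "con S (%s. F (W s))" by (rule continuous_on_compose2[OF chart_cont[OF c] W])
  hence "con S (%s. g (U, F) (inv_into U F (F (W s))) i j)"
   by (rule continuous_on_compose2[OF metric_cont[OF c that]]) (use W(2) in blast)
  thus ?thesis
   by (rule continuous_on_eq) (use W(2) in \<open>simp add: image_subset_iff inv_into_f_f[OF chart_inj[OF c]]\<close>)
 qed
 show ?thesis
  unfolding quad_def
  by (intro continuous_on_real_sqrt continuous_on_sum continuous_on_mult) (use G v in auto)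
qed

text \<open>Here \<open>a = b\<close> is allowed, in contrast to \<open>has_length\<close>, so that
  a path can be cut at any parameter, also at one where two pieces meet.\<close>

definition piece :: "(real => 'a) => real => real => 'a chart => (nat => real => real) => bool" where
 "piece G a b c v \<longleftrightarrow> a <= b & c : A & G ` {a..b} <= fst c &
  (ALL i<n. con {a..b} (v i) &
   (ALL s:{a..b}. ((%r. snd c (G r) i) has_real_derivative v i s) (at s within {a..b})))"

definition speed :: "(real => 'a) => 'a chart => (nat => real => real) => real => real" where
 "speed G c v s = sqrt (quad n (g c (G s)) (%i. v i s))"

text \<open>The subdivision of \<open>has_length\<close> disappears into an inductive relation;
  cutting, concatenating and rescaling become inductions over the pieces.\<close>

inductive len :: "(real => 'a) => real => real => real => bool" for G where
 len_refl: "len G a a 0"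
| len_step: "len G a b L ==> piece G b d c v ==> len G a d (L + integral {b..d} (speed G c v))"

text \<open>In the direction back to \<open>has_length\<close>, pieces over a single parameter are
  dropped, since its subdivision points are strictly increasing.\<close>

lemma has_length_len: "has_length n A g G L \<longleftrightarrow> len G 0 1 L"
proof
 assume "has_length n A g G L"
 then obtain m t c v where t: "t 0 = 0" "t m = 1" and k: "ALL k<m. t k < t (Suc k) & c k : A & G ` {t k..t (Suc k)} <= fst (c k) &
   (ALL i<n. con {t k..t (Suc k)} (v k i) &
    (ALL s:{t k..t (Suc k)}. ((%r. snd (c k) (G r) i) has_real_derivative v k i s) (at s within {t k..t (Suc k)})))"
  and L: "L = (SUM k<m. integral {t k..t (Suc k)} (speed G (c k) (v k)))"
  unfolding has_length_def speed_def[abs_def] quad_def by blast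
 have "j <= m ==> len G 0 (t j) (SUM k<j. integral {t k..t (Suc k)} (speed G (c k) (v k)))" for j
 proof (induction j)
  case (Suc j)
  have "piece G (t j) (t (Suc j)) (c j) (v j)" using k Suc.prems by (auto simp: piece_def less_imp_le)
  thus ?case using len_step Suc by simp
 qed (simp add: t len_refl)
 from this[of m] show "len G 0 1 L" using t L by simp
next
 have "EX m t c v. t 0 = a & t m = b & (ALL k<m. t k < t (Suc k) & piece G (t k) (t (Suc k)) (c k) (v k)) &
   L = (SUM k<m. integral {t k..t (Suc k)} (speed G (c k) (v k)))" if "len G a b L" for a b
  using that
 proof induction
  case 0: (len_refl a)
  thus ?case by (intro exI[of _ 0] exI[of _ "%_. a"]) simp
 next
  case step: (len_step a b L d c' v')
  show ?case
  proof (cases "b = d")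
   case False
   hence bd: "b < d" using step.hyps(2) by (simp add: piece_def)
   obtain m t c v where m: "t 0 = a" "t m = b" "ALL k<m. t k < t (Suc k) & piece G (t k) (t (Suc k)) (c k) (v k)"
    "L = (SUM k<m. integral {t k..t (Suc k)} (speed G (c k) (v k)))" using step.IH by blast
   show ?thesis
    by (intro exI[of _ "Suc m"] exI[of _ "t(Suc m := d)"] exI[of _ "c(m := c')"] exI[of _ "v(m := v')"])
     (use m bd step.hyps(2) in \<open>auto simp: less_Suc_eq\<close>)
  qed (use step.IH in simp)
 qed
 moreover assume "len G 0 1 L"
 ultimately show "has_length n A g G L" unfolding has_length_def speed_def[abs_def] quad_def piece_def by meson
qed

definition joins :: "'b => 'b => real => bool" where
 "joins x y L \<longleftrightarrow> (EX G. path G & pim G <= Mt & pathstart G = x & pathfinish G = y & len (p o G) 0 1 L)"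

lemma riem_dist_joins: "riem_dist n A g Mt p x y = Inf {L. joins x y L}"
 by (simp add: riem_dist_def joins_def has_length_len)

lemma p_path_cont: "path G ==> pim G <= Mt ==> con {0..1} (p o G)"
 unfolding path_def path_image_def using continuous_on_compose continuous_on_subset[OF p_cont] by blast

lemma piece_integrable:
 assumes G: "con {a..b} G" and p: "piece G a b c v"
 shows "speed G c v integrable_on {a..b}" "s : {a..b} ==> 0 <= speed G c v s" "0 <= integral {a..b} (speed G c v)"
proof -
 obtain U F where c: "c = (U, F)" by force
 have p': "(U, F) : A" "G ` {a..b} <= U" "!!i. i < n ==> con {a..b} (v i)" using p by (auto simp: piece_def c)
 show i: "speed G c v integrable_on {a..b}" unfolding c speed_def[abs_def]
  by (rule integrable_continuous_interval[OF speed_continuous[OF p'(1) G p'(2,3)]])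
 show n: "0 <= speed G c v s" if "s : {a..b}" for s using p'(1,2) that by (auto simp: speed_def c intro!: quad_nonneg)
 show "0 <= integral {a..b} (speed G c v)" by (rule integral_nonneg[OF i n])
qed

lemma piece_subinterval:
 assumes "piece G a b c v" "a <= a'" "a' <= b'" "b' <= b" shows "piece G a' b' c v"
proof -
 have sub: "{a'..b'} <= {a..b}" using assms by auto
 show ?thesis using assms sub unfolding piece_def
  by (auto intro: continuous_on_subset[OF _ sub] DERIV_subset[OF _ sub])
qed

lemma len_le: "len G a b L ==> a <= b"
 by (induction rule: len.induct) (auto simp: piece_def)

lemma len_nonneg: "len G a b L ==> con {a..b} G ==> 0 <= L"
proof (induction rule: len.induct)
 case step: (len_step a b L d c v)
 have "a <= b" "b <= d" using len_le[OF step.hyps(1)] step.hyps(2) by (auto simp: piece_def)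
 hence "con {a..b} G" "con {b..d} G" by (auto intro: continuous_on_subset[OF step.prems])
 thus ?case using step.IH piece_integrable(3)[OF _ step.hyps(2)] by (simp add: add_nonneg_nonneg)
qed simp

lemma len_trans: "len G b d L2 ==> len G a b L1 ==> len G a d (L1 + L2)"
proof (induction rule: len.induct)
 case step: (len_step b d L e c v)
 show ?case using len_step[OF step.IH[OF step.prems] step.hyps(2)] by (simp add: add.assoc)
qed simp

lemma len_cong: "len G a b L ==> (!!t. t : {a..b} ==> G t = B t) ==> len B a b L"
proof (induction rule: len.induct)
 case step: (len_step a b L d c v)
 have ab: "a <= b" "b <= d" using len_le[OF step.hyps(1)] step.hyps(2) by (auto simp: piece_def)
 have eq: "G t = B t" if "t : {b..d}" for t using step.prems that ab by auto
 have "((%r. snd c (B r) i) has_real_derivative v i s) (at s within {b..d})" if "i < n" "s : {b..d}" for i s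
  by (rule has_field_derivative_transform_within[of "%r. snd c (G r) i", OF _ zero_less_one that(2)])
   (use step.hyps(2) that eq in \<open>auto simp: piece_def\<close>)
 hence "piece B b d c v" using step.hyps(2) eq unfolding piece_def by (auto simp: image_subset_iff)
 moreover have "integral {b..d} (speed G c v) = integral {b..d} (speed B c v)"
  by (rule integral_cong) (simp add: speed_def eq)
 ultimately show ?case using len_step[of B a b L d c v] step.IH step.prems ab by auto
qed (rule len_refl)

lemma len_split:
 "len G a b L ==> a <= t ==> t <= b ==> con {a..b} G ==> EX L1 L2. len G a t L1 & len G t b L2 & L = L1 + L2"
proof (induction rule: len.induct)
 case 0: (len_refl a)
 thus ?case using len_refl[of G a] by (intro exI[of _ 0]) simp
next
 case step: (len_step a b L d c v)
 have ab: "a <= b" "b <= d" using len_le[OF step.hyps(1)] step.hyps(2) by (auto simp: piece_def)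
 show ?case
 proof (cases "t <= b")
  case True
  have "con {a..b} G" by (rule continuous_on_subset[OF step.prems(3)]) (use ab in auto)
  then obtain L1 L2 where "len G a t L1" "len G t b L2" "L = L1 + L2" using step.IH[OF step.prems(1) True] by blast
  thus ?thesis using len_step[OF _ step.hyps(2)] by (metis add.assoc)
 next
  case False
  have "con {b..d} G" by (rule continuous_on_subset[OF step.prems(3)]) (use ab in auto)
  hence "integral {b..t} (speed G c v) + integral {t..d} (speed G c v) = integral {b..d} (speed G c v)"
   by (intro Henstock_Kurzweil_Integration.integral_combine piece_integrable(1)[OF _ step.hyps(2)]) (use False step.prems(2) in auto)
  moreover have "len G a t (L + integral {b..t} (speed G c v))"
   by (rule len_step[OF step.hyps(1) piece_subinterval[OF step.hyps(2)]]) (use False step.prems(2) in auto)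
  moreover have "len G t d (0 + integral {t..d} (speed G c v))"
   by (rule len_step[OF len_refl piece_subinterval[OF step.hyps(2)]]) (use False step.prems(2) in auto)
  ultimately show ?thesis by (rule_tac exI[of _ "L + integral {b..t} (speed G c v)"], rule_tac exI[of _ "integral {t..d} (speed G c v)"]) simp
 qed
qed

lemma len_rescale:
 "len W a b L ==> con {a..b} W ==> (!!r. r : {(a + e) / 2..(b + e) / 2} ==> E r = W (2 * r - e)) ==>
  len E ((a + e) / 2) ((b + e) / 2) L"
proof (induction rule: len.induct)
 case step: (len_step a b L d c v)
 have ab: "a <= b" "b <= d" using len_le[OF step.hyps(1)] step.hyps(2) by (auto simp: piece_def)
 have eq: "E r = W (2 * r - e)" if "r : {(b + e) / 2..(d + e) / 2}" for r using step.prems(2) that ab by auto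
 have "speed W c v integrable_on {b..d}"
  by (rule piece_integrable(1)[OF continuous_on_subset[OF step.prems(1)] step.hyps(2)]) (use ab in auto)
 note R = rescale_piece[where G="g c" and F="snd c" and n=n and v=v, OF ab(2) eq _ this[unfolded speed_def[abs_def]]]
 have v: "con {b..d} (v i) & (ALL s:{b..d}. ((%r. snd c (W r) i) has_real_derivative v i s) (at s within {b..d}))" if "i < n" for i
  using step.hyps(2) that by (simp add: piece_def)
 have "2 * r - e : {b..d}" if "r : {(b + e) / 2..(d + e) / 2}" for r using that by auto
 hence "E ` {(b + e) / 2..(d + e) / 2} <= fst c" using eq step.hyps(2) by (fastforce simp: piece_def)
 hence "piece E ((b + e) / 2) ((d + e) / 2) c (%i s. 2 * v i (2 * s - e))"
  using R(1)[OF _ v] step.hyps(2) by (simp add: piece_def)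
 moreover have "len E ((a + e) / 2) ((b + e) / 2) L"
  using step.IH continuous_on_subset[OF step.prems(1)] step.prems(2) ab by auto
 moreover have "integral {(b + e) / 2..(d + e) / 2} (speed E c (%i s. 2 * v i (2 * s - e))) = integral {b..d} (speed W c v)"
  unfolding speed_def[abs_def] by (rule R(2)[OF _ v])
 ultimately show ?case using len_step by metis
qed (rule len_refl)

lemma joins_nonneg: "joins x y L ==> L >= 0"
 unfolding joins_def using len_nonneg[OF _ p_path_cont] by blast

lemma joins_trans:
 assumes "joins x y L1" "joins y z L2" shows "joins x z (L1 + L2)"
proof -
 obtain G where g: "path G" "pim G <= Mt" "pathstart G = x" "pathfinish G = y" "len (p o G) 0 1 L1"
  using assms(1) unfolding joins_def by blast
 obtain E where d: "path E" "pim E <= Mt" "pathstart E = y" "pathfinish E = z" "len (p o E) 0 1 L2"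
  using assms(2) unfolding joins_def by blast
 have "len (p o (G +++ E)) ((0 + 0) / 2) ((1 + 0) / 2) L1"
  by (rule len_rescale[OF g(5) p_path_cont[OF g(1,2)]]) (simp add: joinpaths_left)
 moreover have "len (p o (G +++ E)) ((0 + 1) / 2) ((1 + 1) / 2) L2"
  by (rule len_rescale[OF d(5) p_path_cont[OF d(1,2)]]) (use g(4) d(3) in \<open>simp add: joinpaths_right\<close>)
 ultimately have "len (p o (G +++ E)) 0 1 (L1 + L2)" using len_trans by fastforce
 thus ?thesis unfolding joins_def using g(1-4) d(1-4) by (intro exI[of _ "G +++ E"]) (auto simp: path_image_join)
qed

end

lemma open_coordinate_box: "finite I ==> open {z :: 'i => real. ALL i:I. \<bar>z i - w i\<bar> < r}"
proof (induction I rule: finite_induct)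
 case (insert i I)
 have "open {z :: 'i => real. \<bar>z i - w i\<bar> < r}"
  by (intro open_Collect_less continuous_on_rabs continuous_on_diff continuous_coordinate continuous_on_const)
 hence "open ({z :: 'i => real. \<bar>z i - w i\<bar> < r} Int {z. ALL i:I. \<bar>z i - w i\<bar> < r})"
  using insert.IH by (rule open_Int)
 moreover have "{z :: 'i => real. \<bar>z i - w i\<bar> < r} Int {z. ALL i:I. \<bar>z i - w i\<bar> < r} = {z. ALL j:insert i I. \<bar>z j - w j\<bar> < r}"
  by auto
 ultimately show ?case by simp
qed simp

context riem_cover begin

lemma chart_open_image:
 assumes c: "(U, F) : A" and N: "opi (tos M) N"
 shows "opi (Euclidean_space n) (F ` (U Int N))"
proof -
 have "opi (tos (F ` U)) (F ` U Int inv_into U F -` N)"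
 proof (rule open_preim[OF chart_inv_cont[OF c] _ N])
  show "inv_into U F : F ` U \<rightarrow> M" using chart_subset[OF c] inv_into_into[of _ F U] by blast
 qed
 moreover have "F ` U Int inv_into U F -` N = F ` (U Int N)"
  using chart_inj[OF c] by (auto simp: inv_into_f_f)
 ultimately have "opi (tos (F ` U)) (F ` (U Int N))" by simp
 thus ?thesis
  using chart_image_open[OF c] unfolding Eucl_tos by (rule openin_trans)
qed

text \<open>The common source of all local estimates: the closed box of half the available radius is
  compact in the chart, so \<open>quad_bounds\<close> compares the Riemannian norm with the maximum
  norm of the coordinates throughout it.\<close>

lemma ex_box:
 assumes z: "z : M" and N: "opi (tos M) N" "z : N"
 shows "EX U F r c C. (U, F) : A & z : U & r > 0 & c > 0 & C > 0 &
  (ALL y. (ALL i<n. \<bar>y i - F z i\<bar> <= r) --> (ALL i>=n. y i = 0) --> y : F ` (U Int N)) &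
  (ALL x v j. x : U --> (ALL i<n. \<bar>F x i - F z i\<bar> <= r) --> j < n --> c * \<bar>v j\<bar> <= sqrt (quad n (g (U, F) x) v)) &
  (ALL x v m. x : U --> (ALL i<n. \<bar>F x i - F z i\<bar> <= r) --> (ALL j<n. \<bar>v j\<bar> <= m) --> m >= 0 -->
   sqrt (quad n (g (U, F) x) v) <= C * m)"
proof -
 obtain U F where c: "(U, F) : A" "z : U" using ex_chart[OF z] by blast
 have "F z : F ` (U Int N)" using c N by blast
 then obtain r0 where r0: "r0 > 0" "!!y. (ALL i<n. \<bar>y i - F z i\<bar> < r0) ==> (ALL i>=n. y i = 0) ==> y : F ` (U Int N)"
  using Euclidean_space_box[OF chart_open_image[OF c(1) N(1)]] by metis
 define r where "r = r0 / 2"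
 define B where "B = {y. (ALL i<n. \<bar>y i - F z i\<bar> <= r) & (ALL i>=n. y i = 0)}"
 have r: "r > 0" using r0 by (simp add: r_def)
 have BN: "y : F ` (U Int N)" if "ALL i<n. \<bar>y i - F z i\<bar> <= r" "ALL i>=n. y i = 0" for y
 proof (rule r0(2))
  show "ALL i<n. \<bar>y i - F z i\<bar> < r0" using that(1) r0(1) by (auto simp: r_def)
 qed (fact that(2))
 have BU: "B <= F ` U" using BN unfolding B_def by blast
 have phi0: "F x i = 0" if "x : U" "i >= n" for x i
  using openin_subset[OF chart_image_open[OF c(1)]] that by (auto simp: topspace_Euclidean_space)
 have "EX b C. b > 0 & C > 0 &
  (ALL y:B. ALL v. ALL j<n. b * \<bar>v j\<bar> <= sqrt (quad n (g (U, F) (inv_into U F y)) v)) &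
  (ALL y:B. ALL v m. (ALL j<n. \<bar>v j\<bar> <= m) & m >= 0 --> sqrt (quad n (g (U, F) (inv_into U F y)) v) <= C * m)"
 proof (rule quad_bounds)
  show "compact B" unfolding B_def by (rule compact_box)
  show "con B (%y. g (U, F) (inv_into U F y) i j)" if "i < n" "j < n" for i j
   using metric_cont[OF c(1) that] BU by (rule continuous_on_subset)
  show "quad n (g (U, F) (inv_into U F y)) v > 0" if "y : B" "EX i<n. v i ~= 0" for y v
   using that BU by (intro metric_pos[OF c(1)]) (auto intro: inv_into_into)
 qed
 then obtain b C where bC: "b > 0" "C > 0"
  "!!y v j. y : B ==> j < n ==> b * \<bar>v j\<bar> <= sqrt (quad n (g (U, F) (inv_into U F y)) v)"
  "!!y v m. y : B ==> (ALL j<n. \<bar>v j\<bar> <= m) ==> m >= 0 ==> sqrt (quad n (g (U, F) (inv_into U F y)) v) <= C * m"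
  by blast
 have inB: "F x : B" "inv_into U F (F x) = x" if "x : U" "ALL i<n. \<bar>F x i - F z i\<bar> <= r" for x
  using that phi0 chart_inj[OF c(1)] by (auto simp: B_def)
 have low: "b * \<bar>v j\<bar> <= sqrt (quad n (g (U, F) x) v)" if "x : U" "ALL i<n. \<bar>F x i - F z i\<bar> <= r" "j < n" for x v j
  using bC(3)[of "F x" j v] inB[OF that(1,2)] that by simp
 have up: "sqrt (quad n (g (U, F) x) v) <= C * m"
  if "x : U" "ALL i<n. \<bar>F x i - F z i\<bar> <= r" "ALL j<n. \<bar>v j\<bar> <= m" "m >= 0" for x v m
  using bC(4)[of "F x" v m] inB[OF that(1,2)] that by simp
 show ?thesis
  by (rule exI[of _ U], rule exI[of _ F], rule exI[of _ r], rule exI[of _ b], rule exI[of _ C], intro conjI)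
   (use c r bC(1,2) BN low up in \<open>simp_all\<close>)
qed

lemma open_coordinate_nhd:
 assumes "(U, F) : A" shows "opi (tos M) {x : U. ALL i<n. \<bar>F x i - a i\<bar> < r}"
proof -
 have "opi (tos U) (U Int F -` {y. ALL i:{..<n}. \<bar>y i - a i\<bar> < r})"
  using chart_cont[OF assms] open_coordinate_box[of "{..<n}" a r] by (intro continuous_openin_preimage_gen) auto
 moreover have "U Int F -` {y. ALL i:{..<n}. \<bar>y i - a i\<bar> < r} = {x : U. ALL i<n. \<bar>F x i - a i\<bar> < r}" by auto
 ultimately show ?thesis using chart_open[OF assms] openin_trans by fastforce
qed

text \<open>The joining path is a straight segment in a chart, lifted by the inverse q of p on the
  sheet u. Its speed is at most C times the largest coordinate of the velocity.\<close>

lemma local_join: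
 assumes z: "z : M" and N: "opi (tos M) N" "z : N" and e: "e > 0"
 shows "EX W. opi (tos M) W & z : W & W <= N &
  (ALL T u q x x'. homeomorphism u T p q --> u <= Mt --> N <= T --> x : u --> x' : u --> p x : W --> p x' : W -->
   (EX L<e. joins x x' L))"
proof -
 obtain U F r c C where c: "(U, F) : A" "z : U" and rC: "r > 0" "C > 0"
  and BN: "!!y. (ALL i<n. \<bar>y i - F z i\<bar> <= r) ==> (ALL i>=n. y i = 0) ==> y : F ` (U Int N)"
  and up: "!!x v m. x : U ==> (ALL i<n. \<bar>F x i - F z i\<bar> <= r) ==> (ALL j<n. \<bar>v j\<bar> <= m) ==> m >= 0 ==>
   sqrt (quad n (g (U, F) x) v) <= C * m"
  using ex_box[OF z N] by metis
 have phi0: "F x i = 0" if "x : U" "i >= n" for x i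
  using openin_subset[OF chart_image_open[OF c(1)]] that by (auto simp: topspace_Euclidean_space)
 \<comment> \<open>Two points of the box of radius r' differ by at most \<open>2 * r'\<close> in
   each coordinate, so this choice makes the length at most \<open>e / 2\<close>.\<close>
 define r' where "r' = min r (e / (4 * C))"
 have r': "r' > 0" "r' <= r" "C * (2 * r') < e"
 proof -
  show "r' > 0" "r' <= r" using rC e by (auto simp: r'_def)
  have "C * (2 * r') <= C * (2 * (e / (4 * C)))" using rC by (intro mult_left_mono) (auto simp: r'_def)
  also have "... < e" using rC e by simp
  finally show "C * (2 * r') < e" .
 qed
 define W where "W = {x : U. ALL i<n. \<bar>F x i - F z i\<bar> < r'}"
 show ?thesis
 proof (intro exI[of _ W] conjI allI impI)
  show "opi (tos M) W" unfolding W_def by (rule open_coordinate_nhd[OF c(1)])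
  show "z : W" using c r' by (simp add: W_def)
  show "W <= N"
  proof
   fix x assume x: "x : W"
   have "ALL i<n. \<bar>F x i - F z i\<bar> <= r" "ALL i>=n. F x i = 0"
    using x r' phi0 by (auto simp: W_def intro: less_imp_le order.strict_trans2)
   hence "F x : F ` (U Int N)" by (rule BN)
   thus "x : N" using x chart_inj[OF c(1)] by (auto simp: W_def inj_on_def)
  qed
  fix T u q x x' assume h: "homeomorphism u T p q" and u: "u <= Mt" "x : u" "x' : u" and NT: "N <= T"
   and px: "p x : W" "p x' : W"
  define a where "a = F (p x)"
  define b where "b = F (p x')"
  have ab: "\<bar>a i - F z i\<bar> < r'" "\<bar>b i - F z i\<bar> < r'" if "i < n" for i using px that by (auto simp: W_def a_def b_def)
  have ab0: "a i = 0" "b i = 0" if "i >= n" for i using px phi0 that by (auto simp: W_def a_def b_def)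
  define y where "y s = (%i. a i + s * (b i - a i))" for s :: real
  have ybox: "\<bar>y s i - F z i\<bar> <= r'" if "s : {0..1}" "i < n" for s i
  proof -
   have "y s i - F z i = (1 - s) * (a i - F z i) + s * (b i - F z i)" by (simp add: y_def algebra_simps)
   also have "\<bar>...\<bar> <= (1 - s) * \<bar>a i - F z i\<bar> + s * \<bar>b i - F z i\<bar>"
    using that(1) by (intro order_trans[OF abs_triangle_ineq]) (simp add: abs_mult)
   also have "... <= (1 - s) * r' + s * r'"
    using that(1) ab[OF that(2)] by (intro add_mono mult_left_mono) auto
   finally show ?thesis by (simp add: algebra_simps)
  qed
  have yN: "y s : F ` (U Int N)" if "s : {0..1}" for s
   by (rule BN) (use ybox[OF that] r' ab0 in \<open>auto simp: y_def intro: order_trans\<close>)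
  define G where "G s = q (inv_into U F (y s))" for s
  have inv: "inv_into U F (y s) : U Int N" "F (inv_into U F (y s)) = y s" if "s : {0..1}" for s
   using yN[OF that] chart_inj[OF c(1)] by auto
  have q: "p (q w) = w" "q w : u" if "w : T" for w
   using h that by (auto simp: homeomorphism_def)
  have qp: "q (p w) = w" if "w : u" for w using h that by (simp add: homeomorphism_def)
  have pg: "p (G s) = inv_into U F (y s)" if "s : {0..1}" for s
   using q(1) inv(1)[OF that] NT by (auto simp: G_def)
  have yc: "con {0..1} y" unfolding y_def
   by (intro continuous_on_coordinatewise_then_product continuous_intros)
  have "y ` {0..1} <= F ` U" using yN by blast
  hence "con {0..1} (%s. inv_into U F (y s))"
   by (rule continuous_on_compose2[OF chart_inv_cont[OF c(1)] yc])
  note ic = this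
  have qc: "con T q" using h by (simp add: homeomorphism_def)
  have gc: "con {0..1} G"
   unfolding G_def by (rule continuous_on_compose2[OF qc ic]) (use inv NT in blast)
  have gu: "G s : u" if "s : {0..1}" for s
   unfolding G_def using inv(1)[OF that] NT by (intro q(2)) blast
  have g0: "G 0 = x" "G 1 = x'"
  proof -
   have y01: "y 0 = F (p x)" "y 1 = F (p x')" by (auto simp: y_def a_def b_def)
   have "inv_into U F (y 0) = p x" "inv_into U F (y 1) = p x'"
    unfolding y01 using px by (auto simp: W_def inv_into_f_f[OF chart_inj[OF c(1)]])
   thus "G 0 = x" "G 1 = x'" using qp u by (auto simp: G_def)
  qed
  have path: "path G" "pim G <= Mt" "pathstart G = x" "pathfinish G = x'"
   using gc g0 gu u(1) unfolding path_def path_image_def pathstart_def pathfinish_def by blast+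
  have pc: "piece (p o G) 0 1 (U, F) (%i _. b i - a i)"
   unfolding piece_def
  proof (intro conjI allI impI ballI)
   show "(p o G) ` {0..1} <= fst (U, F)" using pg inv by auto
   show "((%r. snd (U, F) ((p o G) r) i) has_real_derivative b i - a i) (at s within {0..1})" if "s : {0..1}" for i s
   proof (rule has_field_derivative_transform_within[OF _ zero_less_one that])
    show "((%r. y r i) has_real_derivative b i - a i) (at s within {0..1})"
     unfolding y_def by (auto intro!: derivative_eq_intros)
    show "y r i = snd (U, F) ((p o G) r) i" if "r : {0..1}" for r using that pg inv by simp
   qed
  qed (use c in auto)
  define L where "L = integral {0..1} (speed (p o G) (U, F) (%i _. b i - a i))"
  have "joins x x' L" using path len_step[OF len_refl pc] unfolding joins_def L_def by auto
  moreover have "L <= C * (2 * r')"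
  proof -
   have "L <= integral {0..1::real} (%_. C * (2 * r'))"
    unfolding L_def
   proof (rule integral_le)
    show "speed (p o G) (U, F) (%i _. b i - a i) integrable_on {0..1}"
     by (rule piece_integrable(1)[OF p_path_cont[OF path(1,2)] pc])
    show "speed (p o G) (U, F) (%i _. b i - a i) s <= C * (2 * r')" if s: "s : {0..1}" for s
     unfolding speed_def
    proof (rule up)
     show "(p o G) s : U" using pg[OF s] inv[OF s] by simp
     show "ALL i<n. \<bar>F ((p o G) s) i - F z i\<bar> <= r"
      using pg[OF s] inv[OF s] ybox[OF s] r' by (auto intro: order_trans)
     have "\<bar>b j - a j\<bar> <= 2 * r'" if "j < n" for j using ab[OF that] by linarith
     thus "ALL j<n. \<bar>b j - a j\<bar> <= 2 * r'" by blast
    qed (use r' in auto)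
   qed (auto intro: integrable_const_ivl)
   thus ?thesis by simp
  qed
  ultimately show "EX L<e. joins x x' L" using r' by (intro exI[of _ L]) auto
 qed
qed

text \<open>The lower bound c is available in the chart U only, while the piece comes with a chart
  of its own. The chain rule and the transformation law of the metric express the speed by the
  velocity in U, and the change of the coordinate j is an integral of that velocity.\<close>

lemma piece_estimate:
 assumes B: "con {a..b} B" and pc: "piece B a b d v"
  and U: "(U, F) : A" "C <= U" "c > 0" "B ` {a..b} <= C" "j < n"
  and low: "!!x v j. x : C ==> j < n ==> c * \<bar>v j\<bar> <= sqrt (quad n (g (U, F) x) v)"
 shows "c * \<bar>F (B b) j - F (B a) j\<bar> <= integral {a..b} (speed B d v)"
proof -
 obtain V P where d: "d = (V, P)" by force
 have ab: "a <= b" and V: "(V, P) : A" "B ` {a..b} <= V"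
  and v: "!!i s. i < n ==> s : {a..b} ==> ((%r. P (B r) i) has_real_derivative v i s) (at s within {a..b})"
  using pc by (auto simp: piece_def d)
 define J where "J x k i = coord_deriv i (%y. F (inv_into V P y) k) (P x)" for x k i
 define u where "u k s = (SUM i<n. J (B s) k i * v i s)" for k s
 have gUV: "B s : U Int V" "B s : C" if "s : {a..b}" for s using that U(2,4) V(2) by blast+
 have sm: "smooth_fun n (P ` (V Int U)) (%y. F (inv_into V P y) k)" if "k < n" for k
 proof -
  have "ALL (U, F):A. ALL (V, P):A. ALL k<n. smooth_fun n (F ` (U Int V)) (%y. P (inv_into U F y) k)"
   using atlas by (simp add: smooth_atlas_def)
  from bspec[OF bspec[OF this V(1), unfolded prod.case] U(1), unfolded prod.case] that show ?thesis by blast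
 qed
 have W: "opi (Euclidean_space n) (P ` (V Int U))" by (rule chart_open_image[OF V(1) chart_open[OF U(1)]])
 have der: "((%s. F (B s) k) has_real_derivative u k s) (at s within {a..b})" if s: "s : {a..b}" and k: "k < n" for s k
 proof -
  have "Ck_on n (Suc 0) (P ` (V Int U)) (%y. F (inv_into V P y) k)" using sm[OF k] unfolding smooth_fun_def by (rule spec)
  hence "((%s. F (inv_into V P (P (B s))) k) has_real_derivative
    (SUM i<n. coord_deriv i (%y. F (inv_into V P y) k) (P (B s)) * v i s)) (at s within {a..b})"
   by (rule Ck_on_chain_rule[OF W _ _ s]) (use gUV v s in auto)
  hence "((%s. F (inv_into V P (P (B s))) k) has_real_derivative u k s) (at s within {a..b})"
   by (simp add: u_def J_def)
  thus ?thesis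
   by (rule has_field_derivative_transform_within[OF _ zero_less_one s])
    (use gUV in \<open>simp add: inv_into_f_f[OF chart_inj[OF V(1)]]\<close>)
 qed
 have trans: "quad n (g (V, P) (B s)) (%i. v i s) = quad n (g (U, F) (B s)) (%k. u k s)" if s: "s : {a..b}" for s
 proof -
  have "ALL (U, F):A. ALL (V, P):A. ALL x:U Int V. ALL i<n. ALL j<n.
    (let J = (%k i. coord_deriv i (%y. P (inv_into U F y) k) (F x)) in
    g (U, F) x i j = (SUM k<n. SUM l<n. J k i * J l j * g (V, P) x k l))"
   using metric by (simp add: riemannian_metric_def)
  from bspec[OF bspec[OF bspec[OF this V(1), unfolded prod.case] U(1), unfolded prod.case], of "B s"] gUV[OF s]
  have tr: "g (V, P) (B s) i j = (SUM k<n. SUM l<n. J (B s) k i * J (B s) l j * g (U, F) (B s) k l)" if "i < n" "j < n" for i j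
   using that unfolding Let_def J_def by blast
  let ?J = "J (B s)" and ?v = "%i. v i s" and ?G = "g (U, F) (B s)"
  have "quad n (g (V, P) (B s)) ?v = (SUM i<n. SUM j<n. SUM k<n. SUM l<n. ?J k i * ?J l j * ?G k l * ?v i * ?v j)"
   unfolding quad_def by (intro sum.cong refl) (simp add: tr sum_distrib_right)
  also have "... = (SUM i<n. SUM k<n. SUM j<n. SUM l<n. ?J k i * ?J l j * ?G k l * ?v i * ?v j)"
   by (rule sum.cong[OF refl]) (rule sum.swap)
  also have "... = (SUM k<n. SUM i<n. SUM l<n. SUM j<n. ?J k i * ?J l j * ?G k l * ?v i * ?v j)"
   by (subst sum.swap) (intro sum.cong[OF refl] sum.swap)
  also have "... = (SUM k<n. SUM l<n. SUM i<n. SUM j<n. ?J k i * ?J l j * ?G k l * ?v i * ?v j)"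
   by (rule sum.cong[OF refl]) (rule sum.swap)
  also have "... = quad n ?G (%k. u k s)"
   unfolding quad_def u_def
   by (intro sum.cong refl) (simp add: sum_distrib_left sum_distrib_right mult_ac)
  finally show ?thesis .
 qed
 have I: "((%s. u j s) has_integral (F (B b) j - F (B a) j)) {a..b}"
  by (rule fundamental_theorem_of_calculus[OF ab])
   (use der U(5) in \<open>simp add: has_real_derivative_iff_has_vector_derivative[symmetric]\<close>)
 have "norm (integral {a..b} (%s. c * u j s)) <= integral {a..b} (speed B d v)"
 proof (rule integral_norm_bound_integral)
  show "(%s. c * u j s) integrable_on {a..b}" using has_integral_mult_right[OF I, of c] by blast
  show "norm (c * u j s) <= speed B d v s" if s: "s : {a..b}" for s
   using low[OF gUV(2)[OF s] U(5), of "%k. u k s"] trans[OF s] U(3) by (simp add: abs_mult speed_def d)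
 qed (rule piece_integrable(1)[OF B pc])
 moreover have "integral {a..b} (%s. c * u j s) = c * (F (B b) j - F (B a) j)"
  using integral_unique[OF has_integral_mult_right[OF I, of c]] .
 ultimately show ?thesis using U(3) by (simp add: abs_mult)
qed
end

context riem_cover begin

lemma len_estimate:
 "len G a b L ==> con {a..b} G ==> (U, F) : A ==> C <= U ==> c > 0 ==> G ` {a..b} <= C ==> j < n ==>
  (!!x v j. x : C ==> j < n ==> c * \<bar>v j\<bar> <= sqrt (quad n (g (U, F) x) v)) ==> c * \<bar>F (G b) j - F (G a) j\<bar> <= L"
proof (induction rule: len.induct)
 case step: (len_step a b L d c' v)
 have ab: "a <= b" "b <= d" using len_le[OF step.hyps(1)] step.hyps(2) by (auto simp: piece_def)
 have sub: "{a..b} <= {a..d}" "{b..d} <= {a..d}" using ab by auto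
 have im: "G ` {a..b} <= C" "G ` {b..d} <= C" using sub step.prems(5) by blast+
 have "c * \<bar>F (G d) j - F (G a) j\<bar> <= c * (\<bar>F (G b) j - F (G a) j\<bar> + \<bar>F (G d) j - F (G b) j\<bar>)"
  using step.prems(4) by (intro mult_left_mono) linarith+
 also have "... <= L + integral {b..d} (speed G c' v)"
  using step.IH[OF continuous_on_subset[OF step.prems(1) sub(1)] step.prems(2-4) im(1) step.prems(6,7)]
   piece_estimate[OF continuous_on_subset[OF step.prems(1) sub(2)] step.hyps(2) step.prems(2-4) im(2) step.prems(6,7)]
  unfolding distrib_left by (rule add_mono)
 finally show ?case .
qed simp

text \<open>A path that starts in the box W of radius \<open>r / 2\<close> and reaches the boundary
  of the box of radius r has changed some coordinate by at least \<open>r / 2\<close>, which costs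
  the length \<open>d = c * (r / 2)\<close>. This constant depends on z and not on the path.\<close>

lemma exit_nhd:
 assumes z: "z : M" and N: "opi (tos M) N" "z : N"
 shows "EX W C d. opi (tos M) W & z : W & compact C & W <= C & C <= N & d > 0 &
  (ALL G L s. path G & pim G <= Mt & len (p o G) s 1 L & s : {0..1} & p (G s) : W -->
   (p o G) ` {s..1} <= C \<or> (EX t:{s..1}. (p o G) ` {s..t} <= C & (EX L'<=L - d. len (p o G) t 1 L')))"
proof -
 obtain U F r c where c: "(U, F) : A" "z : U" and rc: "r > 0" "c > 0"
  and BN: "!!y. (ALL i<n. \<bar>y i - F z i\<bar> <= r) ==> (ALL i>=n. y i = 0) ==> y : F ` (U Int N)"
  and low: "!!x v j. x : U ==> (ALL i<n. \<bar>F x i - F z i\<bar> <= r) ==> j < n ==> c * \<bar>v j\<bar> <= sqrt (quad n (g (U, F) x) v)"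
  using ex_box[OF z N] by metis
 have phi0: "F x i = 0" if "x : U" "i >= n" for x i
  using openin_subset[OF chart_image_open[OF c(1)]] that by (auto simp: topspace_Euclidean_space)
 define B where "B = {y. (ALL i<n. \<bar>y i - F z i\<bar> <= r) & (ALL i>=n. y i = 0)}"
 define C where "C = {x : U. ALL i<n. \<bar>F x i - F z i\<bar> <= r}"
 define O' where "O' = {x : U. ALL i<n. \<bar>F x i - F z i\<bar> < r}"
 define W where "W = {x : U. ALL i<n. \<bar>F x i - F z i\<bar> < r / 2}"
 have BU: "B <= F ` U" using BN unfolding B_def by blast
 have "C = inv_into U F ` B"
 proof
  show "C <= inv_into U F ` B"
  proof
   fix x assume x: "x : C"
   hence "F x : B" "inv_into U F (F x) = x" using phi0 chart_inj[OF c(1)] by (auto simp: C_def B_def)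
   thus "x : inv_into U F ` B" by (metis imageI)
  qed
  show "inv_into U F ` B <= C"
  proof
   fix x assume "x : inv_into U F ` B"
   then obtain y where y: "y : B" "x = inv_into U F y" by blast
   hence "x : U" "F x = y" using BU by (auto intro: inv_into_into f_inv_into_f)
   thus "x : C" using y(1) by (auto simp: C_def B_def)
  qed
 qed
 moreover have "compact (inv_into U F ` B)"
  by (rule compact_continuous_image[OF continuous_on_subset[OF chart_inv_cont[OF c(1)] BU]]) (simp add: B_def compact_box)
 ultimately have compC: "compact C" by simp
 have CN: "C <= N"
 proof
  fix x assume x: "x : C"
  hence "F x : F ` (U Int N)" by (intro BN) (auto simp: C_def phi0)
  thus "x : N" using x chart_inj[OF c(1)] by (auto simp: C_def inj_on_def)
 qed
 have CM: "C <= M" using chart_subset[OF c(1)] by (auto simp: C_def)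
 have closedC: "closedin (tos M) C"
  using compactin_imp_closedin[OF Hausdorff_M] compC CM by (simp add: compactin_subtopology)
 have WO: "W <= O'" "O' <= C" "C <= U" using rc by (fastforce simp: W_def O'_def C_def)+
 have ex: "(p o G) ` {s..1} <= C \<or> (EX t:{s..1}. (p o G) ` {s..t} <= C & (EX L'<=L - c * (r / 2). len (p o G) t 1 L'))"
  if G: "path G" "pim G <= Mt" and len: "len (p o G) s 1 L" and s: "s : {0..1}" "p (G s) : W" for G L s
 proof (cases "(p o G) ` {s..1} <= O'")
  case False
  have pc: "con {s..1} (p o G)"
   by (rule continuous_on_subset[OF p_path_cont[OF G]]) (use s in auto)
  have "G T : Mt" if "T : {s..1}" for T
   using G(2) s(1) that unfolding path_image_def by auto
  hence pM: "p o G : {s..1} \<rightarrow> M" using p_img by auto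
  define S where "S = {s..1} - ({s..1} Int (p o G) -` O')"
  have "opi (tos {s..1}) ({s..1} Int (p o G) -` O')"
   using open_coordinate_nhd[OF c(1)] by (intro open_preim[OF pc pM]) (simp add: O'_def)
  hence "closedin (tos {s..1}) S" unfolding S_def by (intro closedin_diff) auto
  hence cS: "closed S" by (metis closedin_closed_trans closed_atLeastAtMost)
  have S0: "S ~= {}" using False by (auto simp: S_def)
  have bS: "bdd_below S" by (rule bdd_belowI[of _ s]) (auto simp: S_def)
  \<comment> \<open>The first parameter outside the open box O'. Up to and including t the path lies
    in the closed box C.\<close>
  define t where "t = Inf S"
  have tS: "t : S" unfolding t_def by (rule closed_contains_Inf[OF S0 bS cS])
  hence t: "t : {s..1}" "p (G t) ~: O'" by (auto simp: S_def)
  obtain L1 L2 where L: "len (p o G) s t L1" "len (p o G) t 1 L2" "L = L1 + L2" using len_split[OF len _ _ pc, of t] t(1) by auto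
  have st: "s < t" using t s WO by (metis atLeastAtMost_iff le_less subsetD)
  have before: "p (G T) : O'" if "T : {s..<t}" for T
  proof (rule ccontr)
   assume "p (G T) ~: O'"
   hence "T : S" using that t by (auto simp: S_def)
   hence "t <= T" unfolding t_def by (rule cInf_lower[OF _ bS])
   thus False using that by auto
  qed
  have inC: "(p o G) ` {s..t} <= C"
  proof -
   have "closedin (tos {s..1}) ({s..1} Int (p o G) -` C)"
    by (rule continuous_closedin_preimage_gen[OF pc _ closedC]) (use pM in auto)
   hence "closed ({s..1} Int (p o G) -` C)" by (metis closedin_closed_trans closed_atLeastAtMost)
   moreover have "{s..<t} <= {s..1} Int (p o G) -` C" using before WO t by fastforce
   ultimately have "closure {s..<t} <= {s..1} Int (p o G) -` C" by (rule closure_minimal[rotated])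
   thus ?thesis using st by (auto simp: closure_atLeastLessThan)
  qed
  have "p (G t) : C" using inC st by auto
  then obtain i where i: "i < n" "\<bar>F (p (G t)) i - F z i\<bar> >= r" using t(2) by (force simp: C_def O'_def)
  moreover have "\<bar>F (p (G s)) i - F z i\<bar> < r / 2" using s(2) i(1) by (simp add: W_def)
  ultimately have "\<bar>F (p (G t)) i - F (p (G s)) i\<bar> >= r / 2" by linarith
  hence "c * (r / 2) <= c * \<bar>F (p (G t)) i - F (p (G s)) i\<bar>" using rc by (intro mult_left_mono) auto
  also have "... <= L1"
  proof -
   have "con {s..t} (p o G)" by (rule continuous_on_subset[OF pc]) (use t(1) in auto)
   from len_estimate[OF L(1) this c(1) WO(3) rc(2) inC i(1)] low show ?thesis by (simp add: C_def)
  qed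
  finally have "L2 <= L - c * (r / 2)" using L(3) by simp
  thus ?thesis using t(1) inC L(2) by blast
 qed (use WO in blast)
 show ?thesis
  by (rule exI[of _ W], rule exI[of _ C], rule exI[of _ "c * (r / 2)"])
   (use open_coordinate_nhd[OF c(1), of "F z" "r / 2"] c(2) rc WO CN compC ex in \<open>auto simp: W_def\<close>)
qed

lemma Mt_closedin_preimage:
 assumes "closedin (tos M) C" shows "closedin (tos Mt) (Mt Int p -` C)"
 by (rule continuous_closedin_preimage_gen[OF p_cont _ assms]) (use p_img in auto)

lemma compact_closedin_M: "compact C ==> C <= M ==> closedin (tos M) C"
 using compactin_imp_closedin[OF Hausdorff_M] by (simp add: compactin_subtopology)

lemma compact_preimage_Int:
 assumes K: "compact K" "K <= Mt" and C: "compact C" "C <= M"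
 shows "compact (K Int p -` C)"
proof -
 have "closedin (tos K) (K Int (Mt Int p -` C))"
  using Mt_closedin_preimage[OF compact_closedin_M[OF C]] K(2) by (auto simp: closedin_closed)
 moreover have "K Int (Mt Int p -` C) = K Int p -` C" using K by auto
 ultimately show ?thesis using closedin_compact[OF K(1)] by simp
qed

text \<open>While its projection stays in C, a path stays in one sheet over T. The compact set of
  points of K over C meets finitely many sheets, and K' is the union of the copies of C in
  these.\<close>

lemma sheet_compact:
 assumes K: "compact K" "K <= Mt" and C: "compact C" "C <= T" and TM: "T <= M"
  and V: "\<Union>W = Mt Int p -` T" "!!u. u : W ==> opi (tos Mt) u" "pairwise disjnt W"
   "!!u. u : W ==> EX q. homeomorphism u T p q"
 shows "EX K'. compact K' & K' <= Mt & (ALL G s t. path G & pim G <= Mt & 0 <= s & s <= t & t <= 1 &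
  G s : K & (p o G) ` {s..t} <= C --> G t : K')"
proof -
 have KC: "compact (K Int p -` C)" using compact_preimage_Int[OF K C(1)] C(2) TM by blast
 obtain q where q: "!!u. u : W ==> homeomorphism u T p (q u)" using V(4) by metis
 have KV: "K Int p -` C <= \<Union>W" unfolding V(1) using K(2) C(2) by blast
 obtain B where V': "B <= W" "finite B" "K Int p -` C <= \<Union>B"
  by (rule compact_open_cover[OF KC _ V(2) KV]) (use K(2) in auto)
 define K' where "K' = (UN u:B. q u ` C)"
 have "compact K'" unfolding K'_def
 proof (intro compact_UN V'(2))
  fix u assume "u : B"
  hence "con C (q u)" using q V'(1) C(2) by (meson continuous_on_subset homeomorphism_def subsetD)
  thus "compact (q u ` C)" using C(1) by (rule compact_continuous_image)
 qed
 moreover have qu: "q u w : u & p (q u w) = w" if "u : W" "w : T" for u w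
  using q[OF that(1)] that(2) by (auto simp: homeomorphism_def)
 hence "K' <= Mt" unfolding K'_def using V(1) V'(1) C(2) by blast
 moreover have "G t : K'" if G: "path G" "pim G <= Mt" and st: "0 <= s" "s <= t" "t <= 1" and s: "G s : K"
  and im: "(p o G) ` {s..t} <= C" for G s t
 proof -
  have "p (G s) : C" using im st by auto
  then obtain u where u: "u : B" "G s : u" using V'(3) s by blast
  have uV: "u : W" using u V' by blast
  have gc: "con {s..t} G" by (rule continuous_on_subset[of "{0..1}"]) (use G(1) st in \<open>auto simp: path_def\<close>)
  have gM: "G : {s..t} \<rightarrow> Mt" using G(2) st by (auto simp: path_image_def)
  have inT: "p (G k) : T" if "k : {s..t}" for k
  proof -
   have "(p o G) k : C" using im that by blast
   thus ?thesis using C(2) by auto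
  qed
  have pgc: "con {s..t} (%k. p (G k))" by (rule continuous_on_compose2[OF p_cont gc]) (use gM in auto)
  have "G t = q u (p (G t))"
  proof (rule covering_lift_unique[where T="{s..t}" and a=s and ?g1.0=G and ?g2.0="%k. q u (p (G k))", OF cov gc gM])
   show "con {s..t} (%k. q u (p (G k)))"
    by (rule continuous_on_compose2[of T "q u", OF _ pgc]) (use q[OF uV] inT in \<open>auto simp: homeomorphism_def\<close>)
   show "(%k. q u (p (G k))) : {s..t} \<rightarrow> Mt" using qu[OF uV] inT V(1) uV by blast
   show "p (G k) = p (q u (p (G k)))" if "k : {s..t}" for k using qu[OF uV inT[OF that]] by simp
   show "G s = q u (p (G s))" using q[OF uV] u(2) by (simp add: homeomorphism_def)
  qed (use st in auto)
  moreover have "p (G t) : C" using im st by auto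
  ultimately show ?thesis using u(1) unfolding K'_def by blast
 qed
 ultimately have *: "compact K'" "K' <= Mt"
  "!!G s t. path G ==> pim G <= Mt ==> 0 <= s ==> s <= t ==> t <= 1 ==> G s : K ==> (p o G) ` {s..t} <= C ==> G t : K'"
  by blast+
 show ?thesis
 proof (intro exI[of _ K'] conjI allI impI)
  fix G s t
  assume "path G & pim G <= Mt & 0 <= s & s <= t & t <= 1 & G s : K & (p o G) ` {s..t} <= C"
  thus "G t : K'" by (elim conjE) (rule *(3))
 qed (fact *)+
qed
end

section \<open>Compactness of bounded sets\<close>

context riem_cover begin

text \<open>The Hopf-Rinow argument for a covering of a compact manifold. Finitely many exit
  neighbourhoods cover M. With e at most equal to each of their exit lengths, a path of length less
  than \<open>j * e\<close> has fewer than j exits, and each of them leads from a compact set to a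
  compact set.\<close>

lemma bounded_compact_joins:
 assumes x: "x : Mt"
 shows "EX K. compact K & K <= Mt & (ALL y L. joins x y L & L < R --> y : K)"
proof -
 define good where "good z W C d T N \<longleftrightarrow> opi (tos M) W & z : W & compact C & W <= C & C <= T & T <= M & d > 0 &
  (ALL c L s. path c & pim c <= Mt & len (p o c) s 1 L & s : {0..1} & p (c s) : W -->
   (p o c) ` {s..1} <= C \<or> (EX t:{s..1}. (p o c) ` {s..t} <= C & (EX L'<=L - d. len (p o c) t 1 L'))) &
  \<Union>N = Mt Int p -` T & (ALL u:N. opi (tos Mt) u) & pairwise disjnt N & (ALL u:N. EX q. homeomorphism u T p q)"
  for z W C and d :: real and T and N :: "'b set set"
 have "EX W C d T N. good z W C d T N" if z: "z : M" for z
 proof -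
  obtain T N where T: "z : T" "opi (tos M) T" and V: "\<Union>N = Mt Int p -` T"
   "!!u. u : N ==> opi (tos Mt) u" "pairwise disjnt N" "!!u. u : N ==> EX q. homeomorphism u T p q"
   using cov_sheet[OF cov z] by metis
  from exit_nhd[OF z T(2,1)] obtain W C d where "opi (tos M) W & z : W & compact C & W <= C & C <= T & d > 0 &
  (ALL c L s. path c & pim c <= Mt & len (p o c) s 1 L & s : {0..1} & p (c s) : W -->
   (p o c) ` {s..1} <= C \<or> (EX t:{s..1}. (p o c) ` {s..t} <= C & (EX L'<=L - d. len (p o c) t 1 L')))" by blast
  hence "good z W C d T N" unfolding good_def using T V openin_imp_subset[OF T(2)] by simp
  thus ?thesis by blast
 qed
 then obtain W C d T N where G: "!!z. z : M ==> good z (W z) (C z) (d z) (T z) (N z)" by metis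
 obtain B where "B <= W ` M" "finite B" "M <= \<Union>B"
  by (rule compact_open_cover[OF compact_M order_refl, of "W ` M"]) (use G in \<open>auto simp: good_def\<close>)
 then obtain Z where Z: "Z <= M" "finite Z" "M <= \<Union>(W ` Z)" by (metis finite_subset_image)
 define e where "e = Min (insert 1 (d ` Z))"
 have dpos: "d z > 0" if "z : Z" for z using G[of z] Z(1) that unfolding good_def by blast
 have e: "e > 0" "!!z. z : Z ==> e <= d z" using Z(2) dpos by (auto simp: e_def)
 \<comment> \<open>The path is followed from an arbitrary parameter s on, so that its remainder
   after an exit falls under the induction hypothesis, for the larger compact set K1.\<close>
 have reach: "EX K'. compact K' & K' <= Mt & (ALL c L s. path c & pim c <= Mt & len (p o c) s 1 L & s : {0..1} &
   c s : K & L < real j * e --> c 1 : K')" if "compact K" "K <= Mt" for j K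
  using that
 proof (induction j arbitrary: K)
  case 0
  have "0 <= L" if "path c" "pim c <= Mt" "len (p o c) s 1 L" "s : {0..1}" for c L s
   using len_nonneg[OF that(3)] continuous_on_subset[OF p_path_cont[OF that(1,2)], of "{s..1}"] that(4) by auto
  hence "~ (path c & pim c <= Mt & len (p o c) s 1 L & s : {0..1} & c s : K & L < real 0 * e)" for c L s
   by (metis mult_zero_left not_le of_nat_0)
  thus ?case by (intro exI[of _ "{}"] conjI compact_empty empty_subsetI) blast
 next
  case (Suc j)
  have "EX K'. compact K' & K' <= Mt & (ALL c s t. path c & pim c <= Mt & 0 <= s & s <= t & t <= 1 &
   c s : K & (p o c) ` {s..t} <= C z --> c t : K')" if "z : Z" for z
  proof -
   have gz: "good z (W z) (C z) (d z) (T z) (N z)" by (rule G) (use Z(1) that in blast)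
   have "compact (C z)" "C z <= T z" "T z <= M" "\<Union>(N z) = Mt Int p -` T z"
    "!!u. u : N z ==> opi (tos Mt) u" "pairwise disjnt (N z)"
    "!!u. u : N z ==> EX q. homeomorphism u (T z) p q"
    using gz unfolding good_def by simp_all
   thus ?thesis by (rule sheet_compact[OF Suc.prems])
  qed
  then obtain K' where K': "!!z. z : Z ==> compact (K' z)" "!!z. z : Z ==> K' z <= Mt"
   "!!z c s t. z : Z ==> path c ==> pim c <= Mt ==> 0 <= s ==> s <= t ==> t <= 1 ==> c s : K ==>
    (p o c) ` {s..t} <= C z ==> c t : K' z" by metis
  define K1 where "K1 = \<Union>(K' ` Z)"
  have K1: "compact K1" "K1 <= Mt" unfolding K1_def using K' Z(2) by auto
  obtain K2 where K2: "compact K2" "K2 <= Mt" "ALL c L s. path c & pim c <= Mt & len (p o c) s 1 L & s : {0..1} &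
   c s : K1 & L < real j * e --> c 1 : K2"
   using Suc.IH[OF K1] by (elim exE conjE) (rule that)
  show ?case
  proof (intro exI[of _ "K1 Un K2"] conjI allI impI)
   show "compact (K1 Un K2)" "K1 Un K2 <= Mt" using K1 K2 by auto
   fix c L s assume H: "path c & pim c <= Mt & len (p o c) s 1 L & s : {0..1} & c s : K & L < real (Suc j) * e"
   hence "p (c s) : M" using Suc.prems(2) p_img by blast
   then obtain z where z: "z : Z" "p (c s) : W z" using Z(3) by blast
   have "(p o c) ` {s..1} <= C z \<or> (EX t:{s..1}. (p o c) ` {s..t} <= C z & (EX L'<=L - d z. len (p o c) t 1 L'))"
    using G[of z] Z(1) z H unfolding good_def by blast
   thus "c 1 : K1 Un K2"
   proof
    assume "(p o c) ` {s..1} <= C z"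
    hence "c 1 : K' z" using K'(3)[OF z(1), of c s 1] H by simp
    thus ?thesis using z(1) by (auto simp: K1_def)
   next
    assume "EX t:{s..1}. (p o c) ` {s..t} <= C z & (EX L'<=L - d z. len (p o c) t 1 L')"
    then obtain t L' where t: "t : {s..1}" "(p o c) ` {s..t} <= C z" "L' <= L - d z" "len (p o c) t 1 L'" by blast
    have "c t : K' z" using K'(3)[OF z(1), of c s t] H t by simp
    hence "c t : K1" using z(1) by (auto simp: K1_def)
    moreover have "L' < real j * e" using H t(3) e(2)[OF z(1)] by (simp add: algebra_simps)
    moreover have "t : {0..1}" using t(1) H by auto
    ultimately show ?thesis using K2(3) H t(4) by blast
   qed
  qed
 qed
 obtain j where j: "R < real j * e" using e(1) by (metis reals_Archimedean3)
 obtain K where K: "compact K" "K <= Mt" "ALL c L s. path c & pim c <= Mt & len (p o c) s 1 L & s : {0..1} &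
   c s : {x} & L < real j * e --> c 1 : K"
  using reach[of "{x}" j] x by auto
 have "y : K" if L: "joins x y L" "L < R" for y L
 proof -
  obtain c where c: "path c" "pim c <= Mt" "c 0 = x" "c 1 = y" "len (p o c) 0 1 L"
   using L(1) unfolding joins_def pathstart_def pathfinish_def by blast
  thus ?thesis using K(3)[rule_format, of c 0 L] L(2) j by simp
 qed
 thus ?thesis using K by blast
qed

lemma local_nhd:
 assumes y: "y : Mt" and e: "e > 0"
 obtains W where "opi (tos Mt) W" "y : W" "!!x x'. x : W ==> x' : W ==> EX L<e. joins x x' L"
proof -
 obtain T N where T: "p y : T" "opi (tos M) T" and V: "\<Union>N = Mt Int p -` T"
  "!!u. u : N ==> opi (tos Mt) u" "pairwise disjnt N" "!!u. u : N ==> EX q. homeomorphism u T p q"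
  using cov_sheet[OF cov p_img[OF y]] by metis
 obtain W where W: "opi (tos M) W" "p y : W" "W <= T"
  "!!T' u q x x'. homeomorphism u T' p q ==> u <= Mt ==> T <= T' ==> x : u ==> x' : u ==> p x : W ==> p x' : W ==> EX L<e. joins x x' L"
  using local_join[OF p_img[OF y] T(2,1) e] by metis
 have "y : \<Union>N" unfolding V(1) using y T(1) by blast
 then obtain u where u: "u : N" "y : u" by blast
 obtain q where q: "homeomorphism u T p q" using V(4)[OF u(1)] by blast
 have uM: "u <= Mt" using V(2)[OF u(1)] openin_imp_subset by blast
 have "opi (tos Mt) (Mt Int p -` W)" by (rule open_preim[OF p_cont _ W(1)]) (use p_img in auto)
 hence "opi (tos Mt) (u Int (Mt Int p -` W))" using V(2)[OF u(1)] by (rule openin_Int[rotated])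
 thus thesis by (rule that) (use u W(2) y W(4)[OF q uM order_refl] in auto)
qed

text \<open>Connectedness of Mt makes the set in \<open>riem_dist\<close> nonempty; otherwise its
  infimum would carry no information.\<close>

lemma joins_ex: assumes "x : Mt" "y : Mt" obtains L where "joins x y L"
proof -
 have "EX L. joins x y L"
 proof (rule connected_induction_simple[OF conn, of x y "%y. EX L. joins x y L"])
  obtain W where "x : W" "!!y y'. y : W ==> y' : W ==> EX L<1. joins y y' L"
   using local_nhd[OF assms(1), of 1] by (metis zero_less_one)
  thus "EX L. joins x x L" by blast
 next
  fix a assume "a : Mt"
  then obtain W where W: "opi (tos Mt) W" "a : W" "!!y y'. y : W ==> y' : W ==> EX L<1. joins y y' L"
   using local_nhd[of a 1] by (metis zero_less_one)
  thus "EX T. opi (tos Mt) T & a : T & (ALL y:T. ALL z:T. (EX L. joins x y L) --> (EX L. joins x z L))"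
   using joins_trans by (intro exI[of _ W]) blast
 qed (use assms in auto)
 thus thesis using that by blast
qed

abbreviation D :: "'b => 'b => real" where "D == riem_dist n A g Mt p"

lemma D_le: "joins x y L ==> D x y <= L"
 unfolding riem_dist_joins by (rule cInf_lower) (auto intro!: bdd_belowI[of _ 0] joins_nonneg)

lemma D_lessE:
 assumes "x : Mt" "y : Mt" "D x y < R" obtains L where "joins x y L" "L < R"
proof -
 have "{L. joins x y L} ~= {}" using joins_ex[OF assms(1,2)] by blast
 thus thesis using cInf_lessD[of "{L. joins x y L}" R] assms(3) that unfolding riem_dist_joins by blast
qed

lemma D_nonneg: assumes "x : Mt" "y : Mt" shows "D x y >= 0"
proof (rule ccontr)
 assume "~ D x y >= 0"
 then obtain L where "joins x y L" "L < 0" using D_lessE[OF assms, of 0] by auto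
 thus False using joins_nonneg by fastforce
qed

lemma D_triangle:
 assumes "x : Mt" "y : Mt" "z : Mt" shows "D x z <= D x y + D y z"
proof (rule field_le_epsilon)
 fix e :: real assume e: "e > 0"
 obtain L1 where L1: "joins x y L1" "L1 < D x y + e / 2" using D_lessE[OF assms(1,2), of "D x y + e / 2"] e by auto
 obtain L2 where L2: "joins y z L2" "L2 < D y z + e / 2" using D_lessE[OF assms(2,3), of "D y z + e / 2"] e by auto
 have "D x z <= L1 + L2" by (rule D_le[OF joins_trans[OF L1(1) L2(1)]])
 thus "D x z <= D x y + D y z + e" using L1 L2 by simp
qed

lemma bounded_compact:
 assumes x: "x : Mt"
 obtains K where "compact K" "K <= Mt" "{y : Mt. D x y < R} <= K"
proof -
 obtain K where K: "compact K" "K <= Mt" "ALL y L. joins x y L & L < R --> y : K"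
  using bounded_compact_joins[OF x, of R] by blast
 have "{y : Mt. D x y < R} <= K"
 proof
  fix y assume y: "y : {y : Mt. D x y < R}"
  then obtain L where "joins x y L" "L < R" using D_lessE[of x y R] x by auto
  thus "y : K" using K(3) by blast
 qed
 thus thesis using that K by blast
qed

text \<open>The bound is uniform over all lifts k, of which there may be infinitely many. Locally
  every lift is h followed by the inverse of p on a sheet, and \<open>local_join\<close> estimates
  distances in a sheet independently of the sheet; connectedness and compactness of the simplex make
  this global.\<close>

lemma lift_diameter:
 fixes h :: "('v => real) => 'a"
 assumes s: "finite s" "s ~= {}" and h: "con (spts s) h" "h : spts s \<rightarrow> M"
 shows "EX R. ALL k. con (spts s) k & k : spts s \<rightarrow> Mt & (ALL w:spts s. p (k w) = h w) -->
  (ALL w:spts s. ALL w':spts s. D (k w) (k w') <= R)"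
proof -
 define S where "S = spts s"
 define lift where "lift k \<longleftrightarrow> con S k & k : S \<rightarrow> Mt & (ALL w:S. p (k w) = h w)" for k
 have loc: "EX N. opi (tos S) N & w1 : N & (ALL w:N. ALL k. lift k --> D (k w1) (k w) <= 1 & D (k w) (k w1) <= 1)"
  if w1: "w1 : S" for w1
 proof -
  have z: "h w1 : M" using h(2) w1 by (auto simp: S_def)
  obtain T E where T: "h w1 : T" "opi (tos M) T" and V: "\<Union>E = Mt Int p -` T"
   "!!u. u : E ==> opi (tos Mt) u" "pairwise disjnt E" "!!u. u : E ==> EX q. homeomorphism u T p q"
   using cov_sheet[OF cov z] by metis
  obtain W where W: "opi (tos M) W" "h w1 : W" "W <= T"
   "!!T' u q x x'. homeomorphism u T' p q ==> u <= Mt ==> T <= T' ==> x : u ==> x' : u ==> p x : W ==> p x' : W ==> EX L<1. joins x x' L"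
   using local_join[OF z T(2,1) zero_less_one] by metis
  have "opi (tos S) (S Int h -` W)"
   using h by (intro open_preim[OF _ _ W(1)]) (auto simp: S_def)
  then obtain V0 where V0: "open V0" "S Int h -` W = S Int V0" by (auto simp: openin_open)
  have w1V: "w1 : V0" using V0(2) w1 W(2) by blast
  obtain I r where I: "finite I" "r > 0" "{z. ALL i:I. \<bar>z i - w1 i\<bar> < r} <= V0"
   by (rule open_fun_box[OF V0(1) w1V]) blast
  \<comment> \<open>Starlike about w1 and hence connected, so that each lift maps N into a single
    sheet.\<close>
  define N where "N = S Int {z. ALL i:I. \<bar>z i - w1 i\<bar> < r}"
  have star: "(%i. w1 i + t * (w i - w1 i)) : N" if "w : N" "t : {0..1}" for w t
  proof -
   have "(%i. w1 i + t * (w i - w1 i)) : S"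
    using simplex_points_star[of w1 s w t] w1 that by (simp add: S_def N_def)
   moreover have "\<bar>w1 i + t * (w i - w1 i) - w1 i\<bar> < r" if i: "i : I" for i
   proof -
    have "\<bar>t * (w i - w1 i)\<bar> <= 1 * \<bar>w i - w1 i\<bar>"
     unfolding abs_mult using \<open>t \<in> {0..1}\<close> by (intro mult_right_mono) auto
    also have "... < r" using \<open>w \<in> N\<close> i by (simp add: N_def)
    finally show ?thesis by simp
   qed
   ultimately show ?thesis by (simp add: N_def)
  qed
  have w1N: "w1 : N" using w1 I(2) by (simp add: N_def)
  have conN: "connected N" by (rule starlike_connected[OF w1N star])
  have NW: "h w : W" if "w : N" for w using that I(3) V0(2) by (auto simp: N_def)
  show ?thesis
  proof (intro exI[of _ N] conjI ballI allI impI)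
   show "opi (tos S) N" unfolding N_def
    using open_coordinate_box[OF I(1)] by (rule openin_open_Int)
   show "w1 : N" by fact
   fix w k assume w: "w : N" and "lift k"
   hence k: "con S k" "k : S \<rightarrow> Mt" "!!w. w : S ==> p (k w) = h w" by (auto simp: lift_def)
   have "k w1 : \<Union>E" unfolding V(1) using k w1 T(1) by auto
   then obtain u where u: "u : E" "k w1 : u" by blast
   obtain q where q: "homeomorphism u T p q" using V(4)[OF u(1)] by blast
   have uM: "u <= Mt" using V(2)[OF u(1)] openin_imp_subset by blast
   have qu: "q y : u & p (q y) = y" if "y : T" for y using q that by (auto simp: homeomorphism_def)
   have NS: "N <= S" by (auto simp: N_def)
   have hT: "h y : T" if "y : N" for y using NW[OF that] W(3) by blast
   have "k w = q (h w)"
   proof (rule covering_lift_unique[where T=N and a=w1 and ?g1.0=k and ?g2.0="%w. q (h w)" and p=p and S=M and C=Mt])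
    show "con N k" using k(1) NS by (rule continuous_on_subset)
    have hc: "con N h" using h(1) NS unfolding S_def by (rule continuous_on_subset)
    have qc: "con T q" using q by (simp add: homeomorphism_def)
    show "con N (%w. q (h w))" by (rule continuous_on_compose2[OF qc hc]) (use hT in blast)
    show "k w1 = q (h w1)" using q u(2) k(3)[OF w1] by (metis homeomorphism_apply1)
    show "p (k y) = p (q (h y))" if "y : N" for y using k(3) qu[OF hT[OF that]] that NS by auto
    show "(%w. q (h w)) : N \<rightarrow> Mt" using qu hT uM by blast
   qed (use cov k NS conN w1N w in auto)
   hence "k w : u" using qu hT w by simp
   moreover have "p (k w) : W" "p (k w1) : W" using k(3) NW w w1 NS W(2) by auto
   ultimately obtain L1 L2 where "joins (k w1) (k w) L1" "L1 < 1" "joins (k w) (k w1) L2" "L2 < 1"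
    using W(4)[OF q uM order_refl] u(2) by meson
   thus "D (k w1) (k w) <= 1" "D (k w) (k w1) <= 1" using D_le by fastforce+
  qed
 qed
 then obtain N where N: "!!w. w : S ==> opi (tos S) (N w)" "!!w. w : S ==> w : N w"
  "!!w w' k. w : S ==> w' : N w ==> lift k ==> D (k w) (k w') <= 1 & D (k w') (k w) <= 1" by metis
 obtain v where "v : s" using s by blast
 hence w0: "vx v : S" using vx_spts[OF s(1)] by (simp add: S_def)
 have tri: "D (k a) (k c) <= D (k a) (k b) + D (k b) (k c)" if "lift k" "a : S" "b : S" "c : S" for k a b c
  using that by (intro D_triangle) (auto simp: lift_def)
 have conS: "connected S" unfolding S_def by (rule connected_simplex_points)
 have NS: "N w <= S" if "w : S" for w using N(1)[OF that] openin_imp_subset by blast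
 \<comment> \<open>Both orders of the arguments of D are carried along, as the triangle inequality
   is applied in both directions.\<close>
 let ?Q = "%w R. ALL k. lift k --> D (k (vx v)) (k w) <= R & D (k w) (k (vx v)) <= R"
 have bound: "EX R. ?Q w R" if w: "w : S" for w
 proof (rule connected_induction_simple[OF conS w0 w, of "%w. EX R. ?Q w R"])
  show "EX R. ?Q (vx v) R"
   using N(3)[OF w0 N(2)[OF w0]] by blast
  fix a assume a: "a : S"
  show "EX T. opi (tos S) T & a : T & (ALL x:T. ALL y:T.
   (EX R. ?Q x R) -->
   (EX R. ?Q y R))"
  proof (intro exI[of _ "N a"] conjI ballI impI)
   fix x y assume x: "x : N a" and y: "y : N a" and "EX R. ?Q x R"
   then obtain R where R: "!!k. lift k ==> D (k (vx v)) (k x) <= R & D (k x) (k (vx v)) <= R" by blast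
   have xy: "x : S" "y : S" using x y NS[OF a] by auto
   show "EX R. ?Q y R"
   proof (intro exI[of _ "R + 2"] allI impI)
    fix k assume l: "lift k"
    show "D (k (vx v)) (k y) <= R + 2 & D (k y) (k (vx v)) <= R + 2"
     using R[OF l] N(3)[OF a x l] N(3)[OF a y l] tri[OF l w0 xy] tri[OF l xy(2,1) w0] tri[OF l xy(1) a xy(2)] tri[OF l xy(2) a xy(1)]
     by linarith
   qed
  qed (use N a in auto)
 qed
 then obtain R where R: "!!w k. w : S ==> lift k ==> D (k (vx v)) (k w) <= R w & D (k w) (k (vx v)) <= R w" by metis
 have cS: "compact S"
  using compact_spts[OF s] unfolding S_def by (simp add: power_eucl compactin_subtopology)
 obtain G where "G <= N ` S" "finite G" "S <= \<Union>G"
  by (rule compact_open_cover[OF cS order_refl, of "N ` S"]) (use N in auto)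
 then obtain F where F: "F <= S" "finite F" "S <= \<Union>(N ` F)" by (metis finite_subset_image)
 define B where "B = Max (insert 0 (R ` F)) + 1"
 have RB: "R w + 1 <= B" if "w : F" for w using F(2) that by (simp add: B_def)
 have all: "D (k (vx v)) (k w) <= B & D (k w) (k (vx v)) <= B" if w: "w : S" and l: "lift k" for w k
 proof -
  obtain a where a: "a : F" "w : N a" using F(3) w by blast
  have aS: "a : S" using a F by blast
  show ?thesis
   using R[OF aS l] N(3)[OF aS a(2) l] RB[OF a(1)] tri[OF l w0 aS w] tri[OF l w aS w0] by linarith
 qed
 show ?thesis
 proof (intro exI[of _ "2 * B"] allI impI ballI)
  fix k w w' assume l: "con (spts s) k & k : spts s \<rightarrow> Mt & (ALL w:spts s. p (k w) = h w)"
   and w: "w : spts s" "w' : spts s"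
  have l': "lift k" using l by (simp add: lift_def S_def)
  show "D (k w) (k w') <= 2 * B"
   using all[OF _ l', of w] all[OF _ l', of w'] tri[OF l' _ w0, of w w'] w by (simp add: S_def)
 qed
qed
end

section \<open>Local homology of a simplex\<close>

lemma homologous_rel_set_mult:
 assumes "rcy n X S a" "rcy n X S b"
 shows "hcl n X S a \<otimes>\<^bsub>relative_homology_group (int n) X S\<^esub> hcl n X S b
  = hcl n X S (a + b)"
proof -
 have "EX r s. homologous_rel n X S a r & homologous_rel n X S b s & x = r + s" if "homologous_rel n X S (a + b) x" for x
  using that by (rule_tac exI[of _ a], rule_tac exI[of _ "x - a"]) (simp add: homologous_rel_def algebra_simps)
 thus ?thesis
  by (auto simp: mult_relative_homology_group homologous_rel_add)
qed

lemma homologous_rel_set_inv: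
 assumes "rcy n X S a"
 shows "inv\<^bsub>relative_homology_group (int n) X S\<^esub> (hcl n X S a) = hcl n X S (- a)"
proof -
 have "hcl n X S a : carrier (relative_homology_group (int n) X S)"
  using assms by (simp add: carrier_relative_homology_group)
 moreover have "x : uminus ` hcl n X S a" if "homologous_rel n X S (- a) x" for x
  using that singular_relboundary_minus[of n X S "- a - x"]
  by (intro image_eqI[of _ _ "- x"]) (auto simp: homologous_rel_def add.commute)
 moreover have "homologous_rel n X S (- a) (- x)" if "homologous_rel n X S a x" for x
  using that singular_relboundary_minus[of n X S "a - x"] by (simp add: homologous_rel_def algebra_simps)
 ultimately show ?thesis by (auto simp: inv_relative_homology_group)
qed

lemma hcl_pow:
 assumes c: "rcy n X S c"
 shows "hcl n X S c [^]\<^bsub>relative_homology_group (int n) X S\<^esub> (k::int) = hcl n X S (fcm k c)"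
proof -
 let ?H = "relative_homology_group (int n) X S"
 have nat: "hcl n X S c [^]\<^bsub>?H\<^esub> (j::nat) = hcl n X S (fcm (int j) c)" for j
 proof (induction j)
  case 0
  show ?case using singular_relboundary_minus[of n X S] by (auto simp: homologous_rel_def)
 next
  case (Suc j)
  have "fcm (int j) c + c = fcm (int (Suc j)) c" by (simp add: frag_cmul_distrib)
  thus ?case
   using homologous_rel_set_mult[OF singular_relcycle_cmul[OF c, of "int j"] c] by (simp add: Suc)
 qed
 show ?thesis
 proof (cases "k >= 0")
  case True
  then obtain j where "k = int j" using nonneg_eq_int by blast
  thus ?thesis using nat by (simp add: int_pow_int)
 next
  case False
  then obtain j where k: "k = - int j" by (metis int_cases2 of_nat_0_le_iff)
  have "hcl n X S c [^]\<^bsub>?H\<^esub> k = inv\<^bsub>?H\<^esub> (hcl n X S c [^]\<^bsub>?H\<^esub> j)"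
   unfolding k by (rule group.int_pow_neg_int) (use c in \<open>auto simp: carrier_relative_homology_group\<close>)
  also have "... = hcl n X S (fcm k c)"
   unfolding nat using homologous_rel_set_inv[OF singular_relcycle_cmul[OF c, of "int j"]] by (simp add: k)
  finally show ?thesis .
 qed
qed

text \<open>The homology group is infinite cyclic with the class of c as a generator, said in terms
  of chains.\<close>

definition generating :: "nat => 'a topology => 'a set => 'a chain => bool" where
 "generating n X S c \<longleftrightarrow> rcy n X S c &
  (ALL d. rcy n X S d --> (EX k. homologous_rel n X S d (fcm k c))) &
  (ALL k. rbd n X S (fcm k c) --> k = 0)"

lemma generating_iso:
 assumes f: "f : iso (relative_homology_group (int n) X S) (relative_homology_group (int m) Y T)"
  and c: "rcy n X S c" "rcy m Y T c'"
  and fc: "f (hcl n X S c) = hcl m Y T c'"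
 shows "generating n X S c \<longleftrightarrow> generating m Y T c'"
proof -
 let ?G = "relative_homology_group (int n) X S" and ?H = "relative_homology_group (int m) Y T"
 let ?c = "hcl n X S c" and ?c' = "hcl m Y T c'"
 have cG: "?c : carrier ?G" using c by (simp add: carrier_relative_homology_group)
 have hom: "f : hom ?G ?H" and bij: "bij_betw f (carrier ?G) (carrier ?H)" using f by (auto simp: iso_def)
 have gen: "generating j Z U z \<longleftrightarrow> (ALL x:carrier (relative_homology_group (int j) Z U). EX k::int.
   x = hcl j Z U z [^]\<^bsub>relative_homology_group (int j) Z U\<^esub> k) &
   (ALL k::int. hcl j Z U z [^]\<^bsub>relative_homology_group (int j) Z U\<^esub> k
     = \<one>\<^bsub>relative_homology_group (int j) Z U\<^esub> --> k = 0)"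
  if z: "rcy j Z U z" for j and Z :: "'x topology" and U z
  unfolding generating_def hcl_pow[OF z]
  by (simp add: z carrier_relative_homology_group homologous_rel_set_eq homologous_rel_set_eq_relboundary)
 have pow: "f (?c [^]\<^bsub>?G\<^esub> k) = ?c' [^]\<^bsub>?H\<^esub> k" for k :: int
  using group_hom.hom_int_pow[of ?G ?H f ?c k] hom cG fc by (simp add: group_hom_def group_hom_axioms_def)
 have cpow: "?c [^]\<^bsub>?G\<^esub> k : carrier ?G" for k :: int using cG by (simp add: group.int_pow_closed)
 have one: "f \<one>\<^bsub>?G\<^esub> = \<one>\<^bsub>?H\<^esub>" by (rule hom_one[OF hom]) simp_all
 have inj: "f x = f y \<longleftrightarrow> x = y" if "x : carrier ?G" "y : carrier ?G" for x y
  using bij that by (auto simp: bij_betw_def inj_on_eq_iff)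
 have oneG: "\<one>\<^bsub>?G\<^esub> : carrier ?G" by (rule monoid.one_closed) (simp add: group.is_monoid)
 have "(ALL x:carrier ?G. EX k::int. x = ?c [^]\<^bsub>?G\<^esub> k) \<longleftrightarrow> (ALL x:carrier ?G. EX k::int. f x = ?c' [^]\<^bsub>?H\<^esub> k)"
  using inj[OF _ cpow] by (simp add: pow[symmetric])
 also have "... \<longleftrightarrow> (ALL y:carrier ?H. EX k::int. y = ?c' [^]\<^bsub>?H\<^esub> k)"
  unfolding bij_betw_imp_surj_on[OF bij, symmetric] by simp
 finally have 1: "(ALL x:carrier ?G. EX k::int. x = ?c [^]\<^bsub>?G\<^esub> k) \<longleftrightarrow> (ALL y:carrier ?H. EX k::int. y = ?c' [^]\<^bsub>?H\<^esub> k)" .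
 have "?c [^]\<^bsub>?G\<^esub> k = \<one>\<^bsub>?G\<^esub> \<longleftrightarrow> ?c' [^]\<^bsub>?H\<^esub> k = \<one>\<^bsub>?H\<^esub>" for k :: int
  using inj[OF cpow oneG, of k] unfolding pow one by blast
 thus ?thesis unfolding gen[OF c(1)] gen[OF c(2)] 1 by simp
qed

text \<open>The excised set is the complement of D; the interior condition on C puts its closure
  into the open set \<open>tps X - C\<close>.\<close>

lemma excision_iso:
 assumes "closedin X C" "C <= X interior_of D" "D <= tps X"
 shows "hom_induced p (sbt X D) (D - C) X (tps X - C) id
  : iso (relative_homology_group p (sbt X D) (D - C)) (relative_homology_group p X (tps X - C))"
proof -
 have "X closure_of (tps X - D) <= X interior_of (tps X - C)"
 proof -
  have "X interior_of (tps X - C) = tps X - C"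
   using assms(1) by (intro interior_of_openin) (simp add: openin_diff)
  moreover have "X closure_of (tps X - D) = tps X - X interior_of D"
   by (simp add: closure_of_complement)
  ultimately show ?thesis using assms(2) by blast
 qed
 from homology_excision_axiom[OF this, of "tps X" p]
 have "hom_induced p (sbt X (tps X - (tps X - D))) (tps X - C - (tps X - D)) (sbt X (tps X)) (tps X - C) id
  : iso (relative_homology_group p (sbt X (tps X - (tps X - D))) (tps X - C - (tps X - D)))
   (relative_homology_group p (sbt X (tps X)) (tps X - C))" by blast
 moreover have "tps X - (tps X - D) = D" "tps X - C - (tps X - D) = D - C" using assms(3) by auto
 ultimately show ?thesis by simp
qed

lemma chain_map_id_rcy: "rcy n X S c ==> chain_map n id c = c"
 by (meson chain_map_ident singular_relcycle)

lemma hom_id_hcl: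
 assumes "rcy n (sbt X D) S c" "S <= T"
 shows "hom_induced (int n) (sbt X D) S X T id (hcl n (sbt X D) S c) = hcl n X T c"
 using hom_induced_chain_map[of "sbt X D" X id S T n c] assms chain_map_id_rcy[OF assms(1)]
 by (simp add: continuous_map_from_subtopology image_subset_iff_funcset[symmetric])

lemma rcy_sbt:
 assumes "rcy n (sbt X D) S c" "S <= T" shows "rcy n X T c"
 using singular_relcycle_chain_map[OF assms(1), of X id T] assms chain_map_id_rcy[OF assms(1)]
 by (simp add: continuous_map_from_subtopology image_subset_iff_funcset[symmetric])

lemma rbd_sbt:
 assumes "rbd n (sbt X D) S c" "S <= T" shows "rbd n X T c"
 using singular_relboundary_chain_map[OF assms(1), of X id T] assms
  chain_map_id_rcy[OF singular_relboundary_imp_relcycle[OF assms(1)]]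
 by (simp add: continuous_map_from_subtopology image_subset_iff_funcset[symmetric])

text \<open>Injectivity of the isomorphism in \<open>excision_iso\<close>, for chains.\<close>

lemma excision_rbd:
 assumes "closedin X C" "C <= X interior_of D" "D <= tps X"
  and c: "rcy n (sbt X D) (D - C) c"
  and z: "rbd n X (tps X - C) c"
 shows "rbd n (sbt X D) (D - C) c"
proof -
 let ?G = "relative_homology_group (int n) (sbt X D) (D - C)"
 have s: "D - C <= tps X - C" using assms(3) by blast
 have i: "hom_induced (int n) (sbt X D) (D - C) X (tps X - C) id : iso ?G (relative_homology_group (int n) X (tps X - C))"
  by (rule excision_iso[OF assms(1-3)])
 have "hcl n (sbt X D) (D - C) c = hcl n (sbt X D) (D - C) 0"
 proof (rule inj_onD[of "hom_induced (int n) (sbt X D) (D - C) X (tps X - C) id" "carrier ?G"])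
  show "inj_on (hom_induced (int n) (sbt X D) (D - C) X (tps X - C) id) (carrier ?G)"
   using i by (simp add: iso_def bij_betw_def)
  show "hom_induced (int n) (sbt X D) (D - C) X (tps X - C) id (hcl n (sbt X D) (D - C) c)
   = hom_induced (int n) (sbt X D) (D - C) X (tps X - C) id (hcl n (sbt X D) (D - C) 0)"
   unfolding hom_id_hcl[OF c s] hom_id_hcl[OF singular_relcycle_0 s] homologous_rel_set_eq
   using z by (simp add: homologous_rel_def)
 qed (use c in \<open>auto simp: carrier_relative_homology_group\<close>)
 thus ?thesis unfolding homologous_rel_set_eq by (simp add: homologous_rel_def)
qed

text \<open>Surjectivity of the isomorphism in \<open>excision_iso\<close>, for chains: a relative
  cycle can be replaced by one inside D.\<close>

lemma excision_relcycle:
 assumes "closedin X C" "C <= X interior_of D" "D <= tps X"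
  and c: "rcy n X (tps X - C) c"
 obtains c' where "rcy n (sbt X D) (D - C) c'" "rbd n X (tps X - C) (c - c')"
proof -
 let ?G = "relative_homology_group (int n) (sbt X D) (D - C)"
 have s: "D - C <= tps X - C" using assms(3) by blast
 have "hcl n X (tps X - C) c : carrier (relative_homology_group (int n) X (tps X - C))"
  using c by (simp add: carrier_relative_homology_group)
 then obtain x where x: "x : carrier ?G"
  "hom_induced (int n) (sbt X D) (D - C) X (tps X - C) id x = hcl n X (tps X - C) c"
  using excision_iso[OF assms(1-3), of "int n"] unfolding iso_def bij_betw_def by (auto dest: equalityD2[THEN subsetD])
 obtain c' where c': "rcy n (sbt X D) (D - C) c'" "x = hcl n (sbt X D) (D - C) c'"
  using x(1) by (auto simp: carrier_relative_homology_group)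
 have "homologous_rel n X (tps X - C) c c'"
  using x(2) unfolding c'(2) hom_id_hcl[OF c'(1) s] by (simp add: homologous_rel_set_eq homologous_rel_sym)
 thus thesis using that[OF c'(1)] by (simp add: homologous_rel_def)
qed

text \<open>By the exact sequence of the triple \<open>(X, X - A, X - (A \<union> B))\<close> and excision of \<open>A\<close>.\<close>

lemma relboundary_Un:
 assumes "closedin X A" "closedin X B" "A Int B = {}"
  and c: "rcy n X (tps X - (A Un B)) c"
  and A: "rbd n X (tps X - A) c" and B: "rbd n X (tps X - B) c"
 shows "rbd n X (tps X - (A Un B)) c"
proof -
 let ?Y = "sbt X (tps X - A)" and ?S = "tps X - (A Un B)"
 have ST: "?S <= tps X - A" by blast
 obtain d e where de: "singular_chain (Suc n) X d" "singular_chain n ?Y e" "cbd (Suc n) d + e = c"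
  using A by (auto simp: singular_relboundary)
 have "cbd n c = cbd n e"
  using chain_boundary_boundary_alt[OF de(1)] by (simp add: de(3)[symmetric] chain_boundary_add)
 hence e: "rcy n ?Y ?S e"
  using c de(2) unfolding singular_relcycle by (simp add: subtopology_subtopology Int_absorb1[OF ST])
 have ec: "c - e = cbd (Suc n) d" using de(3) by auto
 have bd: "rbd n X T (cbd (Suc n) d)" for T
  unfolding singular_relboundary using de(1) by (rule_tac exI[of _ d], rule_tac exI[of _ 0]) auto
 have eB: "rbd n X (tps X - B) e"
  using singular_relboundary_diff[OF B bd] ec by (metis add_diff_cancel_left' diff_add_cancel diff_diff_eq2)
 have D: "B <= X interior_of (tps X - A)"
  using assms(1-3) closedin_subset[OF assms(2)] by (subst interior_of_openin) (auto simp: openin_diff)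
 have S: "?S = tps X - A - B" by blast
 have "rbd n ?Y ?S e"
  using excision_rbd[OF assms(2) D _ _ eB] e unfolding S by blast
 hence "rbd n X ?S e" by (rule rbd_sbt) simp
 thus ?thesis using singular_relboundary_add[OF bd] de(3) by metis
qed

lemma relboundary_mono:
 assumes "rbd n X S c" "S <= T" shows "rbd n X T c"
 using rbd_sbt[of n X UNIV S c T] assms by simp

lemma relcycle_mono:
 assumes "rcy n X S c" "S <= T" shows "rcy n X T c"
 using rcy_sbt[of n X UNIV S c T] assms by simp

text \<open>By \<open>relboundary_Un\<close>, the points being split off one at a time. It reduces
  the comparison of classes along a finite set to single points.\<close>

lemma relboundary_finite:
 assumes "finite F" "!!x. x : F ==> closedin X {x}"
  and "rcy n X (tps X - F) c" "!!x. x : F ==> rbd n X (tps X - {x}) c"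
 shows "rbd n X (tps X - F) c"
 using assms
proof (induction F rule: finite_induct)
 case empty
 thus ?case by (intro singular_chain_imp_relboundary) (simp add: singular_relcycle)
next
 case (insert x F)
 have cl: "closedin X F" using insert.prems(1) closedin_Union[of "(%x. {x}) ` F" X] insert.hyps(1) by auto
 have "rbd n X (tps X - F) c"
  using insert.prems by (intro insert.IH relcycle_mono[OF insert.prems(2)]) auto
 hence "rbd n X (tps X - ({x} Un F)) c"
  using insert.prems insert.hyps(2) cl by (intro relboundary_Un) auto
 thus ?case by simp
qed

lemma homotopic_relboundary:
 assumes "homotopic_with (%h. h : S \<rightarrow> T) X Y f g" "rcy n X S c"
 shows "rbd n Y T (chain_map n f c - chain_map n g c)"
 using homotopic_imp_homologous_rel_chain_maps[OF assms] by (simp add: homologous_rel_def)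

lemma line_homotopic:
 fixes f g :: "'x => 'i => real"
 assumes f: "cmp X (tos D) f" and g: "cmp X (tos D) g"
  and D: "!!x u. x : tps X ==> u : {0..1} ==> (%i. (1 - u) * f x i + u * g x i) : D"
  and T: "!!x u. x : S ==> u : {0..1} ==> (%i. (1 - u) * f x i + u * g x i) : T"
 shows "homotopic_with (%h. h : S \<rightarrow> T) X (tos D) f g"
proof -
 let ?P = "prod_topology (tos {0..1::real}) X"
 let ?h = "%(u, x) i. (1 - u) * f x i + u * g x i"
 have u: "cmp ?P eur fst"
  using continuous_map_fst[of "tos {0..1::real}" X] by (simp add: continuous_map_in_subtopology)
 have comp: "cmp ?P eur (%z. k (snd z) i)" if k: "cmp X (tos D) k" for k i
 proof -
  have "cmp X eur (%x. k x i)"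
   using k unfolding continuous_map_in_subtopology power_eucl[symmetric] continuous_map_componentwise_UNIV by blast
  from continuous_map_compose[OF continuous_map_snd this, of "tos {0..1::real}"] show ?thesis by (simp add: o_def)
 qed
 have "cmp ?P eur (%z. ?h z i)" for i
  unfolding case_prod_beta
  by (intro continuous_map_add continuous_map_real_mult continuous_map_diff u comp[OF f] comp[OF g]) simp
 hence "cmp ?P (powertop_real UNIV) ?h"
  unfolding continuous_map_componentwise_UNIV by blast
 moreover have "?h : tps ?P \<rightarrow> D" using D by auto
 ultimately have "cmp ?P (tos D) ?h"
  unfolding power_eucl by (simp add: continuous_map_in_subtopology)
 thus ?thesis unfolding homotopic_with_def using T by (intro exI[of _ ?h]) auto
qed

lemma starlike_contractible_space:
 fixes D :: "('i => real) set"
 assumes a: "a : D" and star: "!!x u. x : D ==> u : {0..1} ==> (%i. (1 - u) * x i + u * a i) : D"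
 shows "contractible_space (tos D)"
 unfolding contractible_space_def
proof (rule exI[of _ a])
 have "homotopic_with (%h. h : {} \<rightarrow> {}) (tos D) (tos D) id (%x. a)"
  by (rule line_homotopic) (use a star in \<open>auto simp: id_def[symmetric]\<close>)
 thus "homotopic_with (%x. True) (tos D) (tos D) id (%x. a)"
  by (rule homotopic_with_mono) simp
qed

lemma cmp_coords:
 "cmp X (tos D) (f :: 'x => 'i => real) \<longleftrightarrow>
  (ALL i. cmp X eur (%x. f x i)) & f : tps X \<rightarrow> D"
 unfolding continuous_map_in_subtopology power_eucl[symmetric] continuous_map_componentwise_UNIV by simp

lemma continuous_map_coord: "cmp (tos (D :: ('i => real) set)) eur (%x. x i)"
 by (simp add: continuous_on_subset[OF continuous_on_product_coordinates])

section \<open>Local homology of the standard simplex at an interior point\<close>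

lemma generating_0:
 assumes "tps X = {a}"
 shows "generating 0 X {} (fof (restrict (%x. a) (stds 0)))"
proof -
 let ?s = "restrict (%x. a) (stds 0)"
 have "rcy 0 X {} (fof ?s)"
  unfolding singular_cycle_singleton[OF assms] by (simp add: singular_chain_of singular_simplex_singleton[OF assms])
 moreover have "EX k. homologous_rel 0 X {} d (fcm k (fof ?s))" if "rcy 0 X {} d" for d
  using that unfolding singular_cycle_singleton[OF assms] singular_chain_singleton[OF assms] by (metis homologous_rel_refl)
 moreover have "k = 0" if "rbd 0 X {} (fcm k (fof ?s))" for k
  using that unfolding singular_boundary_singleton[OF assms] by auto
 ultimately show ?thesis unfolding generating_def by blast
qed

text \<open>
 With \<open>b\<close> the projection of \<open>y\<close> from the vertex \<open>0\<close> to the opposite face, the groups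
 \<open>H\<^sub>n\<^sub>+\<^sub>1(\<Delta>, \<Delta> - y)\<close>, reduced \<open>H\<^sub>n(\<Delta> - y)\<close>, \<open>H\<^sub>n(\<Delta> - y, \<Delta> - [y, b])\<close> and \<open>H\<^sub>n(\<Delta>', \<Delta>' - b)\<close>,
 \<open>\<Delta>'\<close> the face, are isomorphic.
\<close>

lemma standard_simplexI:
 assumes "!!i. 0 <= t i" "!!i. i > n ==> t i = 0" "(SUM i<=n. t i) = 1"
 shows "t : stds n"
proof -
 have "t i <= 1" for i
 proof (cases "i <= n")
  case True
  hence "t i <= (SUM i<=n. t i)" using assms(1) by (intro member_le_sum) auto
  thus ?thesis using assms(3) by simp
 qed (use assms(2) in auto)
 thus ?thesis using assms by (simp add: standard_simplex_def)
qed

lemma generating_standard_simplex: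
 assumes "y : stds n" "!!i. i <= n ==> 0 < y i"
 shows "generating n (tos (stds n)) (stds n - {y}) (fof (restrict id (stds n)))"
 using assms
proof (induction n arbitrary: y)
 case 0
 have e: "stds 0 = {vx 0}" by (simp add: standard_simplex_0 vertex_def)
 have y: "y = vx 0" using 0(1) e by blast
 have "restrict (%x. vx 0) (stds 0) = restrict id (stds 0)"
  by (rule restrict_ext) (simp add: e)
 moreover have "stds 0 - {y} = {}" by (simp add: e y)
 ultimately show ?case using generating_0[of "tos (stds 0)" "vx 0"] e by (metis topspace_euclidean_subtopology)
next
 case (Suc n)
 define Z where "Z = stds (Suc n)"
 define b where "b i = (if i = 0 then 0 else y i / (1 - y 0))" for i
 \<comment> \<open>\<open>ray s\<close> moves from b at \<open>s = 0\<close> through y at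
   \<open>s = y 0\<close> to the vertex 0 at \<open>s = 1\<close>; \<open>seg\<close> is the part
   between b and y.\<close>
 define ray where "ray s i = (if i = 0 then s else (1 - s) * b i)" for s :: real and i
 define seg where "seg = ray ` {0..y 0}"
 define S where "S = Z - {y}"
 \<comment> \<open>The part of the simplex below the level of y, measured from the face opposite to
   the vertex 0. It is an open neighbourhood of \<open>seg - {y}\<close> in S, and g projects it
   from the vertex 0 to that face, with indices shifted by one.\<close>
 define V where "V = {t : Z. t 0 < y 0}"
 define g where "g t i = t (Suc i) / (1 - t 0)" for t :: "nat => real" and i
 have B: "0 <= t i" "t i <= 1" "i > Suc n ==> t i = 0" "(SUM i<=Suc n. t i) = 1" if "t : Z" for t i
  using that by (auto simp: Z_def standard_simplex_def)
 have yD: "y : Z" using Suc.prems by (simp add: Z_def)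
 have shift: "(SUM i<=n. t (Suc i)) = 1 - t 0" if "t : Z" for t
  using B(4)[OF that] by (simp add: sum.atMost_Suc_shift del: sum.atMost_Suc)
 have y0: "0 < y 0" "y 0 < 1"
 proof -
  show "0 < y 0" using Suc.prems by simp
  have "0 < (SUM i<=n. y (Suc i))" using Suc.prems(2) by (intro sum_pos) auto
  thus "y 0 < 1" using shift[OF yD] by simp
 qed
 have b_pos: "0 < b i" if "i ~= 0" "i <= Suc n" for i using that Suc.prems(2) y0 by (simp add: b_def)
 have b_nonneg: "0 <= b i" for i using B(1)[OF yD, of i] y0 by (simp add: b_def)
 have b_zero: "b i = 0" if "i > Suc n" for i using B(3)[OF yD that] by (simp add: b_def)
 have b_sum: "(SUM i<=n. b (Suc i)) = 1"
  using shift[OF yD] y0 by (simp add: b_def sum_divide_distrib[symmetric])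
 have ray_in: "ray s : Z" if "s : {0..1}" for s
 unfolding Z_def
 proof (rule standard_simplexI)
  show "0 <= ray s i" for i using that b_nonneg by (simp add: ray_def)
  show "ray s i = 0" if "i > Suc n" for i using b_zero[OF that] that by (simp add: ray_def)
  show "(SUM i<=Suc n. ray s i) = 1"
   using b_sum by (simp add: sum.atMost_Suc_shift ray_def sum_distrib_left[symmetric] del: sum.atMost_Suc)
 qed
 have ray_y: "ray (y 0) = y"
  using y0 by (auto simp: ray_def b_def fun_eq_iff)
 have seg_iff: "t : seg \<longleftrightarrow> 0 <= t 0 & t 0 <= y 0 & (ALL i>0. t i = (1 - t 0) * b i)" for t
 proof
  assume "0 <= t 0 & t 0 <= y 0 & (ALL i>0. t i = (1 - t 0) * b i)"
  hence "t = ray (t 0)" "t 0 : {0..y 0}" by (auto simp: ray_def fun_eq_iff)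
  thus "t : seg" unfolding seg_def by blast
 qed (auto simp: seg_def ray_def)
 have seg_sub: "seg <= Z" using ray_in y0 by (auto simp: seg_def)
 have "con {0..y 0} ray"
 proof (rule continuous_on_coordinatewise_then_product)
  show "con {0..y 0} (%s. ray s i)" for i
   by (cases "i = 0") (auto simp: ray_def intro!: continuous_intros)
 qed
 hence "compact seg" unfolding seg_def by (rule compact_continuous_image) simp
 hence seg_closed: "closed seg" by (rule compact_imp_closed)
 have yseg: "y : seg" unfolding seg_def by (rule image_eqI[of _ _ "y 0"]) (use ray_y y0 in auto)
 have S_sub: "S <= Z" and S_minus: "S - (seg - {y}) = Z - seg"
  using yseg by (auto simp: S_def)
 have V_sub: "V <= S" by (auto simp: V_def S_def)
 have segV: "seg - {y} <= V"
 proof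
  fix t assume t: "t : seg - {y}"
  obtain s where s: "s : {0..y 0}" "t = ray s" using t unfolding seg_def by blast
  hence "t 0 ~= y 0" using ray_y t by (auto simp: ray_def[of s 0])
  thus "t : V" using t seg_iff[of t] seg_sub by (auto simp: V_def)
 qed
 have e0: "vx 0 : Z" by (simp add: Z_def vx_stds)
 have e0seg: "vx 0 ~: seg" using y0 by (simp add: seg_iff vertex_def)

 define c where "c = (fof (restrict (sfce 0) (stds n)) :: (nat => real) chain)"
 let ?b = "%i. b (Suc i)"
 have b': "?b : stds n" by (rule standard_simplexI) (use b_nonneg b_zero b_sum in auto)
 have face: "sfce 0 t : V" if "t : stds n" for t
  using simplical_face_in_standard_simplex[of "Suc n" 0 t] that y0 by (simp add: V_def Z_def simplical_face_def)
 have g_in: "g t : stds n" if "t : V" for t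
 proof -
  have t: "t : Z" "t 0 < 1" using that y0 by (auto simp: V_def)
  thus ?thesis using B[OF t(1)] shift[OF t(1)]
   by (intro standard_simplexI) (simp_all add: g_def sum_divide_distrib[symmetric])
 qed
 have gface: "g (sfce 0 t) = t" for t by (simp add: g_def simplical_face_def fun_eq_iff)
 have seg_g: "t : seg \<longleftrightarrow> g t = ?b" if "t : V" for t
 proof -
  have t: "0 <= t 0" "t 0 < y 0" "t 0 < 1" using that y0 B(1)[of t 0] by (auto simp: V_def)
  have "t : seg \<longleftrightarrow> (ALL i. t (Suc i) = (1 - t 0) * b (Suc i))"
   unfolding seg_iff using t by (auto simp: gr0_conv_Suc)
  also have "... \<longleftrightarrow> g t = ?b" using t(3) by (auto simp: g_def fun_eq_iff field_simps)
  finally show ?thesis .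
 qed
 have cont_face: "cmp (tos (stds n)) (tos V) (sfce 0)"
  unfolding cmp_coords
 proof
  show "ALL i. cmp (tos (stds n)) eur (%x. sfce 0 x i)"
  proof
   show "cmp (tos (stds n)) eur (%x. sfce 0 x i)" for i
    using continuous_map_coord[of "stds n" "i - 1"] by (cases "i = 0") (simp_all add: simplical_face_def)
  qed
 qed (use face in auto)
 have cont_g: "cmp (tos V) (tos (stds n)) g"
  unfolding cmp_coords
 proof
  show "ALL i. cmp (tos V) eur (%x. g x i)"
   unfolding g_def using continuous_map_coord[of V] y0
   by (intro allI continuous_map_real_divide continuous_map_diff) (auto simp: V_def)
 qed (use g_in in auto)
 have hom1: "homotopic_with (%h. h : stds n - {?b} \<rightarrow> stds n - {?b})
   (tos (stds n)) (tos (stds n)) (g o sfce 0) id"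
  by (rule homotopic_with_equal) (auto simp: gface continuous_map_compose[OF cont_face cont_g])
 have line: "(%i. (1 - u) * sfce 0 (g t) i + u * t i) : V & g (%i. (1 - u) * sfce 0 (g t) i + u * t i) = g t"
  if "t : V" "u : {0..1}" for t u
 proof -
  let ?l = "%i. (1 - u) * sfce 0 (g t) i + u * t i"
  have t: "t : Z" "0 <= t 0" "t 0 < y 0" "t 0 < 1" using that y0 B(1)[of t 0] by (auto simp: V_def)
  have "sfce 0 (g t) : Z" using face[OF g_in[OF that(1)]] by (simp add: V_def)
  hence "?l : Z" using convex_standard_simplex[of "sfce 0 (g t)" "Suc n" t u] t(1) that(2) by (simp add: Z_def)
  moreover have l0: "?l 0 = u * t 0" by (simp add: simplical_face_def)
  moreover have "u * t 0 <= 1 * t 0" using that(2) t(2) by (intro mult_right_mono) auto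
  moreover have "?l (Suc i) = (1 - u * t 0) * g t i" for i
  proof -
   have "t (Suc i) = (1 - t 0) * g t i" using t(4) by (simp add: g_def)
   thus ?thesis unfolding simplical_face_def \<open>t (Suc i) = _\<close> by (simp add: algebra_simps)
  qed
  ultimately show ?thesis using t by (auto simp: V_def g_def[of ?l] l0 fun_eq_iff)
 qed
 have hom2: "homotopic_with (%h. h : V - (seg - {y}) \<rightarrow> V - (seg - {y})) (tos V) (tos V) (sfce 0 o g) id"
 proof (rule line_homotopic)
  show "cmp (tos V) (tos V) (sfce 0 o g)" by (rule continuous_map_compose[OF cont_g cont_face])
  show "cmp (tos V) (tos V) id" by simp
  fix t u assume u: "u : {0..1::real}"
  { assume "t : tps (tos V)"
   thus "(%i. (1 - u) * (sfce 0 o g) t i + u * id t i) : V" using line u by simp }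
  { assume "t : V - (seg - {y})"
   hence t: "t : V" "t ~: seg" using V_sub by (auto simp: S_def)
   show "(%i. (1 - u) * (sfce 0 o g) t i + u * id t i) : V - (seg - {y})"
    using line[OF t(1) u] seg_g t by simp }
 qed
 have facemap: "sfce 0 : stds n - {?b} \<rightarrow> V - (seg - {y})"
 proof -
  have "sfce 0 t ~: seg" if "t : stds n - {?b}" for t
   using seg_g[OF face[of t]] that gface by auto
  thus ?thesis using face by auto
 qed
 have iso4: "hom_induced (int n) (tos (stds n)) (stds n - {?b}) (tos V) (V - (seg - {y})) (sfce 0)
  : iso (relative_homology_group (int n) (tos (stds n)) (stds n - {?b})) (relative_homology_group (int n) (tos V) (V - (seg - {y})))"
 proof (rule homotopy_equivalence_relative_homology_group_isomorphism[OF cont_face facemap cont_g _ hom1 hom2])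
  have "g t ~= ?b" if "t : V - (seg - {y})" for t
   using seg_g[of t] that V_sub by (auto simp: S_def)
  thus "g : V - (seg - {y}) \<rightarrow> stds n - {?b}" using g_in by auto
 qed
 let ?id = "fof (restrict id (stds n)) :: (nat => real) chain"
 have IH: "generating n (tos (stds n)) (stds n - {?b}) ?id"
  by (rule Suc.IH[OF b']) (simp add: b_pos)
 have cyc1: "rcy n (tos (stds n)) (stds n - {?b}) ?id"
  using IH by (simp add: generating_def)
 have cm: "chain_map n (sfce 0) ?id = c"
  by (simp add: c_def simplex_map_def) (rule arg_cong[of _ _ frag_of], rule restrict_ext, simp)
 have cyc2: "rcy n (tos V) (V - (seg - {y})) c"
  using singular_relcycle_chain_map[OF cyc1 cont_face facemap] cm by simp
 have gen2: "generating n (tos V) (V - (seg - {y})) c"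
  using generating_iso[OF iso4 cyc1 cyc2] hom_induced_chain_map[OF cont_face facemap cyc1] cm IH by simp
 have topV: "sbt (tos S) V = tos V" using V_sub by (simp add: subtopology_subtopology Int_absorb1)
 have iso3: "hom_induced (int n) (tos V) (V - (seg - {y})) (tos S) (Z - seg) id
  : iso (relative_homology_group (int n) (tos V) (V - (seg - {y}))) (relative_homology_group (int n) (tos S) (Z - seg))"
 proof -
  have "closedin (tos S) (seg - {y})"
   using seg_closed seg_sub by (auto simp: closedin_closed S_def intro!: exI[of _ seg])
  moreover have "opi (tos S) V"
  proof -
   have "V = S Int {t. t 0 < y 0}" by (auto simp: V_def S_def)
   moreover have "open {t :: nat => real. t 0 < y 0}"
    by (intro open_Collect_less continuous_on_product_coordinates continuous_on_const)
   ultimately show ?thesis by (auto simp: openin_open)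
  qed
  hence "seg - {y} <= (tos S) interior_of V" using segV by (simp add: interior_of_openin)
  ultimately show ?thesis using excision_iso[of "tos S" "seg - {y}" V "int n"] V_sub topV S_minus by simp
 qed
 have VS: "V - (seg - {y}) <= Z - seg" using S_minus V_sub by blast
 have cyc3: "rcy n (tos S) (Z - seg) c"
  using rcy_sbt[of n "tos S" V _ c, OF _ VS] cyc2 topV by simp
 have gen3: "generating n (tos S) (Z - seg) c"
  using generating_iso[OF iso3 cyc2 cyc3] hom_id_hcl[of n "tos S" V "V - (seg - {y})" c, OF _ VS] cyc2 topV gen2 by simp
 let ?I = "fof (restrict id Z) :: (nat => real) chain"
 have C: "(%i. (1 - u) * s i + u * t i) : Z" if "s : Z" "t : Z" "u : {0..1}" for s t u
  using convex_standard_simplex[of s "Suc n" t u] that by (simp add: Z_def)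
 have con1: "contractible_space (tos Z)"
  by (rule starlike_contractible_space[OF e0]) (use C e0 in blast)
 have topS: "sbt (tos Z) S = tos S" using S_sub by (simp add: subtopology_subtopology Int_absorb1)
 have topC: "sbt (tos S) (Z - seg) = tos (Z - seg)"
 proof -
  have "S Int (Z - seg) = Z - seg" using yseg by (auto simp: S_def)
  thus ?thesis by (simp add: subtopology_subtopology)
 qed
 have con2: "contractible_space (sbt (tos S) (Z - seg))"
  unfolding topC
 proof (rule starlike_contractible_space)
  show "vx 0 : Z - seg" using e0 e0seg by blast
  fix t u assume t: "t : Z - seg" and u: "u : {0..1::real}"
  let ?l = "%i. (1 - u) * t i + u * vx 0 i"
  \<comment> \<open>Towards the vertex 0 the coordinate 0 only grows, whereas \<open>seg\<close> is
    the lower part of its ray; a point that arrives in \<open>seg\<close> must have started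
    there.\<close>
  have "?l ~: seg"
  proof
   assume "?l : seg"
   hence l: "?l 0 <= y 0" "!!i. i > 0 ==> ?l i = (1 - ?l 0) * b i" unfolding seg_iff by auto
   have l0: "?l 0 = t 0 + u * (1 - t 0)" by (simp add: vertex_def algebra_simps)
   have t01: "0 <= t 0" "t 0 <= 1" using B(1,2)[of t 0] t by auto
   have "u < 1" using l(1) y0 l0 u by (cases "u = 1") auto
   moreover have "0 <= u * (1 - t 0)" using t01 u by simp
   hence "t 0 <= y 0" using l(1) unfolding l0 by linarith
   moreover have "t i = (1 - t 0) * b i" if "i > 0" for i
   proof -
    have "(1 - u) * t i = (1 - u) * ((1 - t 0) * b i)" using l(2)[OF that] that by (simp add: vertex_def algebra_simps)
    thus ?thesis using \<open>u < 1\<close> by simp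
   qed
   ultimately have "t : seg" using t01 by (simp add: seg_iff)
   thus False using t by blast
  qed
  thus "?l : Z - seg" using C[of t "vx 0" u] t e0 u by blast
 qed
 have ne: "tps (tos Z) Int S ~= {}" "tps (tos S) Int (Z - seg) ~= {}"
  using e0 e0seg yseg by (auto simp: S_def)
 let ?f = "hom_induced (int n) (tos S) {} (tos S) (Z - seg) id o hom_boundary (int (Suc n)) (tos Z) S"
 have iso12: "?f : iso (relative_homology_group (int (Suc n)) (tos Z) S) (relative_homology_group (int n) (tos S) (Z - seg))"
 proof (rule iso_set_trans)
  have "int (Suc n) - 1 = int n" by simp
  thus "hom_boundary (int (Suc n)) (tos Z) S
    : iso (relative_homology_group (int (Suc n)) (tos Z) S) (reduced_homology_group (int n) (tos S))"
   using iso_relative_homology_of_contractible[OF con1 ne(1), of "int (Suc n)"] unfolding topS by metis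
 qed (rule iso_reduced_homology_by_contractible[OF con2 ne(2)])
 have Isimp: "ssx (Suc n) (tos Z) (restrict id Z)"
  unfolding singular_simplex_def power_eucl Z_def[symmetric] by (simp add: continuous_map_eq[of _ _ id])
 have faceI: "sfc (Suc n) k (restrict id Z) = restrict (sfce k) (stds n)" if "k <= Suc n" for k
  unfolding singular_face_def using simplical_face_in_standard_simplex[of "Suc n" k] that by (auto simp: Z_def fun_eq_iff)
 have face_k: "sfce k t : Z" "sfce k t k = 0" if "k <= Suc n" "t : stds n" for k t
  using simplical_face_in_standard_simplex[of "Suc n" k t] that by (auto simp: Z_def simplical_face_def)
 have face_y: "sfce k t ~= y" if "k <= Suc n" "t : stds n" for k t
  using face_k(2)[OF that] Suc.prems(2)[OF that(1)] by force
 have fsimp: "ssx n (tos S) (sfc (Suc n) k (restrict id Z))" if "k <= Suc n" for k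
  using singular_simplex_singular_face[OF Isimp, of k] that face_y face_k
   singular_simplex_subtopology[of n "tos Z" S] unfolding topS by (auto simp: faceI S_def)
 have bdI: "cbd (Suc n) ?I = (SUM k<=Suc n. fcm ((-1) ^ k) (fof (sfc (Suc n) k (restrict id Z))))"
  by (simp add: chain_boundary_of)
 have Icyc: "rcy (Suc n) (tos Z) S ?I"
  unfolding singular_relcycle bdI topS
  using Isimp fsimp by (auto simp: singular_chain_of simp del: sum.atMost_Suc intro!: singular_chain_sum singular_chain_cmul)
 have bcyc: "rcy n (tos S) {} (cbd (Suc n) ?I)"
  unfolding singular_cycle using Icyc chain_boundary_boundary_alt[of n "tos Z" ?I] by (simp add: singular_relcycle topS)
 \<comment> \<open>Only the face opposite to the vertex 0 meets \<open>seg\<close>, since all other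
   coordinates are positive on \<open>seg\<close>. The remaining faces vanish relative to
   \<open>Z - seg\<close>, and the face 0 enters with sign 1.\<close>
 have eq: "homologous_rel n (tos S) (Z - seg) (cbd (Suc n) ?I) c"
 proof -
  have "cbd (Suc n) ?I - c = (SUM k<=n. fcm ((-1) ^ Suc k) (fof (sfc (Suc n) (Suc k) (restrict id Z))))"
   unfolding bdI sum.atMost_Suc_shift by (simp add: faceI c_def)
  moreover have "ssx n (tos (Z - seg)) (sfc (Suc n) (Suc k) (restrict id Z))" if "k <= n" for k
  proof -
   have "sfce (Suc k) t ~: seg" if t: "t : stds n" for t
   proof
    let ?s = "sfce (Suc k) t"
    assume "?s : seg"
    hence "?s (Suc k) = (1 - ?s 0) * b (Suc k)" "?s 0 <= y 0" unfolding seg_iff by auto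
    moreover have "?s (Suc k) = 0" using face_k(2)[of "Suc k" t] \<open>k \<le> n\<close> t by simp
    ultimately show False using b_pos[of "Suc k"] y0 \<open>k \<le> n\<close> by auto
   qed
   thus ?thesis using fsimp[of "Suc k"] \<open>k \<le> n\<close> face_k singular_simplex_subtopology[of n "tos S" "Z - seg"]
    unfolding topC by (auto simp: faceI)
  qed
  ultimately show ?thesis unfolding homologous_rel_def
   by (auto simp: topC singular_chain_of intro!: singular_chain_imp_relboundary singular_chain_sum singular_chain_cmul)
 qed
 have "?f (hcl (Suc n) (tos Z) S ?I) = hcl n (tos S) (Z - seg) c"
 proof -
  have "?f (hcl (Suc n) (tos Z) S ?I) = hom_induced (int n) (tos S) {} (tos S) (Z - seg) id
    (hcl n (tos S) {} (cbd (Suc n) ?I))"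
   using hom_boundary_chain_boundary[OF Icyc] by (simp add: topS)
  also have "... = hcl n (tos S) (Z - seg) (cbd (Suc n) ?I)"
   using hom_id_hcl[of n "tos S" UNIV "{}" _ "Z - seg"] bcyc by simp
  finally show ?thesis using eq by (simp add: homologous_rel_set_eq)
 qed
 thus ?case
  using generating_iso[OF iso12 Icyc cyc3] gen3 unfolding Z_def[symmetric] S_def[symmetric] by blast
qed

section \<open>Constancy of local classes on an open simplex\<close>

definition itr :: "nat => (nat => real) set" where
 "itr n = {t : stds n. ALL i<=n. 0 < t i}"

text \<open>The affine hyperplane of the standard simplex. The open simplex is open in it, and
  translations by differences of its points preserve it.\<close>

abbreviation spln :: "nat => (nat => real) set" where
 "spln n == {t. (ALL i>n. t i = 0) & (SUM i<=n. t i) = 1}"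

lemma simplex_planeI:
 assumes "t : spln n" "!!i. i <= n ==> 0 <= t i" shows "t : stds n"
proof (rule standard_simplexI)
 show "0 <= t i" for i using assms by (cases "i <= n") auto
qed (use assms(1) in auto)

lemma itr_eq: "itr n = spln n Int (INT i:{..n}. {t. 0 < t i})"
 using simplex_planeI[of _ n] by (auto simp: itr_def standard_simplex_def less_imp_le)

lemma stds_plane: "stds n <= spln n"
 by (auto simp: standard_simplex_def)

lemma openin_simplex_interior: "opi (tos (spln n)) (itr n)"
proof -
 have "open (INT i:{..n}. {t :: nat => real. 0 < t i})"
  by (intro open_INT finite_atMost ballI open_Collect_less continuous_on_const continuous_on_product_coordinates)
 thus ?thesis unfolding itr_eq by (auto simp: openin_open)
qed

lemma itr_sub: "itr n <= stds n"
 by (auto simp: itr_def)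

lemma itr_segment:
 assumes "z : itr n" "z' : itr n" "u : {0..1}"
 shows "(%i. (1 - u) * z i + u * z' i) : itr n"
proof -
 have "0 < (1 - u) * z i + u * z' i" if "i <= n" for i
 proof (cases "u = 0")
  case False
  thus ?thesis using assms that by (intro add_nonneg_pos) (auto simp: itr_def intro: less_imp_le)
 qed (use assms that in \<open>auto simp: itr_def\<close>)
 thus ?thesis using assms convex_standard_simplex[of z n z' u] by (simp add: itr_def)
qed

text \<open>The translation by \<open>z' - z\<close> carries z to z'. On the way from the identity
  to it, a point passes through z' only if it started on the segment B, which the boundary of c
  avoids.\<close>

lemma relboundary_translate:
 fixes z z' :: "'i => real"
 assumes H: "!!x u. x : H ==> u : {0..1} ==> (%i. x i + u * (z' i - z i)) : H"
  and B: "!!u. u : {0..1} ==> (%i. (1 - u) * z' i + u * z i) : B"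
  and c: "rcy n (tos H) (H - B) c" and z: "rbd n (tos H) (H - {z}) c"
 shows "rbd n (tos H) (H - {z'}) c"
proof -
 define T where "T x i = x i + (z' i - z i)" for x :: "'i => real" and i
 have cT: "cmp (tos H) (tos H) T"
  unfolding cmp_coords
 proof
  show "ALL i. cmp (tos H) eur (%x. T x i)"
   unfolding T_def by (intro allI continuous_map_add continuous_map_coord) simp
  show "T : tps (tos H) \<rightarrow> H" using H[of _ 1] by (auto simp: T_def[abs_def])
 qed
 have line: "(%i. (1 - u) * id x i + u * T x i) = (%i. x i + u * (z' i - z i))" for x u
  by (rule ext) (simp add: T_def algebra_simps)
 have "homotopic_with (%h. h : (H - B) \<rightarrow> (H - {z'})) (tos H) (tos H) id T"
 proof (rule line_homotopic)
  fix x u assume u: "u : {0..1::real}"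
  { assume "x : tps (tos H)"
   thus "(%i. (1 - u) * id x i + u * T x i) : H" unfolding line using H u by simp }
  { assume x: "x : H - B"
   have "(%i. x i + u * (z' i - z i)) ~= z'"
   proof
    assume e: "(%i. x i + u * (z' i - z i)) = z'"
    have "x i = (1 - u) * z' i + u * z i" for i
     using fun_cong[OF e, of i] by (simp add: algebra_simps)
    hence "x = (%i. (1 - u) * z' i + u * z i)" by (rule ext)
    thus False using x B[OF u] by simp
   qed
   thus "(%i. (1 - u) * id x i + u * T x i) : H - {z'}" unfolding line using H u x by simp }
 qed (use cT in auto)
 hence "rbd n (tos H) (H - {z'}) (chain_map n id c - chain_map n T c)"
  by (rule homotopic_relboundary[OF _ c])
 moreover have "rbd n (tos H) (H - {z'}) (chain_map n T c)"
 proof (rule singular_relboundary_chain_map[OF z cT])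
  have "T x = z' ==> x = z" for x by (auto simp: T_def fun_eq_iff)
  thus "T : H - {z} \<rightarrow> H - {z'}" using H[of _ 1] by (auto simp: T_def[abs_def])
 qed
 ultimately show ?thesis using singular_relboundary_add chain_map_id_rcy[OF c] by fastforce
qed

text \<open>Openness of the image of \<open>itr n\<close> expresses that the simplex has full
  dimension in X; it is what allows excision of the complement of the simplex.\<close>

locale embedded_simplex =
 fixes n :: nat and X :: "'a topology" and \<sigma> :: "(nat => real) => 'a"
 assumes haus: "Hausdorff_space X" and simplex: "ssx n X \<sigma>" and inj: "inj_on \<sigma> (stds n)"
  and opn: "opi X (\<sigma> ` itr n)"
begin

abbreviation (input) "\<Delta> == stds n"

lemma cont: "cmp (tos \<Delta>) X \<sigma>"
 using simplex by (simp add: singular_simplex_def power_eucl)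

lemma image_sub: "\<sigma> ` \<Delta> <= tps X" using cont by (auto simp: continuous_map_def)

lemma interior_sub: "\<sigma> ` itr n <= X interior_of (\<sigma> ` \<Delta>)"
 using opn itr_sub[of n] by (intro interior_of_maximal) auto

lemma homeo: obtains g where "homeomorphic_maps (tos \<Delta>) (sbt X (\<sigma> ` \<Delta>)) \<sigma> g"
proof -
 have "compact \<Delta>" using compactin_standard_simplex[of n] by (simp add: power_eucl)
 hence "homeomorphic_map (tos \<Delta>) (sbt X (\<sigma> ` \<Delta>)) \<sigma>"
  using cont inj image_sub haus
  by (intro continuous_imp_homeomorphic_map)
   (auto simp: continuous_map_in_subtopology compact_space_subtopology Hausdorff_space_subtopology)
 thus thesis unfolding homeomorphic_map_maps by (elim exE) (rule that)
qed

lemma closed_image: "B <= \<Delta> ==> compact B ==> closedin X (\<sigma> ` B)"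
 using image_compactin[OF _ cont, of B] compactin_imp_closedin[OF haus] by (simp add: compactin_subtopology)

lemma generating_simplex:
 assumes y: "y : itr n"
 shows "generating n X (tps X - {\<sigma> y}) (fof \<sigma>)"
proof -
 let ?D = "\<sigma> ` \<Delta>"
 have B: "y : \<Delta>" using y itr_sub by blast
 obtain g where g: "homeomorphic_maps (tos \<Delta>) (sbt X ?D) \<sigma> g" by (rule homeo)
 have hm: "homeomorphic_map (tos \<Delta>) (sbt X ?D) \<sigma>" using g homeomorphic_maps_map by blast
 have im: "\<sigma> ` (\<Delta> - {y}) = ?D - {\<sigma> y}" using inj B by (auto simp: inj_on_def)
 let ?I = "fof (restrict id \<Delta>) :: (nat => real) chain"
 have g0: "generating n (tos \<Delta>) (\<Delta> - {y}) ?I"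
  using y by (intro generating_standard_simplex) (auto simp: itr_def)
 have c0: "rcy n (tos \<Delta>) (\<Delta> - {y}) ?I" using g0 by (simp add: generating_def)
 have fm: "\<sigma> : \<Delta> - {y} \<rightarrow> ?D - {\<sigma> y}" using im by blast
 have cD: "cmp (tos \<Delta>) (sbt X ?D) \<sigma>" using cont by (simp add: continuous_map_in_subtopology)
 have map: "chain_map n \<sigma> ?I = fof \<sigma>" by (rule singular_simplex_chain_map_id[OF simplex])
 have c1: "rcy n (sbt X ?D) (?D - {\<sigma> y}) (fof \<sigma>)"
  using singular_relcycle_chain_map[OF c0 cD fm] map by simp
 have iso1: "hom_induced (int n) (tos \<Delta>) (\<Delta> - {y}) (sbt X ?D) (?D - {\<sigma> y}) \<sigma>
   : iso (relative_homology_group (int n) (tos \<Delta>) (\<Delta> - {y})) (relative_homology_group (int n) (sbt X ?D) (?D - {\<sigma> y}))"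
  using homeomorphic_map_relative_homology_iso[OF hm _ im] by auto
 have g1: "generating n (sbt X ?D) (?D - {\<sigma> y}) (fof \<sigma>)"
  using generating_iso[OF iso1 c0 c1] hom_induced_chain_map[OF cD fm c0] map g0 by simp
 have s: "?D - {\<sigma> y} <= tps X - {\<sigma> y}" using image_sub by blast
 have c2: "rcy n X (tps X - {\<sigma> y}) (fof \<sigma>)" by (rule rcy_sbt[OF c1 s])
 have "closedin X {\<sigma> y}" using closed_image[of "{y}"] B by simp
 hence iso2: "hom_induced (int n) (sbt X ?D) (?D - {\<sigma> y}) X (tps X - {\<sigma> y}) id
  : iso (relative_homology_group (int n) (sbt X ?D) (?D - {\<sigma> y})) (relative_homology_group (int n) X (tps X - {\<sigma> y}))"
  using interior_sub y image_sub by (intro excision_iso) auto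
 show ?thesis using generating_iso[OF iso2 c1 c2] hom_id_hcl[OF c1 s] g1 by simp
qed

text \<open>By excision c is replaced by a chain in the simplex, which is then read in the
  hyperplane \<open>spln n\<close>. There \<open>relboundary_translate\<close> moves z to z', and
  excision leads back. So a local class cannot vanish at one point of an open simplex and survive at
  another.\<close>

lemma relboundary_constant:
 assumes z: "z : itr n" and z': "z' : itr n"
  and c: "rcy n X (tps X - \<sigma> ` ((%u i. (1 - u) * z' i + u * z i) ` {0..1})) c"
  and cz: "rbd n X (tps X - {\<sigma> z}) c"
 shows "rbd n X (tps X - {\<sigma> z'}) c"
proof -
 let ?seg = "%u i. (1 - u) * z' i + u * z i"
 define B where "B = ?seg ` {0..1::real}"
 let ?D = "\<sigma> ` \<Delta>" and ?X = "sbt X (\<sigma> ` \<Delta>)" and ?H = "tos (spln n)"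
 have BI: "B <= itr n" using itr_segment[OF z' z] by (auto simp: B_def)
 have C: "B <= \<Delta>" using BI itr_sub by blast
 have zB: "z : B" "z' : B" unfolding B_def by (rule image_eqI[of _ _ 1]; auto) (rule image_eqI[of _ _ 0]; auto)
 have "con {0..1} ?seg"
  by (intro continuous_on_coordinatewise_then_product continuous_intros)
 hence cB: "compact B" unfolding B_def by (rule compact_continuous_image) simp
 have clB: "closedin X (\<sigma> ` B)" by (rule closed_image[OF C cB])
 have cl: "closedin X {\<sigma> y}" if "y : B" for y using closed_image[of "{y}"] that C by auto
 have intB: "\<sigma> ` B <= X interior_of ?D" using BI interior_sub by blast
 obtain c' where c': "rcy n ?X (?D - \<sigma> ` B) c'" "rbd n X (tps X - \<sigma> ` B) (c - c')"
  by (rule excision_relcycle[OF clB intB image_sub c[folded B_def]]) blast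
 have diff: "rbd n X (tps X - {\<sigma> y}) (c - c')" if "y : B" for y
  by (rule relboundary_mono[OF c'(2)]) (use that in auto)
 have cyc: "rcy n ?X (?D - {\<sigma> y}) c'" if "y : B" for y
  by (rule relcycle_mono[OF c'(1)]) (use that in auto)
 have "rbd n X (tps X - {\<sigma> z}) c'"
  using singular_relboundary_diff[OF cz diff[OF zB(1)]] by simp
 hence bz: "rbd n ?X (?D - {\<sigma> z}) c'"
  using zB intB by (intro excision_rbd[OF cl[OF zB(1)] _ image_sub cyc[OF zB(1)]]) auto
 obtain g where g: "homeomorphic_maps (tos \<Delta>) ?X \<sigma> g" by (rule homeo)
 have gc: "cmp ?X (tos \<Delta>) g" and gs: "!!y. y : \<Delta> ==> g (\<sigma> y) = y"
  and sg: "!!x. x : ?D ==> \<sigma> (g x) = x"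
  using g image_sub by (auto simp: homeomorphic_maps_def)
 have gB: "g : ?D - \<sigma> ` A \<rightarrow> \<Delta> - A" if "A <= \<Delta>" for A
  using gs that by auto
 let ?c = "chain_map n g c'"
 have HB: "rcy n (tos \<Delta>) (\<Delta> - B) ?c"
  by (rule singular_relcycle_chain_map[OF c'(1) gc gB[OF C]])
 have Hz: "rbd n (tos \<Delta>) (\<Delta> - {z}) ?c"
  by (rule singular_relboundary_chain_map[OF bz gc]) (use gB[of "{z}"] zB C in auto)
 have top: "sbt ?H \<Delta> = tos \<Delta>"
  using stds_plane[of n] by (simp add: subtopology_subtopology Int_absorb1)
 have sub: "\<Delta> - A <= spln n - A" for A using stds_plane[of n] by blast
 have "rbd n ?H (spln n - {z'}) ?c"
 proof (rule relboundary_translate)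
  show "(%i. (1 - u) * z' i + u * z i) : B" if "u : {0..1}" for u using that by (auto simp: B_def)
  show "rcy n ?H (spln n - B) ?c"
   by (rule rcy_sbt[of _ _ \<Delta>, OF _ sub]) (simp add: top HB)
  show "rbd n ?H (spln n - {z}) ?c"
   by (rule rbd_sbt[of _ _ \<Delta>, OF _ sub]) (simp add: top Hz)
  show "(%i. x i + u * (z' i - z i)) : spln n" if "x : spln n" for x u
   using that z z' unfolding itr_eq by (simp add: sum.distrib sum_distrib_left[symmetric] sum_subtractf)
 qed
 hence "rbd n ?H (tps ?H - {z'}) ?c" by simp
 moreover have "closedin ?H {z'}" using z' unfolding itr_eq by (intro closed_subset) auto
 moreover have "{z'} <= ?H interior_of \<Delta>"
  using openin_simplex_interior[of n] itr_sub[of n] z' interior_of_maximal by blast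
 moreover have "rcy n (sbt ?H \<Delta>) (\<Delta> - {z'}) ?c"
  unfolding top by (rule relcycle_mono[OF HB]) (use zB in auto)
 ultimately have "rbd n (sbt ?H \<Delta>) (\<Delta> - {z'}) ?c"
  using stds_plane[of n] by (intro excision_rbd) auto
 hence "rbd n (tos \<Delta>) (\<Delta> - {z'}) ?c" unfolding top .
 hence "rbd n X (tps X - {\<sigma> z'}) (chain_map n \<sigma> ?c)"
 proof (rule singular_relboundary_chain_map[OF _ cont])
  show "\<sigma> : \<Delta> - {z'} \<rightarrow> tps X - {\<sigma> z'}" using inj zB C image_sub by (auto simp: inj_on_def)
 qed
 moreover have "chain_map n \<sigma> ?c = c'"
 proof -
  have "chain_map n \<sigma> ?c = chain_map n (\<sigma> o g) c'" by (simp add: chain_map_compose)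
  also have "... = c'"
   using c'(1) sg by (intro chain_map_id_gen[of n ?X]) (auto simp: singular_relcycle)
  finally show ?thesis .
 qed
 ultimately show ?thesis using singular_relboundary_add[OF diff[OF zB(2)]] by fastforce
qed

lemma boundary_avoids:
 assumes "1 <= n" "k <= n" "t : stds (n - Suc 0)"
 shows "sfc n k \<sigma> t : tps X - \<sigma> ` itr n"
proof -
 have f: "sfce k t : \<Delta>" by (rule simplical_face_in_standard_simplex[OF assms])
 have "sfce k t k = 0" by (simp add: simplical_face_def)
 hence "sfce k t ~: itr n" using assms(2) by (auto simp: itr_def)
 hence "\<sigma> (sfce k t) ~: \<sigma> ` itr n"
  using inj f itr_sub[of n] unfolding inj_on_def by blast
 thus ?thesis using f image_sub assms(3) by (auto simp: singular_face_def)
qed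

lemma relcycle: "rcy n X (tps X - \<sigma> ` itr n) (fof \<sigma>)"
proof (cases "n = 0")
 case False
 have "ssx (n - Suc 0) (sbt X (tps X - \<sigma> ` itr n)) (sfc n k \<sigma>)" if "k <= n" for k
  unfolding singular_simplex_subtopology
  using singular_simplex_singular_face[OF simplex _ that] boundary_avoids[OF _ that] False by auto
 thus ?thesis unfolding singular_relcycle using False simplex
  by (auto simp: singular_chain_of chain_boundary_of intro!: singular_chain_sum singular_chain_cmul)
qed (use simplex in \<open>simp add: singular_relcycle singular_chain_of chain_boundary_of\<close>)

end

text \<open>A generator of an infinite cyclic group is unique up to sign, and exponents of a
  generator can be compared.\<close>

lemma generating_orientation:
 assumes w: "w : carrier (relative_homology_group (int n) X S)"
   "generate (relative_homology_group (int n) X S) {w} = carrier (relative_homology_group (int n) X S)"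
  and c: "generating n X S c"
 shows "EX e:{1, -1}. w = hcl n X S (fcm e c)"
  "w [^]\<^bsub>relative_homology_group (int n) X S\<^esub> (k::int) = hcl n X S (fcm e c) ==>
  w = hcl n X S (fcm e' c) ==> k * e' = e"
proof -
 let ?G = "relative_homology_group (int n) X S"
 have cyc: "rcy n X S c" using c by (simp add: generating_def)
 have uniq: "k = l" if "hcl n X S (fcm k c) = hcl n X S (fcm l c)" for k l
 proof -
  have "rbd n X S (fcm (k - l) c)"
   using that unfolding homologous_rel_set_eq unfolding homologous_rel_def by (simp add: frag_cmul_diff_distrib)
  thus "k = l" using c by (auto simp: generating_def)
 qed
 obtain a where a: "w = hcl n X S a" "rcy n X S a"
  using w(1) by (auto simp: carrier_relative_homology_group)
 obtain m where "homologous_rel n X S a (fcm m c)" using c a(2) by (auto simp: generating_def)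
 hence m: "w = hcl n X S (fcm m c)" unfolding a(1) homologous_rel_set_eq .
 have pow: "w [^]\<^bsub>?G\<^esub> (l::int) = hcl n X S (fcm (l * e) c)" if "w = hcl n X S (fcm e c)" for l e
  unfolding that hcl_pow[OF singular_relcycle_cmul[OF cyc]] by simp
 have "hcl n X S c : generate ?G {w}" unfolding w(2) using cyc by (simp add: carrier_relative_homology_group)
 then obtain l :: int where "hcl n X S c = w [^]\<^bsub>?G\<^esub> l"
  using group.generate_pow[of ?G w] w(1) by auto
 hence "hcl n X S (fcm 1 c) = hcl n X S (fcm (l * m) c)"
  unfolding pow[OF m] by simp
 hence "l * m = 1" using uniq by blast
 hence "m = 1 \<or> m = -1" by (metis mult.commute zmult_eq_1_iff)
 thus "EX e:{1, -1}. w = hcl n X S (fcm e c)" using m by blast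
 show "k * e' = e" if "w [^]\<^bsub>?G\<^esub> (k::int) = hcl n X S (fcm e c)" "w = hcl n X S (fcm e' c)"
  using that(1) unfolding pow[OF that(2)] by (rule uniq)
qed

section \<open>The fundamental cycle of a triangulation\<close>

lemma aff_at:
 assumes "bij_betw vs {..n} s" "i <= n" "t : stds n"
 shows "aff n vs t (vs i) = t i"
proof -
 have "(SUM j<=n. if vs j = vs i then t j else 0) = (SUM j:{i}. t j)"
  using assms by (intro sum.mono_neutral_cong_right) (auto simp: bij_betw_def inj_on_def)
 thus ?thesis using assms(3) by (simp add: aff_apply)
qed

lemma simplex_interior_nonempty: "(%i. if i <= n then 1 / (real n + 1) else 0) : itr n"
 unfolding itr_eq by (auto simp: field_simps)

locale tri_manifold =
 fixes n :: nat and M :: "'a::topological_space set" and A :: "'a chart set" and \<omega> :: "'a => 'a chain set"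
  and K :: "'v::linorder set set" and h :: "('v => real) => 'a"
 assumes manifold: "closed_oriented_manifold n M A \<omega>" and triangulated: "triangulation_of K h (tos M)"
begin

lemma haus: "Hausdorff_space (tos M)" and compact_M: "compact M"
 and orient: "orientation n (tos M) \<omega>"
 using manifold by (auto simp: closed_oriented_manifold_def)

lemma complex: "simplicial_complex K" and homeo_h: "homeomorphic_map (rlz K) (tos M) h"
 using triangulated by (auto simp: triangulation_of_def)

lemma simplexD: "s : K ==> finite s" "s : K ==> s ~= {}" "s : K ==> t <= s ==> t ~= {} ==> t : K"
 using complex unfolding simplicial_complex_def by blast+

lemma cont_h: "cmp (rlz K) (tos M) h"
 and inj_h: "inj_on h (tps (rlz K))" and surj_h: "h ` tps (rlz K) = M"
 using homeo_h by (auto simp: homeomorphic_eq_everything_map)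

lemma in_rlz: "s : K ==> w : spts s ==> w : tps (rlz K)"
 unfolding topspace_realization by blast

lemma finite_vertices: "finite (\<Union>K)"
proof -
 have "compactin (tos M) M" by (simp add: compactin_subtopology compact_M)
 hence "compactin (rlz K) (tps (rlz K))"
  using homeomorphic_map_compactness[OF homeo_h, of "tps (rlz K)"] surj_h by simp
 hence "finite {v. EX w:tps (rlz K). w v ~= 0}"
  by (rule compact_rlz_finite[OF complex])
 moreover have "\<Union>K <= {v. EX w:tps (rlz K). w v ~= 0}"
 proof
  fix v assume "v : \<Union>K"
  then obtain s where s: "s : K" "v : s" by blast
  hence "vx v : tps (rlz K)"
   using simplexD(1)[OF s(1)] by (intro in_rlz vx_spts) auto
  moreover have "vx v v ~= 0" by (simp add: vertex_def)
  ultimately show "v : {v. EX w:tps (rlz K). w v ~= 0}" by blast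
 qed
 ultimately show ?thesis by (rule finite_subset[rotated])
qed

lemma finite_K: "finite K"
proof -
 have "K <= Pow (\<Union>K)" by blast
 thus ?thesis using finite_vertices by (metis finite_Pow_iff finite_subset)
qed

lemma enum:
 assumes s: "s : K" "card s = Suc m"
 shows "bij_betw (%i. lst s ! i) {..m} s"
 using enum_bij simplexD(1)[OF s(1)] s(2) by blast

lemma osx_apply:
 assumes s: "s : K" "card s = Suc m"
 shows "t : stds m ==> osx m h s t = h (aff m (%i. lst s ! i) t)"
 by (simp add: ordered_simplex_aff smp_apply)

lemma aff_in:
 assumes s: "s : K" "card s = Suc m"
 shows "t : stds m ==> aff m (%i. lst s ! i) t : spts s"
 using enum[OF s] simplexD(1)[OF s(1)] by (intro aff_in_spts) (auto simp: bij_betw_def)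

lemma ssx_osx:
 assumes s: "s : K" "card s = Suc m"
 shows "ssx m (tos M) (osx m h s)"
 unfolding ordered_simplex_aff
proof (rule singular_simplex_simplex_map[OF _ cont_h])
 show "ssx m (rlz K) (aff m ((!) (lst s)))"
  using enum[OF s] s(1) complex by (intro ssx_aff) (auto simp: bij_betw_def)
qed

lemma inj_osx:
 assumes s: "s : K" "card s = Suc m"
 shows "inj_on (osx m h s) (stds m)"
proof (rule inj_onI)
 fix t t' assume t: "t : stds m" "t' : stds m" "osx m h s t = osx m h s t'"
 have "aff m (%i. lst s ! i) t = aff m (%i. lst s ! i) t'"
  by (rule inj_onD[OF inj_h]) (use t(3) aff_in[OF s] t(1,2) in_rlz[OF s(1)] in \<open>simp_all add: osx_apply[OF s]\<close>)
 hence "t i = t' i" if "i <= m" for i using aff_at[OF enum[OF s] that] t(1,2) by metis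
 moreover have "t i = t' i" if "i > m" for i using t(1,2) that by (simp add: standard_simplex_def)
 ultimately show "t = t'" by (metis ext not_le)
qed

text \<open>Invariance of domain. For a face with n + 2 vertices, a chart of M would map an open
  part of it injectively into \<open>Euclidean_space n\<close>. Read as a map of an open subset of
  \<open>Euclidean_space (Suc n)\<close> to that space it would be open, although the last
  coordinate of its values vanishes.\<close>

lemma dim_le: assumes s: "s : K" shows "card s <= Suc n"
proof (rule ccontr)
 assume "~ card s <= Suc n"
 then obtain r where r: "r <= s" "card r = Suc (Suc n)" by (metis Suc_leI not_le obtain_subset_with_card_n)
 hence rK: "r : K" using simplexD(3)[OF s] by (metis card.empty Zero_not_Suc)
 define m where "m = Suc n"
 have rm: "card r = Suc m" using r by (simp add: m_def)
 let ?\<sigma> = "osx m h r" and ?E = "{y :: nat => real. ALL i>=m. y i = 0}"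
 \<comment> \<open>Affine coordinates on the hyperplane of the m-simplex; the coordinate 0 is
   determined by the others.\<close>
 define c where "c y i = (if i = 0 then 1 - (SUM j<m. y j) else y (i - 1))" for y :: "nat => real" and i
 have cP: "c y : spln m" if "y : ?E" for y
  using that by (auto simp: c_def sum.atMost_shift m_def)
 have cc: "cmp (tos ?E) (tos (spln m)) c"
  unfolding cmp_coords
 proof
  show "ALL i. cmp (tos ?E) eur (%y. c y i)"
  proof
   show "cmp (tos ?E) eur (%y. c y i)" for i
    unfolding c_def
    using continuous_map_coord[of ?E] by (cases "i = 0") (auto intro!: continuous_intros continuous_on_subset[OF continuous_on_product_coordinates])
  qed
 qed (use cP in auto)
 let ?b = "%i. if i <= m then 1 / (real m + 1) else 0"
 have b: "?b : itr m" by (rule simplex_interior_nonempty)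
 have B: "cmp (tos (itr m)) (tos M) ?\<sigma>"
  using ssx_osx[OF rK rm] itr_sub[of m]
  unfolding ssx_iff by (auto intro: continuous_on_subset)
 have "?\<sigma> ?b : M" using B b by auto
 moreover have at: "smooth_atlas n (tos M) A" using manifold by (simp add: closed_oriented_manifold_def)
 ultimately obtain U F where U: "(U, F) : A" "?\<sigma> ?b : U" unfolding smooth_atlas_def by auto
 have U': "opi (tos M) U" "homeomorphic_map (tos U) (sbt (Euclidean_space n) (F ` U)) F"
  "opi (Euclidean_space n) (F ` U)"
  using at U(1) openin_imp_subset[of "euclidean" M U] unfolding smooth_atlas_def
  by (auto simp: subtopology_subtopology Int_absorb1)
 define W where "W = {t : itr m. ?\<sigma> t : U}"
 have "opi (tos (itr m)) W"
  using openin_continuous_map_preimage[OF B U'(1)] by (simp add: W_def)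
 hence Wo: "opi (tos (spln m)) W" using openin_simplex_interior openin_trans by blast
 define V where "V = {y : ?E. c y : W}"
 have Vo: "opi (Euclidean_space m) V"
  using openin_continuous_map_preimage[OF cc Wo] by (simp add: V_def Eucl_tos)
 define f where "f = F o (?\<sigma> o c)"
 have VE: "V <= ?E" by (auto simp: V_def)
 have c1: "cmp (tos V) (tos (itr m)) c"
 proof -
  have "con ?E c" using cc by simp
  hence "con V c" using VE by (rule continuous_on_subset)
  thus ?thesis by (auto simp: V_def W_def)
 qed
 have c2: "cmp (tos V) (tos U) (?\<sigma> o c)"
 proof -
  have "cmp (tos V) (tos M) (?\<sigma> o c)" by (rule continuous_map_compose[OF c1 B])
  thus ?thesis using openin_imp_subset[OF U'(1)] by (auto simp: V_def W_def)
 qed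
 have "cmp (tos V) (Euclidean_space n) f"
  unfolding f_def using continuous_map_compose[OF c2 homeomorphic_imp_continuous_map[OF U'(2)]]
  by (simp add: continuous_map_in_subtopology)
 hence fc: "cmp (tos V) (tos {y. ALL i>=n. y i = 0}) f"
  by (simp add: Eucl_tos)
 have fm: "cmp (sbt (Euclidean_space m) V) (Euclidean_space m) f"
 proof -
  have "sbt (Euclidean_space m) V = tos V"
   using VE by (simp add: Eucl_tos subtopology_subtopology Int_absorb1)
  moreover have "cmp (tos V) (tos ?E) f"
  proof -
   have "{y. ALL i>=n. y i = 0} <= ?E" by (auto simp: m_def)
   thus ?thesis using fc by (simp add: image_subset_iff_funcset[symmetric]) blast
  qed
  ultimately show ?thesis by (simp add: Eucl_tos)
 qed
 have "inj_on f V"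
 proof -
  have "inj_on c V"
  proof (rule inj_onI)
   fix y y' assume y: "y : V" "y' : V" "c y = c y'"
   have "y i = y' i" for i using fun_cong[OF y(3), of "Suc i"] by (simp add: c_def)
   thus "y = y'" by blast
  qed
  moreover have "inj_on ?\<sigma> (c ` V)"
   using itr_sub[of m] by (intro inj_on_subset[OF inj_osx[OF rK rm]]) (auto simp: V_def W_def)
  moreover have "inj_on F (?\<sigma> ` c ` V)"
  proof (rule inj_on_subset)
   show "inj_on F U" using U'(2) by (simp add: homeomorphic_eq_everything_map)
  qed (auto simp: V_def W_def)
  ultimately show ?thesis unfolding f_def by (intro comp_inj_on) (auto simp: image_comp)
 qed
 hence op: "opi (Euclidean_space m) (f ` V)" by (rule invariance_of_domain_Euclidean_space[OF Vo fm])
 define y where "y i = (if i < m then 1 / (real m + 1) else 0)" for i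
 have "c y = ?b" by (auto simp: c_def y_def fun_eq_iff field_simps)
 hence "y : V" using b U(2) by (simp add: V_def W_def y_def)
 hence fy: "f y : f ` V" by blast
 obtain O' where O': "open O'" "f ` V = ?E Int O'" using op by (auto simp: Eucl_tos openin_open)
 obtain I r where I: "finite I" "r > 0" "{z. ALL i:I. \<bar>z i - f y i\<bar> < r} <= O'"
  by (rule open_fun_box[OF O'(1), of "f y"]) (use fy O'(2) in auto)
 \<comment> \<open>A displacement within the supposedly open image, in the direction of the
   coordinate n, in which all image points are 0.\<close>
 define z where "z = (f y)(n := f y n + r / 2)"
 have fn: "w i = 0" if "w : f ` V" "i >= n" for w i using fc that by auto
 have "z : ?E" using fn[OF fy] by (auto simp: z_def m_def)
 moreover have "z : O'" using I by (intro subsetD[OF I(3)]) (auto simp: z_def)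
 ultimately have "z : f ` V" using O'(2) by blast
 hence "z n = 0" by (rule fn) simp
 moreover have "f y n = 0" by (rule fn[OF fy]) simp
 ultimately show False using I(2) by (simp add: z_def)
qed

text \<open>A point with positive coordinates at all vertices of s can only lie in a simplex that
  contains s, and s is maximal by \<open>dim_le\<close>.\<close>

lemma open_simplex:
 assumes s: "s : K" "card s = Suc n"
 shows "opi (rlz K) {w : tps (rlz K). ALL v:s. 0 < w v}"
  "{w : tps (rlz K). ALL v:s. 0 < w v} <= spts s"
proof -
 show "{w : tps (rlz K). ALL v:s. 0 < w v} <= spts s"
 proof
  fix w assume w: "w : {w : tps (rlz K). ALL v:s. 0 < w v}"
  then obtain s' where s': "s' : K" "w : spts s'" by (auto simp: topspace_realization)
  have "v : s'" if "v : s" for v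
  proof (rule ccontr)
   assume "v ~: s'"
   hence "w v = 0" using s'(2) by (simp add: simplex_points_def)
   thus False using w that by auto
  qed
  hence "s = s'" using card_subset_eq[OF simplexD(1)[OF s'(1)], of s] dim_le[OF s'(1)] s(2) card_mono[OF simplexD(1)[OF s'(1)], of s]
   by (metis le_antisym subsetI)
  thus "w : spts s" using s'(2) by simp
 qed
 have "opi (simplex_top r) ({w : tps (rlz K). ALL v:s. 0 < w v} Int spts r)" if "r : K" for r
 proof -
  have "{w : tps (rlz K). ALL v:s. 0 < w v} Int spts r = spts r Int (INT v:s. {w. 0 < w v})"
   using in_rlz[OF that] by auto
  moreover have "open (INT v:s. {w :: 'v => real. 0 < w v})"
   using simplexD(1)[OF s(1)] by (intro open_INT ballI open_Collect_less continuous_on_const continuous_on_product_coordinates)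
  ultimately show ?thesis unfolding power_eucl by (auto simp: openin_open)
 qed
 thus "opi (rlz K) {w : tps (rlz K). ALL v:s. 0 < w v}"
  unfolding openin_realization by (auto simp: topspace_realization)
qed

lemma interior_image:
 assumes s: "s : K" "card s = Suc n"
 shows "osx n h s ` itr n = h ` {w : tps (rlz K). ALL v:s. 0 < w v}"
proof -
 note e = enum[OF s]
 let ?a = "aff n (%i. lst s ! i)"
 have "?a ` itr n = {w : tps (rlz K). ALL v:s. 0 < w v}" (is "_ = ?R")
 proof (intro equalityI subsetI)
  fix w assume "w : ?a ` itr n"
  then obtain t where t: "t : itr n" "w = ?a t" by blast
  have B: "t : stds n" using t(1) itr_sub by blast
  have "0 < w v" if v: "v : s" for v
  proof -
   obtain i where "i <= n" "v = lst s ! i" using v e by (auto simp: bij_betw_def)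
   thus ?thesis using aff_at[OF e _ B] t by (auto simp: itr_def)
  qed
  thus "w : ?R" using in_rlz[OF s(1) aff_in[OF s B]] t(2) by simp
 next
  fix w assume w: "w : ?R"
  hence ws: "w : spts s" using open_simplex(2)[OF s] by blast
  let ?t = "%i. if i <= n then w (lst s ! i) else 0"
  have "?t : itr n" using aff_surj(1)[OF e ws] w e by (auto simp: itr_def bij_betw_def)
  thus "w : ?a ` itr n" by (rule image_eqI[rotated]) (rule aff_surj(2)[OF e ws, symmetric])
 qed
 moreover have "osx n h s ` itr n = h ` ?a ` itr n"
  unfolding image_image using itr_sub[of n] by (intro image_cong refl osx_apply[OF s]) auto
 ultimately show ?thesis by simp
qed

lemma embedded:
 assumes s: "s : K" "card s = Suc n"
 shows "embedded_simplex n (tos M) (osx n h s)"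
proof
 show "opi (tos M) (osx n h s ` itr n)"
  unfolding interior_image[OF s] using homeomorphic_map_openness[OF homeo_h, of "{w : tps (rlz K). ALL v:s. 0 < w v}"] open_simplex(1)[OF s]
  by auto
qed (use haus ssx_osx[OF s] inj_osx[OF s] in auto)

lemma orientation_at:
 assumes "x : M"
 shows "\<omega> x : carrier (local_homology n (tos M) x)" "generate (local_homology n (tos M) x) {\<omega> x} = carrier (local_homology n (tos M) x)"
  "EX U a. opi (tos M) U & x : U & rcy n (tos M) (M - U) a &
   (ALL y:U. \<omega> y = hcl n (tos M) (M - {y}) a)"
proof -
 from orient assms obtain U J where U: "opi (tos M) U" "x : U"
  "J : carrier (relative_homology_group (int n) (tos M) (M - U))"
  "!!y. y : U ==> hom_induced (int n) (tos M) (M - U) (tos M) (M - {y}) id J = \<omega> y"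
  unfolding orientation_def by auto
 obtain a where a: "rcy n (tos M) (M - U) a" "J = hcl n (tos M) (M - U) a"
  using U(3) by (auto simp: carrier_relative_homology_group)
 have "\<omega> y = hcl n (tos M) (M - {y}) a" if "y : U" for y
  using U(4)[OF that] hom_id_hcl[of n "tos M" UNIV "M - U" a "M - {y}"] a that by auto
 thus "EX U a. opi (tos M) U & x : U & rcy n (tos M) (M - U) a &
   (ALL y:U. \<omega> y = hcl n (tos M) (M - {y}) a)"
  using U(1,2) a(1) by blast
qed (use orient assms in \<open>auto simp: orientation_def\<close>)

text \<open>This justifies the definite description in \<open>simplex_sign\<close>. At each interior
  point a sign exists because the simplex generates the local homology; it is locally constant by
  \<open>relboundary_constant\<close>, and the open simplex is connected. Since the sign squares to
  1, the defining equation can be solved for \<omega>.\<close>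

lemma simplex_sign:
 assumes s: "s : K" "card s = Suc n"
 shows "simplex_sign n (tos M) \<omega> h s : {1, -1}"
  "!!t. t : itr n ==> \<omega> (osx n h s t) =
   hcl n (tos M) (M - {osx n h s t}) (fcm (simplex_sign n (tos M) \<omega> h s) (fof (osx n h s)))"
proof -
 interpret embedded_simplex n "tos M" "osx n h s" by (rule embedded[OF s])
 define \<sigma> where "\<sigma> = osx n h s"
 let ?c = "fof \<sigma> :: 'a chain" and ?X = "tos M"
 define sg where "sg e t \<longleftrightarrow> \<omega> (\<sigma> t) = hcl n ?X (M - {\<sigma> t}) (fcm e ?c)" for e t
 have C: "\<sigma> t : M" if "t : itr n" for t using image_sub itr_sub that by (auto simp: \<sigma>_def)
 have gen: "generating n ?X (M - {\<sigma> t}) ?c" if "t : itr n" for t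
  using generating_simplex[OF that] by (simp add: \<sigma>_def)
 have ex: "EX e:{1, -1}. sg e t" if "t : itr n" for t
  unfolding sg_def by (rule generating_orientation(1)[OF _ _ gen[OF that]]) (use orientation_at(1,2)[OF C[OF that]] in simp_all)
 let ?b = "%i. if i <= n then 1 / (real n + 1) else 0"
 have b: "?b : itr n" by (rule simplex_interior_nonempty)
 obtain e where e: "e : {1, -1}" "sg e ?b" using ex[OF b] by blast
 have conn: "connected (itr n)"
 proof (rule starlike_connected[OF b])
  fix t u assume "t : itr n" "u : {0..1::real}"
  thus "(%i. ?b i + u * (t i - ?b i)) : itr n"
   using itr_segment[OF b, of t u] by (simp add: algebra_simps)
 qed
 have loc: "EX T. opi (tos (itr n)) T & t0 : T & (ALL t:T. ALL t':T. sg e t --> sg e t')" if t0: "t0 : itr n" for t0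
 proof -
  obtain U a where U: "opi ?X U" "\<sigma> t0 : U" and a: "rcy n ?X (M - U) a"
   "!!y. y : U ==> \<omega> y = hcl n ?X (M - {y}) a"
   using orientation_at(3)[OF C[OF t0]] by blast
  have E: "cmp (tos (itr n)) ?X \<sigma>"
   using cont itr_sub[of n] unfolding \<sigma>_def by (auto intro: continuous_on_subset)
  have "opi (tos (itr n)) {t : itr n. \<sigma> t : U}"
   using openin_continuous_map_preimage[OF E U(1)] by simp
  then obtain V where V: "open V" "{t : itr n. \<sigma> t : U} = itr n Int V" by (auto simp: openin_open)
  have t0V: "t0 : V" using V(2) t0 U(2) by blast
  obtain I r where I: "finite I" "r > 0" "{z. ALL i:I. \<bar>z i - t0 i\<bar> < r} <= V"
   by (rule open_fun_box[OF V(1) t0V]) blast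
  \<comment> \<open>With two points this box contains the segment between them, and \<sigma> maps it
    into U, where the class a is given; so the segment is admissible in
    \<open>relboundary_constant\<close>.\<close>
  define T where "T = itr n Int {z. ALL i:I. \<bar>z i - t0 i\<bar> < r}"
  have "opi (tos (itr n)) T" unfolding T_def
   using open_coordinate_box[OF I(1)] by (rule openin_open_Int)
  moreover have "t0 : T" using t0 I(2) by (simp add: T_def)
  moreover have "sg e t'" if T: "t : T" "t' : T" "sg e t" for t t'
  proof -
   have tI: "t : itr n" "t' : itr n" using T by (auto simp: T_def)
   have segT: "(%i. (1 - u) * t' i + u * t i) : T" if u: "u : {0..1}" for u
   proof -
    have "\<bar>(1 - u) * t' i + u * t i - t0 i\<bar> < r" if "i : I" for i
    proof -
     have d: "\<bar>t' i - t0 i\<bar> < r" "\<bar>t i - t0 i\<bar> < r" using T that by (auto simp: T_def)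
     have "(1 - u) * t' i + u * t i - t0 i = (1 - u) * (t' i - t0 i) + u * (t i - t0 i)" by (simp add: algebra_simps)
     also have "\<bar>...\<bar> <= (1 - u) * \<bar>t' i - t0 i\<bar> + u * \<bar>t i - t0 i\<bar>"
      using u abs_triangle_ineq[of "(1 - u) * (t' i - t0 i)" "u * (t i - t0 i)"] by (simp add: abs_mult)
     also have "... <= (1 - u) * max \<bar>t' i - t0 i\<bar> \<bar>t i - t0 i\<bar> + u * max \<bar>t' i - t0 i\<bar> \<bar>t i - t0 i\<bar>"
      using u by (intro add_mono mult_left_mono) auto
     also have "... = max \<bar>t' i - t0 i\<bar> \<bar>t i - t0 i\<bar>" by (simp add: algebra_simps)
     also have "... < r" using d by simp
     finally show ?thesis .
    qed
    thus ?thesis using itr_segment[OF tI(2,1) u] by (simp add: T_def)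
   qed
   let ?B = "(%u i. (1 - u) * t' i + u * t i) ` {0..1}"
   have B: "?B <= T" using segT by blast
   have TU: "\<sigma> z : U" if "z : T" for z using that I(3) V(2) by (auto simp: T_def)
   have "rcy n ?X (M - \<sigma> ` ?B) a" using B TU by (intro relcycle_mono[OF a(1)]) auto
   moreover have "rcy n ?X (M - \<sigma> ` ?B) (fcm e ?c)"
   proof (rule singular_relcycle_cmul, rule relcycle_mono)
    show "rcy n ?X (M - \<sigma> ` itr n) ?c" using relcycle by (simp add: \<sigma>_def)
    have "?B <= itr n" using B by (auto simp: T_def)
    thus "M - \<sigma> ` itr n <= M - \<sigma> ` ?B" by (intro Diff_mono image_mono order_refl)
   qed
   ultimately have cyc: "rcy n ?X (M - \<sigma> ` ?B) (a - fcm e ?c)" by (rule singular_relcycle_diff)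
   have "rbd n ?X (M - {\<sigma> t}) (a - fcm e ?c)"
    using T(3)[unfolded sg_def a(2)[OF TU[OF T(1)]] homologous_rel_set_eq] by (simp add: homologous_rel_def)
   hence "rbd n ?X (M - {\<sigma> t'}) (a - fcm e ?c)"
    using relboundary_constant[OF tI, of "a - fcm e ?c"] cyc by (simp add: \<sigma>_def)
   thus ?thesis
    unfolding sg_def a(2)[OF TU[OF T(2)]] homologous_rel_set_eq by (simp add: homologous_rel_def)
  qed
  ultimately show ?thesis by blast
 qed
 have all: "sg e t" if "t : itr n" for t
  by (rule connected_induction_simple[OF conn b that, of "sg e"]) (use e loc in auto)
 have cyc: "rcy n ?X (M - {\<sigma> t}) ?c" if "t : itr n" for t using gen[OF that] by (simp add: generating_def)
 have "simplex_sign n ?X \<omega> h s = e"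
  unfolding simplex_sign_def
 proof (rule the_equality)
  have "hcl n ?X (M - {\<sigma> t}) ?c = \<omega> (\<sigma> t) [^]\<^bsub>local_homology n ?X (\<sigma> t)\<^esub> e" if "t : itr n" for t
  proof -
   have "\<omega> (\<sigma> t) [^]\<^bsub>relative_homology_group (int n) ?X (M - {\<sigma> t})\<^esub> e = hcl n ?X (M - {\<sigma> t}) (fcm (e * e) ?c)"
    using all[OF that] hcl_pow[OF singular_relcycle_cmul[OF cyc[OF that], of e], of e] unfolding sg_def by simp
   moreover have "e * e = 1" using e(1) by auto
   ultimately show ?thesis by simp
  qed
  thus "ALL t:stds n. (ALL i<=n. 0 < t i) --> (let x = osx n h s t in
   hcl n ?X (tps ?X - {x}) (fof (osx n h s)) = \<omega> x [^]\<^bsub>local_homology n ?X x\<^esub> e)"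
   by (simp add: Let_def \<sigma>_def itr_def)
  fix e' :: int assume e': "ALL t:stds n. (ALL i<=n. 0 < t i) --> (let x = osx n h s t in
   hcl n ?X (tps ?X - {x}) (fof (osx n h s)) = \<omega> x [^]\<^bsub>local_homology n ?X x\<^esub> e')"
  hence "hcl n ?X (M - {\<sigma> ?b}) ?c = \<omega> (\<sigma> ?b) [^]\<^bsub>local_homology n ?X (\<sigma> ?b)\<^esub> e'"
   using b unfolding itr_def Let_def \<sigma>_def by auto
  hence "\<omega> (\<sigma> ?b) [^]\<^bsub>relative_homology_group (int n) ?X (M - {\<sigma> ?b})\<^esub> e' = hcl n ?X (M - {\<sigma> ?b}) (fcm 1 ?c)"
   by simp
  hence "e' * e = 1"
   using generating_orientation(2)[OF _ _ gen[OF b], of "\<omega> (\<sigma> ?b)" e' 1 e] orientation_at(1,2)[OF C[OF b]] e(2) unfolding sg_def by simp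
  thus "e' = e" using e(1) by auto
 qed
 thus "simplex_sign n ?X \<omega> h s : {1, -1}"
  "!!t. t : itr n ==> \<omega> (osx n h s t) =
   hcl n ?X (M - {osx n h s t}) (fcm (simplex_sign n ?X \<omega> h s) (fof (osx n h s)))"
  using e(1) all unfolding sg_def \<sigma>_def by auto
qed

end

section \<open>Cancellation of signs along a face\<close>

abbreviation Eucl :: "nat => (nat => real) set" where "Eucl n == {y. ALL i>=n. y i = 0}"

text \<open>The simplex with vertices \<open>e\<^sub>0, \<dots>, e\<^sub>n\<^sub>-\<^sub>1\<close> and \<open>0\<close>, where \<open>0\<close> is the vertex number \<open>j\<close>.\<close>

definition corner :: "nat => nat => nat => real" where
 "corner j i = (if i < j then vx i else if i = j then (%_. 0) else vx (i - 1))"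

lemma corner_apply:
 assumes "j <= n" "t : stds n"
 shows "orsx n (corner j) t = (%k. if k < n then t (if k < j then k else Suc k) else 0)"
proof
 fix k
 have "orsx n (corner j) t k = (SUM i<=n. corner j i k * t i)" using assms by (simp add: oriented_simplex_def)
 also have "... = (SUM i<=n. if i = (if k < j then k else Suc k) then t i else 0)"
  by (rule sum.cong) (auto simp: corner_def vertex_def)
 also have "... = (if k < n then t (if k < j then k else Suc k) else 0)"
  using assms(1) by (auto simp: sum.delta)
 finally show "orsx n (corner j) t k = (if k < n then t (if k < j then k else Suc k) else 0)" .
qed

lemma singular_oriented_simplex:
 fixes l :: "nat => nat => real"
 assumes "!!t. t : stds m ==> (%i. SUM j<=m. l j i * t j) : S"
 shows "ssx m (tos S) (orsx m l)"
 using simplicial_imp_singular_simplex[of m S "orsx m l"] assms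
 by (auto simp: simplicial_simplex_oriented_simplex power_eucl)

text \<open>In the simplex with vertices u the origin occurs twice, right before and right after
  \<open>vx j\<close>. Omitting one or the other gives the two corners, with equal signs; every
  other face lacks some \<open>vx k\<close> and stays in a coordinate hyperplane, away from
  y.\<close>

lemma corner_step:
 assumes y: "!!k. k < n ==> 0 < y k" and j: "j < n"
 shows "rbd n (tos (Eucl n)) (Eucl n - {y}) (fof (orsx n (corner (Suc j))) + fof (orsx n (corner j)))"
proof -
 define u where "u i = (if i < j then vx i else if i = j then (%_. 0) else if i = Suc j then vx j
  else if i = Suc (Suc j) then (%_. 0) else vx (i - 2))" for i :: nat
 let ?E = "tos (Eucl n)" and ?s = "orsx (Suc n) u"
 have uE: "u i k = 0" if "k >= n" "i <= Suc n" for i k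
  using that j by (auto simp: u_def vertex_def)
 have sE: "ssx (Suc n) ?E ?s"
  using uE by (intro singular_oriented_simplex) (auto intro!: sum.neutral)
 define face where "face k = sfc (Suc n) k ?s" for k
 have face: "face k = orsx n (%i. if i < k then u i else u (Suc i))" if "k <= Suc n" for k
  using singular_face_oriented_simplex[of "Suc n" k u] that by (simp add: face_def)
 have f1: "face j = orsx n (corner (Suc j))"
  using j by (auto simp: face oriented_simplex_eq corner_def u_def less_Suc_eq)
 have f2: "face (Suc (Suc j)) = orsx n (corner j)"
  using j by (auto simp: face oriented_simplex_eq corner_def u_def less_Suc_eq)
 have f3: "ssx n (sbt ?E (Eucl n - {y})) (face k)" if k: "k <= Suc n" "k ~= j" "k ~= Suc (Suc j)" for k
 proof -
  obtain m where m: "m < n" "!!i. i <= n ==> (if i < k then u i else u (Suc i)) m = 0"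
  proof (cases "k < j")
   case True
   thus ?thesis using j by (intro that[of k]) (auto simp: u_def vertex_def)
  next
   case False
   then consider "k = Suc j" | "k > Suc (Suc j)" using k by linarith
   thus ?thesis
   proof cases
    case 1
    thus ?thesis using j by (intro that[of j]) (auto simp: u_def vertex_def)
   next
    case 2
    thus ?thesis using j k by (intro that[of "k - 2"]) (auto simp: u_def vertex_def)
   qed
  qed
  have "face k t ~= y" if t: "t : stds n" for t
  proof -
   have "face k t m = 0" unfolding face[OF k(1)] oriented_simplex_def using t m by simp
   thus ?thesis using y[OF m(1)] by auto
  qed
  moreover have fs: "ssx n ?E (face k)"
   using singular_simplex_singular_face[OF sE _ k(1)] by (simp add: face_def)
  moreover have "face k t : Eucl n" if "t : stds n" for t
   using fs that unfolding ssx_iff by blast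
  ultimately show ?thesis using singular_simplex_subtopology[of n ?E "Eucl n - {y}" "face k"] by blast
 qed
 have fin: "finite {..Suc n}" "j : {..Suc n}" "Suc (Suc j) : {..Suc n} - {j}" using j by auto
 let ?rest = "SUM k:{..Suc n} - {j} - {Suc (Suc j)}. fcm ((-1) ^ k) (fof (face k))"
 have "cbd (Suc n) (fof ?s) = (SUM k<=Suc n. fcm ((-1) ^ k) (fof (face k)))"
  by (simp add: chain_boundary_of face_def)
 also have "... = fcm ((-1) ^ j) (fof (face j)) + (fcm ((-1) ^ j) (fof (face (Suc (Suc j)))) + ?rest)"
  using sum.remove[OF fin(1,2), of "%k. fcm ((-1) ^ k) (fof (face k))"]
   sum.remove[OF _ fin(3), of "%k. fcm ((-1) ^ k) (fof (face k))"] by (simp del: sum.atMost_Suc)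
 finally have "fcm ((-1) ^ j) (fof (face j) + fof (face (Suc (Suc j)))) = cbd (Suc n) (fof ?s) - ?rest"
  by (simp add: frag_cmul_distrib2)
 moreover have "rbd n ?E (Eucl n - {y}) (cbd (Suc n) (fof ?s))"
  unfolding singular_relboundary using sE by (rule_tac exI[of _ "fof ?s"], rule_tac exI[of _ 0]) (simp add: singular_chain_of)
 moreover have "rbd n ?E (Eucl n - {y}) ?rest"
  by (intro singular_chain_imp_relboundary singular_chain_sum singular_chain_cmul)
   (use f3 in \<open>simp add: singular_chain_of\<close>)
 ultimately have "rbd n ?E (Eucl n - {y}) (fcm ((-1) ^ j) (fof (face j) + fof (face (Suc (Suc j)))))"
  by (simp add: singular_relboundary_diff)
 hence "rbd n ?E (Eucl n - {y}) (fcm ((-1) ^ j) (fcm ((-1) ^ j) (fof (face j) + fof (face (Suc (Suc j))))))"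
  by (rule singular_relboundary_cmul)
 thus ?thesis by (simp add: f1 f2 power_add[symmetric] flip: mult_2)
qed

lemma corner_sign:
 assumes y: "!!k. k < n ==> 0 < y k" and j: "j <= n"
 shows "rbd n (tos (Eucl n)) (Eucl n - {y})
  (fof (orsx n (corner j)) - fcm ((-1) ^ j) (fof (orsx n (corner 0))))"
 using j
proof (induction j)
 case (Suc j)
 let ?B = "rbd n (tos (Eucl n)) (Eucl n - {y})"
 let ?c = "%j. fof (orsx n (corner j)) :: (nat => real) chain"
 have "?B (?c (Suc j) + ?c j - (?c j - fcm ((-1) ^ j) (?c 0)))"
  by (rule singular_relboundary_diff[OF corner_step[OF y] Suc.IH]) (use Suc.prems in auto)
 moreover have "fcm ((-1) ^ Suc j) (?c 0) = - fcm ((-1) ^ j) (?c 0)"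
  using frag_cmul_diff_distrib[of 0 "(-1) ^ j" "?c 0"] by simp
 ultimately show ?case by (simp only: diff_minus_eq_add) (simp add: algebra_simps)
qed simp

lemma corner_generating:
 assumes y: "y : Eucl n" "!!k. k < n ==> 0 < y k" "(SUM k<n. y k) < 1"
 shows "generating n (tos (Eucl n)) (Eucl n - {y}) (fof (orsx n (corner 0)))"
proof -
 let ?c = "orsx n (corner 0)" and ?E = "tos (Eucl n)"
 have c: "?c t = (%k. if k < n then t (Suc k) else 0)" if "t : stds n" for t
  using corner_apply[OF le0 that] by (simp only: less_nat_zero_code if_False)
 define tt where "tt z i = (if i = 0 then 1 - (SUM k<n. z k) else if i <= n then z (i - 1) else 0)" for z :: "nat => real" and i
 have tt: "tt z : itr n" "?c (tt z) = z" if "z : Eucl n" "!!k. k < n ==> 0 < z k" "(SUM k<n. z k) < 1" for z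
 proof -
  show i: "tt z : itr n" unfolding itr_eq using that by (auto simp: tt_def sum.atMost_shift)
  show "?c (tt z) = z" using subsetD[OF itr_sub i] that(1) by (subst c) (auto simp: tt_def fun_eq_iff)
 qed
 interpret embedded_simplex n ?E ?c
 proof
  show "Hausdorff_space ?E" by (simp add: Hausdorff_space_subtopology)
  have "?c t : Eucl n" if "t : stds n" for t using c[OF that] by simp
  thus "ssx n ?E ?c" by (intro singular_oriented_simplex) (simp add: oriented_simplex_def)
  show "inj_on ?c (stds n)"
  proof (rule inj_onI)
   fix t t' assume t: "t : stds n" "t' : stds n" "?c t = ?c t'"
   have e: "t (Suc k) = t' (Suc k)" if "k < n" for k using fun_cong[OF t(3)[unfolded c[OF t(1)] c[OF t(2)]], of k] that by simp
   have "t 0 = 1 - (SUM k<n. t (Suc k))" "t' 0 = 1 - (SUM k<n. t' (Suc k))"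
    using t(1,2) by (auto simp: standard_simplex_def sum.atMost_shift)
   hence "t 0 = t' 0" using e by simp
   moreover have "t i = t' i" if "i > n" for i using t(1,2) that by (simp add: standard_simplex_def)
   ultimately have "t i = t' i" for i using e[of "i - 1"] by (cases "i = 0"; cases "i > n") auto
   thus "t = t'" by blast
  qed
  have "?c ` itr n = Eucl n Int ({z. (SUM k<n. z k) < 1} Int (\<Inter>k<n. {z. 0 < z k}))" (is "_ = ?R")
  proof (intro equalityI subsetI)
   fix z assume "z : ?c ` itr n"
   then obtain t where t: "t : itr n" "z = ?c t" by blast
   have B: "t : stds n" using t(1) itr_sub by blast
   have "1 = t 0 + (SUM k<n. t (Suc k))" using B by (simp add: standard_simplex_def sum.atMost_shift)
   thus "z : ?R" using t by (auto simp: c[OF B] itr_def)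
  next
   fix z assume "z : ?R"
   thus "z : ?c ` itr n" using tt[of z] by (intro image_eqI[of _ _ "tt z"]) auto
  qed
  moreover have "open ({z :: nat => real. (SUM k<n. z k) < 1} Int (\<Inter>k<n. {z. 0 < z k}))"
   by (intro open_Int open_INT finite_lessThan ballI open_Collect_less continuous_on_const continuous_on_sum continuous_on_product_coordinates)
  ultimately show "opi ?E (?c ` itr n)" by (auto simp: openin_open)
 qed
 show ?thesis using generating_simplex[OF tt(1)[OF y]] tt(2)[OF y] by simp
qed

lemma simplex_relcycle:
 assumes S: "ssx n X S" and F: "!!t. t : stds n ==> S t : F ==> t : itr n"
 shows "rcy n X (tps X - F) (fof S)"
proof (cases "n = 0")
 case False
 have "ssx (n - Suc 0) (sbt X (tps X - F)) (sfc n k S)" if k: "k <= n" for k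
 proof -
  have f: "ssx (n - Suc 0) X (sfc n k S)" using singular_simplex_singular_face[OF S _ k] False by simp
  have "sfc n k S t ~: F" if t: "t : stds (n - Suc 0)" for t
  proof
   assume "sfc n k S t : F"
   hence "sfce k t : itr n"
    using F[of "sfce k t"] simplical_face_in_standard_simplex[of n k t] t k False by (simp add: singular_face_def)
   thus False using k by (auto simp: itr_def simplical_face_def)
  qed
  moreover have "sfc n k S t : tps X" if "t : stds (n - Suc 0)" for t
   using f that by (auto simp: singular_simplex_def continuous_map_def)
  ultimately show ?thesis unfolding singular_simplex_subtopology using f by auto
 qed
 thus ?thesis unfolding singular_relcycle using False S
  by (auto simp: singular_chain_of chain_boundary_of intro!: singular_chain_sum singular_chain_cmul)
qed (use S in \<open>simp add: singular_relcycle singular_chain_of chain_boundary_of\<close>)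

lemma aff_cong: "(!!i. i <= n ==> vs i = vs' i) ==> aff n vs = aff n vs'"
 unfolding aff_def by (rule restrict_ext) (simp cong: conj_cong)

lemma remove1_nth:
 assumes "distinct l" "k < length l" and that: "j < length l - 1"
 shows "remove1 (l ! k) l ! j = (if j < k then l ! j else l ! Suc j)"
proof -
 have "l = take k l @ l ! k # drop (Suc k) l" by (rule id_take_nth_drop[OF assms(2)])
 moreover have "l ! k ~: set (take k l)" using assms by (metis distinct_take in_set_conv_nth length_take less_not_refl min.absorb4 nth_eq_iff_index_eq nth_take order.strict_trans)
 ultimately have "remove1 (l ! k) l = take k l @ drop (Suc k) l" by (metis remove1.simps(2) remove1_append)
 thus ?thesis using assms(2) that by (simp add: nth_append)
qed

context tri_manifold begin

abbreviation \<sigma> where "\<sigma> s == osx n h s"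
abbreviation sgn_of where "sgn_of s == simplex_sign n (tos M) \<omega> h s"
abbreviation nsimps where "nsimps == {s : K. card s = Suc n}"
abbreviation fund where "fund == fundamental_chain n (tos M) \<omega> K h (tos M) id"

lemma finite_top: "finite nsimps" using finite_K by simp

lemma vertices_of_ordered_simplex:
 assumes "s : K" "card s = Suc m" "i <= m"
 shows "osx m h s (vx i) = h (vx (lst s ! i))"
 using trans[OF osx_apply[OF assms(1,2) vx_stds[OF assms(3)]] arg_cong[OF aff_vertex[OF assms(3)], of h]] .

lemma ordered_simplex_inject:
 assumes s: "s : K" "card s = Suc m" and t: "t : K" "card t = Suc m" and eq: "osx m h s = osx m h t"
 shows "s = t"
proof -
 have sub: "s <= t" if s: "s : K" "card s = Suc m" and t: "t : K" "card t = Suc m" and eq: "osx m h s = osx m h t" for s t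
 proof
  fix v assume "v : s"
  then obtain i where i: "i <= m" "v = lst s ! i" using enum[OF s] by (auto simp: bij_betw_def)
  have u: "lst t ! i : t" using enum[OF t] i(1) by (auto simp: bij_betw_def)
  have "h (vx v) = h (vx (lst t ! i))"
   using vertices_of_ordered_simplex[OF s i(1)] vertices_of_ordered_simplex[OF t i(1)] eq i(2) by simp
  moreover have "vx v : tps (rlz K)" "vx (lst t ! i) : tps (rlz K)"
   using in_rlz[OF s(1) vx_spts[OF simplexD(1)[OF s(1)] \<open>v \<in> s\<close>]]
    in_rlz[OF t(1) vx_spts[OF simplexD(1)[OF t(1)] u]] by simp_all
  ultimately have "vx v = vx (lst t ! i)" by (rule inj_onD[OF inj_h])
  hence "v = lst t ! i" by (auto simp: vertex_def fun_eq_iff split: if_splits)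
  thus "v : t" using u by simp
 qed
 show ?thesis by (rule equalityI[OF sub[OF s t eq] sub[OF t s eq[symmetric]]])
qed

lemma fund_gpush: "fund = gpush \<sigma> (%s. if s : nsimps then of_int (sgn_of s) else 0)"
proof
 fix T
 have "smp n id T = T" if "ssx n (tos M) T"
  using that by (simp add: singular_simplex_def extensional_restrict)
 hence "{s. s : K & card s = Suc n & ssx n (tos M) T & smp n id T = \<sigma> s} = {s : nsimps. \<sigma> s = T}"
  using ssx_osx by auto
 moreover have "sgn_of s ~= 0" if "s : nsimps" for s
 proof -
  have "sgn_of s : {1, -1}" by (rule simplex_sign(1)) (use that in simp_all)
  thus ?thesis by fastforce
 qed
 hence "{s. (if s : nsimps then of_int (sgn_of s) else 0 :: rat) ~= 0 & \<sigma> s = T} = {s : nsimps. \<sigma> s = T}" by auto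
 ultimately show "fund T = gpush \<sigma> (%s. if s : nsimps then of_int (sgn_of s) else 0) T"
  unfolding fundamental_chain_def gpush_def by (auto intro!: sum.cong)
qed

lemma face_ordered_simplex:
 assumes s: "s : nsimps" and k: "k <= n" and n: "1 <= n"
 shows "sfc n k (\<sigma> s) = osx (n - Suc 0) h (s - {lst s ! k})"
proof -
 have f: "finite s" using simplexD(1) s by blast
 have "lst (s - {lst s ! k}) ! j = (if j < k then lst s ! j else lst s ! Suc j)" if "j <= n - Suc 0" for j
  unfolding sorted_list_of_set_remove[OF f] by (rule remove1_nth) (use s k n that f in auto)
 thus ?thesis unfolding ordered_simplex_aff using k n
  by (subst sfc_smp[OF n k], subst singular_face_aff[OF n k]) (auto intro!: arg_cong[of _ _ "smp _ h"] aff_cong)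
qed

lemma fund_boundary:
 "qbd n fund T = (if n = 0 then 0 else (SUM k<=n. (-1) ^ k * (SUM s:nsimps. if sfc n k (\<sigma> s) = T then of_int (sgn_of s) else 0)))"
proof -
 let ?a = "%s. if s : nsimps then of_int (sgn_of s) else 0 :: rat"
 have sub: "{s. ?a s ~= 0 & P s} <= nsimps" for P by auto
 have "gpush (sfc n k) fund T = (SUM s:nsimps. if sfc n k (\<sigma> s) = T then of_int (sgn_of s) else 0)" for k
 proof -
  have "gpush (sfc n k) fund = gpush (%s. sfc n k (\<sigma> s)) ?a"
   unfolding fund_gpush by (rule gpush_gpush) (rule finite_subset[OF sub finite_top])
  hence "gpush (sfc n k) fund T = (SUM s:nsimps. if sfc n k (\<sigma> s) = T then ?a s else 0)"
   using gpush_on_superset[OF finite_top sub, of "%s. sfc n k (\<sigma> s)" T] by simp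
  thus ?thesis by (simp only:) (rule sum.cong, simp_all)
 qed
 thus ?thesis unfolding qbd_faces by simp
qed

end

context tri_manifold begin

text \<open>
 The \<open>n\<close>-simplices with a common face \<open>t\<close> are mapped to a half space by the barycentric coordinates of \<open>t\<close>,
 so that a local orientation class at a point of \<open>t\<close> is mapped to zero.
\<close>

lemma sign_sum_face:
 assumes n: "1 <= n" and t: "t : K" "card t = n"
  and S: "S = {s : nsimps. t <= s}"
  and pos: "!!s. s : S ==> pos s <= n & s - {lst s ! pos s} = t"
 shows "(SUM s:S. (-1) ^ pos s * sgn_of s) = 0"
proof -
 let ?X = "tos M" and ?R = "rlz K" and ?lt = "%i. lst t ! i"
 have finS: "finite S" by (rule finite_subset[OF _ finite_top]) (auto simp: S)
 have ft: "finite t" by (rule simplexD(1)[OF t(1)])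
 have et: "bij_betw ?lt {..<n} t" using bij_betw_nth[of "lst t" "{..<n}" t] ft t(2) by auto
 obtain g where g: "homeomorphic_maps ?R ?X h g" using homeo_h homeomorphic_map_maps by blast
 have gc: "cmp ?X ?R g" and gh: "!!w. w : tps ?R ==> g (h w) = w" and hg: "!!x. x : M ==> h (g x) = x"
  using g by (auto simp: homeomorphic_maps_def)
 have hM: "h w : M" if "w : tps ?R" for w using surj_h that by blast
 have gR: "g x : tps ?R" if "x : M" for x using gc that by (auto simp: continuous_map_def)
 \<comment> \<open>The barycentric coordinates at the n vertices of t. The image lies in the region
   where coordinates add up to at most 1, and t goes to the boundary of this region.\<close>
 define G where "G x i = (if i < n then g x (?lt i) else 0)" for x i
 have GE: "G x : Eucl n" for x by (simp add: G_def)
 have coord: "cmp ?R eur (%w. w v)" for v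
  by (rule cmp_from_rlz) (simp add: power_eucl continuous_on_subset[OF continuous_on_product_coordinates])
 have Gc: "cmp ?X (tos (Eucl n)) G"
  unfolding cmp_coords
 proof
  show "ALL i. cmp ?X eur (%x. G x i)"
  proof
   show "cmp ?X eur (%x. G x i)" for i
    using continuous_map_compose[OF gc coord, of "?lt i"] by (cases "i < n") (simp_all add: G_def o_def)
  qed
 qed (use GE in auto)
 \<comment> \<open>The point of s with value a at every vertex of t and the rest at the remaining
   vertex; for \<open>a = 1 / real n\<close> it is the barycentre \<open>?bt\<close> of t.\<close>
 define P where "P s a v = (if v : t then a else if v : s then 1 - real n * a else 0)" for s v and a :: real
 have S_card: "s : K" "card s = Suc n" "t <= s" "finite s" if "s : S" for s using that simplexD(1) by (auto simp: S)
 have one_more: "card (s - t) = 1" if "s : S" for s using S_card[OF that] ft t(2) by (simp add: card_Diff_subset)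
 have P_in: "P s a : spts s" if s: "s : S" and a: "a : {0..1 / real n}" for s a
 proof -
  have "sum (P s a) s = sum (P s a) t + sum (P s a) (s - t)"
   using S_card[OF s] by (subst sum.subset_diff[of t s]) (auto simp: add.commute)
  also have "sum (P s a) t = (SUM v:t. a)" by (rule sum.cong) (auto simp: P_def)
  also have "sum (P s a) (s - t) = (SUM v:s - t. 1 - real n * a)" by (rule sum.cong) (auto simp: P_def)
  finally have "sum (P s a) s = 1" using one_more[OF s] t(2) by simp
  moreover have "0 <= P s a v" for v using a n by (auto simp: P_def field_simps)
  moreover have "P s a v = 0" if "v ~: s" for v using that S_card(3)[OF s] by (auto simp: P_def)
  ultimately show ?thesis by (simp add: simplex_points_def)
 qed
 have P_R: "P s a : tps ?R" if "s : S" "a : {0..1 / real n}" for s a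
  by (rule in_rlz[OF S_card(1)[OF that(1)] P_in[OF that]])
 let ?bt = "%v. if v : t then 1 / real n else 0"
 have bt_in: "?bt : spts t" using n ft t(2) by (simp add: simplex_points_def)
 have bt_R: "?bt : tps ?R" by (rule in_rlz[OF t(1) bt_in])
 have P_bt: "P s (1 / real n) = ?bt" for s using n by (auto simp: P_def fun_eq_iff)
 \<comment> \<open>A point with equal positive coordinates at the vertices of t lies in a simplex
   that contains t; by \<open>dim_le\<close> this is t or a member of S.\<close>
 have preimage: "(EX s:S. w = P s a) \<or> (a = 1 / real n & w = ?bt)" and a_le: "a <= 1 / real n"
  if w: "w : tps ?R" and a: "0 < a" and wa: "!!v. v : t ==> w v = a" for w a
 proof -
  obtain s where s: "s : K" "w : spts s" using w by (auto simp: topspace_realization)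
  have fs: "finite s" by (rule simplexD(1)[OF s(1)])
  have p0: "0 <= w v" for v using s(2) by (simp add: simplex_points_def)
  have z: "v ~: s ==> w v = 0" for v using s(2) by (simp add: simplex_points_def)
  have sum1: "sum w s = 1" using s(2) by (simp add: simplex_points_def)
  have ts: "t <= s" using z wa a by force
  have split: "sum w t + sum w (s - t) = 1" using sum1 sum.subset_diff[OF ts fs, of w] by simp
  have sumt: "sum w t = real n * a" using wa t(2) by simp
  show "a <= 1 / real n" using split sumt sum_nonneg[of "s - t" w] p0 n by (simp add: field_simps)
  show "(EX s:S. w = P s a) \<or> (a = 1 / real n & w = ?bt)"
  proof (cases "s = t")
   case True
   hence "a = 1 / real n" using split sumt n by (simp add: field_simps)
   moreover have "w = ?bt" using wa z True \<open>a = 1 / real n\<close> by (auto simp: fun_eq_iff)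
   ultimately show ?thesis by blast
  next
   case False
   have "card t < card s" using False ts fs by (intro psubset_card_mono) auto
   hence "card s = Suc n" using dim_le[OF s(1)] t(2) by simp
   hence sS: "s : S" using s(1) ts by (simp add: S)
   obtain v where v: "s - t = {v}" using one_more[OF sS] card_1_singletonE by blast
   have "w u = P s a u" for u
   proof -
    consider "u : t" | "u = v" | "u ~: s" using v by blast
    thus ?thesis
    proof cases
     case 2
     hence "u ~: t" "u : s" using v by auto
     thus ?thesis using split sumt v 2 by (simp add: P_def)
    qed (use wa z ts in \<open>auto simp: P_def\<close>)
   qed
   thus ?thesis using sS by blast
  qed
 qed
 obtain U J where U: "opi ?X U" "h ?bt : U" and J: "rcy n ?X (M - U) J"
  "!!y. y : U ==> \<omega> y = hcl n ?X (M - {y}) J"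
  using orientation_at(3)[OF hM[OF bt_R]] by blast
 have UM: "U <= M" using U(1) openin_imp_subset by blast
 have near: "EX d>0. ALL a:{0..1 / real n}. 1 / real n - d < a --> h (P s a) : U" if s: "s : S" for s
 proof -
  let ?I = "{0..1 / real n}"
  have "cmp (tos ?I) (simplex_top s) (P s)"
   unfolding power_eucl cmp_coords
  proof
   show "ALL i. cmp (tos ?I) eur (%x. P s x i)"
   proof
    fix i
    consider "i : t" | "i ~: t" "i : s" | "i ~: t" "i ~: s" by blast
    thus "cmp (tos ?I) eur (%x. P s x i)"
     by cases (auto simp: P_def intro!: continuous_intros)
   qed
  qed (use P_in[OF s] in auto)
  hence "cmp (tos ?I) ?R (P s)" by (rule cmp_into_rlz[OF S_card(1)[OF s]])
  hence "cmp (tos ?I) ?X (h o P s)" by (rule continuous_map_compose[OF _ cont_h])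
  from openin_continuous_map_preimage[OF this U(1)]
  obtain V where V: "open V" "{a : ?I. (h o P s) a : U} = ?I Int V" by (auto simp: openin_open)
  have "1 / real n : {a : ?I. (h o P s) a : U}" using U(2) P_bt[of s] by simp
  hence "1 / real n : V" unfolding V(2) by simp
  then obtain d where d: "d > 0" "!!a. dist a (1 / real n) < d ==> a : V" using V(1) unfolding open_dist by blast
  have "h (P s a) : U" if "a : ?I" "1 / real n - d < a" for a
  proof -
   have "a : V" using d(2)[of a] that by (auto simp: dist_real_def)
   hence "a : {a : ?I. (h o P s) a : U}" unfolding V(2) using that(1) by blast
   thus ?thesis by simp
  qed
  thus ?thesis using d(1) by blast
 qed
 then obtain d where d: "!!s. s : S ==> d s > 0"
  "!!s a. s : S ==> a : {0..1 / real n} ==> 1 / real n - d s < a ==> h (P s a) : U" by metis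
 \<comment> \<open>A margin such that for every s the points \<open>P s b\<close> with b between
   \<open>1 / real n - C\<close> and \<open>1 / real n\<close> lie in U; half of the minimum keeps
   the inequalities strict.\<close>
 define C where "C = Min (insert (1 / real n) (d ` S)) / 2"
 have m0: "0 < Min (insert (1 / real n) (d ` S))" using finS d(1) n by (subst Min_gr_iff) auto
 have C: "0 < C" "C < 1 / real n" "!!s. s : S ==> C < d s"
 proof -
  have le: "Min (insert (1 / real n) (d ` S)) <= z" if "z : insert (1 / real n) (d ` S)" for z
   using finS that by (intro Min_le) auto
  show "0 < C" using m0 by (simp add: C_def)
  show "C < 1 / real n" using m0 le[of "1 / real n"] by (simp add: C_def)
  show "C < d s" if "s : S" for s using m0 le[of "d s"] that by (simp add: C_def)
 qed
 define a where "a = 1 / real n - C"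
 have a: "0 < a" "a < 1 / real n" "a : {0..1 / real n}" using C by (auto simp: a_def)
 define y where "y i = (if i < n then a else 0)" for i
 have yE: "y : Eucl n" by (simp add: y_def)
 have y_pos: "0 < y k" if "k < n" for k using that a by (simp add: y_def)
 have y_sum: "(SUM k<n. y k) < 1" using a(2) n by (simp add: y_def field_simps)
 have G_eq: "g x v = b" if Gb: "!!i. i < n ==> G x i = b" and v: "v : t" for x v b
 proof -
  obtain i where "i < n" "v = ?lt i" using et v by (auto simp: bij_betw_def)
  thus ?thesis using Gb[of i] by (simp add: G_def)
 qed
 have inU: "x : U" if x: "x : M" and b: "a <= b" and Gx: "!!i. i < n ==> G x i = b" for x b
 proof -
  have gx: "g x v = b" if "v : t" for v by (rule G_eq[OF Gx that])
  have b0: "0 < b" using a(1) b by simp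
  have "h (g x) : U"
   using preimage[OF gR[OF x] b0 gx]
  proof
   assume "EX s:S. g x = P s b"
   then obtain s where s: "s : S" "g x = P s b" by blast
   have "b : {0..1 / real n}" using a_le[OF gR[OF x] b0 gx] b0 by simp
   thus ?thesis unfolding s(2) using d(2)[OF s(1)] C(3)[OF s(1)] b by (simp add: a_def)
  qed (use U(2) in auto)
  thus ?thesis using hg[OF x] by simp
 qed
 define F where "F = (%s. h (P s a)) ` S"
 have finF: "finite F" using finS by (simp add: F_def)
 have Gx_iff: "G x = y \<longleftrightarrow> x : F" if x: "x : M" for x
 proof
  assume "G x = y"
  hence gx: "g x v = a" if "v : t" for v using G_eq[OF _ that, of x a] by (simp add: y_def)
  have "EX s:S. g x = P s a" using preimage[OF gR[OF x] a(1) gx] a(2) by auto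
  thus "x : F" using hg[OF x] by (auto simp: F_def intro!: image_eqI)
 next
  assume "x : F"
  then obtain s where s: "s : S" "x = h (P s a)" by (auto simp: F_def)
  have "g x = P s a" unfolding s(2) by (rule gh[OF P_R[OF s(1) a(3)]])
  moreover have "?lt i : t" if "i < n" for i using et that by (auto simp: bij_betw_def)
  ultimately show "G x = y" by (auto simp: G_def y_def P_def fun_eq_iff)
 qed
 have FU: "F <= U"
 proof
  fix x assume "x : F"
  hence xM: "x : M" using hM P_R a(3) by (auto simp: F_def)
  have "G x = y" using Gx_iff[OF xM] \<open>x \<in> F\<close> by simp
  thus "x : U" using inU[OF xM, of a] by (simp add: y_def)
 qed
 have FM: "F <= M" using FU UM by blast
 have in_simplex: "s' = s" "T : itr n" if s: "s : S" and s': "s' : S" and T: "T : stds n" "\<sigma> s' T = h (P s a)" for s s' T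
 proof -
  note sK = S_card(1,2)[OF s] and sK' = S_card(1,2)[OF s']
  have Ppos: "0 < P s a v" if "v : s" for v using that a n by (auto simp: P_def field_simps)
  have e: "aff n (%i. lst s' ! i) T = P s a"
   using T(2) unfolding osx_apply[OF sK' T(1)]
   by (rule inj_onD[OF inj_h]) (rule in_rlz[OF sK'(1) aff_in[OF sK' T(1)]], rule P_R[OF s a(3)])
  hence "P s a : spts s'" using aff_in[OF sK' T(1)] by simp
  hence "v : s'" if "v : s" for v using Ppos[OF that] by (auto simp: simplex_points_def)
  hence "s <= s'" by blast
  thus ss: "s' = s" using card_subset_eq[OF S_card(4)[OF s']] sK(2) sK'(2) by metis
  have "0 < T i" if "i <= n" for i
  proof -
   have "T i = P s a (lst s' ! i)" using aff_at[OF enum[OF sK'] that T(1)] e by simp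
   moreover have "lst s' ! i : s" using enum[OF sK'] that ss by (auto simp: bij_betw_def)
   ultimately show ?thesis using Ppos by simp
  qed
  thus "T : itr n" using T(1) by (simp add: itr_def)
 qed
 \<comment> \<open>The orientation class minus the signed simplices. At each preimage of y only one
   simplex contributes, and it does so with the right sign; hence L vanishes along F and its image
   under G vanishes at y.\<close>
 define L where "L = J - (SUM s:S. fcm (sgn_of s) (fof (\<sigma> s)))"
 have cyc: "rcy n ?X (M - F) L"
  unfolding L_def
 proof (intro singular_relcycle_diff singular_relcycle_sum singular_relcycle_cmul)
  show "rcy n ?X (M - F) J" by (rule relcycle_mono[OF J(1)]) (use FU in blast)
  fix s assume s: "s : S"
  have "rcy n ?X (tps ?X - F) (fof (\<sigma> s))"
  proof (rule simplex_relcycle[OF ssx_osx[OF S_card(1,2)[OF s]]])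
   fix T assume "T : stds n" "\<sigma> s T : F"
   thus "T : itr n" using in_simplex(2)[OF _ s] by (auto simp: F_def)
  qed
  thus "rcy n ?X (M - F) (fof (\<sigma> s))" by simp
 qed
 have zero: "rbd n ?X (M - {x}) L" if x: "x : F" for x
 proof -
  obtain s where s: "s : S" "x = h (P s a)" using x by (auto simp: F_def)
  have "0 < P s a v" if "v : s" for v using that a n by (auto simp: P_def field_simps)
  hence "x : h ` {w : tps ?R. ALL v:s. 0 < w v}" unfolding s(2)
   using P_R[OF s(1) a(3)] by (intro imageI) simp
  then obtain q where q: "q : itr n" "x = \<sigma> s q"
   unfolding interior_image[OF S_card(1,2)[OF s(1)], symmetric] by blast
  have xU: "x : U" using x FU by blast
  have "hcl n ?X (M - {x}) J = hcl n ?X (M - {x}) (fcm (sgn_of s) (fof (\<sigma> s)))"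
   using simplex_sign(2)[OF S_card(1,2)[OF s(1)] q(1), folded q(2)] J(2)[OF xU] by (rule trans[OF sym, rotated])
  hence "homologous_rel n ?X (M - {x}) J (fcm (sgn_of s) (fof (\<sigma> s)))" unfolding homologous_rel_set_eq .
  hence 1: "rbd n ?X (M - {x}) (J - fcm (sgn_of s) (fof (\<sigma> s)))" by (simp add: homologous_rel_def)
  have 2: "rbd n ?X (M - {x}) (SUM s':S - {s}. fcm (sgn_of s') (fof (\<sigma> s')))"
  proof (intro singular_chain_imp_relboundary singular_chain_sum singular_chain_cmul)
   fix s' assume s': "s' : S - {s}"
   hence ss: "ssx n ?X (\<sigma> s')" using ssx_osx[OF S_card(1,2)[of s']] by simp
   have "\<sigma> s' T ~= x" if "T : stds n" for T using in_simplex(1)[OF s(1) _ that, of s'] s' s(2) by blast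
   thus "singular_chain n (sbt ?X (M - {x})) (fof (\<sigma> s'))"
    unfolding singular_chain_of using ss singular_simplex_subtopology[of n ?X "M - {x}"]
    unfolding ssx_iff by blast
  qed
  have "L = J - fcm (sgn_of s) (fof (\<sigma> s)) - (SUM s':S - {s}. fcm (sgn_of s') (fof (\<sigma> s')))"
   unfolding L_def using sum.remove[OF finS s(1), of "%s'. fcm (sgn_of s') (fof (\<sigma> s'))"] by (simp add: algebra_simps)
  thus ?thesis using singular_relboundary_diff[OF 1 2] by simp
 qed
 have "rbd n ?X (tps ?X - F) L"
 proof (rule relboundary_finite[OF finF])
  show "closedin ?X {x}" if "x : F" for x
   using closedin_Hausdorff_singleton[OF haus] that FM by auto
 qed (use cyc zero in auto)
 hence b1: "rbd n (tos (Eucl n)) (Eucl n - {y}) (chain_map n G L)"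
  by (rule singular_relboundary_chain_map[OF _ Gc]) (use Gx_iff GE in auto)
 \<comment> \<open>G with \<open>2 * C\<close> subtracted from every coordinate. A point sent to y
   by it would have coordinates \<open>a + 2 * C = 1 / real n + C\<close>, beyond the image of G.
   During the movement only points of U pass through y, so the image of J vanishes at y.\<close>
 define G' where "G' x i = (if i < n then G x i - 2 * C else 0)" for x i
 have G'c: "cmp ?X (tos (Eucl n)) G'"
  unfolding cmp_coords
 proof
  have "cmp ?X eur (%x. G x i)" for i
   using Gc unfolding cmp_coords by blast
  thus "ALL i. cmp ?X eur (%x. G' x i)"
   unfolding G'_def by (intro allI, case_tac "i < n") (auto intro!: continuous_intros)
 qed (auto simp: G'_def)
 have hom: "homotopic_with (%f. f : M - U \<rightarrow> Eucl n - {y}) ?X (tos (Eucl n)) G G'"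
 proof (rule line_homotopic[OF Gc G'c])
  fix x u assume u: "u : {0..1::real}"
  show E: "(%i. (1 - u) * G x i + u * G' x i) : Eucl n" by (simp add: G_def G'_def)
  { assume x: "x : M - U"
   have "(%i. (1 - u) * G x i + u * G' x i) ~= y"
   proof
    assume e: "(%i. (1 - u) * G x i + u * G' x i) = y"
    have "G x i = a + u * (2 * C)" if "i < n" for i
     using fun_cong[OF e, of i] that by (simp add: G'_def y_def algebra_simps)
    hence "x : U" using inU[of x "a + u * (2 * C)"] x u C(1) by simp
    thus False using x by blast
   qed
   thus "(%i. (1 - u) * G x i + u * G' x i) : Eucl n - {y}" using E by blast }
 qed
 have "G' x ~= y" if x: "x : M" for x
 proof
  assume e: "G' x = y"
  have "G x i = a + 2 * C" if "i < n" for i using fun_cong[OF e, of i] that by (simp add: G'_def y_def)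
  hence "g x v = a + 2 * C" if "v : t" for v using G_eq[OF _ that] by simp
  hence "a + 2 * C <= 1 / real n" using a_le[OF gR[OF x], of "a + 2 * C"] a(1) C(1) by simp
  thus False using C(1) by (simp add: a_def)
 qed
 hence G'im: "G' : M \<rightarrow> Eucl n - {y}" by (auto simp: G'_def)
 have "singular_chain n (sbt ?X M) J" using J(1) by (simp add: singular_relcycle subtopology_subtopology)
 hence "rbd n ?X M J" by (rule singular_chain_imp_relboundary)
 hence "rbd n (tos (Eucl n)) (Eucl n - {y}) (chain_map n G' J)"
  by (rule singular_relboundary_chain_map[OF _ G'c G'im])
 moreover have "rbd n (tos (Eucl n)) (Eucl n - {y}) (chain_map n G J - chain_map n G' J)"
  by (rule homotopic_relboundary[OF hom J(1)])
 ultimately have b2: "rbd n (tos (Eucl n)) (Eucl n - {y}) (chain_map n G J)"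
  using singular_relboundary_add by fastforce
 let ?c = "%j. fof (orsx n (corner j)) :: (nat => real) chain"
 \<comment> \<open>In the coordinates G the simplex s becomes a corner, its vertex outside t being
   sent to the origin; the position of that vertex in s decides which corner it is.\<close>
 have push: "smp n G (\<sigma> s) = orsx n (corner (pos s))" if s: "s : S" for s
 proof
  fix T
  note sK = S_card(1,2)[OF s]
  have p: "pos s <= n" "t = s - {lst s ! pos s}" using pos[OF s] by auto
  show "smp n G (\<sigma> s) T = orsx n (corner (pos s)) T"
  proof (cases "T : stds n")
   case True
   have lt: "?lt i = (if i < pos s then lst s ! i else lst s ! Suc i)" if "i < n" for i
    unfolding p(2) sorted_list_of_set_remove[OF S_card(4)[OF s]]
    by (rule remove1_nth) (use that p(1) sK(2) S_card(4)[OF s] in auto)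
   have "g (\<sigma> s T) = aff n (%i. lst s ! i) T"
    unfolding osx_apply[OF sK True] by (rule gh[OF in_rlz[OF sK(1) aff_in[OF sK True]]])
   hence "G (\<sigma> s T) = (%k. if k < n then T (if k < pos s then k else Suc k) else 0)"
    using aff_at[OF enum[OF sK] _ True] by (auto simp: G_def lt fun_eq_iff)
   thus ?thesis using corner_apply[OF p(1) True] smp_apply[OF True, of G "\<sigma> s"] by simp
  next
   case False
   thus ?thesis by (simp add: simplex_map_def oriented_simplex_def)
  qed
 qed
 let ?B = "rbd n (tos (Eucl n)) (Eucl n - {y})"
 have "chain_map n G J - chain_map n G L = (SUM s:S. fcm (sgn_of s) (?c (pos s)))"
  unfolding chain_map_diff[symmetric] L_def by (simp add: chain_map_sum[OF finS] push cong: sum.cong)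
 hence "?B (SUM s:S. fcm (sgn_of s) (?c (pos s)))" using singular_relboundary_diff[OF b2 b1] by simp
 moreover have "?B (SUM s:S. fcm (sgn_of s) (?c (pos s) - fcm ((-1) ^ pos s) (?c 0)))"
 proof -
  have "?B (SUM s:S'. fcm (sgn_of s) (?c (pos s) - fcm ((-1) ^ pos s) (?c 0)))" if "finite S'" "S' <= S" for S'
   using that
  proof (induction S')
   case (insert s S')
   have "?B (fcm (sgn_of s) (?c (pos s) - fcm ((-1) ^ pos s) (?c 0)))"
    using corner_sign[where y=y and n=n and j="pos s", OF y_pos] pos insert.prems by (intro singular_relboundary_cmul) auto
   thus ?case using insert by (simp add: singular_relboundary_add)
  qed simp
  thus ?thesis using finS by blast
 qed
 ultimately have "?B ((SUM s:S. fcm (sgn_of s) (?c (pos s))) - (SUM s:S. fcm (sgn_of s) (?c (pos s) - fcm ((-1) ^ pos s) (?c 0))))"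
  by (rule singular_relboundary_diff)
 moreover have "fcm k x - fcm k (x - z) = fcm k z" for k and x z :: "(nat => real) chain"
  using frag_cmul_distrib2[of k "x - z" z] by simp
 ultimately have "?B (SUM s:S. fcm (sgn_of s) (fcm ((-1) ^ pos s) (?c 0)))"
  by (simp add: sum_subtractf[symmetric])
 moreover have "(SUM s:S. fcm (sgn_of s) (fcm ((-1) ^ pos s) (?c 0))) = fcm (SUM s:S. (-1) ^ pos s * sgn_of s) (?c 0)"
  using finS by (induction S) (simp_all add: frag_cmul_distrib mult.commute)
 ultimately show ?thesis using corner_generating[OF yE y_pos y_sum] by (simp add: generating_def)
qed

text \<open>A face T that occurs is the ordered simplex of some t with n vertices. Each n-simplex
  containing t has it as a face exactly once, at the position \<open>pos s\<close>, so the
  coefficient at T is the alternating sum of \<open>sign_sum_face\<close>.\<close>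

lemma fund_cycle: "qbd n fund = (%_. 0)"
proof
 fix T
 show "qbd n fund T = 0"
 proof (cases "n = 0")
  case False
  hence n: "1 <= n" by simp
  let ?l = "%s k. lst s ! k"
  let ?f = "%s k. if sfc n k (\<sigma> s) = T then (-1) ^ k * of_int (sgn_of s) else 0 :: rat"
  have "qbd n fund T = (SUM k<=n. SUM s:nsimps. ?f s k)"
   unfolding fund_boundary using False by (simp add: sum_distrib_left if_distrib cong: if_cong)
  also have "... = (SUM s:nsimps. SUM k<=n. ?f s k)" by (rule sum.swap)
  also have "... = 0"
  proof (cases "EX s0:nsimps. EX k0<=n. sfc n k0 (\<sigma> s0) = T")
   case False
   thus ?thesis by (intro sum.neutral ballI) auto
  next
   case True
   then obtain s0 k0 where s0: "s0 : nsimps" "k0 <= n" "sfc n k0 (\<sigma> s0) = T" by blast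
   define t where "t = s0 - {?l s0 k0}"
   have rem: "s - {?l s k} : K" "card (s - {?l s k}) = n" "?l s k : s" if s: "s : nsimps" and k: "k <= n" for s k
   proof -
    have sK: "s : K" "card s = Suc n" using s by auto
    show e: "?l s k : s" using enum[OF sK] k by (auto simp: bij_betw_def)
    show c: "card (s - {?l s k}) = n" using e sK simplexD(1)[OF sK(1)] by simp
    have "s - {?l s k} ~= {}" using c n by (metis card.empty not_one_le_zero)
    thus "s - {?l s k} : K" by (intro simplexD(3)[OF sK(1)]) auto
   qed
   have face: "sfc n k (\<sigma> s) = T \<longleftrightarrow> s - {?l s k} = t" if s: "s : nsimps" and k: "k <= n" for s k
   proof -
    have T: "T = osx (n - Suc 0) h t"
     unfolding t_def s0(3)[symmetric] by (rule face_ordered_simplex[OF s0(1,2) n])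
    have c: "card (s - {?l s k}) = Suc (n - Suc 0)" "card t = Suc (n - Suc 0)"
     using rem(2)[OF s k] rem(2)[OF s0(1,2)] n by (simp_all add: t_def)
    have "t : K" using rem(1)[OF s0(1,2)] by (simp add: t_def)
    thus ?thesis unfolding face_ordered_simplex[OF s k n] T
     using ordered_simplex_inject[OF rem(1)[OF s k] c(1) _ c(2)] by metis
   qed
   define S where "S = {s : nsimps. t <= s}"
   have tK: "t : K" "card t = n" using rem[OF s0(1,2)] by (auto simp: t_def)
   have ex: "EX k<=n. s - {?l s k} = t" if s: "s : S" for s
   proof -
    have sK: "s : K" "card s = Suc n" "t <= s" using s by (auto simp: S_def)
    have "card (s - t) = 1" using sK tK simplexD(1)[OF tK(1)] by (simp add: card_Diff_subset)
    then obtain v where v: "s - t = {v}" using card_1_singletonE by blast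
    then obtain k where "k <= n" "v = ?l s k" using enum[OF sK(1,2)] by (auto simp: bij_betw_def)
    moreover have "s - {v} = t" using v sK(3) by blast
    ultimately show ?thesis by blast
   qed
   define pos where "pos s = (SOME k. k <= n & s - {?l s k} = t)" for s
   have pos: "pos s <= n & s - {?l s (pos s)} = t" if "s : S" for s
    unfolding pos_def using ex[OF that] by (rule someI_ex)
   have "(SUM k<=n. ?f s k) = (if s : S then (-1) ^ pos s * of_int (sgn_of s) else 0)" if s: "s : nsimps" for s
   proof (cases "s : S")
    case True
    have "sfc n k (\<sigma> s) = T \<longleftrightarrow> k = pos s" if k: "k <= n" for k
    proof -
     have "k = pos s" if "s - {?l s k} = t"
     proof -
      have "?l s k = ?l s (pos s)" using that pos[OF True] rem(3)[OF s k] rem(3)[OF s, of "pos s"] by blast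
      thus ?thesis using enum[of s n] s k pos[OF True] by (auto simp: bij_betw_def inj_on_def)
     qed
     thus ?thesis unfolding face[OF s k] using pos[OF True] by blast
    qed
    hence "(SUM k<=n. ?f s k) = (SUM k<=n. if k = pos s then (-1) ^ k * of_int (sgn_of s) else 0)"
     by (intro sum.cong refl) simp
    thus ?thesis using True pos[OF True] by simp
   next
    case False
    have "sfc n k (\<sigma> s) ~= T" if k: "k <= n" for k
     unfolding face[OF s k] using False s by (auto simp: S_def)
    thus ?thesis using False by simp
   qed
   hence "(SUM s:nsimps. SUM k<=n. ?f s k) = (SUM s:nsimps. if s : S then (-1) ^ pos s * of_int (sgn_of s) else 0)"
    by (rule sum.cong[OF refl])
   also have "... = (SUM s:S. (-1) ^ pos s * of_int (sgn_of s))"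
    by (subst sum.inter_filter[symmetric, OF finite_top], rule sum.cong) (auto simp: S_def)
   also have "... = of_int (SUM s:S. (-1) ^ pos s * sgn_of s)" by simp
   also have "... = 0" using sign_sum_face[OF n tK S_def pos] by simp
   finally show ?thesis .
  qed
  finally show ?thesis .
 qed (subst fund_boundary, simp)
qed

end

section \<open>The fundamental cycle of the covering and its image in a nerve\<close>

locale macro = tri_manifold n M A \<omega> K h
 for n :: nat and M :: "'a::topological_space set" and A :: "'a chart set" and \<omega> :: "'a => 'a chain set"
  and K :: "'v::linorder set set" and h :: "('v => real) => 'a" +
 fixes g :: "'a chart => 'a => nat => nat => real"
  and Mt :: "'b::topological_space set" and p :: "'b => 'a"
  and \<U> :: "nat => 'b set set" and r :: "nat => 'b set => 'b set" and m :: nat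
 assumes metric: "riemannian_metric n A g" and covering: "universal_covering Mt p M"
  and coarsening: "coarsening_sequence (tos Mt) (riem_dist n A g Mt p) \<U>"
  and refinement: "refinement_maps \<U> r"
  and balls: "\<U> m = ball_cover K h (tos Mt) p (riem_dist n A g Mt p)"

lemma simply_connected_connected:
 fixes S :: "'b::topological_space set"
 assumes S: "simply_connected S" shows "connected S"
proof (rule path_connected_imp_connected, unfold path_connected_def, intro ballI)
 fix a b assume "a : S" "b : S"
 hence "homotopic_loops S (%_. a) (%_. b)"
  by (intro S[unfolded simply_connected_def, rule_format]) (auto simp: path_def path_image_def pathstart_def pathfinish_def)
 then obtain k :: "real \<times> real => 'b" where k: "con ({0..1} \<times> {0..1}) k" "k : {0..1} \<times> {0..1} \<rightarrow> S"
  "ALL x:{0..1}. k (0, x) = a" "ALL x:{0..1}. k (1, x) = b"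
  unfolding homotopic_loops by blast
 have "path (%t. k (t, 0))" unfolding path_def
  by (rule continuous_on_compose2[OF k(1)]) (auto intro!: continuous_intros)
 moreover have "pim (%t. k (t, 0)) <= S" using k(2) by (auto simp: path_image_def)
 ultimately show "EX g. path g & pim g <= S & pathstart g = a & pathfinish g = b"
  using k(3,4) by (intro exI[of _ "%t. k (t, 0)"]) (simp add: pathstart_def pathfinish_def)
qed

sublocale macro \<subseteq> riem_cover n M A g Mt p
proof
 show "compact M" "Hausdorff_space (tos M)" by (fact compact_M haus)+
 show "smooth_atlas n (tos M) A" using manifold by (simp add: closed_oriented_manifold_def)
 show "riemannian_metric n A g" by (fact metric)
 show "covering_space Mt p M" "connected Mt"
  using covering simply_connected_connected by (auto simp: universal_covering_def)
qed

context macro begin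

lemma Hausdorff_Mt: "Hausdorff_space (tos Mt)"
 unfolding Hausdorff_space_def
proof (intro allI impI)
 fix x y assume "x : tps (tos Mt) & y : tps (tos Mt) & x ~= y"
 hence xy: "x : Mt" "y : Mt" "x ~= y" by auto
 show "EX U V. opi (tos Mt) U & opi (tos Mt) V & x : U & y : V & disjnt U V"
 proof (cases "p x = p y")
  case True
  obtain T N where T: "p x : T" "opi (tos M) T" and V: "\<Union>N = Mt Int p -` T"
   "!!u. u : N ==> opi (tos Mt) u" "pairwise disjnt N" "!!u. u : N ==> EX q. homeomorphism u T p q"
   using cov_sheet[OF cov p_img[OF xy(1)]] by metis
  have "x : \<Union>N" "y : \<Union>N" unfolding V(1) using xy T True by auto
  then obtain u u' where u: "u : N" "x : u" "u' : N" "y : u'" by blast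
  obtain q where "homeomorphism u T p q" using V(4)[OF u(1)] by blast
  hence "u ~= u'" using u True xy(3) by (metis homeomorphism_apply1)
  hence "disjnt u u'" using V(3) u by (auto simp: pairwise_def)
  thus ?thesis using u V(2) by blast
 next
  case False
  then obtain U V where UV: "opi (tos M) U" "opi (tos M) V" "p x : U" "p y : V" "disjnt U V"
   using haus p_img xy unfolding Hausdorff_space_def by (metis topspace_euclidean_subtopology)
  have "opi (tos Mt) (Mt Int p -` W)" if "opi (tos M) W" for W
   by (rule open_preim[OF p_cont _ that]) (use p_img in auto)
  thus ?thesis using UV xy by (rule_tac exI[of _ "Mt Int p -` U"], rule_tac exI[of _ "Mt Int p -` V"]) (simp add: disjnt_iff)
 qed
qed

lemma finite_fibre:
 assumes C: "compact C" "C <= Mt" and z: "z : M"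
 shows "finite {y : C. p y = z}"
proof -
 obtain T W where T: "z : T" "opi (tos M) T" and V: "\<Union>W = Mt Int p -` T"
   "!!u. u : W ==> opi (tos Mt) u" "pairwise disjnt W" "!!u. u : W ==> EX q. homeomorphism u T p q"
  using cov_sheet[OF cov z] by metis
 define S where "S = {y : C. p y = z}"
 have "compact (C Int p -` {z})" by (rule compact_preimage_Int[OF C]) (use z in auto)
 moreover have "C Int p -` {z} = S" by (auto simp: S_def)
 ultimately have cS: "compact S" by simp
 have SV: "S <= \<Union>W" unfolding V(1) using C T by (auto simp: S_def)
 obtain N where D: "N <= W" "finite N" "S <= \<Union>N"
  by (rule compact_open_cover[OF cS _ V(2) SV]) (use C in \<open>auto simp: S_def\<close>)
 have "finite (S Int u)" if u: "u : N" for u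
 proof -
  obtain q where q: "homeomorphism u T p q" using V(4) D(1) u by blast
  have "S Int u <= {q z}" unfolding S_def using homeomorphism_apply1[OF q] by auto
  thus ?thesis by (rule finite_subset) simp
 qed
 hence "finite (UN u:N. S Int u)" using D(2) by blast
 hence "finite S" by (rule finite_subset[rotated]) (use D(3) in blast)
 thus ?thesis by (simp add: S_def)
qed

lemma compact_bounded:
 assumes C: "compact C" "C <= Mt" and x0: "x0 : Mt"
 shows "EX R. ALL y:C. D x0 y <= R & D y x0 <= R"
proof -
 have "EX W. opi (tos Mt) W & y : W & (ALL x:W. ALL x':W. D x x' <= 1)" if y: "y : Mt" for y
 proof -
  obtain W where W: "opi (tos Mt) W" "y : W" "!!x x'. x : W ==> x' : W ==> EX L<1. joins x x' L"
   using local_nhd[OF y, of 1] by (metis zero_less_one)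
  have "D x x' <= 1" if x: "x : W" "x' : W" for x x'
  proof -
   obtain L where "L < 1" "joins x x' L" using W(3)[OF x] by blast
   thus ?thesis using D_le[of x x' L] by simp
  qed
  thus ?thesis using W(1,2) by blast
 qed
 then obtain W where W: "!!y. y : Mt ==> opi (tos Mt) (W y)" "!!y. y : Mt ==> y : W y"
  "!!y x x'. y : Mt ==> x : W y ==> x' : W y ==> D x x' <= 1" by metis
 obtain F0 where "F0 <= W ` C" "finite F0" "C <= \<Union>F0"
  by (rule compact_open_cover[OF C, of "W ` C"]) (use W(1) C(2) in blast, use W(2) C(2) in blast)
 then obtain F where F: "F <= C" "finite F" "C <= \<Union>(W ` F)" by (metis finite_subset_image)
 define B where "B = Max (insert 0 ((%y. max (D x0 y) (D y x0)) ` F)) + 1"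
 have "D x0 y <= B & D y x0 <= B" if y: "y : C" for y
 proof -
  obtain a where a: "a : F" "y : W a" using F(3) y by blast
  have aM: "a : Mt" "y : Mt" using a F(1) C(2) y by auto
  have "max (D x0 a) (D a x0) <= Max (insert 0 ((%y. max (D x0 y) (D y x0)) ` F))" using F(2) a(1) by (intro Max_ge) auto
  hence "max (D x0 a) (D a x0) + 1 <= B" unfolding B_def by simp
  moreover have "D a y <= 1" "D y a <= 1" using W(3)[OF aM(1)] W(2)[OF aM(1)] a(2) by auto
  ultimately show ?thesis using D_triangle[OF x0 aM] D_triangle[OF aM(2,1) x0] by linarith
 qed
 thus ?thesis by blast
qed

text \<open>Values of T outside the simplex are left open, so one lift has many representatives;
  where lifts are counted, \<open>T : extensional (spts s)\<close> is added.\<close>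

definition lift :: "'v set => (('v => real) => 'b) => bool" where
 "lift s T \<longleftrightarrow> s : K & con (spts s) T & T : spts s \<rightarrow> Mt & (ALL w:spts s. p (T w) = h w)"

lemma lifted_simplices_iff: "(s, T) : lifted_simplices K h (tos Mt) p \<longleftrightarrow> lift s T"
 by (auto simp: lifted_simplices_def lift_def cmp_stop)

lemma liftD:
 assumes "lift s T"
 shows "s : K" "finite s" "s ~= {}" "con (spts s) T" "T : spts s \<rightarrow> Mt"
  "!!w. w : spts s ==> p (T w) = h w" "!!w. w : spts s ==> T w : Mt"
 using assms simplexD unfolding lift_def by blast+

lemma h_simplex: "s : K ==> con (spts s) h" "s : K ==> h : spts s \<rightarrow> M"
 using continuous_map_compose[OF cmp_simplex_rlz cont_h, of s]
 by (simp_all add: cmp_stop o_def)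

lemma lift_ex:
 assumes s: "s : K" "w : spts s" and x: "x : Mt" "p x = h w"
 obtains T where "lift s T" "T w = x" "T : extensional (spts s)"
proof -
 obtain T where t: "con (spts s) T" "T : spts s \<rightarrow> Mt" "T w = x"
  "!!w. w : spts s ==> p (T w) = h w"
  using simplex_points_lift[OF cov h_simplex[OF s(1)] s(2) x] by metis
 let ?t = "restrict T (spts s)"
 have "con (spts s) ?t" using t(1) by (rule continuous_on_eq) simp
 hence "lift s ?t" using t s by (auto simp: lift_def)
 thus thesis by (rule that) (use t(3) s(2) in auto)
qed

lemma lift_through:
 assumes x: "x : Mt"
 obtains s w T where "lift s T" "w : spts s" "T w = x" "T : extensional (spts s)"
proof -
 obtain w where w: "w : tps (rlz K)" "h w = p x" using surj_h p_img[OF x] by (metis imageE)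
 then obtain s where s: "s : K" "w : spts s" by (auto simp: topspace_realization)
 from lift_ex[OF s x w(2)[symmetric]] show thesis using that s(2) by metis
qed

lemma lift_unique:
 assumes "lift s T" "lift s B" "w : spts s" "T w = B w" "w' : spts s"
 shows "T w' = B w'"
 using assms liftD(6)[OF assms(1)] liftD(6)[OF assms(2)]
 by (intro simplex_points_lift_unique[OF cov liftD(4,5)[OF assms(1)] liftD(4,5)[OF assms(2)] _ assms(3,4,5)]) simp

lemma lift_face:
 assumes "lift s T" "t <= s" "t ~= {}" shows "lift t T"
proof -
 have sub: "spts t <= spts s"
 proof
  fix w assume w: "w : spts t"
  have "sum w s = sum w t" using assms(2) liftD(2)[OF assms(1)] w by (intro sum.mono_neutral_right) (auto simp: simplex_points_def)
  thus "w : spts s" using w assms(2) by (auto simp: simplex_points_def)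
 qed
 thus ?thesis using assms simplexD(3)[OF liftD(1)[OF assms(1)] assms(2,3)] unfolding lift_def
  by (auto intro: continuous_on_subset)
qed

lemma lift_bound: "EX R. ALL s T w w'. lift s T & w : spts s & w' : spts s --> D (T w) (T w') <= R"
proof -
 have "EX R. ALL T. con (spts s) T & T : spts s \<rightarrow> Mt & (ALL w:spts s. p (T w) = h w) -->
  (ALL w:spts s. ALL w':spts s. D (T w) (T w') <= R)" if s: "s : K" for s
  by (rule lift_diameter[OF simplexD(1,2)[OF s] h_simplex[OF s]])
 then obtain R where R: "!!s T. s : K ==> con (spts s) T & T : spts s \<rightarrow> Mt & (ALL w:spts s. p (T w) = h w) ==>
  (ALL w:spts s. ALL w':spts s. D (T w) (T w') <= R s)" by metis
 have "D (T w) (T w') <= Max (R ` K)" if "lift s T & w : spts s & w' : spts s" for s T w w'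
 proof -
  have sK: "s : K" using that liftD(1) by blast
  have "D (T w) (T w') <= R s" using R[OF sK, of T] that by (simp add: lift_def)
  also have "... <= Max (R ` K)" using sK finite_K by simp
  finally show ?thesis .
 qed
 thus ?thesis by blast
qed

abbreviation (input) "\<mu> == mesh K h (tos Mt) p D"
abbreviation (input) "vball == vertex_ball K h (tos Mt) p D"

text \<open>The supremum in \<open>mesh\<close> is over a bounded set, by
  \<open>lift_bound\<close>.\<close>

lemma lift_mesh:
 assumes "lift s T" "w : spts s" "w' : spts s"
 shows "D (T w) (T w') <= \<mu>"
 unfolding mesh_def
proof (rule cSup_upper)
 show "D (T w) (T w') : {D (T w) (T w') |s T w w'.
  (s, T) : lifted_simplices K h (tos Mt) p & w : spts s & w' : spts s}"
  using assms lifted_simplices_iff by blast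
 obtain R where "ALL s T w w'. lift s T & w : spts s & w' : spts s --> D (T w) (T w') <= R"
  using lift_bound by blast
 thus "bdd_above {D (T w) (T w') |s T w w'.
  (s, T) : lifted_simplices K h (tos Mt) p & w : spts s & w' : spts s}"
  by (intro bdd_aboveI[of _ R]) (auto simp: lifted_simplices_iff)
qed

lemma Mt_nonempty: "Mt ~= {}"
proof -
 have "M ~= {}" using manifold by (simp add: closed_oriented_manifold_def)
 thus ?thesis using covering_space_imp_surjective[OF cov] by blast
qed

lemma cover: "\<Union>(\<U> i) = Mt" and cover_open: "V : \<U> i ==> opi (tos Mt) V"
 and cover_sub: "V : \<U> i ==> V <= Mt" and cover_lf: "locally_finite_in (tos Mt) (\<U> i)"
 using coarsening by (auto simp: coarsening_sequence_def)

text \<open>The balls cover a nonempty space; without a positive mesh all of them would be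
  empty.\<close>

lemma mesh_pos: "0 < \<mu>"
proof -
 have "\<Union>(\<U> m) ~= {}" using cover Mt_nonempty by simp
 then obtain x y where "x : lifted_vertices K h (tos Mt) p" "y : vball x" by (auto simp: balls ball_cover_def)
 hence "x : Mt" "y : Mt" "D x y < 2 * \<mu>" by (auto simp: lifted_vertices_def vertex_ball_def)
 thus ?thesis using D_nonneg[of x y] by simp
qed

text \<open>A lift is determined by its simplex and the position of one vertex. If it meets C, its
  bounded diameter confines that vertex to a compact set C', and a fibre meets C' in finitely many
  points.\<close>

lemma finite_lifts_meeting:
 assumes C: "compact C" "C <= Mt"
 shows "finite {(s, t). lift s t & t : extensional (spts s) & t ` spts s Int C ~= {}}" (is "finite ?L")
proof -
 obtain R where R: "!!s t w w'. lift s t ==> w : spts s ==> w' : spts s ==> D (t w) (t w') <= R"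
  using lift_bound by blast
 obtain x0 where x0: "x0 : Mt" using Mt_nonempty by blast
 obtain R' where R': "!!y. y : C ==> D x0 y <= R'" using compact_bounded[OF C x0] by blast
 obtain C' where C': "compact C'" "C' <= Mt" "{y : Mt. D x0 y < R' + R + 1} <= C'" by (rule bounded_compact[OF x0]) blast
 define b where "b s = vx (SOME v. v : s)" for s :: "'v set"
 have b: "b s : spts s" if "s : K" for s
  unfolding b_def using simplexD(1,2)[OF that] by (intro vx_spts) (auto intro: someI_ex)
 let ?T = "Sigma K (%s. {y : C'. p y = h (b s)})"
 have "h (b s) : M" if "s : K" for s using h_simplex(2)[OF that] b[OF that] by blast
 hence fin: "finite ?T" using finite_K finite_fibre[OF C'(1,2)] by (intro finite_SigmaI) auto
 have "(s, t (b s)) : ?T" if l: "lift s t" and ne: "t ` spts s Int C ~= {}" for s t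
 proof -
  from ne obtain w where w: "w : spts s" "t w : C" by blast
  note bs = b[OF liftD(1)[OF l]]
  have "D x0 (t (b s)) <= D x0 (t w) + D (t w) (t (b s))"
   by (rule D_triangle[OF x0 liftD(7)[OF l w(1)] liftD(7)[OF l bs]])
  hence "D x0 (t (b s)) < R' + R + 1" using R'[OF w(2)] R[OF l w(1) bs] by simp
  thus ?thesis
   using C'(3) liftD(7)[OF l bs] liftD(6)[OF l bs] liftD(1)[OF l] by blast
 qed
 hence sub: "(%(s, t). (s, t (b s))) ` ?L <= ?T" by auto
 have inj: "inj_on (%(s, t). (s, t (b s))) ?L"
 proof (rule inj_onI)
  fix z z' assume z: "z : ?L" "z' : ?L" and eq: "(%(s, t). (s, t (b s))) z = (%(s, t). (s, t (b s))) z'"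
  obtain s t s' B where z': "z = (s, t)" "z' = (s', B)" by fastforce
  have l: "lift s t" "lift s B" and e: "t : extensional (spts s)" "B : extensional (spts s)"
   and bb: "t (b s) = B (b s)" and ss: "s = s'" using z eq unfolding z' by auto
  have "t = B" by (rule extensionalityI[OF e]) (rule lift_unique[OF l b[OF liftD(1)[OF l(1)]] bb])
  thus "z = z'" using ss z' by simp
 qed
 show ?thesis by (rule inj_on_finite[OF inj sub fin])
qed

lemma spm_spm:
 assumes "finite s" "w : spts s"
 shows "spm f (spm f' w) = spm (%v. f (f' v)) w"
proof -
 have ne: "s ~= {}" using assms(2) by (auto simp: simplex_points_def)
 obtain k :: nat and vs where vs: "bij_betw vs {..k} s" using ex_enum[OF assms(1) ne] by metis
 from aff_surj[OF vs assms(2)] obtain t where t: "t : stds k" "aff k vs t = w" by blast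
 show ?thesis unfolding t(2)[symmetric] simplicial_map_aff[OF t(1)] by simp
qed

lemma simplicial_map_cong: "(!!v. w v ~= 0 ==> f v = f' v) ==> spm f w = spm f' w"
 unfolding simplicial_map_def by (rule ext, rule sum.cong) auto

text \<open>The definite description is unambiguous: a point of Mt determines its barycentric
  coordinates w by injectivity of h, and two lifts through the point agree on the face that carries
  w.\<close>

lemma lifted_coords_eq:
 assumes l: "lift s T" and w: "w : spts s"
 shows "lifted_coords K h (tos Mt) p (T w) = spm (%v. T (vx v)) w"
 unfolding lifted_coords_def
proof (rule the_equality)
 show "EX (s', B):lifted_simplices K h (tos Mt) p. EX w':spts s'. B w' = T w &
  spm (%v. T (vx v)) w = spm (%v. B (vx v)) w'"
  using l w by (intro bexI[of _ "(s, T)"]) (auto simp: lifted_simplices_iff)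
 fix b assume "EX (s', B):lifted_simplices K h (tos Mt) p. EX w':spts s'. B w' = T w &
  b = spm (%v. B (vx v)) w'"
 then obtain s' B w' where l': "lift s' B" and w': "w' : spts s'" and eq: "B w' = T w"
  and b: "b = spm (%v. B (vx v)) w'" by (auto simp: lifted_simplices_iff)
 have "h w' = h w" using liftD(6)[OF l w] liftD(6)[OF l' w'] eq by simp
 hence ww: "w' = w" using inj_h in_rlz liftD(1)[OF l] liftD(1)[OF l'] w w' by (auto simp: inj_on_def)
 define f where "f = {v. w v ~= 0}"
 have fs: "f <= s" "f <= s'" using w w' ww by (auto simp: f_def simplex_points_def)
 have wf: "w : spts f"
 proof -
  have "sum w s = sum w f" using fs(1) liftD(2)[OF l] by (intro sum.mono_neutral_right) (auto simp: f_def)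
  thus ?thesis using w by (auto simp: simplex_points_def f_def)
 qed
 hence "f ~= {}" by (auto simp: simplex_points_def)
 hence lf: "lift f T" "lift f B" using lift_face l l' fs by blast+
 have "B (vx v) = T (vx v)" if "w v ~= 0" for v
  by (rule lift_unique[OF lf(2,1) wf]) (use eq ww that liftD(2)[OF lf(1)] in \<open>auto simp: f_def intro: vx_spts\<close>)
 thus "b = spm (%v. T (vx v)) w" unfolding b ww by (rule simplicial_map_cong)
qed

lemma to_nerve_eq:
 assumes l: "lift s T" and w: "w : spts s"
 shows "to_nerve K h (tos Mt) p D (T w) = spm (%v. vball (T (vx v))) w"
 unfolding to_nerve_def lifted_coords_eq[OF l w] by (rule spm_spm[OF liftD(2)[OF l] w])

lemma lift_vertex:
 assumes l: "lift s T" and v: "v : s"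
 shows "T (vx v) : lifted_vertices K h (tos Mt) p" "T (vx v) : Mt" "vball (T (vx v)) : \<U> m"
  "w : spts s ==> T w : vball (T (vx v))"
proof -
 have vs: "vx v : spts s" by (rule vx_spts[OF liftD(2)[OF l] v])
 show t: "T (vx v) : Mt" by (rule liftD(7)[OF l vs])
 have "{v} : K" using simplexD(3)[OF liftD(1)[OF l]] v by blast
 thus 1: "T (vx v) : lifted_vertices K h (tos Mt) p"
  using t liftD(6)[OF l vs] by (auto simp: lifted_vertices_def)
 thus "vball (T (vx v)) : \<U> m" by (simp add: balls ball_cover_def)
 show "T w : vball (T (vx v))" if w: "w : spts s"
  using lift_mesh[OF l vs w] mesh_pos liftD(7)[OF l w] by (simp add: vertex_ball_def)
qed

end

section \<open>Vanishing of the coarse fundamental class\<close>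

lemma direct_limit_class_one:
 assumes one: "!!i. F i \<one>\<^bsub>G i\<^esub> = \<one>\<^bsub>G (Suc i)\<^esub>" and x: "x : carrier (G m)"
 shows "direct_limit_class G F m x = \<one>\<^bsub>direct_limit G F\<^esub> \<longleftrightarrow> (EX k>=m. bonding F m k x = \<one>\<^bsub>G k\<^esub>)"
proof -
 have b1: "bonding F i k \<one>\<^bsub>G i\<^esub> = \<one>\<^bsub>G k\<^esub>" if "i <= k" for i k
  using that by (induction rule: dec_induct) (simp_all add: bonding_def one)
 have trans: "bonding F i l y = bonding F k l (bonding F i k y)" if "i <= k" "k <= l" for i k l y
 proof -
  have "[i..<l] = [i..<k] @ [k..<l]" using upt_add_eq_append[of i k "l - k"] that by simp
  thus ?thesis by (simp add: bonding_def)
 qed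
 have oneG: "\<one>\<^bsub>direct_limit G F\<^esub> = direct_limit_class G F 0 \<one>\<^bsub>G 0\<^esub>" by (simp add: direct_limit_def)
 show ?thesis unfolding oneG
 proof
  assume e: "direct_limit_class G F m x = direct_limit_class G F 0 \<one>\<^bsub>G 0\<^esub>"
  have "(m, x) : direct_limit_class G F m x" using x by (auto simp: direct_limit_class_def)
  then obtain k where "m <= k" "bonding F 0 k \<one>\<^bsub>G 0\<^esub> = bonding F m k x"
   unfolding e by (auto simp: direct_limit_class_def)
  thus "EX k>=m. bonding F m k x = \<one>\<^bsub>G k\<^esub>" using b1[of 0 k] by auto
 next
  assume "EX k>=m. bonding F m k x = \<one>\<^bsub>G k\<^esub>"
  then obtain k0 where k0: "k0 >= m" "bonding F m k0 x = \<one>\<^bsub>G k0\<^esub>" by blast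
  have late: "bonding F m k x = \<one>\<^bsub>G k\<^esub>" if "k >= k0" for k
   using trans[OF k0(1) that, of x] k0(2) b1[OF that] by simp
  have "(EX k. m <= k & j <= k & bonding F m k x = bonding F j k y) \<longleftrightarrow> (EX k. 0 <= k & j <= k & bonding F 0 k \<one>\<^bsub>G 0\<^esub> = bonding F j k y)" for j y
  proof
   assume "EX k. m <= k & j <= k & bonding F m k x = bonding F j k y"
   then obtain k where k: "m <= k" "j <= k" "bonding F m k x = bonding F j k y" by blast
   let ?l = "max k k0"
   have "bonding F j ?l y = bonding F m ?l x" using trans[of j k ?l y] trans[of m k ?l x] k by simp
   thus "EX k. 0 <= k & j <= k & bonding F 0 k \<one>\<^bsub>G 0\<^esub> = bonding F j k y"
    using late[of ?l] b1[of 0 ?l] k by (intro exI[of _ ?l]) auto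
  next
   assume "EX k. 0 <= k & j <= k & bonding F 0 k \<one>\<^bsub>G 0\<^esub> = bonding F j k y"
   then obtain k where k: "j <= k" "bonding F j k y = \<one>\<^bsub>G k\<^esub>" using b1 by auto
   let ?l = "max k k0"
   have "bonding F j ?l y = \<one>\<^bsub>G ?l\<^esub>" using trans[of j k ?l y] k b1[of k ?l] by simp
   thus "EX k. m <= k & j <= k & bonding F m k x = bonding F j k y"
    using late[of ?l] k k0(1) by (intro exI[of _ ?l]) auto
  qed
  thus "direct_limit_class G F m x = direct_limit_class G F 0 \<one>\<^bsub>G 0\<^esub>" by (simp add: direct_limit_class_def)
 qed
qed

lemma lf_class_one:
 "qhc (lfc X) q z = \<one>\<^bsub>qhg (lfc X) q\<^esub> \<longleftrightarrow> z : qbd (Suc q) ` lfc X (Suc q)"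
proof
 assume e: "qhc (lfc X) q z = \<one>\<^bsub>qhg (lfc X) q\<^esub>"
 have z: "(%_. 0) : qbd (Suc q) ` lfc X (Suc q)" by (rule image_eqI[of _ _ "%_. 0"]) simp_all
 have "(%S. 0 + z S) : qhc (lfc X) q z"
  unfolding qhomology_class_eq by (rule CollectI, rule exI[of _ "%_. 0"]) (use z in simp)
 thus "z : qbd (Suc q) ` lfc X (Suc q)" unfolding e one_qhomology_group by simp
next
 assume "z : qbd (Suc q) ` lfc X (Suc q)"
 from qhomology_class_boundary[OF this, of "%_. 0"]
 show "qhc (lfc X) q z = \<one>\<^bsub>qhg (lfc X) q\<^esub>" by (simp add: qhomology_class_zero)
qed

context macro begin

abbreviation nspc where "nspc i == rlz (nerve (\<U> i))"
abbreviation ct where "ct == transfer n Mt p fund"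

lemma cover_compact: assumes V: "V : \<U> i" shows "EX C. compact C & C <= Mt & V <= C"
proof (cases "V = {}")
 case False
 then obtain x where x: "x : V" by blast
 obtain R where R: "ALL V:\<U> i. ALL x:V. ALL y:V. D x y <= R" using coarsening unfolding coarsening_sequence_def by meson
 have xM: "x : Mt" using cover_sub[OF V] x by blast
 obtain C where C: "compact C" "C <= Mt" "{y : Mt. D x y < R + 1} <= C" by (rule bounded_compact[OF xM]) blast
 have "V <= C"
 proof
  fix y assume y: "y : V"
  have "D x y <= R" using R V x y by blast
  thus "y : C" using C(3) y cover_sub[OF V] by auto
 qed
 thus ?thesis using C by blast
qed auto

lemma ex_cover: "x : Mt ==> EX V:\<U> i. x : V" using cover[of i] by blast

lemma finite_cover_meeting:
 assumes C: "compact C" "C <= Mt" shows "finite {V : \<U> i. V Int C ~= {}}"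
proof -
 have "ALL x:Mt. EX W. opi (tos Mt) W & x : W & finite {U : \<U> i. U Int W ~= {}}"
  using cover_lf[of i] by (simp add: locally_finite_in_def)
 from bchoice[OF this] obtain W where W': "ALL x:Mt. opi (tos Mt) (W x) & x : W x & finite {U : \<U> i. U Int W x ~= {}}"
  by (elim exE) (rule that)
 have W: "opi (tos Mt) (W x)" "x : W x" "finite {U : \<U> i. U Int W x ~= {}}" if "x : Mt" for x
  using bspec[OF W' that] by simp_all
 obtain F where F: "F <= W ` C" "finite F" "C <= \<Union>F"
  by (rule compact_open_cover[OF C, of "W ` C"]) (use W(1) C(2) in blast, use W(2) C(2) in blast)
 have "finite {V : \<U> i. V Int w ~= {}}" if "w : F" for w using F(1) W(3) C(2) that by blast
 hence "finite (UN w:F. {V : \<U> i. V Int w ~= {}})" using F(2) by blast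
 moreover have "{V : \<U> i. V Int C ~= {}} <= (UN w:F. {V : \<U> i. V Int w ~= {}})" using F(3) by blast
 ultimately show ?thesis by (rule finite_subset[rotated])
qed

lemma nerve_refine: "s : nerve (\<U> i) ==> r i ` s : nerve (\<U> (Suc i))"
proof -
 assume s: "s : nerve (\<U> i)"
 then obtain x where "!!V. V : s ==> x : V" by (auto simp: nerve_def)
 hence "x : \<Inter>(r i ` s)" using s refinement unfolding nerve_def refinement_maps_def by blast
 thus ?thesis using s refinement unfolding nerve_def refinement_maps_def by auto
qed

text \<open>A member sent to W is contained in W, which lies in a compact set; only finitely many
  members meet that set.\<close>

lemma lf_proper_refine: "lf_proper (nspc i) (nspc (Suc i)) (spm (r i))"
proof (rule lf_proper_simplicial_map[OF cplx_nerve cplx_nerve nerve_refine])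
 fix W
 show "finite {V. {V} : nerve (\<U> i) & r i V = W}"
 proof (cases "EX V. {V} : nerve (\<U> i) & r i V = W")
  case True
  hence "W : \<U> (Suc i)" using refinement by (auto simp: nerve_def refinement_maps_def)
  from cover_compact[OF this] obtain C where C: "compact C" "C <= Mt" "W <= C" by blast
  have "{V. {V} : nerve (\<U> i) & r i V = W} <= {V : \<U> i. V Int C ~= {}}"
  proof
   fix V assume "V : {V. {V} : nerve (\<U> i) & r i V = W}"
   hence V: "V : \<U> i" "V ~= {}" "r i V = W" by (auto simp: nerve_def)
   hence "V <= C" using C(3) refinement unfolding refinement_maps_def by blast
   thus "V : {V : \<U> i. V Int C ~= {}}" using V by auto
  qed
  thus ?thesis using finite_cover_meeting[OF C(1,2)] by (rule finite_subset)
 next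
  case False
  hence "{V. {V} : nerve (\<U> i) & r i V = W} = {}" by blast
  thus ?thesis by (simp only: finite.emptyI)
 qed
qed

lemma fund_support: assumes "fund R ~= 0" obtains s where "s : K" "card s = Suc n" "R = \<sigma> s"
proof -
 from gpush_nonzero[OF assms[unfolded fund_gpush]]
 obtain s where s: "(if s : nsimps then of_int (sgn_of s) else 0 :: rat) ~= 0" "\<sigma> s = R" by blast
 have "s : nsimps" by (rule ccontr) (use s(1) in \<open>simp only: if_False\<close>)
 thus thesis using that[of s] s(2) by simp
qed

lemma fund_simplex: "fund R ~= 0 ==> ssx n (tos M) R"
 using fund_support ssx_osx by metis

lemma fundamental_chain_cover: "fundamental_chain n (tos M) \<omega> K h (tos Mt) p = ct"
proof
 fix T
 have "ssx n (tos M) (smp n p T)" if "ssx n (tos Mt) T"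
  by (rule singular_simplex_simplex_map[OF that]) (use p_cont p_img in auto)
 moreover have "smp n id (smp n p T) = smp n p T" by (simp add: simplex_map_def)
 ultimately show "fundamental_chain n (tos M) \<omega> K h (tos Mt) p T = ct T"
  by (simp add: fundamental_chain_def transfer_def)
qed

lemma lifted_simplex:
 fixes T :: "('v => real) => 'b"
 assumes l: "lift s T" and card: "card s = Suc n"
 defines "R == smp n T (aff n (%i. lst s ! i))"
 shows "ssx n (tos Mt) R" "smp n p R = \<sigma> s"
proof -
 let ?a = "aff n (%i. lst s ! i)"
 note s = liftD(1)[OF l] card
 have "cmp (sbt (powertop_real UNIV) (stds n)) (simplex_top s) ?a"
  using enum[OF s] by (intro continuous_map_aff[OF _ liftD(2)[OF l]]) (auto simp: bij_betw_def)
 hence "ssx n (simplex_top s) ?a" unfolding singular_simplex_def by (simp add: aff_def)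
 thus "ssx n (tos Mt) R"
  unfolding R_def by (rule singular_simplex_simplex_map) (use liftD(4,5)[OF l] in \<open>simp add: cmp_stop\<close>)
 show "smp n p R = \<sigma> s"
 proof
  fix t show "smp n p R t = \<sigma> s t"
  proof (cases "t : stds n")
   case True
   thus ?thesis using osx_apply[OF s True] liftD(6)[OF l aff_in[OF s True]] by (simp add: R_def smp_apply)
  qed (simp add: simplex_map_def ordered_simplex_def)
 qed
qed

lemma ct_support:
 assumes "ct R ~= 0"
 obtains s T where "lift s T" "T : extensional (spts s)" "card s = Suc n"
  "R = smp n T (aff n (%i. lst s ! i))" "smp n p R = \<sigma> s"
proof -
 have R: "ssx n (tos Mt) R" "fund (smp n p R) ~= 0"
  using assms by (auto simp: transfer_def split: if_splits)
 obtain s where s: "s : K" "card s = Suc n" "smp n p R = \<sigma> s" using fund_support[OF R(2)] by metis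
 let ?a = "aff n (%i. lst s ! i)"
 have v0: "vx 0 : stds n" by (rule vx_stds) simp
 have "p (R (vx 0)) = h (?a (vx 0))"
  using osx_apply[OF s(1,2) v0] smp_apply[OF v0, of p R] s(3) by simp
 moreover have "R (vx 0) : Mt" using R(1) v0 unfolding ssx_iff by blast
 ultimately obtain T where T: "lift s T" "T (?a (vx 0)) = R (vx 0)" "T : extensional (spts s)"
  using lift_ex[OF s(1) aff_in[OF s(1,2) v0]] by metis
 note L = lifted_simplex[OF T(1) s(2)]
 have "R = smp n T ?a"
  by (rule ssx_unique[OF cov R(1) L(1) _ v0]) (simp_all only: s(3) L(2) smp_apply[OF v0] T(2))
 thus thesis using that T(1,3) s(2,3) by blast
qed

lemma ct_lf: "ct : lfc (tos Mt) n"
 unfolding lf_chains_def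
proof (rule CollectI, intro conjI allI impI)
 show "ssx n (tos Mt) R" if "ct R ~= 0" for R using that by (auto simp: transfer_def split: if_splits)
 fix C assume "compactin (tos Mt) C"
 hence C: "compact C" "C <= Mt" by (auto simp: compactin_subtopology)
 let ?L = "{(s, T). lift s T & T : extensional (spts s) & T ` spts s Int C ~= {}}"
 let ?f = "%(s, T). smp n T (aff n (%i. lst s ! i))"
 have "R : ?f ` ?L" if R: "ct R ~= 0" and ne: "R ` stds n Int C ~= {}" for R
 proof -
  obtain s T where s: "lift s T" "T : extensional (spts s)" "card s = Suc n"
   "R = smp n T (aff n (%i. lst s ! i))" using ct_support[OF R] by metis
  obtain t where t: "t : stds n" "R t : C" using ne by blast
  have "T (aff n (%i. lst s ! i) t) : C" using t s(4) by (simp add: smp_apply)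
  hence "T ` spts s Int C ~= {}" using aff_in[OF liftD(1)[OF s(1)] s(3) t(1)] by blast
  hence "(s, T) : ?L" using s(1,2) by simp
  thus ?thesis using s(4) by (intro image_eqI[of _ _ "(s, T)"]) auto
 qed
 hence "{R. ct R ~= 0 & R ` stds n Int C ~= {}} <= ?f ` ?L" by blast
 thus "finite {R. ct R ~= 0 & R ` stds n Int C ~= {}}"
  by (rule finite_subset) (rule finite_imageI[OF finite_lifts_meeting[OF C]])
qed

lemma ct_cycle: "qbd n ct = (%_. 0)"
proof (cases n)
 case 0
 thus ?thesis by (simp add: qboundary_def)
next
 case (Suc k)
 have "qbd (Suc k) (transfer (Suc k) Mt p c) = transfer k Mt p (qbd (Suc k) c)"
  if "!!R. c R ~= 0 ==> ssx (Suc k) (tos M) R" for c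
  by (rule transfer_boundary[OF cov that])
 from this[of fund, folded Suc, OF fund_simplex] show ?thesis unfolding fund_cycle by (simp add: transfer_def)
qed

text \<open>The passage from compact sets of a nerve back to the covering space: finitely many
  members occur in Q, and each of them lies in a compact set because it is bounded.\<close>

lemma compact_nerve_vertices:
 assumes "compactin (nspc i) Q"
 obtains C where "compact C" "C <= Mt" "!!V w. w : Q ==> w V ~= 0 ==> V <= C"
proof -
 let ?W = "{V. EX w:Q. w V ~= 0}"
 have fin: "finite ?W" by (rule compact_rlz_finite[OF cplx_nerve assms])
 have "V : \<U> i" if V: "V : ?W" for V
 proof -
  obtain w where w: "w : Q" "w V ~= 0" using V by blast
  hence "w : tps (nspc i)" using compactin_subset_topspace[OF assms] by blast
  then obtain s where "s : nerve (\<U> i)" "w : spts s" by (auto simp: topspace_realization)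
  thus ?thesis using w(2) by (auto simp: nerve_def simplex_points_def)
 qed
 hence "ALL V:?W. EX C. compact C & C <= Mt & V <= C" using cover_compact by blast
 from bchoice[OF this] obtain C where C': "ALL V:?W. compact (C V) & C V <= Mt & V <= C V"
  by (elim exE) (rule that)
 have C: "compact (C V)" "C V <= Mt" "V <= C V" if "V : ?W" for V using bspec[OF C' that] by simp_all
 show thesis
 proof (rule that[of "\<Union>(C ` ?W)"])
  show "compact (\<Union>(C ` ?W))" using fin C(1) by (intro compact_UN) auto
  show "\<Union>(C ` ?W) <= Mt" using C(2) by blast
  show "V <= \<Union>(C ` ?W)" if "w : Q" "w V ~= 0" for V w using C(3)[of V] that by blast
 qed
qed

lemma to_nerve_simplex:
 assumes l: "lift s T"
 shows "(%v. vball (T (vx v))) ` s : nerve (\<U> m)"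
proof -
 obtain v where v: "v : s" using liftD(3)[OF l] by blast
 hence "T (vx v) : \<Inter>((%v. vball (T (vx v))) ` s)"
  using lift_vertex(4)[OF l] vx_spts[OF liftD(2)[OF l] v] by blast
 thus ?thesis using lift_vertex(3)[OF l] liftD(2,3)[OF l] by (auto simp: nerve_def)
qed

text \<open>Continuity is glued from the lifted simplices, a locally finite closed cover of Mt; each
  is homeomorphic to its model, where the map is simplicial. For properness, x lies in the balls
  around the vertices of its simplex, and those of positive weight occur in the image of x.\<close>

lemma to_nerve_proper: "lf_proper (tos Mt) (nspc m) (to_nerve K h (tos Mt) p D)"
 unfolding lf_proper_def
proof (intro conjI allI impI)
 let ?I = "{(s, t). lift s t & t : extensional (spts s)}" and ?N = "to_nerve K h (tos Mt) p D"
 let ?T = "%(s, t). t ` spts s"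
 have compT: "compactin (tos Mt) (t ` spts s)" if l: "lift s t" for s t
  using image_compactin[OF compact_spts[OF liftD(2,3)[OF l]], of "tos Mt" t] liftD(4,5)[OF l]
  by (simp add: cmp_stop del: compactin_subtopology)
 show "cmp (tos Mt) (nspc m) ?N"
 proof (rule pasting_lemma_locally_finite[where I="?I" and T="?T" and f="%_. ?N"])
  fix x assume "x : tps (tos Mt)"
  hence x: "x : Mt" by simp
  obtain V where V: "V : \<U> m" "x : V" using ex_cover[OF x] by blast
  obtain C where C: "compact C" "C <= Mt" "V <= C" using cover_compact[OF V(1)] by blast
  have "{i : ?I. ?T i Int V ~= {}} <= {(s, t). lift s t & t : extensional (spts s) & t ` spts s Int C ~= {}}"
   using C(3) by auto
  hence "finite {i : ?I. ?T i Int V ~= {}}" using finite_lifts_meeting[OF C(1,2)] by (rule finite_subset)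
  thus "EX V. opi (tos Mt) V & x : V & finite {i : ?I. ?T i Int V ~= {}}"
   using cover_open[OF V(1)] V(2) by blast
  obtain s w t where "lift s t" "w : spts s" "t w = x" "t : extensional (spts s)" using lift_through[OF x] by metis
  thus "EX j. j : ?I & x : ?T j & ?N x = ?N x" by (intro exI[of _ "(s, t)"]) auto
 next
  fix i assume "i : ?I"
  then obtain s t where i: "i = (s, t)" "lift s t" by auto
  show "closedin (tos Mt) (?T i)" unfolding i(1) prod.case by (rule compactin_imp_closedin[OF Hausdorff_Mt compT[OF i(2)]])
  let ?S = "spts s"
  have TM: "t ` ?S <= Mt" using liftD(5)[OF i(2)] by blast
  have "homeomorphic_map (simplex_top s) (tos (t ` ?S)) t"
  proof (rule continuous_imp_homeomorphic_map)
   show "cmp (simplex_top s) (tos (t ` ?S)) t" using liftD(4)[OF i(2)] by (auto simp: cmp_stop)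
   show "compact_space (simplex_top s)"
    using compact_spts[OF liftD(2,3)[OF i(2)]] by (simp add: compact_space_def)
   show "Hausdorff_space (tos (t ` ?S))"
    using Hausdorff_space_subtopology[OF Hausdorff_Mt, of "t ` ?S"] TM by (simp add: subtopology_subtopology Int_absorb1)
   show "inj_on t (tps (simplex_top s))"
   proof (rule inj_onI)
    fix w w' assume w: "w : tps (simplex_top s)" "w' : tps (simplex_top s)" "t w = t w'"
    hence "h w = h w'" using liftD(6)[OF i(2), of w] liftD(6)[OF i(2), of w'] by simp
    thus "w = w'" using inj_h in_rlz[OF liftD(1)[OF i(2)]] w by (auto simp: inj_on_def)
   qed
  qed simp
  then obtain g where g: "homeomorphic_maps (simplex_top s) (tos (t ` ?S)) t g" unfolding homeomorphic_map_maps by metis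
  let ?m = "spm (%v. vball (t (vx v)))"
  have "cmp (simplex_top s) (nspc m) ?m"
   by (rule cmp_into_rlz[OF to_nerve_simplex[OF i(2)] cmp_spm_simplex[OF liftD(2)[OF i(2)]]])
  moreover have "cmp (tos (t ` ?S)) (simplex_top s) g" using g by (simp add: homeomorphic_maps_def)
  ultimately have "cmp (tos (t ` ?S)) (nspc m) (?m o g)" by (rule continuous_map_compose[rotated])
  moreover have "(?m o g) x = ?N x" if x: "x : tps (tos (t ` ?S))" for x
  proof -
   obtain w where w: "w : ?S" "x = t w" using x by auto
   have "g x = w" using g w by (auto simp: homeomorphic_maps_def)
   thus ?thesis using to_nerve_eq[OF i(2) w(1)] w(2) by simp
  qed
  ultimately have "cmp (tos (t ` ?S)) (nspc m) ?N" by (rule continuous_map_eq)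
  thus "cmp (sbt (tos Mt) (?T i)) (nspc m) ?N"
   using TM by (simp add: i(1) subtopology_subtopology Int_absorb1)
 qed auto
 fix Q assume Q: "compactin (nspc m) Q"
 obtain C where C: "compact C" "C <= Mt" "!!V w. w : Q ==> w V ~= 0 ==> V <= C" using compact_nerve_vertices[OF Q] by metis
 have "x : C" if x: "x : Mt" "?N x : Q" for x
 proof -
  obtain s w t where l: "lift s t" "w : spts s" "t w = x" using lift_through[OF x(1)] by metis
  have "EX v:s. w v ~= 0"
  proof (rule ccontr)
   assume "~ (EX v:s. w v ~= 0)"
   hence "sum w s = 0" by simp
   thus False using l(2) by (simp add: simplex_points_def)
  qed
  then obtain v where v: "v : s" "w v ~= 0" by blast
  have "?N x (vball (t (vx v))) > 0"
   unfolding l(3)[symmetric] to_nerve_eq[OF l(1,2)] by (rule simplicial_map_pos[OF liftD(2)[OF l(1)] l(2) v(2)])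
  hence "vball (t (vx v)) <= C" using C(3)[OF x(2)] by simp
  thus ?thesis using lift_vertex(4)[OF l(1) v(1) l(2)] l(3) by blast
 qed
 thus "EX Q'. compactin (tos Mt) Q' & {x : tps (tos Mt). ?N x : Q} <= Q'"
  using C(1,2) by (intro exI[of _ C]) (auto simp: compactin_subtopology)
qed

text \<open>The new vertices \<open>F R j\<close> have to meet R. Members that occur in a compact
  part of the nerve lie in a compact set of Mt, and only finitely many simplices of the locally
  finite chain \<open>ct\<close> meet that set.\<close>

lemma lf_aff_push:
 assumes F: "!!R. ct R ~= 0 ==> F R ` {..q} : nerve (\<U> i)"
  "!!R j. ct R ~= 0 ==> j <= q ==> F R j Int R ` stds n ~= {}"
 shows "gpush (%R. aff q (F R)) ct : lfc (nspc i) q" "fib_finite (%R. aff q (F R)) ct"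
proof -
 have s: "ssx q (nspc i) (aff q (F R))" if "ct R ~= 0" for R
  by (rule ssx_aff[OF cplx_nerve F(1)[OF that]])
 have fin: "finite {R. ct R ~= 0 & aff q (F R) ` stds q Int Q ~= {}}" if Q: "compactin (nspc i) Q" for Q
 proof -
  obtain C where C: "compact C" "C <= Mt" "!!V w. w : Q ==> w V ~= 0 ==> V <= C" using compact_nerve_vertices[OF Q] by metis
  have "{R. ct R ~= 0 & aff q (F R) ` stds q Int Q ~= {}} <= {R. ct R ~= 0 & R ` stds n Int C ~= {}}"
  proof (rule Collect_mono, rule impI, elim conjE, rule conjI)
   fix R assume R: "ct R ~= 0" and "aff q (F R) ` stds q Int Q ~= {}"
   from aff_meets[OF this(2)] obtain j w where "j <= q" "w : Q" "w (F R j) ~= 0" by blast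
   thus "R ` stds n Int C ~= {}" using C(3)[of w "F R j"] F(2)[OF R, of j] by blast
  qed
  moreover have "finite {R. ct R ~= 0 & R ` stds n Int C ~= {}}"
   using ct_lf C(1,2) unfolding lf_chains_def by (simp add: compactin_subtopology)
  ultimately show ?thesis by (rule finite_subset)
 qed
 show "gpush (%R. aff q (F R)) ct : lfc (nspc i) q" by (rule lf_gpush(1)[OF s fin])
 show "fib_finite (%R. aff q (F R)) ct" by (rule lf_gpush(2)[OF s fin])
qed

text \<open>The image of the lifted fundamental cycle when each vertex x is replaced by the member
  \<open>f x\<close> of a cover and the simplices are filled in affinely. No continuity is asked of
  f.\<close>

definition vchain :: "('b => 'b set) => ('b set => real) qchain" where
 "vchain f = gpush (%R. aff n (%i. f (R (vx i)))) ct"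

definition ball_at :: "nat => 'b => 'b set" where "ball_at k x = fold r [m..<k] (vball x)"

lemma ball_at_Suc: "m <= k ==> ball_at (Suc k) x = r k (ball_at k x)" by (simp add: ball_at_def)

lemma ball_at_in:
 assumes "vball x : \<U> m" "m <= k" shows "ball_at k x : \<U> k & vball x <= ball_at k x"
 using assms(2)
proof (induction rule: dec_induct)
 case base
 thus ?case using assms(1) by (simp add: ball_at_def)
next
 case (step k)
 thus ?case using refinement unfolding ball_at_Suc[OF step.hyps(1)] refinement_maps_def by blast
qed

lemma ct_vertex:
 assumes "ct R ~= 0" "i <= n"
 shows "R (vx i) : Mt" "vball (R (vx i)) : \<U> m" "!!t. t : stds n ==> R t : vball (R (vx i))"
  "R (vx i) : lifted_vertices K h (tos Mt) p"
proof -
 obtain s T where s: "lift s T" "card s = Suc n" "R = smp n T (aff n (%i. lst s ! i))" using ct_support[OF assms(1)] by metis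
 have v: "R (vx i) = T (vx (lst s ! i))"
  unfolding s(3) smp_apply[OF vx_stds[OF assms(2)]] aff_vertex[OF assms(2)] ..
 have i: "lst s ! i : s" using enum[OF liftD(1)[OF s(1)] s(2)] assms(2) by (auto simp: bij_betw_def)
 show "R (vx i) : Mt" "vball (R (vx i)) : \<U> m" "R (vx i) : lifted_vertices K h (tos Mt) p"
  using lift_vertex(1-3)[OF s(1) i] unfolding v by auto
 show "R t : vball (R (vx i))" if "t : stds n" for t
 proof -
  have "R t = T (aff n (%i. lst s ! i) t)" unfolding s(3) smp_apply[OF that] ..
  thus ?thesis using lift_vertex(4)[OF s(1) i aff_in[OF liftD(1)[OF s(1)] s(2) that]] v by simp
 qed
qed

lemma ball_at_nerve:
 assumes R: "ct R ~= 0" and k: "m <= k"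
 shows "(%i. ball_at k (R (vx i))) ` {..n} : nerve (\<U> k)" "i <= n ==> ball_at k (R (vx i)) Int R ` stds n ~= {}"
  "i <= n ==> j <= n ==> R (vx j) : ball_at k (R (vx i))"
proof -
 have vb: "R (vx j) : ball_at k (R (vx i))" if "i <= n" "j <= n" for i j
  using ball_at_in[OF ct_vertex(2)[OF R that(1)] k] ct_vertex(3)[OF R that(1) vx_stds[OF that(2)]] by blast
 thus "i <= n ==> j <= n ==> R (vx j) : ball_at k (R (vx i))" by blast
 have "R (vx 0) : \<Inter>((%i. ball_at k (R (vx i))) ` {..n})" using vb[of _ 0] by auto
 thus "(%i. ball_at k (R (vx i))) ` {..n} : nerve (\<U> k)"
  using ball_at_in[OF ct_vertex(2)[OF R] k] by (auto simp: nerve_def)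
 show "i <= n ==> ball_at k (R (vx i)) Int R ` stds n ~= {}"
  using vb[of i i] vx_stds by blast
qed

lemma vchain_lf: "m <= k ==> vchain (ball_at k) : lfc (nspc k) n"
 unfolding vchain_def by (rule lf_aff_push(1)) (use ball_at_nerve in auto)

lemma push_to_nerve: "qpush n (to_nerve K h (tos Mt) p D) ct = vchain (ball_at m)"
 unfolding qpush_gpush vchain_def
proof (rule gpush_cong)
 fix R assume "ct R ~= 0"
 then obtain s T where s: "lift s T" "card s = Suc n" "R = smp n T (aff n (%i. lst s ! i))" using ct_support by metis
 let ?a = "aff n (%i. lst s ! i)"
 have v: "ball_at m (R (vx i)) = vball (T (vx (lst s ! i)))" if "i <= n" for i
  unfolding s(3) smp_apply[OF vx_stds[OF that]] aff_vertex[OF that] by (simp add: ball_at_def)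
 have "smp n (to_nerve K h (tos Mt) p D) R = smp n (spm (%v. vball (T (vx v)))) ?a"
 proof
  fix t
  show "smp n (to_nerve K h (tos Mt) p D) R t = smp n (spm (%v. vball (T (vx v)))) ?a t"
  proof (cases "t : stds n")
   case True
   thus ?thesis unfolding s(3) smp_apply[OF True] by (intro to_nerve_eq[OF s(1)] aff_in[OF liftD(1)[OF s(1)] s(2)])
  qed (simp add: simplex_map_def)
 qed
 also have "... = aff n (%i. vball (T (vx (lst s ! i))))" by (rule smp_spm_aff)
 also have "... = aff n (%i. ball_at m (R (vx i)))" by (rule aff_cong) (simp add: v)
 finally show "smp n (to_nerve K h (tos Mt) p D) R = aff n (%i. ball_at m (R (vx i)))" .
qed

lemma push_refine:
 assumes k: "m <= k"
 shows "qpush n (spm (r k)) (vchain (ball_at k)) = vchain (ball_at (Suc k))"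
proof -
 have e: "smp n (spm (r k)) (aff n (%i. ball_at k (R (vx i)))) = aff n (%i. ball_at (Suc k) (R (vx i)))" for R
  unfolding smp_spm_aff ball_at_Suc[OF k] ..
 have "fib_finite (%R. aff n (%i. ball_at (Suc k) (R (vx i)))) ct"
  by (rule lf_aff_push(2)[of _ n "Suc k"]) (use ball_at_nerve k in auto)
 hence "gpush (smp n (spm (r k))) (gpush (%R. aff n (%i. ball_at k (R (vx i)))) ct)
  = gpush (%R. smp n (spm (r k)) (aff n (%i. ball_at k (R (vx i))))) ct"
  unfolding fib_finite_def by (intro gpush_gpush) (simp add: e)
 thus ?thesis unfolding qpush_gpush vchain_def e .
qed

text \<open>The refinement maps act on vertices, so the class at stage k is represented by
  \<open>vchain (ball_at k)\<close>; and a class dies in a direct limit exactly if it dies at a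
  finite stage. Both parts of the theorem start from this form.\<close>

lemma macroscopically_large_iff:
 "macroscopically_large n (tos M) \<omega> K h (tos Mt) p D \<U> r m \<longleftrightarrow>
  (ALL k>=m. vchain (ball_at k) ~: qbd (Suc n) ` lfc (nspc k) (Suc n))"
proof -
 let ?G = "nerve_homology \<U> n" and ?F = "nerve_bonding \<U> r n"
 let ?x = "%k. qhc (lfc (nspc k)) n (vchain (ball_at k))"
 have one: "?F i \<one>\<^bsub>?G i\<^esub> = \<one>\<^bsub>?G (Suc i)\<^esub>" for i by (rule qhomology_map_one[OF lf_proper_refine])
 have bond: "bonding ?F m k (?x m) = ?x k" if "m <= k" for k
  using that
 proof (induction rule: dec_induct)
  case (step k)
  have "?F k (?x k) = ?x (Suc k)"
   by (subst qhomology_map_class[OF lf_proper_refine vchain_lf[OF step.hyps(1)]]) (simp add: push_refine[OF step.hyps(1)])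
  thus ?case using step by (simp add: bonding_def)
 qed (simp add: bonding_def)
 have "qbd n (vchain (ball_at m)) = qpush (n - Suc 0) (to_nerve K h (tos Mt) p D) (qbd n ct)"
  unfolding push_to_nerve[symmetric] by (rule lf_push_boundary[OF to_nerve_proper ct_lf])
 hence "qbd n (vchain (ball_at m)) = (%_. 0)" by (simp add: ct_cycle qpush_gpush)
 hence carr: "?x m : carrier (?G m)"
  using vchain_lf[OF order_refl] unfolding qhomology_group_def qhomology_class_def FactGroup_def RCOSETS_def by (auto simp: qcycle_group_def)
 have cls: "coarse_fundamental_class n (tos M) \<omega> K h (tos Mt) p D \<U> r m = direct_limit_class ?G ?F m (?x m)"
  unfolding coarse_fundamental_class_def lf_fundamental_class_def fundamental_chain_cover
   qhomology_map_class[OF to_nerve_proper ct_lf] push_to_nerve ..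
 have "coarse_fundamental_class n (tos M) \<omega> K h (tos Mt) p D \<U> r m = \<one>\<^bsub>coarse_homology_group \<U> r n\<^esub>
   \<longleftrightarrow> (EX k>=m. bonding ?F m k (?x m) = \<one>\<^bsub>?G k\<^esub>)"
  unfolding cls coarse_homology_group_def by (rule direct_limit_class_one[where G="?G" and F="?F", OF one carr])
 also have "... \<longleftrightarrow> (EX k>=m. vchain (ball_at k) : qbd (Suc n) ` lfc (nspc k) (Suc n))"
  using bond lf_class_one by (metis (no_types, lifting))
 finally show ?thesis unfolding macroscopically_large_def by blast
qed

end

section \<open>The prism operator and deck transformations\<close>

lemma prism_sum:
 fixes a b :: "nat => nat => 'x::comm_ring_1"
 assumes "!!j. j <= n ==> a j j = e j" "!!j. j <= n ==> a j (Suc j) = e (Suc j)"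
  and "!!j k. j < n ==> k <= j ==> a (Suc j) k = b j k" "!!j k. j < k ==> k <= n ==> a j (Suc k) = b j k"
 shows "(SUM j<=n. SUM k<=Suc n. (-1) ^ j * (-1) ^ k * a j k) = e 0 - e (Suc n) - (SUM j<n. SUM k<=n. (-1) ^ j * (-1) ^ k * b j k)"
proof -
 let ?s = "%j k. (-1) ^ j * (-1) ^ k :: 'x"
 have sq: "?s j j = 1" for j by (simp add: power_add[symmetric] flip: mult_2)
 \<comment> \<open>For fixed j the faces j and j + 1 form the telescoping part; those with smaller
   or larger index are faces shared with neighbours or lying over the boundary, collected in
   b.\<close>
 have split: "(SUM k<=Suc n. ?s j k * a j k) = (SUM k<j. ?s j k * a j k) + (e j - e (Suc j)) + (SUM k:{Suc j..n}. ?s j (Suc k) * a j (Suc k))"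
  if j: "j <= n" for j
 proof -
  have "{..Suc n} = {..<j} Un {j, Suc j} Un Suc ` {Suc j..n}" using j by (auto simp: image_Suc_atLeastAtMost)
  hence "(SUM k<=Suc n. ?s j k * a j k) = (SUM k:{..<j} Un {j, Suc j}. ?s j k * a j k) + (SUM k:Suc ` {Suc j..n}. ?s j k * a j k)"
   by (simp only:) (rule sum.union_disjoint, auto)
  also have "(SUM k:{..<j} Un {j, Suc j}. ?s j k * a j k) = (SUM k<j. ?s j k * a j k) + (SUM k:{j, Suc j}. ?s j k * a j k)"
   by (rule sum.union_disjoint) auto
  also have "(SUM k:{j, Suc j}. ?s j k * a j k) = e j - e (Suc j)" using assms(1,2)[OF j] sq[of j] by simp
  also have "(SUM k:Suc ` {Suc j..n}. ?s j k * a j k) = (SUM k:{Suc j..n}. ?s j (Suc k) * a j (Suc k))"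
   by (rule sum.reindex_cong[of Suc "{Suc j..n}"]) auto
  finally show ?thesis .
 qed
 have "(SUM j<=n. SUM k<=Suc n. ?s j k * a j k)
  = (SUM j<=n. SUM k<j. ?s j k * a j k) + (SUM j<=n. e j - e (Suc j)) + (SUM j<=n. SUM k:{Suc j..n}. ?s j (Suc k) * a j (Suc k))"
  unfolding sum.distrib[symmetric] by (rule sum.cong[OF refl], rule split) simp
 also have "(SUM j<=n. e j - e (Suc j)) = e 0 - e (Suc n)" by (rule sum_telescope)
 also have "(SUM j<=n. SUM k<j. ?s j k * a j k) = (SUM j<n. SUM k<=j. - (?s j k * b j k))"
 proof -
  have "(SUM j<=n. SUM k<j. ?s j k * a j k) = (SUM j<n. SUM k<Suc j. ?s (Suc j) k * a (Suc j) k)" by (simp add: sum.atMost_shift)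
  also have "... = (SUM j<n. SUM k<=j. - (?s j k * b j k))"
   unfolding lessThan_Suc_atMost using assms(3) by (intro sum.cong refl) auto
  finally show ?thesis .
 qed
 also have "(SUM j<=n. SUM k:{Suc j..n}. ?s j (Suc k) * a j (Suc k)) = (SUM j<n. SUM k:{Suc j..n}. - (?s j k * b j k))"
 proof -
  have "(SUM j<=n. SUM k:{Suc j..n}. ?s j (Suc k) * a j (Suc k)) = (SUM j<n. SUM k:{Suc j..n}. ?s j (Suc k) * a j (Suc k))"
   by (simp add: lessThan_Suc_atMost[symmetric])
  also have "... = (SUM j<n. SUM k:{Suc j..n}. - (?s j k * b j k))"
   using assms(4) by (intro sum.cong refl) auto
  finally show ?thesis .
 qed
 also have "(SUM j<n. SUM k<=j. - (?s j k * b j k)) + (e 0 - e (Suc n)) + (SUM j<n. SUM k:{Suc j..n}. - (?s j k * b j k))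
  = e 0 - e (Suc n) - (SUM j<n. (SUM k<=j. ?s j k * b j k) + (SUM k:{Suc j..n}. ?s j k * b j k))"
  by (simp add: sum_negf sum.distrib)
 also have "(SUM j<n. (SUM k<=j. ?s j k * b j k) + (SUM k:{Suc j..n}. ?s j k * b j k)) = (SUM j<n. SUM k<=n. ?s j k * b j k)"
 proof (rule sum.cong[OF refl])
  fix j assume "j : {..<n}"
  hence "{..n} = {..j} Un {Suc j..n}" by auto
  thus "(SUM k<=j. ?s j k * b j k) + (SUM k:{Suc j..n}. ?s j k * b j k) = (SUM k<=n. ?s j k * b j k)"
   by (simp only:) (rule sum.union_disjoint[symmetric], auto)
 qed
 finally show ?thesis .
qed

lemma singular_face_vertex:
 assumes "1 <= q" "k <= q" "i <= q - Suc 0"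
 shows "sfc q k R (vx i) = R (vx (if i < k then i else Suc i))"
proof -
 have "vx i : stds (q - Suc 0)" by (rule vx_stds[OF assms(3)])
 moreover have "sfce k (vx i) = vx (if i < k then i else Suc i)"
  by (auto simp: simplical_face_def vertex_def fun_eq_iff)
 ultimately show ?thesis by (simp add: singular_face_def)
qed

context macro begin

text \<open>The first hypothesis is contiguity of the two vertex maps along the cycle, so that all
  simplices of the prism belong to the nerve. The two ends of the prism are the two chains, and its
  walls vanish with the boundary of \<open>ct\<close>.\<close>

lemma prism:
 assumes W: "!!R. ct R ~= 0 ==> (%i. f (R (vx i))) ` {..n} Un (%i. f' (R (vx i))) ` {..n} : nerve (\<U> l)"
  and meet: "!!R i. ct R ~= 0 ==> i <= n ==> f (R (vx i)) Int R ` stds n ~= {} & f' (R (vx i)) Int R ` stds n ~= {}"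
 shows "EX P:lfc (nspc l) (Suc n). qbd (Suc n) P = (%T. vchain f' T - vchain f T)"
proof -
 let ?W = "%R. (%i. f (R (vx i))) ` {..n} Un (%i. f' (R (vx i))) ` {..n}"
 have push: "gpush (%R. aff q (F R)) ct : lfc (nspc l) q & fib_finite (%R. aff q (F R)) ct"
  if F: "!!R j. ct R ~= 0 ==> j <= q ==> F R j : ?W R" for q and F :: "((nat => real) => 'b) => nat => 'b set"
 proof -
  have "F R ` {..q} : nerve (\<U> l)" if R: "ct R ~= 0" for R
  proof -
   have sub: "F R ` {..q} <= ?W R" using F[OF R] by blast
   have w: "\<Inter>(?W R) ~= {}" "?W R <= \<U> l" using W[OF R] unfolding nerve_def by blast+
   have "\<Inter>(F R ` {..q}) ~= {}" using Inter_anti_mono[OF sub] w(1) by (metis subset_empty)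
   moreover have "F R ` {..q} <= \<U> l" by (rule subset_trans[OF sub w(2)])
   ultimately show ?thesis unfolding nerve_def by simp
  qed
  moreover have "F R j Int R ` stds n ~= {}" if R: "ct R ~= 0" "j <= q" for R j
   using F[OF R] meet[OF R(1)] by auto
  ultimately show ?thesis using lf_aff_push[of F q l] by blast
 qed
 \<comment> \<open>\<open>F j R\<close> is the j-th simplex of the prism, with f at the vertices up
   to j and f' at the vertices from j on; \<open>E j R\<close>, with f before j and f' from j on,
   interpolates between the two ends.\<close>
 define F where "F j R i = (if i <= j then f (R (vx i)) else f' (R (vx (i - 1))))" for j and R :: "(nat => real) => 'b" and i
 define E where "E j R i = (if i < j then f (R (vx i)) else f' (R (vx i)))" for j and R :: "(nat => real) => 'b" and i
 have FW: "F j R i : ?W R" if "j <= n" "i <= Suc n" for j R i using that unfolding F_def by auto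
 define P where "P = (%j. gpush (%R. aff (Suc n) (F j R)) ct)"
 have P: "P j : lfc (nspc l) (Suc n)" if "j <= n" for j
  unfolding P_def using push[of "Suc n" "F j"] FW that by blast
 define PP where "PP = (%T. SUM j<=n. (-1) ^ j * P j T)"
 have PPlf: "PP : lfc (nspc l) (Suc n)"
  unfolding PP_def by (intro lf_sum lf_scale P) auto
 define a where "a = (%T j k. gpush (%R. aff n (%i. F j R (if i < k then i else Suc i))) ct T)"
 have face: "gpush (sfc (Suc n) k) (P j) T = a T j k" if "j <= n" "k <= Suc n" for j k T
 proof -
  have e: "sfc (Suc n) k (aff (Suc n) (F j R)) = aff n (%i. F j R (if i < k then i else Suc i))" for R
   using singular_face_aff[of "Suc n" k "F j R"] that(2) by (simp add: if_distrib)
  have "fib_finite (%R. aff n (%i. F j R (if i < k then i else Suc i))) ct"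
   using push[of n "%R i. F j R (if i < k then i else Suc i)"] FW[OF that(1)] by auto
  hence "gpush (sfc (Suc n) k) (P j) = gpush (%R. sfc (Suc n) k (aff (Suc n) (F j R))) ct"
   unfolding P_def fib_finite_def by (intro gpush_gpush) (simp add: e)
  thus ?thesis by (simp add: e a_def)
 qed
 have bd: "qbd (Suc n) PP T = (SUM j<=n. SUM k<=Suc n. (-1) ^ j * (-1) ^ k * a T j k)" for T
 proof -
  have "gpush (sfc (Suc n) k) PP T = (SUM j<=n. (-1) ^ j * a T j k)" if "k <= Suc n" for k
  proof -
   have "gpush (sfc (Suc n) k) PP = (%T. SUM j<=n. gpush (sfc (Suc n) k) (%T. (-1) ^ j * P j T) T)"
    unfolding PP_def using lf_gpush_face(2)[OF lf_scale[OF P], of _ k] that by (intro gpush_sum[THEN conjunct1]) auto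
   thus ?thesis using face[OF _ that] by (simp add: gpush_scale)
  qed
  hence "qbd (Suc n) PP T = (SUM k<=Suc n. SUM j<=n. (-1) ^ j * (-1) ^ k * a T j k)"
   by (simp add: qbd_faces sum_distrib_left mult_ac del: sum.atMost_Suc)
  thus ?thesis by (subst sum.swap)
 qed
 define b where "b = (%T j k. gpush (%R. aff n (F j (sfc n k R))) ct T)"
 have Fface: "aff n (F j (sfc n k R)) = aff n (%i. if i <= j then f (R (vx (if i < k then i else Suc i))) else f' (R (vx (if i - 1 < k then i - 1 else Suc (i - 1)))))"
  if "j < n" "k <= n" for j k R
  using that singular_face_vertex[of n k _ R] by (intro aff_cong) (auto simp: F_def)
 \<comment> \<open>This holds for each j separately: the assignment of \<open>aff n (F j B)\<close>
   to a face B of R is pushed over the boundary of \<open>ct\<close>, which is 0.\<close>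
 have sum0: "(SUM k<=n. (-1) ^ k * b T j k) = 0" if j: "j < n" for j T
 proof -
  have fin: "finite {R. ct R ~= 0 & aff n (F j (sfc n k R)) = T}" if k: "k <= n" for k T
  proof -
   let ?F = "%R i. if i <= j then f (R (vx (if i < k then i else Suc i))) else f' (R (vx (if i - 1 < k then i - 1 else Suc (i - 1))))"
   have "?F R i : ?W R" if "i <= n" for i and R :: "(nat => real) => 'b" using that j by auto
   hence "fib_finite (%R. aff n (?F R)) ct" using push[of n ?F] by blast
   thus ?thesis unfolding fib_finite_def Fface[OF j k] by blast
  qed
  have n1: "1 <= n" using j by simp
  have gg: "gpush (%B. aff n (F j B)) (gpush (sfc n k) ct) = gpush (%R. aff n (F j (sfc n k R))) ct"
   and ff: "fib_finite (%B. aff n (F j B)) (gpush (sfc n k) ct)" if "k <= n" for k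
   using fin[OF that] by (intro gpush_gpush fib_finite_gpush; simp)+
  have "(%T. SUM k<=n. (-1) ^ k * gpush (sfc n k) ct T) = (%_. 0)"
   using ct_cycle n1 by (simp add: qbd_faces)
  hence "gpush (%B. aff n (F j B)) (%T. SUM k<=n. (-1) ^ k * gpush (sfc n k) ct T) = (%_. 0)" by simp
  moreover have "gpush (%B. aff n (F j B)) (%T. SUM k<=n. (-1) ^ k * gpush (sfc n k) ct T)
   = (%T. SUM k<=n. gpush (%B. aff n (F j B)) (%T. (-1) ^ k * gpush (sfc n k) ct T) T)"
   using ff by (intro gpush_sum[THEN conjunct1] fib_finite_scale) auto
  ultimately have "(SUM k<=n. gpush (%B. aff n (F j B)) (%T. (-1) ^ k * gpush (sfc n k) ct T) T) = 0"
   by metis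
  thus ?thesis using gg by (simp add: gpush_scale b_def)
 qed
 have main: "qbd (Suc n) PP T = vchain f' T - vchain f T" for T
 proof -
  let ?e = "%j. gpush (%R. aff n (E j R)) ct T"
  have "qbd (Suc n) PP T = ?e 0 - ?e (Suc n) - (SUM j<n. SUM k<=n. (-1) ^ j * (-1) ^ k * b T j k)"
   unfolding bd
  proof (rule prism_sum)
   show "a T j j = ?e j" for j unfolding a_def
    by (rule arg_cong[of _ _ "%c. c T"], rule gpush_cong, rule aff_cong) (auto simp: F_def E_def)
   show "a T j (Suc j) = ?e (Suc j)" for j unfolding a_def
    by (rule arg_cong[of _ _ "%c. c T"], rule gpush_cong, rule aff_cong) (auto simp: F_def E_def)
   show "a T (Suc j) k = b T j k" if "j < n" "k <= j" for j k unfolding a_def b_def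
   proof (rule arg_cong[of _ _ "%c. c T"], rule gpush_cong)
    fix R
    have "k <= n" using that by simp
    thus "aff n (%i. F (Suc j) R (if i < k then i else Suc i)) = aff n (F j (sfc n k R))"
     unfolding Fface[OF that(1) \<open>k \<le> n\<close>] using that(2) by (intro aff_cong) (auto simp: F_def)
   qed
   show "a T j (Suc k) = b T j k" if "j < k" "k <= n" for j k unfolding a_def b_def
   proof (rule arg_cong[of _ _ "%c. c T"], rule gpush_cong)
    fix R
    have "j < n" using that by simp
    thus "aff n (%i. F j R (if i < Suc k then i else Suc i)) = aff n (F j (sfc n k R))"
     unfolding Fface[OF \<open>j < n\<close> that(2)] using that(1) by (intro aff_cong) (auto simp: F_def)
   qed
  qed
  also have "(SUM j<n. SUM k<=n. (-1) ^ j * (-1) ^ k * b T j k) = (SUM j<n. (-1) ^ j * (SUM k<=n. (-1) ^ k * b T j k))"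
   by (simp add: sum_distrib_left mult.assoc)
  also have "... = 0" using sum0 by simp
  also have "?e 0 = vchain f' T" unfolding vchain_def
   by (rule arg_cong[of _ _ "%c. c T"], rule gpush_cong, rule aff_cong) (auto simp: E_def)
  also have "?e (Suc n) = vchain f T" unfolding vchain_def
   by (rule arg_cong[of _ _ "%c. c T"], rule gpush_cong, rule aff_cong) (auto simp: E_def)
  finally show ?thesis by simp
 qed
 show ?thesis using PPlf main by (intro bexI[of _ PP]) auto
qed

text \<open>A deck transformation carries a joining path to one with the same projection, and
  lengths are measured after projection.\<close>

lemma deck_D_le:
 assumes a: "con Mt q" "q : Mt \<rightarrow> Mt" "!!x. x : Mt ==> p (q x) = p x" and x: "x : Mt" "y : Mt"
 shows "D (q x) (q y) <= D x y"
proof (rule field_le_epsilon)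
 fix e :: real assume e: "e > 0"
 obtain L where L: "joins x y L" "L < D x y + e" using D_lessE[OF x, of "D x y + e"] e by auto
 obtain G where G: "path G" "pim G <= Mt" "pathstart G = x" "pathfinish G = y" "len (p o G) 0 1 L"
  using L(1) unfolding joins_def by blast
 have B: "G t : Mt" if "t : {0..1}" for t using G(2) that by (auto simp: path_image_def)
 have "joins (q x) (q y) L" unfolding joins_def
 proof (rule exI[of _ "q o G"], intro conjI)
  show "path (q o G)" by (rule path_continuous_image[OF G(1) continuous_on_subset[OF a(1) G(2)]])
  show "pim (q o G) <= Mt" unfolding path_image_compose using G(2) a(2) by blast
  show "pathstart (q o G) = q x" "pathfinish (q o G) = q y"
   using G(3,4) by (auto simp: pathstart_def pathfinish_def)
  show "len (p o (q o G)) 0 1 L" by (rule len_cong[OF G(5)]) (use a(3) B in simp)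
 qed
 thus "D (q x) (q y) <= D x y + e" using D_le L(2) by fastforce
qed

end

lemma bounded_on_finite:
 fixes P :: "'x => real => bool"
 assumes "finite X" "!!x. x : X ==> EX R. P x R" "!!x R R'. P x R ==> R <= R' ==> P x R'"
 shows "EX R. ALL x:X. P x R"
proof -
 obtain R where R: "!!x. x : X ==> P x (R x)" using assms(2) by metis
 have "P x (Max (R ` X))" if "x : X" for x
  by (rule assms(3)[OF R[OF that]]) (use assms(1) that in simp)
 thus ?thesis by blast
qed

section \<open>Inessential manifolds\<close>

lemma principal_bundleD:
 assumes "principal_bundle G E q B R"
 shows "covering_space E q B"
  "!!a x. a : carrier G ==> x : E ==> R a x : E" "!!a. a : carrier G ==> con E (R a)"
  "!!a x. a : carrier G ==> x : E ==> q (R a x) = q x"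
  "!!a b x. a : carrier G ==> b : carrier G ==> x : E ==> a \<otimes>\<^bsub>G\<^esub> b : carrier G & R (a \<otimes>\<^bsub>G\<^esub> b) x = R a (R b x)"
  "!!x. x : E ==> \<one>\<^bsub>G\<^esub> : carrier G & R \<one>\<^bsub>G\<^esub> x = x"
  "!!x y. x : E ==> y : E ==> q x = q y ==> EX a. a : carrier G & R a x = y"
  "!!x a b. x : E ==> a : carrier G ==> b : carrier G ==> R a x = R b x ==> a = b"
proof -
 have pb: "covering_space E q B" "group_action G E R" "!!a. a : carrier G ==> con E (R a)"
  "!!a x. a : carrier G ==> x : E ==> q (R a x) = q x"
  "!!x y. x : E ==> y : E ==> q x = q y ==> EX! a. a : carrier G & R a x = y"
  using assms unfolding principal_bundle_def by blast+
 interpret group_action G E R by (rule pb(2))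
 have G: "group G" using group_hom by (simp add: group_hom_def)
 show "covering_space E q B" by (rule pb(1))
 show im: "R a x : E" if "a : carrier G" "x : E" for a x using element_image[OF that] by blast
 show "con E (R a)" if "a : carrier G" for a by (rule pb(3)[OF that])
 show fib: "q (R a x) = q x" if "a : carrier G" "x : E" for a x by (rule pb(4)[OF that])
 show "a \<otimes>\<^bsub>G\<^esub> b : carrier G & R (a \<otimes>\<^bsub>G\<^esub> b) x = R a (R b x)" if "a : carrier G" "b : carrier G" "x : E" for a b x
  using composition_rule[OF that(3,1,2)] monoid.m_closed[OF group.is_monoid[OF G]] that by simp
 show "\<one>\<^bsub>G\<^esub> : carrier G & R \<one>\<^bsub>G\<^esub> x = x" if "x : E" for x
  using monoid.one_closed[OF group.is_monoid[OF G]] fun_cong[OF id_eq_one, of x] that by simp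
 show "EX a. a : carrier G & R a x = y" if "x : E" "y : E" "q x = q y" for x y using pb(5)[OF that] by blast
 show "a = b" if "x : E" "a : carrier G" "b : carrier G" "R a x = R b x" for x a b
  using pb(5)[OF that(1) im[OF that(3,1)]] fib[OF that(3,1)] that by metis
qed

lemma qhomology_map_one_boundary:
 assumes "qhomology_map q (finite_chains Y) f (qhc (finite_chains X) q z) = \<one>\<^bsub>qhg (finite_chains Y) q\<^esub>"
 shows "EX e:finite_chains Y (Suc q). qbd (Suc q) e = qpush q f z"
proof -
 have z0: "(%_. 0) : qbd (Suc q) ` finite_chains U (Suc q)" for U :: "'x topology"
  by (rule image_eqI[of _ _ "%_. 0"]) (simp_all add: finite_chains_def)
 have self: "w : qhc (finite_chains U) q w" for U :: "'x topology" and w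
  unfolding qhomology_class_eq by (rule CollectI, rule exI[of _ "%_. 0"]) (use z0[of U] in simp)
 have "qpush q f z : qhomology_map q (finite_chains Y) f (qhc (finite_chains X) q z)"
  unfolding qhomology_map_def by (rule UN_I[OF self self])
 thus ?thesis unfolding assms one_qhomology_group by (metis imageE)
qed

lemma finite_subsingleton:
 assumes "!!x y. x : S ==> y : S ==> x = y"
 shows "finite S"
proof (cases "S = {}")
 case False
 then obtain x where "x : S" by blast
 hence "S <= {x}" using assms by blast
 thus ?thesis by (rule finite_subset) simp
qed simp

context macro begin

text \<open>
 Vertices of \<open>E\<close> are moved to the orbit of one point of the covering space, equivariantly, so that the simplices of
 \<open>E\<close> in the infinite transfer of a finite chain become simplices of the nerve of a sufficiently coarse cover.
\<close>

lemma inessential_boundary: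
 fixes E :: "'e::topological_space set" and B :: "'f::topological_space set" and c :: "'a => 'f"
 assumes PM: "principal_bundle G Mt p M N" and PE: "principal_bundle G E q B Z"
  and CM: "classifying_map G Mt p M N E q B Z c"
  and zero: "qhomology_map n (finite_chains (tos B)) c (fundamental_class n (tos M) \<omega> K h)
   = \<one>\<^bsub>qhg (finite_chains (tos B)) n\<^esub>"
 shows "EX k>=m. vchain (ball_at k) : qbd (Suc n) ` lfc (nspc k) (Suc n)"
proof -
 note T = principal_bundleD[OF PM] and R = principal_bundleD[OF PE]
 obtain C where cB: "con M c" "c : M \<rightarrow> B" and C: "con Mt C" "C : Mt \<rightarrow> E"
  "!!x. x : Mt ==> q (C x) = c (p x)" "!!a x. a : carrier G ==> x : Mt ==> C (N a x) = Z a (C x)"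
  using CM unfolding classifying_map_def by auto
 have CE: "C x : E" if "x : Mt" for x using C(2) that by blast
 have Dle: "D (N a x) (N a y) <= D x y" if a: "a : carrier G" and xy: "x : Mt" "y : Mt" for a x y
  by (rule deck_D_le[OF T(3)[OF a] _ T(4)[OF a] xy]) (use T(2)[OF a] in auto)
 obtain e where e: "e : finite_chains (tos B) (Suc n)" "qbd (Suc n) e = qpush n c fund"
  using qhomology_map_one_boundary[OF zero[unfolded fundamental_class_def]] by blast
 have e_simp: "ssx (Suc n) (tos B) J" if "e J ~= 0" for J using e(1) that by (simp add: finite_chains_def)
 have e_fin: "finite {J. e J ~= 0}" using e(1) by (simp add: finite_chains_def)
 define ee where "ee = transfer (Suc n) E q e"
 have ee: "ssx (Suc n) (tos E) J" "e (smp (Suc n) q J) ~= 0" if "ee J ~= 0" for J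
  using that by (auto simp: ee_def transfer_def split: if_splits)
 \<comment> \<open>On both sides G acts freely and transitively on the fibres, and C is equivariant;
   hence Mt is the pullback of E along c, as \<open>transfer_push\<close> requires.\<close>
 have fib: "EX! x. x : Mt & p x = y & C x = z" if z: "z : E" and y: "y : M" and qz: "q z = c y" for z y
 proof -
  obtain x1 where x1: "x1 : Mt" "p x1 = y" using covering_space_imp_surjective[OF cov] y by blast
  obtain a where a: "a : carrier G" "Z a (C x1) = z" using R(7)[OF CE[OF x1(1)] z] C(3)[OF x1(1)] qz x1(2) by auto
  show ?thesis
  proof (rule ex1I[of _ "N a x1"])
   show "N a x1 : Mt & p (N a x1) = y & C (N a x1) = z" using T(2,4)[OF a(1) x1(1)] C(4)[OF a(1) x1(1)] a(2) x1(2) by simp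
   fix x assume x: "x : Mt & p x = y & C x = z"
   obtain b where b: "b : carrier G" "N b x1 = x" using T(7)[OF x1(1), of x] x x1(2) by auto
   have "Z b (C x1) = Z a (C x1)" using C(4)[OF b(1) x1(1)] b(2) x a(2) by simp
   hence "b = a" by (rule R(8)[OF CE[OF x1(1)] b(1) a(1)])
   thus "x = N a x1" using b(2) by simp
  qed
 qed
 have bd: "qbd (Suc n) ee = qpush n C ct"
 proof -
  have "qbd (Suc n) ee = transfer n E q (qpush n c fund)"
   unfolding ee_def e(2)[symmetric] by (rule transfer_boundary[OF R(1) e_simp])
  also have "... = qpush n C ct"
   by (rule transfer_push[OF cov R(1) C(1,2) cB C(3) fib fund_simplex, symmetric])
  finally show ?thesis .
 qed
 obtain y0 where y0: "y0 : Mt" using Mt_nonempty by blast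
 \<comment> \<open>A set-theoretic section of q. Its lack of continuity does no harm, as only
   vertices are moved.\<close>
 have "ALL b:B. EX x. x : E & q x = b" using covering_space_imp_surjective[OF R(1)] by blast
 from bchoice[OF this] obtain base where base: "ALL b:B. base b : E & q (base b) = b" by (elim exE) (rule that)
 have qB: "q x : B" if "x : E" for x using covering_space_imp_surjective[OF R(1)] that by blast
 have baseE: "base (q x) : E" "q (base (q x)) = q x" if "x : E" for x using base qB[OF that] by auto
 have "ALL x:E. EX a. a : carrier G & Z a (base (q x)) = x" using R(7)[OF baseE(1)] baseE(2) by blast
 from bchoice[OF this] obtain elt where elt: "ALL x:E. elt x : carrier G & Z (elt x) (base (q x)) = x" by (elim exE) (rule that)
 \<comment> \<open>An equivariant map from E to the orbit of y0, injective on each fibre of q.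
   Equivariance yields uniform bounds, injectivity yields local finiteness.\<close>
 define F where "F x = N (elt x) y0" for x
 have f: "F x : Mt" if "x : E" for x unfolding F_def using elt T(2) y0 that by blast
 have ah: "p (F x) = p y0" if "x : E" for x unfolding F_def using elt T(4) y0 that by blast
 have ac: "F (Z a x) = N a (F x)" if a: "a : carrier G" and x: "x : E" for a x
 proof -
  have ax: "Z a x : E" "q (Z a x) = q x" using R(2,4)[OF a x] by auto
  have ex: "elt x : carrier G" "Z (elt x) (base (q x)) = x" using elt x by auto
  have m: "a \<otimes>\<^bsub>G\<^esub> elt x : carrier G" "Z (a \<otimes>\<^bsub>G\<^esub> elt x) (base (q x)) = Z a x"
   using R(5)[OF a ex(1) baseE(1)[OF x]] ex(2) by auto
  have "elt (Z a x) : carrier G" "Z (elt (Z a x)) (base (q x)) = Z a x" using elt ax by auto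
  hence "elt (Z a x) = a \<otimes>\<^bsub>G\<^esub> elt x" using R(8)[OF baseE(1)[OF x] _ m(1)] m(2) by simp
  thus ?thesis unfolding F_def using T(5)[OF a ex(1) y0] by simp
 qed
 have ai: "x = y" if xy: "x : E" "y : E" "q x = q y" "F x = F y" for x y
 proof -
  have "elt x = elt y" using T(8)[OF y0, of "elt x" "elt y"] elt xy unfolding F_def by blast
  thus ?thesis using elt xy by metis
 qed
 have vE: "J (vx i) : E" if "ee J ~= 0" "i <= Suc n" for J i
  using ee(1)[OF that(1)] vx_stds[OF that(2)] unfolding ssx_iff by blast
 have same: "J = L" if t: "ee J ~= 0" "ee L ~= 0" "smp (Suc n) q J = smp (Suc n) q L"
  and i: "i <= Suc n" "J (vx i) = L (vx i)" for J L i
  by (rule ssx_unique[OF R(1) ee(1)[OF t(1)] ee(1)[OF t(2)] t(3) vx_stds[OF i(1)] i(2)])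
 have q_vertex: "q (J (vx i)) = smp (Suc n) q J (vx i)" if "i <= Suc n" for J i
  by (simp add: smp_apply[OF vx_stds[OF that]])
 \<comment> \<open>Any two lifts of one simplex of B differ by an element of G, by unique
   lifting.\<close>
 have translate: "EX a:carrier G. ALL i<=Suc n. L (vx i) = Z a (J (vx i))"
  if t: "ee J ~= 0" "ee L ~= 0" "smp (Suc n) q J = smp (Suc n) q L" for J L
 proof -
  have v0: "vx 0 : stds (Suc n)" by (rule vx_stds) simp
  obtain a where a: "a : carrier G" "Z a (J (vx 0)) = L (vx 0)"
   using R(7)[OF vE[OF t(1), of 0] vE[OF t(2), of 0]] q_vertex[of 0 J] q_vertex[of 0 L] t(3) by auto
  have s: "ssx (Suc n) (tos E) (smp (Suc n) (Z a) J)"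
   by (rule singular_simplex_simplex_map[OF ee(1)[OF t(1)]]) (use R(2,3)[OF a(1)] in auto)
  have "J u : E" if "u : stds (Suc n)" for u using ee(1)[OF t(1)] that unfolding ssx_iff by blast
  hence "smp (Suc n) q (smp (Suc n) (Z a) J) = smp (Suc n) q J"
   unfolding simplex_map_def using R(4)[OF a(1)] by (intro restrict_ext) simp
  hence "L = smp (Suc n) (Z a) J"
   using t(3) a(2) by (intro ssx_unique[OF R(1) ee(1)[OF t(2)] s _ v0]) (simp_all add: smp_apply[OF v0])
  thus ?thesis using a(1) vx_stds by (intro bexI[of _ a]) (auto simp: smp_apply)
 qed
 \<comment> \<open>Up to G the transfer has finitely many simplices, one for each simplex of e, and
   elements of G do not increase distances; so one bound for the moved vertices serves all
   lifts.\<close>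
 have "EX R1. ALL aa:{J. e J ~= 0}. ALL J. ee J ~= 0 & smp (Suc n) q J = aa -->
  (ALL i<=Suc n. ALL j<=Suc n. D (F (J (vx i))) (F (J (vx j))) <= R1)"
 proof (rule bounded_on_finite[OF e_fin])
  fix aa
  show "EX R. ALL J. ee J ~= 0 & smp (Suc n) q J = aa --> (ALL i<=Suc n. ALL j<=Suc n. D (F (J (vx i))) (F (J (vx j))) <= R)"
  proof (cases "EX J. ee J ~= 0 & smp (Suc n) q J = aa")
   case True
   then obtain ab where t1: "ee ab ~= 0" "smp (Suc n) q ab = aa" by blast
   let ?d = "%(i, j). D (F (ab (vx i))) (F (ab (vx j)))"
   have "D (F (J (vx i))) (F (J (vx j))) <= Max (?d ` ({..Suc n} \<times> {..Suc n}))"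
    if t: "ee J ~= 0" "smp (Suc n) q J = aa" and ij: "i <= Suc n" "j <= Suc n" for J i j
   proof -
    obtain a where a: "a : carrier G" "!!i. i <= Suc n ==> J (vx i) = Z a (ab (vx i))"
     using translate[OF t1(1) t(1)] t1(2) t(2) by metis
    note v = vE[OF t1(1) ij(1)] vE[OF t1(1) ij(2)]
    have "D (F (J (vx i))) (F (J (vx j))) = D (N a (F (ab (vx i)))) (N a (F (ab (vx j))))"
     unfolding a(2)[OF ij(1)] a(2)[OF ij(2)] ac[OF a(1) v(1)] ac[OF a(1) v(2)] ..
    also have "... <= ?d (i, j)" using Dle[OF a(1) f[OF v(1)] f[OF v(2)]] by simp
    also have "... <= Max (?d ` ({..Suc n} \<times> {..Suc n}))" using ij by (intro Max_ge imageI) auto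
    finally show ?thesis .
   qed
   thus ?thesis by blast
  qed blast
 qed (intro allI impI, elim conjE, erule allE, erule impE, erule (1) conjI, rule order_trans[rotated], assumption, simp)
 then obtain R1 where R1: "!!J i j. ee J ~= 0 ==> i <= Suc n ==> j <= Suc n ==> D (F (J (vx i))) (F (J (vx j))) <= R1"
  using ee(2) by blast
 \<comment> \<open>The displacement of a vertex of the covering under C followed by F. Again there
   are finitely many orbits, one for each vertex of K.\<close>
 have "EX R2. ALL v:\<Union>K. ALL x. x : Mt & p x = h (vx v) --> D (F (C x)) x <= R2 & D x (F (C x)) <= R2"
 proof (rule bounded_on_finite[OF finite_vertices])
  fix v
  show "EX R2. ALL x. x : Mt & p x = h (vx v) --> D (F (C x)) x <= R2 & D x (F (C x)) <= R2"
  proof (cases "EX x. x : Mt & p x = h (vx v)")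
   case True
   then obtain x1 where x1: "x1 : Mt" "p x1 = h (vx v)" by blast
   have "D (F (C x)) x <= max (D (F (C x1)) x1) (D x1 (F (C x1))) & D x (F (C x)) <= max (D (F (C x1)) x1) (D x1 (F (C x1)))"
    if x: "x : Mt" "p x = h (vx v)" for x
   proof -
    obtain a where a: "a : carrier G" "N a x1 = x" using T(7)[OF x1(1) x(1)] x1(2) x(2) by auto
    have "F (C x) = N a (F (C x1))" unfolding a(2)[symmetric] C(4)[OF a(1) x1(1)] by (rule ac[OF a(1) CE[OF x1(1)]])
    thus ?thesis
     using Dle[OF a(1) f[OF CE[OF x1(1)]] x1(1)] Dle[OF a(1) x1(1) f[OF CE[OF x1(1)]]] a(2) by (simp add: le_max_iff_disj)
   qed
   thus ?thesis by blast
  qed blast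
 qed (meson order_trans)
 then obtain R2 where R2': "ALL v:\<Union>K. ALL x. x : Mt & p x = h (vx v) --> D (F (C x)) x <= R2 & D x (F (C x)) <= R2" by blast
 have R2: "D (F (C x)) x <= R2" "D x (F (C x)) <= R2" if "x : lifted_vertices K h (tos Mt) p" for x
  using R2' that unfolding lifted_vertices_def by auto
 \<comment> \<open>R1 serves the simplices of the transfer, \<open>R2 + 2 * \<mu>\<close> the prism,
   where a moved vertex is compared with another vertex of the same simplex.\<close>
 define R0 where "R0 = max R1 (R2 + 2 * \<mu>)"
 obtain Rs where Rs: "filterlim Rs at_top sequentially"
  "!!i S. S <= Mt ==> (ALL x:S. ALL y:S. D x y <= Rs i) ==> EX V:\<U> (Suc i). S <= V"
  using coarsening unfolding coarsening_sequence_def by (elim conjE exE) (rule that, auto)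
 have "eventually (%i. 2 * R0 <= Rs i) sequentially" using Rs(1) by (simp add: filterlim_at_top)
 then obtain i0 where i0: "!!i. i >= i0 ==> 2 * R0 <= Rs i" by (auto simp: eventually_sequentially)
 \<comment> \<open>Sets of diameter at most \<open>2 * R0\<close> lie in members of the cover
   \<open>Suc i\<close> as soon as \<open>2 * R0 <= Rs i\<close>, whence the successor; moreover l
   must not precede m.\<close>
 define l where "l = Suc (max m i0)"
 have l: "m <= l" by (simp add: l_def)
 have "ALL z:Mt. EX V. V : \<U> l & {z' : Mt. D z z' <= R0 & D z' z <= R0} <= V"
 proof
  fix z assume z: "z : Mt"
  let ?S = "{z' : Mt. D z z' <= R0 & D z' z <= R0}"
  have "D x y <= Rs (max m i0)" if "x : ?S" "y : ?S" for x y
   using D_triangle[of x z y] that z i0[of "max m i0"] by auto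
  thus "EX V. V : \<U> l & ?S <= V" using Rs(2)[of ?S "max m i0"] unfolding l_def by blast
 qed
 from bchoice[OF this] obtain V where V: "ALL z:Mt. V z : \<U> l & {z' : Mt. D z z' <= R0 & D z' z <= R0} <= V z"
  by (elim exE) (rule that)
 have VI: "z' : V z" if "z : Mt" "z' : Mt" "D z z' <= R0" "D z' z <= R0" for z z' using V that by blast
 let ?\<Theta> = "%j J. aff j (%i. V (F (J (vx i))))"
 have ae: "ssx (Suc n) (nspc l) (?\<Theta> (Suc n) J)" if t: "ee J ~= 0" for J
 proof (rule ssx_aff[OF cplx_nerve])
  have "F (J (vx 0)) : V (F (J (vx i)))" if "i <= Suc n" for i
   using VI[OF f[OF vE[OF t that]] f[OF vE[OF t, of 0]]] R1[OF t that, of 0] R1[OF t _ that, of 0] by (simp add: R0_def)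
  hence "F (J (vx 0)) : \<Inter>((%i. V (F (J (vx i)))) ` {..Suc n})" by blast
  moreover have "(%i. V (F (J (vx i)))) ` {..Suc n} <= \<U> l" using V f vE[OF t] by blast
  ultimately show "(%i. V (F (J (vx i)))) ` {..Suc n} : nerve (\<U> l)" unfolding nerve_def by blast
 qed
 \<comment> \<open>A simplex of the transfer is recovered from its projection, an index i and its
   moved i-th vertex. In a compact part of the nerve these range over the simplices of e, finitely
   many indices and the points over \<open>p y0\<close> in a compact set.\<close>
 have af: "finite {J. ee J ~= 0 & ?\<Theta> (Suc n) J ` stds (Suc n) Int Q ~= {}}" if Q: "compactin (nspc l) Q" for Q
 proof -
  obtain Cq where Cq: "compact Cq" "Cq <= Mt" "!!V w. w : Q ==> w V ~= 0 ==> V <= Cq" using compact_nerve_vertices[OF Q] by metis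
  let ?X = "{J. e J ~= 0} \<times> {..Suc n} \<times> {y : Cq. p y = p y0}"
  let ?Y = "%(aa, i, z). {J. ee J ~= 0 & smp (Suc n) q J = aa & i <= Suc n & F (J (vx i)) = z}"
  have "finite ?X" using e_fin finite_fibre[OF Cq(1,2) p_img[OF y0]] by simp
  moreover have "finite (?Y x)" for x
  proof -
   obtain aa i z where x: "x = (aa, i, z)" using prod_cases3 by blast
   have "J = L" if "J : ?Y x" "L : ?Y x" for J L
   proof -
    have t: "ee J ~= 0" "ee L ~= 0" "smp (Suc n) q J = smp (Suc n) q L" "i <= Suc n"
     "F (J (vx i)) = F (L (vx i))" using that unfolding x by auto
    have "J (vx i) = L (vx i)"
     by (rule ai[OF vE[OF t(1,4)] vE[OF t(2,4)] _ t(5)]) (simp add: q_vertex[OF t(4)] t(3))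
    thus ?thesis by (rule same[OF t(1-4)])
   qed
   thus ?thesis by (rule finite_subsingleton)
  qed
  ultimately have "finite (UN x:?X. ?Y x)" by blast
  moreover have "{J. ee J ~= 0 & ?\<Theta> (Suc n) J ` stds (Suc n) Int Q ~= {}} <= (UN x:?X. ?Y x)"
  proof
   fix J assume "J : {J. ee J ~= 0 & ?\<Theta> (Suc n) J ` stds (Suc n) Int Q ~= {}}"
   hence t: "ee J ~= 0" and "?\<Theta> (Suc n) J ` stds (Suc n) Int Q ~= {}" by auto
   from aff_meets[OF this(2)] obtain i w where i: "i <= Suc n" "w : Q" "w (V (F (J (vx i)))) ~= 0" by blast
   have E': "J (vx i) : E" by (rule vE[OF t i(1)])
   have "F (J (vx i)) : V (F (J (vx i)))"
    using VI[OF f[OF E'] f[OF E']] R1[OF t i(1) i(1)] by (simp add: R0_def)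
   hence "F (J (vx i)) : Cq" using Cq(3)[OF i(2,3)] by blast
   hence "(smp (Suc n) q J, i, F (J (vx i))) : ?X" using ee(2)[OF t] i(1) ah[OF E'] by simp
   thus "J : (UN x:?X. ?Y x)" by (rule UN_I) (use t i(1) in simp)
  qed
  ultimately show ?thesis by (rule finite_subset[rotated])
 qed
 have ag: "gpush (?\<Theta> (Suc n)) ee : lfc (nspc l) (Suc n)" by (rule lf_gpush(1)[OF ae af])
 have ad: "sfc (Suc n) k (?\<Theta> (Suc n) J) = ?\<Theta> n (sfc (Suc n) k J)" if k: "k <= Suc n" for J k
 proof -
  have "sfc (Suc n) k (?\<Theta> (Suc n) J) = aff n (%j. if j < k then V (F (J (vx j))) else V (F (J (vx (Suc j)))))"
   using singular_face_aff[of "Suc n" k "%i. V (F (J (vx i)))"] k by simp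
  also have "... = ?\<Theta> n (sfc (Suc n) k J)"
   by (rule aff_cong) (use k in \<open>simp add: singular_face_vertex\<close>)
  finally show ?thesis .
 qed
 have aj: "qbd (Suc n) (gpush (?\<Theta> (Suc n)) ee) = gpush (?\<Theta> n) (qbd (Suc n) ee)"
 proof (rule qboundary_gpush[OF ad])
  fix k J assume k: "k <= Suc n"
  show "finite {U. ee U ~= 0 & ?\<Theta> n (sfc (Suc n) k U) = J}"
  proof (cases "EX U. ee U ~= 0 & ?\<Theta> n (sfc (Suc n) k U) = J")
   case True
   then obtain U where u: "ee U ~= 0" "sfc (Suc n) k (?\<Theta> (Suc n) U) = J" using ad[OF k] by blast
   have "ssx n (nspc l) J" using singular_simplex_singular_face[OF ae[OF u(1)], of k] k u(2) by simp
   hence Q: "compactin (nspc l) (J ` stds n)" by (rule compact_ssx)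
   have "{U. ee U ~= 0 & ?\<Theta> n (sfc (Suc n) k U) = J}
    <= {U. ee U ~= 0 & ?\<Theta> (Suc n) U ` stds (Suc n) Int J ` stds n ~= {}}"
   proof (rule Collect_mono, rule impI, elim conjE, rule conjI)
    fix U assume "?\<Theta> n (sfc (Suc n) k U) = J"
    hence "sfc (Suc n) k (?\<Theta> (Suc n) U) = J" using ad[OF k] by simp
    hence "J ` stds n <= ?\<Theta> (Suc n) U ` stds (Suc n)"
     using sfc_image[of "Suc n" k "?\<Theta> (Suc n) U"] k by simp
    thus "?\<Theta> (Suc n) U ` stds (Suc n) Int J ` stds n ~= {}"
     using nonempty_standard_simplex[of n] by blast
   qed
   thus ?thesis using af[OF Q] by (rule finite_subset)
  next
   case False
   hence "{U. ee U ~= 0 & ?\<Theta> n (sfc (Suc n) k U) = J} = {}" by blast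
   thus ?thesis by (simp only: finite.emptyI)
  qed
 qed
 let ?g = "%x. V (F (C x))"
 \<comment> \<open>Contiguity for the prism, with \<open>I (vx 0)\<close> as a common point of all
   members involved.\<close>
 have near: "I (vx 0) : ?g (I (vx i))" "?g (I (vx i)) : \<U> l" if r: "ct I ~= 0" "i <= n" for I i
 proof -
  let ?x = "I (vx i)" and ?y = "I (vx 0)"
  note x = ct_vertex[OF r] and y = ct_vertex[OF r(1), of 0]
  have d: "D ?x ?y <= 2 * \<mu>" "D ?y ?x <= 2 * \<mu>"
   using x(3)[OF vx_stds[of 0 n]] y(3)[OF _ vx_stds[OF r(2)]] by (auto simp: vertex_ball_def)
  have P: "F (C ?x) : Mt" by (rule f[OF CE[OF x(1)]])
  have "D (F (C ?x)) ?y <= R0" using D_triangle[OF P x(1) y(1)] R2(1)[OF x(4)] d(1) by (simp add: R0_def)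
  moreover have "D ?y (F (C ?x)) <= R0" using D_triangle[OF y(1) x(1) P] R2(2)[OF x(4)] d(2) by (simp add: R0_def)
  ultimately show "?y : ?g ?x" using VI[OF P y(1)] by simp
  show "?g ?x : \<U> l" using V P by blast
 qed
 have ball: "I (vx 0) : ball_at l (I (vx i))" "ball_at l (I (vx i)) : \<U> l" if r: "ct I ~= 0" "i <= n" for I i
  using ball_at_nerve(3)[OF r(1) l r(2), of 0] ball_at_in[OF ct_vertex(2)[OF r] l] by auto
 have v0: "I (vx 0) : I ` stds n" for I :: "(nat => real) => 'b"
  using vx_stds[of 0 n] by blast
 have nerve_W: "(%i. ball_at l (I (vx i))) ` {..n} Un (%i. ?g (I (vx i))) ` {..n} : nerve (\<U> l)" if r: "ct I ~= 0" for I
 proof -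
  let ?W = "(%i. ball_at l (I (vx i))) ` {..n} Un (%i. ?g (I (vx i))) ` {..n}"
  have "I (vx 0) : \<Inter>?W" using near(1)[OF r] ball(1)[OF r] by blast
  moreover have "?W <= \<U> l" using near(2)[OF r] ball(2)[OF r] by blast
  ultimately show ?thesis unfolding nerve_def by blast
 qed
 obtain P where P: "P : lfc (nspc l) (Suc n)" "qbd (Suc n) P = (%J. vchain ?g J - vchain (ball_at l) J)"
 proof -
  have m: "ball_at l (I (vx i)) Int I ` stds n ~= {} & ?g (I (vx i)) Int I ` stds n ~= {}"
   if r: "ct I ~= 0" "i <= n" for I i
   using near(1)[OF r] ball(1)[OF r] v0[of I] by blast
  have "EX P:lfc (nspc l) (Suc n). qbd (Suc n) P = (%J. vchain ?g J - vchain (ball_at l) J)"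
   by (rule prism) (erule nerve_W, erule (1) m)
  thus thesis by (elim bexE) (rule that)
 qed
 have "gpush (?\<Theta> n) (qpush n C ct) = vchain ?g"
 proof -
  have v: "smp n C I (vx i) = C (I (vx i))" if "i <= n" for I i
   by (rule smp_apply[OF vx_stds[OF that]])
  have eq: "?\<Theta> n (smp n C I) = aff n (%i. ?g (I (vx i)))" for I
   by (rule aff_cong) (simp add: v)
  have "fib_finite (%I. aff n (%i. ?g (I (vx i)))) ct"
  proof (rule lf_aff_push(2)[of _ n l])
   fix I assume r: "ct I ~= 0"
   have "I (vx 0) : \<Inter>((%i. ?g (I (vx i))) ` {..n})" using near(1)[OF r] by blast
   moreover have "(%i. ?g (I (vx i))) ` {..n} <= \<U> l" using near(2)[OF r] by blast
   ultimately show "(%i. ?g (I (vx i))) ` {..n} : nerve (\<U> l)" unfolding nerve_def by blast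
   show "?g (I (vx j)) Int I ` stds n ~= {}" if "j <= n" for j using near(1)[OF r that] v0 by blast
  qed
  hence "gpush (?\<Theta> n) (gpush (smp n C) ct) = gpush (%I. ?\<Theta> n (smp n C I)) ct"
   unfolding fib_finite_def by (intro gpush_gpush) (simp add: eq)
  thus ?thesis unfolding qpush_gpush vchain_def eq .
 qed
 hence g: "qbd (Suc n) (gpush (?\<Theta> (Suc n)) ee) = vchain ?g" unfolding aj bd .
 let ?Q = "%J. gpush (?\<Theta> (Suc n)) ee J + (-1) * P J"
 have "qbd (Suc n) ?Q = vchain (ball_at l)"
  unfolding lf_qboundary_add[OF ag lf_scale[OF P(1)]] qboundary_scale g P(2) by simp
 moreover have "?Q : lfc (nspc l) (Suc n)" by (rule lf_add[OF ag lf_scale[OF P(1)]])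
 ultimately have "vchain (ball_at l) : qbd (Suc n) ` lfc (nspc l) (Suc n)" by (rule image_eqI[OF sym])
 thus ?thesis using l by blast
qed

end

section \<open>Enlargeable manifolds\<close>

text \<open>Gaussian elimination: an equation with a nonzero coefficient at k is solved for the
  unknown k, which leaves one equation and one unknown less.\<close>

lemma homogeneous_solution:
 fixes v :: "'i => 'j => 'c::field"
 assumes "finite I" "finite J" "card I < card J"
 shows "EX l. (EX j:J. l j ~= 0) & (ALL i:I. (SUM j:J. l j * v i j) = 0)"
 using assms
proof (induction I arbitrary: J v rule: finite_induct)
 case empty
 hence "J ~= {}" by auto
 thus ?case by (intro exI[of _ "%_. 1"]) auto
next
 case (insert i I)
 show ?case
 proof (cases "ALL j:J. v i j = 0")
  case True
  thus ?thesis using insert.IH[OF insert.prems(1), of v] insert.hyps insert.prems(2) by auto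
 next
  case False
  then obtain k where k: "k : J" "v i k ~= 0" by blast
  let ?J = "J - {k}"
  have "card I < card ?J" using insert.hyps insert.prems k by (simp add: card_Diff_singleton)
  then obtain l where l: "EX j:?J. l j ~= 0" "!!i'. i' : I ==> (SUM j:?J. l j * (v i' j - v i' k * v i j / v i k)) = 0"
   using insert.IH[of ?J "%i' j. v i' j - v i' k * v i j / v i k"] insert.prems(1) by blast
  let ?l = "l(k := - (SUM j:?J. l j * v i j) / v i k)"
  have sum: "(SUM j:J. ?l j * v i' j) = (SUM j:?J. l j * v i' j) - (SUM j:?J. l j * v i j) / v i k * v i' k" for i'
   unfolding sum.remove[OF insert.prems(1) k(1)] by simp
  have "(SUM j:J. ?l j * v i' j) = 0" if "i' : insert i I" for i'
  proof (cases "i' = i")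
   case False
   thus ?thesis using l(2)[of i'] that unfolding sum
    by (simp add: right_diff_distrib sum_subtractf sum_divide_distrib sum_distrib_right sum_distrib_left mult_ac)
  qed (simp only: sum, simp add: k(2))
  thus ?thesis using l(1) by (intro exI[of _ ?l]) auto
 qed
qed

section \<open>The unit sphere and generic points on it\<close>

abbreviation ip :: "nat => (nat => real) => (nat => real) => real" where
 "ip n x y == SUM i<=n. x i * y i"

abbreviation sph :: "nat => (nat => real) set" where
 "sph n == {x. ip n x x = 1 & (ALL i>n. x i = 0)}"

definition unit :: "nat => (nat => real) => nat => real" where
 "unit n x = (%i. x i / sqrt (ip n x x))"

lemma nsphere_eq: "nsphere n = tos (sph n)"
 by (simp add: nsphere power_eucl power2_eq_square)

lemma ip_pos: assumes "ip n x b ~= 0" shows "0 < ip n x x"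
proof (rule ccontr)
 assume "~ 0 < ip n x x"
 moreover have "0 <= ip n x x" by (intro sum_nonneg) simp
 ultimately have "ip n x x = 0" by simp
 hence "ALL i<=n. x i = 0" by (simp add: sum_nonneg_eq_0_iff)
 thus False using assms by simp
qed

lemma ip_unit: "ip n (unit n x) b = ip n x b / sqrt (ip n x x)"
 by (simp add: unit_def sum_divide_distrib)

lemma ip_unit_self: assumes "0 < ip n x x" shows "ip n (unit n x) (unit n x) = 1"
proof -
 have "ip n x (unit n x) = ip n x x / sqrt (ip n x x)" by (simp add: unit_def sum_divide_distrib)
 thus ?thesis using assms unfolding ip_unit by (simp add: real_div_sqrt)
qed

lemma unit_sph: "x : sph n ==> unit n x = x" by (simp add: unit_def)

lemma unit_in_sph: "0 < ip n x x ==> (!!i. i > n ==> x i = 0) ==> unit n x : sph n"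
 using ip_unit_self by (simp add: unit_def)

lemma unit_eqD: assumes "unit n z = y" "0 < ip n z z" shows "EX c>0. z = (%i. c * y i)"
 using assms by (intro exI[of _ "sqrt (ip n z z)"]) (auto simp: unit_def)

lemma continuous_on_unit: "con {x. 0 < ip n x x} (unit n)"
 unfolding unit_def
 by (intro continuous_on_coordinatewise_then_product continuous_intros continuous_on_product_then_coordinatewise[OF continuous_on_id]) auto

lemma sphere_homotopic:
 fixes f g :: "'x => nat => real"
 assumes f: "!!i. cmp X eur (%x. f x i)" and g: "!!i. cmp X eur (%x. g x i)"
  and Z: "!!x u. x : tps X ==> u : {0..1} ==>
   0 < ip n (%i. (1 - u) * f x i + u * g x i) (%i. (1 - u) * f x i + u * g x i) & unit n (%i. (1 - u) * f x i + u * g x i) : Y"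
  and T: "!!x u. x : S ==> u : {0..1} ==> unit n (%i. (1 - u) * f x i + u * g x i) : T"
 shows "homotopic_with (%h. h : S \<rightarrow> T) X (tos Y) (%x. unit n (f x)) (%x. unit n (g x))"
proof -
 let ?D = "{z. 0 < ip n z z & unit n z : Y}"
 have "homotopic_with (%h. h : S \<rightarrow> {z. unit n z : T}) X (tos ?D) f g"
  by (rule line_homotopic) (use f g Z Z[of _ 0] Z[of _ 1] T in \<open>auto simp: cmp_coords\<close>)
 moreover have "cmp (tos ?D) (tos Y) (unit n)"
  using continuous_on_subset[OF continuous_on_unit, of ?D n] by (auto simp: image_subset_iff_funcset)
 ultimately have "homotopic_with (%h. h : S \<rightarrow> T) X (tos Y) (unit n o f) (unit n o g)"
  by (rule homotopic_with_compose_continuous_map_left) auto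
 thus ?thesis by (simp add: o_def)
qed

text \<open>Normalized segments lead to the antipode of y. If one of them met the ray of y, then
  comparing norms would give \<open>x = y\<close>; the case \<open>c = 0\<close> of the same
  argument excludes the origin.\<close>

lemma contractible_punctured_sphere:
 assumes y: "y : sph n"
 shows "contractible_space (tos (sph n - {y}))"
proof -
 let ?Y = "sph n - {y}" and ?z = "%x u i. (1 - u) * x i + u * - y i"
 have no: "~ (0 <= c & ?z x u = (%i. c * y i))" if x: "x : ?Y" and u: "u : {0..1}" for x u c
 proof
  assume c: "0 <= c & ?z x u = (%i. c * y i)"
  hence eq: "(1 - u) * x i = (c + u) * y i" for i using fun_cong[of "?z x u" "%i. c * y i" i] by (simp add: algebra_simps)
  have "(1 - u) * (1 - u) * ip n x x = (c + u) * (c + u) * ip n y y"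
   unfolding sum_distrib_left
  proof (rule sum.cong[OF refl])
   fix i
   have "(1 - u) * x i * ((1 - u) * x i) = (c + u) * y i * ((c + u) * y i)" unfolding eq ..
   thus "(1 - u) * (1 - u) * (x i * x i) = (c + u) * (c + u) * (y i * y i)" by (simp only: mult_ac)
  qed
  hence "(1 - u)\<^sup>2 = (c + u)\<^sup>2" using x y by (simp add: power2_eq_square)
  hence cu: "1 - u = c + u" using c u by (simp add: power2_eq_iff_nonneg)
  hence "1 - u ~= 0" using c u by auto
  hence "x i = y i" for i using eq[of i] cu by simp
  thus False using x by auto
 qed
 have "homotopic_with (%h. h : UNIV \<rightarrow> UNIV) (tos ?Y) (tos ?Y) (%x. unit n x) (%x. unit n (%i. - y i))"
 proof (rule sphere_homotopic)
  fix x u assume xu: "x : tps (tos ?Y)" "(u::real) : {0..1}"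
  hence x: "x : ?Y" by simp
  have v: "?z x u i = 0" if "i > n" for i using x y that by simp
  have pos: "0 < ip n (?z x u) (?z x u)"
  proof (rule ccontr)
   assume "~ ?thesis"
   hence "ip n (?z x u) (?z x u) = 0" using ip_pos[where x="?z x u" and b="?z x u" and n=n] by blast
   hence "ALL i<=n. ?z x u i = 0" by (simp add: sum_nonneg_eq_0_iff)
   hence "?z x u i = 0 * y i" for i using v[of i] by (cases "i <= n") auto
   thus False using no[OF x xu(2), of 0] by fastforce
  qed
  moreover have "unit n (?z x u) ~= y" using unit_eqD[OF _ pos, of y] no[OF x xu(2)] by (metis less_imp_le)
  ultimately show "0 < ip n (?z x u) (?z x u) & unit n (?z x u) : ?Y" using unit_in_sph[OF pos v] by blast
 qed (rule continuous_map_coord, auto)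
 hence "homotopic_with (%h. True) (tos ?Y) (tos ?Y) (%x. unit n x) (%x. unit n (%i. - y i))"
  by (rule homotopic_with_mono) simp
 hence "homotopic_with (%h. True) (tos ?Y) (tos ?Y) id (%x. unit n (%i. - y i))"
  by (rule homotopic_with_eq) (auto simp: unit_sph)
 thus ?thesis unfolding contractible_space_def by blast
qed

text \<open>The group is isomorphic to the reduced homology of the sphere, which is infinite cyclic
  for every n, including 0.\<close>

lemma sphere_generator_infinite:
 assumes a: "a : sph n" and s: "s : carrier (relative_homology_group (int n) (nsphere n) {a})"
  "generate (relative_homology_group (int n) (nsphere n) {a}) {s} = carrier (relative_homology_group (int n) (nsphere n) {a})"
  and k: "s [^]\<^bsub>relative_homology_group (int n) (nsphere n) {a}\<^esub> (k::int) = \<one>\<^bsub>relative_homology_group (int n) (nsphere n) {a}\<^esub>"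
 shows "k = 0"
proof (rule ccontr)
 let ?H = "relative_homology_group (int n) (nsphere n) {a}"
 assume k0: "k ~= 0"
 have gr: "group ?H" by simp
 have "?H \<cong> integer_group"
  using iso_trans[OF isomorphic_relative_homology_by_singleton reduced_homology_group_nsphere(1), of a n] a by (simp add: nsphere_eq)
 then obtain f where f: "f : iso ?H integer_group" by (auto simp: is_iso_def)
 hence hom: "group_hom ?H integer_group f" by (simp add: group_hom_def group_hom_axioms_def iso_def)
 have inj: "inj_on f (carrier ?H)" and surj: "f ` carrier ?H = UNIV" using f by (auto simp: iso_def bij_betw_def)
 have "k * f s = 0" using group_hom.hom_int_pow[OF hom s(1), of k] group_hom.hom_one[OF hom] k by simp
 hence "f s = f \<one>\<^bsub>?H\<^esub>" using k0 group_hom.hom_one[OF hom] by simp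
 hence "s = \<one>\<^bsub>?H\<^esub>" using inj_onD[OF inj _ s(1) monoid.one_closed[OF group.is_monoid[OF gr]]] by blast
 hence "carrier ?H = {\<one>\<^bsub>?H\<^esub>}" using s(2) group.generate_one[OF gr] by simp
 hence "f ` {\<one>\<^bsub>?H\<^esub>} = (UNIV :: int set)" using surj by simp
 hence "(UNIV :: int set) <= {f \<one>\<^bsub>?H\<^esub>}" by simp
 thus False by (metis infinite_UNIV_int finite.emptyI finite_insert finite_subset)
qed

text \<open>Injectivity of the map from the homology relative to a to the local homology at y, by
  the exact sequence of the triple: the punctured sphere is contractible, so its homology relative
  to a vanishes.\<close>

lemma punctured_relboundary:
 assumes y: "y : sph n" and a: "a : sph n" "a ~= y"
  and c: "rcy n (nsphere n) {a} c" and b: "rbd n (nsphere n) (sph n - {y}) c"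
 shows "rbd n (nsphere n) {a} c"
proof -
 let ?Y = "sbt (nsphere n) (sph n - {y})"
 have Y: "?Y = tos (sph n - {y})" "{a} <= sph n - {y}" using a
  by (auto simp: nsphere_eq subtopology_subtopology intro!: arg_cong[of _ _ top_of_set])
 obtain d e where de: "singular_chain (Suc n) (nsphere n) d" "singular_chain n ?Y e" "cbd (Suc n) d + e = c"
  using b by (auto simp: singular_relboundary)
 have "cbd n c = cbd n e"
  using chain_boundary_boundary_alt[OF de(1)] by (simp add: de(3)[symmetric] chain_boundary_add)
 hence e: "rcy n ?Y {a} e"
  using c de(2) unfolding singular_relcycle by (simp only: subtopology_subtopology Int_absorb1[OF Y(2)] simp_thms)
 have "trivial_group (relative_homology_group (int n) ?Y {a})"
  using trivial_reduced_homology_group_contractible_space[OF contractible_punctured_sphere[OF y], of "int n"]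
   isomorphic_group_triviality[OF isomorphic_reduced_homology_by_singleton[of a ?Y "int n"]] a unfolding Y(1) by simp
 moreover have "hcl n ?Y {a} e : carrier (relative_homology_group (int n) ?Y {a})"
  unfolding carrier_relative_homology_group by (rule imageI) (simp add: e)
 ultimately have "hcl n ?Y {a} e = \<one>\<^bsub>relative_homology_group (int n) ?Y {a}\<^esub>"
  unfolding trivial_group_def by (simp only: singleton_iff)
 hence "rbd n ?Y {a} e" using e
  by (simp add: one_relative_homology_group homologous_rel_set_eq_relboundary)
 hence "rbd n (nsphere n) {a} e" by (rule rbd_sbt) simp
 moreover have "rbd n (nsphere n) {a} (cbd (Suc n) d)"
  unfolding singular_relboundary using de(1) by (rule_tac exI[of _ d], rule_tac exI[of _ 0]) auto
 ultimately show ?thesis using singular_relboundary_add de(3) by metis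
qed

text \<open>For each T some nonzero l is orthogonal to T. Along the moment curve
  \<open>x ^ i\<close> the product with l is a nonzero polynomial in x, so all but finitely many x
  avoid all these hyperplanes at once. The sign of y is then chosen to suit a.\<close>

lemma generic_point:
 assumes B: "finite B" and a: "a : sph n"
 obtains y where "y : sph n" "ip n y a <= 0"
  "!!T. T <= B ==> card T <= n ==> EX l. (ALL b:T. ip n l b = 0) & ip n l y ~= 0"
proof -
 let ?\<T> = "{T. T <= B & card T <= n}"
 have fin: "finite ?\<T>" using B by (simp add: finite_Collect_conjI)
 have "ALL T:?\<T>. EX l. (EX j<=n. l j ~= 0) & (ALL b:T. ip n l b = 0)"
 proof
  fix T assume T: "T : ?\<T>"
  hence "finite T" using B finite_subset by blast
  thus "EX l. (EX j<=n. l j ~= 0) & (ALL b:T. ip n l b = 0)"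
   using homogeneous_solution[of T "{..n}" "%b. b"] T by auto
 qed
 from bchoice[OF this] obtain l where l: "ALL T:?\<T>. (EX j<=n. l T j ~= 0) & (ALL b:T. ip n (l T) b = 0)" by (elim exE) (rule that)
 have "finite (UN T:?\<T>. {x::real. (SUM i<=n. l T i * x ^ i) = 0})"
  using fin l by (intro finite_UN_I) (auto simp: polyfun_finite_roots)
 then obtain x where x: "x ~: (UN T:?\<T>. {x::real. (SUM i<=n. l T i * x ^ i) = 0})" using ex_new_if_finite[OF infinite_UNIV_char_0] by blast
 let ?v = "%i. if i <= n then x ^ i else 0"
 have pos: "0 < ip n ?v ?v" by (rule ip_pos[where b="%i. if i = 0 then 1 else 0"]) (simp add: if_distrib cong: if_cong)
 define w where "w = unit n ?v"
 have w: "w : sph n" unfolding w_def by (rule unit_in_sph[OF pos]) simp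
 define y where "y = (if ip n w a <= 0 then w else (%i. - w i))"
 have "y : sph n" "ip n y a <= 0" using w by (auto simp: y_def sum_negf)
 moreover have "EX k. (ALL b:T. ip n k b = 0) & ip n k y ~= 0" if T: "T <= B" "card T <= n" for T
 proof (intro exI conjI)
  show "ALL b:T. ip n (l T) b = 0" using l T by blast
  have "ip n (l T) ?v = (SUM i<=n. l T i * x ^ i)" by (rule sum.cong) auto
  hence "ip n (l T) ?v ~= 0" using x T by auto
  moreover have "ip n (l T) w = ip n (l T) ?v / sqrt (ip n ?v ?v)" unfolding w_def unit_def by (simp add: sum_divide_distrib)
  ultimately have "ip n (l T) w ~= 0" using pos by simp
  thus "ip n (l T) y ~= 0" by (simp add: y_def sum_negf)
 qed
 ultimately show thesis by (rule that)
qed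

section \<open>From rational chains to integral homology\<close>

lemma common_denominator:
 fixes e :: "'i => rat"
 assumes "finite T" shows "EX N>0::int. ALL x:T. of_int N * e x : \<int>"
 using assms
proof (induction T rule: finite_induct)
 case (insert x T)
 then obtain N where N: "N > 0" "ALL y:T. of_int N * e y : \<int>" by blast
 obtain a b where ab: "e x = of_int a / of_int b" "b > 0" by (cases "e x" rule: Rat_cases) (auto simp: Fract_of_int_quotient)
 have "of_int (N * b) * e y : \<int>" if y: "y : insert x T" for y
 proof (cases "y = x")
  case True
  hence "of_int (N * b) * e y = of_int (N * a)" using ab by simp
  thus ?thesis by (simp only: Ints_of_int)
 next
  case False
  hence "of_int N * e y : \<int>" using y N(2) by blast
  hence "of_int b * (of_int N * e y) : \<int>" by (rule Ints_mult[OF Ints_of_int])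
  thus ?thesis by (simp add: mult_ac)
 qed
 thus ?case using N(1) ab(2) by (intro exI[of _ "N * b"]) simp
qed (auto intro: exI[of _ 1])

lemma lookup_frag_of: "Poly_Mapping.lookup (fof a) b = (if a = b then 1 else 0)"
 by (simp add: lookup_single when_def)

text \<open>Only finitely many simplices of e meet Q, and N clears their denominators. Truncated to
  these, e has the prescribed boundary up to simplices in the complement of Q, relative to which
  they count for nothing.\<close>

lemma qboundary_relboundary:
 fixes c :: "'i => int"
 assumes e: "e : lfc X (Suc n)" and Q: "compactin X Q" and S: "finite S"
  and A: "!!i. i : S ==> ssx n X (A i)"
  and eq: "!!u. u ` stds n Int Q ~= {} ==> qbd (Suc n) e u = (SUM i:S. if A i = u then of_int (c i) else 0)"
 shows "EX N>0. rbd n X (tps X - Q) (fcm N (SUM i:S. fcm (c i) (fof (A i))))"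
proof -
 define T where "T = {t. e t ~= 0 & t ` stds (Suc n) Int Q ~= {}}"
 have T: "finite T" "!!t. t : T ==> ssx (Suc n) X t" using e Q by (auto simp: lf_chains_def T_def)
 obtain N :: int where N: "N > 0" "ALL t:T. of_int N * e t : \<int>" using common_denominator[OF T(1)] by blast
 have "ALL t:T. EX d. of_int N * e t = of_int d" using N(2) by (auto elim: Ints_cases)
 from bchoice[OF this] obtain d where d: "ALL t:T. of_int N * e t = of_int (d t)" by (elim exE) (rule that)
 let ?E = "SUM t:T. fcm (d t) (fof t)" and ?C = "SUM i:S. fcm (c i) (fof (A i))"
 let ?w = "fcm N ?C - cbd (Suc n) ?E"
 have E: "singular_chain (Suc n) X ?E" by (intro singular_chain_sum singular_chain_cmul) (simp add: singular_chain_of T(2))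
 have C: "singular_chain n X ?C" by (intro singular_chain_sum singular_chain_cmul) (simp add: singular_chain_of A)
 have wc: "singular_chain n X ?w"
  using singular_chain_diff[OF singular_chain_cmul[OF C] singular_chain_boundary_alt[OF E]] .
 have zero: "Poly_Mapping.lookup ?w u = 0" if u: "u ` stds n Int Q ~= {}" for u
 proof -
  have "of_int (Poly_Mapping.lookup (cbd (Suc n) ?E) u)
   = (SUM t:T. SUM k<=Suc n. of_int (d t) * ((-1) ^ k * (if sfc (Suc n) k t = u then 1 else (0::rat))))"
   by (simp only: chain_boundary_sum o_def chain_boundary_cmul chain_boundary_of lookup_sum lookup_frag_cmul nat.distinct if_False
     lookup_frag_of of_int_sum of_int_mult of_int_power of_int_minus of_int_1 sum_distrib_left of_int_0 if_distrib[of of_int])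
  also have "... = (SUM k<=Suc n. SUM t:T. if sfc (Suc n) k t = u then (-1) ^ k * (of_int N * e t) else 0)"
   using d by (subst sum.swap) (intro sum.cong refl, simp)
  also have "... = (SUM k<=Suc n. of_int N * (SUM t | e t ~= 0 & sfc (Suc n) k t = u. (-1) ^ k * e t))"
  proof (rule sum.cong[OF refl])
   fix k assume k: "k : {..Suc n}"
   have "{t. e t ~= 0 & sfc (Suc n) k t = u} = {t : T. sfc (Suc n) k t = u}"
    using sfc_image[of "Suc n" k] u k by (fastforce simp: T_def)
   thus "(SUM t:T. if sfc (Suc n) k t = u then (-1) ^ k * (of_int N * e t) else 0)
    = of_int N * (SUM t | e t ~= 0 & sfc (Suc n) k t = u. (-1) ^ k * e t)"
    by (simp add: sum.inter_filter[OF T(1), symmetric] sum_distrib_left mult.left_commute)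
  qed
  also have "... = of_int N * qbd (Suc n) e u" by (simp only: qboundary_def sum_distrib_left nat.distinct if_False)
  also have "... = of_int (Poly_Mapping.lookup (fcm N ?C) u)"
   unfolding eq[OF u] by (simp only: lookup_frag_cmul lookup_sum lookup_frag_of of_int_mult of_int_sum) (simp add: if_distrib cong: if_cong)
  finally show ?thesis by (simp only: of_int_eq_iff lookup_minus cancel_comm_monoid_add_class.diff_cancel)
 qed
 have "singular_chain n (sbt X (tps X - Q)) ?w"
  unfolding singular_chain_def
 proof
  fix u assume u: "u : Poly_Mapping.keys ?w"
  hence s: "ssx n X u" using wc by (auto simp: singular_chain_def)
  have "u ` stds n Int Q = {}" using zero[of u] u unfolding in_keys_iff by blast
  moreover have "u ` stds n <= tps X" using s by (auto simp: singular_simplex_def continuous_map_def)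
  ultimately show "u : singular_simplex_set n (sbt X (tps X - Q))" using s by (auto simp: singular_simplex_subtopology)
 qed
 hence "rbd n X (tps X - Q) (fcm N ?C)"
  unfolding singular_relboundary using E by (rule_tac exI[of _ ?E], rule_tac exI[of _ ?w]) simp
 thus ?thesis using N(1) by blast
qed

context macro begin

text \<open>
 All the neighbourhoods allowed in the definition of the lifted orientation at \<open>x\<close> lie in the complement \<open>W\<close> of the other
 points of the fibre, where the covering map induces an injection on local homology, by excision.
\<close>

lemma lift_orientation_simplex:
 assumes R: "ct R ~= 0" "smp n p R = \<sigma> s" and s: "s : K" "card s = Suc n" and t: "t : itr n"
 shows "rcy n (tos Mt) (Mt - {R t}) (fof R)"
  "lift_orientation n (tos Mt) p (tos M) \<omega> (R t)
   = hcl n (tos Mt) (Mt - {R t}) (fcm (sgn_of s) (fof R))"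
proof -
 let ?Y = "tos Mt" and ?X = "tos M"
 define x where "x = R t"
 define W where "W = {y : Mt. p y = p x --> y = x}"
 let ?YW = "tos W" and ?c = "fcm (sgn_of s) (fof R)"
 have tD: "t : stds n" using t itr_sub by blast
 have sing: "ssx n ?Y R" using R(1) by (auto simp: transfer_def split: if_splits)
 have C: "p (R u) = \<sigma> s u" if "u : stds n" for u using smp_apply[OF that, of p R] R(2) by simp
 have uniq: "u = t" if "u : stds n" "p (R u) = p x" for u
  using inj_onD[OF inj_osx[OF s] _ that(1) tD] that C[OF that(1)] C[OF tD] by (simp add: x_def)
 have E: "R u : Mt" if "u : stds n" for u using sing that unfolding ssx_iff by blast
 have xM: "x : Mt" and xW: "x : W" unfolding x_def W_def using E[OF tD] by auto
 have WM: "W <= Mt" by (auto simp: W_def)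
 have sub: "sbt ?YW U = tos U" "sbt ?Y U = tos U" if "U <= W" for U
  using that WM by (auto simp: subtopology_subtopology Int_absorb1)
 have contp: "cmp ?Y ?X p" using covering_space_imp_continuous[OF cov] covering_space_imp_surjective[OF cov] by auto
 have contW: "cmp ?YW ?X p" using continuous_map_from_subtopology[OF contp, of W] WM by (simp add: subtopology_subtopology Int_absorb1)
 have pW: "p : W - {x} \<rightarrow> M - {p x}" using p_img by (auto simp: W_def)
 have "ssx n ?YW R"
  using sing E uniq unfolding ssx_iff W_def by (auto simp: x_def)
 hence "rcy n ?YW (tps ?YW - {x}) (fof R)"
  by (rule simplex_relcycle) (use uniq t in auto)
 hence cycW: "rcy n ?YW (W - {x}) (fof R)" and c: "rcy n ?YW (W - {x}) ?c"
  by (simp_all add: singular_relcycle_cmul)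
 have toY: "rcy n ?Y (Mt - {x}) b" if "rcy n ?YW (W - {x}) b" for b
  using rcy_sbt[of n ?Y W "W - {x}" b "Mt - {x}"] that WM sub(2)[of W] by auto
 have bdY: "rbd n ?Y (Mt - {x}) b" if "rbd n ?YW (W - {x}) b" for b
  using rbd_sbt[of n ?Y W "W - {x}" b "Mt - {x}"] that WM sub(2)[of W] by auto
 show "rcy n ?Y (Mt - {R t}) (fof R)" using toY[OF cycW] by (simp add: x_def)
 have pc: "chain_map n p ?c = fcm (sgn_of s) (fof (\<sigma> s))" by (simp add: R(2))
 have w: "\<omega> (p x) = hcl n ?X (M - {p x}) (chain_map n p ?c)"
  unfolding pc using simplex_sign(2)[OF s t] C[OF tD] by (simp add: x_def)
 obtain U0 u0 q where U: "x : U0" "opi ?Y U0" "p x : u0" "opi ?X u0" "homeomorphism U0 u0 p q"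
  using covering_space_local_homeomorphism[OF cov xM] by metis
 have inj0: "inj_on p U0" using homeomorphism_apply1[OF U(5)] by (metis inj_onI)
 have U0M: "U0 <= Mt" and u0M: "u0 <= M" using U(2,4) openin_subset by fastforce+
 have inW: "U' <= W" if "inj_on p U'" "x : U'" "U' <= Mt" for U' using that by (auto simp: W_def inj_on_def)
 have U0W: "U0 <= W" by (rule inW[OF inj0 U(1) U0M])
 have clW: "closedin ?YW {x}" using Hausdorff_Mt xW closedin_Hausdorff_singleton[OF Hausdorff_space_subtopology[OF Hausdorff_Mt, of W], of x] WM
  by (simp add: subtopology_subtopology Int_absorb1)
 have intW: "{x} <= ?YW interior_of U0"
  using U(1) openin_subset_topspace_eq openin_subtopology_Int2[OF U(2), of W] U0W WM
  by (subst interior_of_openin) (auto simp: subtopology_subtopology Int_absorb1 Int_absorb2 intro: openin_subset_trans[OF U(2)])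
 have exc: "EX b'. rcy n (tos U0) (U0 - {x}) b' & rbd n ?YW (W - {x}) (b - b')"
  if b: "rcy n ?YW (W - {x}) b" for b
  using excision_relcycle[OF clW intW, of n b] U0W b unfolding sub(1)[OF U0W] by (simp, metis)
 \<comment> \<open>Injectivity of p on local homology at x. By excision b is moved into the sheet
   U0, where q inverts p, and the vanishing downstairs is excised to the image u0 of the
   sheet.\<close>
 have inj: "rbd n ?YW (W - {x}) b"
  if b: "rcy n ?YW (W - {x}) b" and pb: "rbd n ?X (M - {p x}) (chain_map n p b)" for b
 proof -
  obtain b' where b': "rcy n (tos U0) (U0 - {x}) b'" "rbd n ?YW (W - {x}) (b - b')" using exc[OF b] by blast
  have "rbd n ?X (M - {p x}) (chain_map n p (b - b'))" by (rule singular_relboundary_chain_map[OF b'(2) contW pW])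
  hence pb': "rbd n ?X (tps ?X - {p x}) (chain_map n p b')"
   using singular_relboundary_diff[OF pb, of "chain_map n p (b - b')"] by (simp add: chain_map_diff)
  have cu: "cmp (tos U0) (tos u0) p" "cmp (tos u0) (tos U0) q"
   using U(5) by (auto simp: homeomorphism_def)
  have pU: "p : U0 - {x} \<rightarrow> u0 - {p x}" "q : u0 - {p x} \<rightarrow> U0 - {x}"
   using U(1,3,5) inj0 by (auto simp: homeomorphism_def inj_on_def)
  have r: "rcy n (sbt ?X u0) (u0 - {p x}) (chain_map n p b')"
   using singular_relcycle_chain_map[OF b'(1) cu(1) pU(1)] u0M by (simp add: subtopology_subtopology Int_absorb1)
  have "closedin ?X {p x}" using closedin_Hausdorff_singleton[OF haus] U(3) u0M by auto
  hence "rbd n (tos u0) (u0 - {p x}) (chain_map n p b')"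
   using excision_rbd[OF _ _ _ r pb'] interior_of_openin[OF U(4)] U(3) u0M by (simp add: subtopology_subtopology Int_absorb1)
  hence "rbd n (tos U0) (U0 - {x}) (chain_map n q (chain_map n p b'))"
   by (rule singular_relboundary_chain_map[OF _ cu(2) pU(2)])
  moreover have "chain_map n q (chain_map n p b') = b'"
  proof -
   have sc: "singular_chain n (tos U0) b'" using b'(1) by (simp add: singular_relcycle)
   have "chain_map n (q o p) b' = chain_map n id b'"
    by (rule chain_map_eq[OF sc]) (use homeomorphism_apply1[OF U(5)] in simp)
   thus ?thesis by (simp only: chain_map_compose comp_apply chain_map_ident[OF sc])
  qed
  ultimately have "rbd n ?YW (W - {x}) b'"
   using rbd_sbt[of n ?YW U0 "U0 - {x}" b' "W - {x}"] U0W unfolding sub(1)[OF U0W] by auto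
  thus ?thesis using singular_relboundary_add[OF b'(2), of b'] by simp
 qed
 have ind: "hom_induced (int n) (tos U) (U - {x}) ?Y (Mt - {x}) id (hcl n (tos U) (U - {x}) b) = hcl n ?Y (Mt - {x}) b" (is ?A)
  "hom_induced (int n) (tos U) (U - {x}) ?X (M - {p x}) p (hcl n (tos U) (U - {x}) b) = hcl n ?X (M - {p x}) (chain_map n p b)" (is ?B)
  "rcy n ?YW (W - {x}) b"
  if U: "U <= W" and b: "rcy n (tos U) (U - {x}) b" for U b
 proof -
  show ?A
   using hom_id_hcl[of n ?Y U "U - {x}" b "Mt - {x}"] b U WM unfolding sub(2)[OF U] by auto
  show ?B
  proof (rule hom_induced_chain_map[OF _ _ b])
   show "cmp (tos U) ?X p"
    using continuous_map_from_subtopology[OF contW, of U] unfolding sub(1)[OF U] .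
  qed (use pW U in auto)
  show "rcy n ?YW (W - {x}) b"
   using rcy_sbt[of n ?YW U "U - {x}" b "W - {x}"] b U unfolding sub(1)[OF U] by auto
 qed
 let ?P = "%U J a. opi ?Y U & x : U & inj_on p U & J : carrier (local_homology n (sbt ?Y U) x) &
   hom_induced (int n) (sbt ?Y U) (tps (sbt ?Y U) - {x}) ?Y (tps ?Y - {x}) id J = a &
   hom_induced (int n) (sbt ?Y U) (tps (sbt ?Y U) - {x}) ?X (tps ?X - {p x}) p J = \<omega> (p x)"
 have "(THE a. EX U J. ?P U J a) = hcl n ?Y (Mt - {x}) ?c"
 proof (rule the_equality)
  obtain b where b: "rcy n (tos U0) (U0 - {x}) b" "rbd n ?YW (W - {x}) (?c - b)" using exc[OF c] by blast
  have "hcl n ?Y (Mt - {x}) b = hcl n ?Y (Mt - {x}) ?c"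
   unfolding homologous_rel_set_eq using bdY[OF b(2)] by (subst homologous_rel_sym) (simp add: homologous_rel_def)
  moreover have "hcl n ?X (M - {p x}) (chain_map n p b) = \<omega> (p x)"
   unfolding w homologous_rel_set_eq using singular_relboundary_chain_map[OF b(2) contW pW]
   by (subst homologous_rel_sym) (simp only: homologous_rel_def chain_map_diff)
  moreover have "hcl n (tos U0) (U0 - {x}) b : carrier (local_homology n (tos U0) x)"
   using b(1) by (auto simp: carrier_relative_homology_group)
  ultimately show "EX U J. ?P U J (hcl n ?Y (Mt - {x}) ?c)"
   using U(1,2) inj0 ind(1,2)[OF U0W b(1)]
   by (intro exI[of _ U0] exI[of _ "hcl n (tos U0) (U0 - {x}) b"]) (simp only: sub(2)[OF U0W] topspace_euclidean_subtopology simp_thms)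
 next
  fix a
  assume "EX U J. ?P U J a"
  then obtain U' J where U': "opi ?Y U'" "x : U'" "inj_on p U'" and be: "J : carrier (local_homology n (sbt ?Y U') x)"
   "hom_induced (int n) (sbt ?Y U') (tps (sbt ?Y U') - {x}) ?Y (tps ?Y - {x}) id J = a"
   "hom_induced (int n) (sbt ?Y U') (tps (sbt ?Y U') - {x}) ?X (tps ?X - {p x}) p J = \<omega> (p x)" by blast
  have UW: "U' <= W" using inW[OF U'(3,2)] openin_subset[OF U'(1)] by simp
  note be = be[unfolded sub(2)[OF UW] topspace_euclidean_subtopology]
  obtain b where b: "rcy n (tos U') (U' - {x}) b" "J = hcl n (tos U') (U' - {x}) b"
   using be(1) by (auto simp: carrier_relative_homology_group)
  note I = ind[OF UW b(1)]
  have "homologous_rel n ?X (M - {p x}) (chain_map n p b) (chain_map n p ?c)"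
   using be(3) unfolding b(2) I(2) w by (simp only: homologous_rel_set_eq)
  hence "rbd n ?YW (W - {x}) (b - ?c)"
   by (intro inj singular_relcycle_diff[OF I(3) c]) (simp only: chain_map_diff homologous_rel_def)
  hence "hcl n ?Y (Mt - {x}) b = hcl n ?Y (Mt - {x}) ?c"
   unfolding homologous_rel_set_eq by (simp only: homologous_rel_def bdY)
  thus "a = hcl n ?Y (Mt - {x}) ?c" using be(2) unfolding b(2) I(1) by simp
 qed
 thus "lift_orientation n ?Y p ?X \<omega> (R t) = hcl n ?Y (Mt - {R t}) ?c"
  unfolding lift_orientation_def x_def .
qed

end

section \<open>The continuous map from the covering to a nerve\<close>

context macro begin

text \<open>\<open>to_nerve\<close> followed by the refinement maps up to stage k, in closed form on
  barycentric coordinates. On a simplex of \<open>ct\<close> it is the affine simplex that occurs in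
  \<open>vchain (ball_at k)\<close>.\<close>

definition nerve_map :: "nat => 'b => 'b set => real" where
 "nerve_map k x = spm (ball_at k) (lifted_coords K h (tos Mt) p x)"

lemma nerve_map_lift:
 assumes l: "lift s T" and w: "w : spts s"
 shows "nerve_map k (T w) = spm (%v. ball_at k (T (vx v))) w"
 unfolding nerve_map_def lifted_coords_eq[OF l w] by (rule spm_spm[OF liftD(2)[OF l] w])

lemma nerve_map_continuous:
 assumes "m <= k" shows "cmp (tos Mt) (nspc k) (nerve_map k)"
 using assms
proof (induction k rule: nat_induct_at_least)
 case base
 have "ball_at m = vball" by (rule ext) (simp add: ball_at_def)
 hence "nerve_map m = to_nerve K h (tos Mt) p D" by (intro ext) (simp only: nerve_map_def to_nerve_def)
 thus ?case using to_nerve_proper by (simp add: lf_proper_def)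
next
 case (Suc k)
 have "cmp (tos Mt) (nspc (Suc k)) (spm (r k) o nerve_map k)"
  using lf_proper_refine by (intro continuous_map_compose[OF Suc.IH]) (simp add: lf_proper_def)
 moreover have "(spm (r k) o nerve_map k) x = nerve_map (Suc k) x" if x: "x : tps (tos Mt)" for x
 proof -
  obtain s w T where l: "lift s T" "w : spts s" "T w = x" using lift_through[of x] x by (metis topspace_euclidean_subtopology)
  show ?thesis
   unfolding l(3)[symmetric] comp_apply nerve_map_lift[OF l(1,2)] spm_spm[OF liftD(2)[OF l(1)] l(2)]
   by (simp add: ball_at_Suc[OF Suc.hyps])
 qed
 ultimately show ?case by (rule continuous_map_eq)
qed

lemma nerve_map_ct:
 assumes R: "ct R ~= 0" and t: "t : stds n"
 shows "nerve_map k (R t) = aff n (%i. ball_at k (R (vx i))) t"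
proof -
 obtain s T where s: "lift s T" "card s = Suc n" "R = smp n T (aff n (%i. lst s ! i))" using ct_support[OF R] by metis
 have v: "R (vx i) = T (vx (lst s ! i))" if "i <= n" for i
  unfolding s(3) smp_apply[OF vx_stds[OF that]] aff_vertex[OF that] ..
 have "nerve_map k (R t) = aff n (%i. ball_at k (T (vx (lst s ! i)))) t"
  unfolding s(3) smp_apply[OF t] nerve_map_lift[OF s(1) aff_in[OF liftD(1)[OF s(1)] s(2) t]] simplicial_map_aff[OF t] ..
 also have "... = aff n (%i. ball_at k (R (vx i))) t" by (rule fun_cong[OF aff_cong]) (simp add: v)
 finally show ?thesis .
qed

lemma ct_singular: "ct R ~= 0 ==> ssx n (tos Mt) R"
 by (auto simp: transfer_def split: if_splits)

lemma ct_coefficient: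
 assumes s: "s : K" "card s = Suc n" and R: "ssx n (tos Mt) R" "smp n p R = \<sigma> s"
 shows "ct R = of_int (sgn_of s)" "ct R ~= 0"
proof -
 have "{s'. (if s' : nsimps then of_int (sgn_of s') else 0 :: rat) ~= 0 & \<sigma> s' = \<sigma> s} <= {s}"
  using ordered_simplex_inject[OF _ _ s] by auto
 hence "fund (\<sigma> s) = of_int (sgn_of s)" unfolding fund_gpush by (subst gpush_on_superset[of "{s}"]) (simp_all add: s)
 thus "ct R = of_int (sgn_of s)" using R by (simp add: transfer_def)
 thus "ct R ~= 0" using simplex_sign(1)[OF s] by auto
qed

text \<open>An open n-simplex of M meets no other closed n-simplex, so both project to the same
  simplex, and unique lifting does the rest.\<close>

lemma ct_interior_unique:
 assumes R: "ct R ~= 0" "ct B ~= 0" and t: "t : itr n" and u: "u : stds n" "B u = R t"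
 shows "B = R"
proof -
 have tD: "t : stds n" using t itr_sub by blast
 obtain s T where s: "lift s T" "card s = Suc n" "smp n p R = \<sigma> s" using ct_support[OF R(1)] by metis
 obtain s' C where s': "lift s' C" "card s' = Suc n" "smp n p B = \<sigma> s'" using ct_support[OF R(2)] by metis
 note K = liftD(1)[OF s(1)] s(2) and K' = liftD(1)[OF s'(1)] s'(2)
 let ?a = "aff n (%i. lst s ! i) t" and ?b = "aff n (%i. lst s' ! i) u"
 have eq: "\<sigma> s' u = \<sigma> s t"
  using smp_apply[OF tD, of p R] smp_apply[OF u(1), of p B] u(2) s(3) s'(3) by simp
 hence "h ?b = h ?a" unfolding osx_apply[OF K tD] osx_apply[OF K' u(1)] .
 hence ab: "?b = ?a"
  using inj_h in_rlz[OF K(1) aff_in[OF K tD]] in_rlz[OF K'(1) aff_in[OF K' u(1)]] by (auto simp: inj_on_def)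
 have "v : s'" if v: "v : s" for v
 proof -
  obtain i where i: "i <= n" "v = lst s ! i" using enum[OF K] v by (auto simp: bij_betw_def)
  have "0 < ?a v" unfolding i(2) aff_at[OF enum[OF K] i(1) tD] using t i(1) by (simp add: itr_def)
  hence "?b v ~= 0" using ab by simp
  thus ?thesis using aff_in[OF K' u(1)] by (auto simp: simplex_points_def)
 qed
 hence ss: "s = s'" using card_subset_eq[of s' s] liftD(2)[OF s'(1)] s(2) s'(2) by auto
 hence "u = t" using inj_onD[OF inj_osx[OF K] _ u(1) tD] eq by simp
 thus ?thesis
  using u by (intro ssx_unique[OF cov ct_singular[OF R(2)] ct_singular[OF R(1)] _ tD]) (simp_all add: s(3) s'(3) ss)
qed

end

section \<open>Interpolation on the sphere and the degree\<close>

lemma ip_near: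
 assumes x: "x : sph n" "y : sph n" and d: "sphere_dist n x y <= 1"
 shows "0 < ip n x y"
proof (rule ccontr)
 assume c: "~ ?thesis"
 have "0 <= (SUM i<=n. (x i + y i) * (x i + y i))" by (intro sum_nonneg) simp
 also have "... = 2 + 2 * ip n x y" using x by (simp add: algebra_simps sum.distrib sum_distrib_left)
 finally have "arccos 0 <= arccos (ip n x y)" using c by (intro arccos_le_arccos) auto
 thus False using d pi_gt3 by (simp add: sphere_dist_def)
qed

lemma interpolation_sum:
 fixes b :: "'v => nat => real"
 assumes J: "finite J" and w: "!!V. w V = (SUM j:J. if q j = V then c j else 0)"
 shows "(SUM V | w V ~= 0. w V * b V i) = (SUM j:J. c j * b (q j) i)"
proof -
 have "V : q ` J" if "w V ~= 0" for V
 proof (rule ccontr)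
  assume "V ~: q ` J"
  hence "(SUM j:J. if q j = V then c j else 0) = 0" by (intro sum.neutral) auto
  thus False using that w by simp
 qed
 hence "(SUM V | w V ~= 0. w V * b V i) = (SUM V:q ` J. w V * b V i)" by (intro sum.mono_neutral_left) (use J in auto)
 also have "... = (SUM V:q ` J. SUM j:J. if q j = V then c j * b (q j) i else 0)"
  unfolding w sum_distrib_right by (intro sum.cong refl) simp
 also have "... = (SUM j:J. c j * b (q j) i)" by (subst sum.swap) (simp add: J sum.delta)
 finally show ?thesis .
qed

lemma interpolation_ray:
 fixes b :: "'v => nat => real"
 assumes "finite J" "!!V. w V = (SUM j:J. if q j = V then c j else 0)" "(%i. SUM V | w V ~= 0. w V * b V i) = (%i. l * y i)" "l > 0"
 shows "y = (%i. SUM j:J. (c j / l) * b (q j) i)"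
proof
 fix i
 have "l * y i = (SUM j:J. c j * b (q j) i)" using fun_cong[OF assms(3), of i] interpolation_sum[OF assms(1,2)] by simp
 hence "y i = (SUM j:J. c j * b (q j) i) / l" using assms(4) by (simp add: field_simps)
 thus "y i = (SUM j:J. (c j / l) * b (q j) i)" by (simp add: sum_divide_distrib)
qed

text \<open>If at most n coefficients were nonzero, y would lie in the span of at most n points of
  B, and the functional l that vanishes on them would vanish at y.\<close>

lemma generic_card:
 fixes C :: "'j => nat => real"
 assumes y: "ALL T. T <= B & card T <= n --> (EX l. (ALL b:T. ip n l b = 0) & ip n l y ~= 0)"
  and J: "finite J" "!!j. j : J ==> C j : B" and yc: "y = (%i. SUM j:J. c j * C j i)"
 shows "n < card {j : J. c j ~= 0}"
proof (rule ccontr)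
 let ?J = "{j : J. c j ~= 0}"
 assume "~ n < card ?J"
 hence "card (C ` ?J) <= n" using card_image_le[of ?J C] J(1) by simp
 then obtain l where l: "ALL b:C ` ?J. ip n l b = 0" "ip n l y ~= 0" using y[rule_format, of "C ` ?J"] J(2) by blast
 have "ip n l y = (SUM j:J. c j * ip n l (C j))"
  unfolding yc sum_distrib_left by (subst sum.swap) (simp add: mult_ac)
 also have "... = 0" using l(1) by (intro sum.neutral) auto
 finally show False using l(2) by simp
qed

context macro begin

text \<open>
 A map to the sphere that varies little on the members of the cover factors, up to homotopy, through the nerve by
 interpolation. In the nerve the fundamental chain bounds, while near the preimages of a generic point \<open>y\<close> it
 represents the orientation class.
\<close>

lemma enlargeable_not_boundary:
 assumes UE: "universally_enlargeable n M A \<omega> g Mt p" and k: "m <= k"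
  and e: "e : lfc (nspc k) (Suc n)" "qbd (Suc n) e = vchain (ball_at k)"
 shows False
proof -
 let ?Y = "tos Mt" and ?S = "nsphere n"
 obtain R where R: "!!V x y. V : \<U> k ==> x : V ==> y : V ==> D x y <= R" using coarsening unfolding coarsening_sequence_def by meson
 \<comment> \<open>Points of two members that share a point have distance at most twice |R|; with
   this constant their images have spherical distance at most 1, less than a right angle.\<close>
 define d where "d = 1 / (2 * (\<bar>R\<bar> + 1))"
 have d: "0 < d" "d * (2 * \<bar>R\<bar>) <= 1" by (auto simp: d_def field_simps)
 obtain f k0 where f: "cmp ?Y ?S f" and flip: "!!x y. x : Mt ==> y : Mt ==> sphere_dist n (f x) (f y) <= d * D x y"
  and k0: "k0 ~= 0" and deg: "has_degree n ?Y (lift_orientation n ?Y p (tos M) \<omega>) f k0"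
  using UE d(1) unfolding universally_enlargeable_def by meson
 obtain C a aa s where C: "compactin ?Y C" and aS: "a : tps ?S" and fa: "ALL x:tps ?Y - C. f x = a"
  and aa: "aa : carrier (relative_homology_group (int n) ?Y (tps ?Y - C))"
   "ALL x:C. hom_induced (int n) ?Y (tps ?Y - C) ?Y (tps ?Y - {x}) id aa = lift_orientation n ?Y p (tos M) \<omega> x"
  and s: "s : carrier (relative_homology_group (int n) ?S {a})"
   "generate (relative_homology_group (int n) ?S {a}) {s} = carrier (relative_homology_group (int n) ?S {a})"
   "hom_induced (int n) ?Y (tps ?Y - C) ?S {a} f aa = s [^]\<^bsub>relative_homology_group (int n) ?S {a}\<^esub> k0"
  using deg unfolding has_degree_def by blast
 have CM: "C <= Mt" "compact C" using C by (simp_all add: compactin_subtopology)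
 have a: "a : sph n" using aS unfolding nsphere_eq by simp
 have fS: "f x : sph n" if "x : Mt" for x using f that unfolding nsphere_eq by (auto simp: cmp_coords)
 have foff: "f x = a" if "x : Mt" "x ~: C" for x using fa that by simp
 have close: "0 < ip n (f x) (f y)" if "x : Mt" "y : Mt" "D x y <= 2 * \<bar>R\<bar>" for x y
 proof (rule ip_near[OF fS fS])
  have "d * D x y <= d * (2 * \<bar>R\<bar>)" using that(3) d(1) by simp
  thus "sphere_dist n (f x) (f y) <= 1" using flip[OF that(1,2)] d(2) by simp
 qed (use that in auto)
 \<comment> \<open>The vertex map to the sphere. On a simplex of the nerve its values have pairwise
   positive products, so that their convex combinations do not vanish and can be normalized.\<close>
 define b where "b V = f (SOME x. x : V)" for V
 have pt: "(SOME x. x : V) : V" "(SOME x. x : V) : Mt" if "V : \<U> k" "x : V" for V x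
  using someI[of "%x. x : V" x] that cover_sub[OF that(1)] by blast+
 have bS: "b V : sph n" if "V : \<U> k" "x : V" for V x unfolding b_def by (rule fS[OF pt(2)[OF that]])
 have b_pt: "0 < ip n (b V) (f x)" if V: "V : \<U> k" "x : V" for V x
  unfolding b_def using R[OF V(1) pt(1)[OF V] V(2)] pt(2)[OF V] cover_sub[OF V(1)] V(2) by (intro close) auto
 have b_b: "0 < ip n (b V) (b W)" if V: "V : \<U> k" "W : \<U> k" "x : V" "x : W" for V W x
 proof -
  note v = pt[OF V(1,3)] and w = pt[OF V(2,4)]
  have "x : Mt" using cover_sub[OF V(1)] V(3) by blast
  hence "D (SOME x. x : V) (SOME x. x : W) <= 2 * \<bar>R\<bar>"
   using D_triangle[OF v(2) _ w(2), of x] R[OF V(1) v(1) V(3)] R[OF V(2,4) w(1)] by auto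
  thus ?thesis unfolding b_def by (rule close[OF v(2) w(2)])
 qed
 define G where "G w i = (SUM V | w V ~= 0. w V * b V i)" for w :: "'b set => real" and i :: nat
 have Gs: "G w = (%i. SUM V:t. w V * b V i)" if "t : nerve (\<U> k)" "w : spts t" for t w
  unfolding G_def by (intro ext interpolation_sum[where q="%V. V"]) (use that in \<open>auto simp: nerve_def simplex_points_def\<close>)
 have Gpos: "0 < ip n (G w) c" if t: "t : nerve (\<U> k)" "w : spts t" and c: "!!V. V : t ==> w V ~= 0 ==> 0 < ip n (b V) c" for t w c
 proof -
  have fin: "finite t" using t(1) by (simp add: nerve_def)
  have w: "0 <= w V" "sum w t = 1" for V using t(2) by (auto simp: simplex_points_def)
  obtain V0 where V0: "V0 : t" "w V0 ~= 0" using w(2) by (metis sum.neutral zero_neq_one)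
  have "ip n (G w) c = (SUM V:t. w V * ip n (b V) c)"
   unfolding Gs[OF t] sum_distrib_right sum_distrib_left by (subst sum.swap) (simp add: mult_ac)
  also have "... > 0"
  proof (rule sum_pos2[OF fin V0(1)])
   show "0 < w V0 * ip n (b V0) c" using c[OF V0] V0(2) w(1)[of V0] by simp
   show "0 <= w V * ip n (b V) c" if "V : t" for V using c[OF that] w(1)[of V] by (cases "w V = 0") auto
  qed
  finally show ?thesis .
 qed
 have nerveD: "finite t" "t <= \<U> k" "EX x. ALL V:t. x : V" if "t : nerve (\<U> k)" for t using that by (auto simp: nerve_def)
 have Gnz: "0 < ip n (G w) (G w)" if t: "t : nerve (\<U> k)" "w : spts t" for t w
 proof -
  obtain V0 where V0: "V0 : t" using t(1) by (auto simp: nerve_def)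
  have "0 < ip n (G w) (b V0)" by (rule Gpos[OF t]) (use nerveD[OF t(1)] b_b V0 in blast)
  thus ?thesis by (intro ip_pos[where b="b V0"]) simp
 qed
 have G0: "G w i = 0" if "t : nerve (\<U> k)" "w : spts t" "i > n" for t w i
  unfolding Gs[OF that(1,2)] using bS nerveD[OF that(1)] that(3) by (intro sum.neutral) fastforce
 have G_cont: "cmp (nspc k) eur (%w. G w i)" for i
 proof (rule cmp_from_rlz)
  fix t assume t: "t : nerve (\<U> k)"
  have "cmp (simplex_top t) eur (%w. SUM V:t. w V * b V i)"
   by (intro continuous_map_sum continuous_map_real_mult_right continuous_map_from_subtopology continuous_map_product_projection nerveD(1)[OF t]) simp
  thus "cmp (simplex_top t) eur (%w. G w i)"
   by (rule continuous_map_eq) (simp add: Gs[OF t])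
 qed
 have Nt: "EX t:nerve (\<U> k). w : spts t" if "w : tps (nspc k)" for w using that by (auto simp: topspace_realization)
 define F where "F w = unit n (G w)" for w
 have F_cont: "cmp (nspc k) ?S F"
 proof -
  let ?T = "{z. 0 < ip n z z & (ALL i>n. z i = 0)}"
  have "cmp (nspc k) (tos ?T) G"
   unfolding cmp_coords using G_cont Nt Gnz G0 by blast
  moreover have "cmp (tos ?T) ?S (unit n)"
   unfolding nsphere_eq by (rule iffD2[OF continuous_map_subtopology_eu], intro conjI continuous_on_subset[OF continuous_on_unit])
    (use unit_in_sph in auto)
  ultimately have "cmp (nspc k) ?S (unit n o G)" by (rule continuous_map_compose)
  thus ?thesis by (simp add: F_def[abs_def] o_def)
 qed
 define f' where "f' = F o nerve_map k"
 note nm = nerve_map_continuous[OF k]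
 have f'_cont: "cmp ?Y ?S f'" unfolding f'_def by (rule continuous_map_compose[OF nm F_cont])
 have nm_top: "nerve_map k x : tps (nspc k)" if "x : Mt" for x using nm that by (auto simp: continuous_map_def)
 \<comment> \<open>Every member that contributes to the interpolation at x contains x, so f and the
   interpolated map are nowhere opposite, and the segment between them can be normalized.\<close>
 have Gf: "0 < ip n (G (nerve_map k x)) (f x)" if x: "x : Mt" for x
 proof -
  obtain s w J where l: "lift s J" "w : spts s" "J w = x" using lift_through[OF x] by metis
  let ?q = "%v. ball_at k (J (vx v))"
  obtain t where t: "t : nerve (\<U> k)" "nerve_map k x : spts t" using Nt[OF nm_top[OF x]] by blast
  show ?thesis
  proof (rule Gpos[OF t])
   fix V assume V: "V : t" "nerve_map k x V ~= 0"
   have "nerve_map k x : spts (?q ` s)" unfolding l(3)[symmetric] nerve_map_lift[OF l(1,2)]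
    by (rule spm_in_spts[OF liftD(2)[OF l(1)] l(2)])
   then obtain v where v: "v : s" "V = ?q v" using V(2) unfolding simplex_points_def by blast
   have "x : V" unfolding v(2) using lift_vertex(3,4)[OF l(1) v(1)] ball_at_in[OF lift_vertex(3)[OF l(1) v(1)] k] l(2,3) by blast
   thus "0 < ip n (b V) (f x)" using b_pt nerveD(2)[OF t(1)] V(1) by blast
  qed
 qed
 have unit_ip: "0 < ip n (unit n z) c" if "0 < ip n z c" for z c
  using that ip_pos[where x=z and b=c and n=n] unfolding ip_unit by simp
 define U where "U = {V : \<U> k. V Int C ~= {}}"
 have U: "finite U" unfolding U_def by (rule finite_cover_meeting[OF CM(2,1)])
 \<comment> \<open>Members that avoid C have the value a, so the vertex values form a finite set
   although the cover may be infinite.\<close>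
 define B where "B = insert a (b ` U)"
 have bB: "b V : B" "b V ~= a ==> V : U" if "V : \<U> k" "x : V" for V x
  using pt[OF that] foff[of "SOME x. x : V"] that(1) unfolding B_def b_def U_def by blast+
 have B: "finite B" using U by (simp add: B_def)
 obtain y where y: "y : sph n" "ip n y a <= 0" "ALL T. T <= B & card T <= n --> (EX l. (ALL b:T. ip n l b = 0) & ip n l y ~= 0)"
  by (rule generic_point[OF B a]) blast
 have ya: "a ~= y" using y(2) a by auto
 note generic = generic_card[OF y(3)]
 have ray: "EX l>0. (%i. SUM V | w V ~= 0. w V * b V i) = (%i. l * y i)"
  if Fw: "F w = y" and t: "t : nerve (\<U> k)" "w : spts t" for w t
  using unit_eqD[OF Fw[unfolded F_def] Gnz[OF t]] unfolding G_def by blast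
 define P where "P = {x : Mt. f' x = y}"
 let ?q = "%E i. ball_at k (E (vx i))"
 let ?A = "%E. aff n (?q E)"
 have ct_rep: "EX l>0. y = (%i. SUM j<=n. (t j / l) * b (?q E j) i)" if E: "ct E ~= 0" "t : stds n" "E t : P" for E t
 proof -
  have "?A E t : spts (?q E ` {..n})" by (rule aff_in_spts[OF E(2)]) auto
  moreover have "F (?A E t) = y" using E(3) nerve_map_ct[OF E(1,2)] by (simp add: P_def f'_def)
  ultimately obtain l where l: "l > 0" "(%i. SUM V | ?A E t V ~= 0. ?A E t V * b V i) = (%i. l * y i)"
   using ray[of "?A E t"] ball_at_nerve(1)[OF E(1) k] by blast
  show ?thesis using interpolation_ray[OF finite_atMost aff_apply[OF E(2)] l(2,1)] l(1) by blast
 qed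
 have ct_B: "b (?q E j) : B" if "ct E ~= 0" "j <= n" for E j
  using bB(1)[of "?q E j" "E (vx j)"] ball_at_in[OF ct_vertex(2)[OF that] k] ball_at_nerve(3)[OF that(1) k that(2,2)] by blast
 \<comment> \<open>As y lies outside the span of any n vertex values, its representation on a
   simplex uses all vertices. This places preimages of y in the interiors of n-simplices.\<close>
 have full: "c j ~= 0" if E: "ct E ~= 0" and yc: "y = (%i. SUM j<=n. c j * b (?q E j) i)" and j: "j <= n" for E c j
 proof
  assume "c j = 0"
  hence "{j : {..n}. c j ~= 0} <= {..n} - {j}" by auto
  hence "card {j : {..n}. c j ~= 0} <= n" using card_mono[of "{..n} - {j}"] j by fastforce
  thus False using generic[OF finite_atMost _ yc] ct_B[OF E] by simp
 qed
 have interior: "t : itr n" if E: "ct E ~= 0" "t : stds n" "E t : P" for E t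
 proof -
  obtain l where l: "l > 0" "y = (%i. SUM j<=n. (t j / l) * b (?q E j) i)" using ct_rep[OF E] by blast
  have "t j ~= 0" if "j <= n" for j using full[OF E(1) l(2) that] by auto
  thus ?thesis using E(2) by (auto simp: itr_def standard_simplex_def less_le)
 qed
 have single: "t = t'" if E: "ct E ~= 0" "t : stds n" "E t : P" "t' : stds n" "E t' : P" for E t t'
 proof -
  obtain l where l: "l > 0" "y = (%i. SUM j<=n. (t j / l) * b (?q E j) i)" using ct_rep[OF E(1-3)] by blast
  obtain l' where l': "l' > 0" "y = (%i. SUM j<=n. (t' j / l') * b (?q E j) i)" using ct_rep[OF E(1,4,5)] by blast
  have same: "t j / l = t' j / l'" if j: "j <= n" for j
  proof (rule ccontr)
   assume ne: "t j / l ~= t' j / l'"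
   \<comment> \<open>The factor for which the affine combination of the two representations of y
     loses its j-th coefficient, contrary to \<open>full\<close>.\<close>
   let ?u = "(t j / l) / (t j / l - t' j / l')"
   let ?c = "%i. t i / l + ?u * (t' i / l' - t i / l)"
   have "y i = y i + ?u * (y i - y i)" for i by simp
   hence "y i = (SUM j<=n. (t j / l) * b (?q E j) i) + ?u * ((SUM j<=n. (t' j / l') * b (?q E j) i) - (SUM j<=n. (t j / l) * b (?q E j) i))" for i
    using fun_cong[OF l(2), of i] fun_cong[OF l'(2), of i] by metis
   also have "... i = (SUM j<=n. ?c j * b (?q E j) i)" for i
    unfolding sum_subtractf[symmetric] sum_distrib_left sum.distrib[symmetric] by (intro sum.cong refl) (simp only: algebra_simps)
   finally have "y = (%i. SUM j<=n. ?c j * b (?q E j) i)" by blast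
   from full[OF E(1) this j] have "?c j ~= 0" .
   moreover have "ab + ab / (ab - ac) * (ac - ab) = 0" if "ab ~= ac" for ab ac :: real
    using that by (simp add: divide_simps) (simp add: algebra_simps)
   from this[OF ne] have "?c j = 0" .
   ultimately show False by blast
  qed
  have sums: "(SUM j<=n. t j) = 1" "(SUM j<=n. t' j) = 1" "!!j. j > n ==> t j = 0 & t' j = 0" using E(2,4) by (auto simp: standard_simplex_def)
  have "(SUM j<=n. t j) / l = (SUM j<=n. t' j) / l'" unfolding sum_divide_distrib by (rule sum.cong) (use same in auto)
  hence "l = l'" using sums by simp
  hence "t j = t' j" for j using same[of j] l(1) sums(3)[of j] by (cases "j <= n") auto
  thus ?thesis by blast
 qed
 \<comment> \<open>Outside C the map f' stays in the open half sphere around a, while the product of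
   y and a is not positive.\<close>
 have P_C: "x : C" if x: "x : P" for x
 proof (rule ccontr)
  assume "x ~: C"
  hence "f x = a" using foff x by (simp add: P_def)
  thus False using unit_ip[OF Gf[of x]] x y(2) by (simp add: P_def f'_def F_def)
 qed
 \<comment> \<open>The count of nonzero coefficients, applied to a lifted simplex through x, shows
   that it has n + 1 vertices; so x is an interior point of a simplex of \<open>ct\<close>.\<close>
 have P_ct: "EX E t s. ct E ~= 0 & t : itr n & x = E t & s : K & card s = Suc n & smp n p E = \<sigma> s & ct E = of_int (sgn_of s)"
  if x: "x : P" for x
 proof -
  have xM: "x : Mt" and Fx: "F (nerve_map k x) = y" using x by (auto simp: P_def f'_def)
  obtain s w J where l: "lift s J" "w : spts s" "J w = x" using lift_through[OF xM] by metis
  obtain t where t: "t : nerve (\<U> k)" "nerve_map k x : spts t" using Nt[OF nm_top[OF xM]] by blast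
  have w0: "w v = 0" if "v ~: s" for v using l(2) that by (simp add: simplex_points_def)
  obtain c where c: "c > 0" "y = (%i. SUM v:s. (w v / c) * b (ball_at k (J (vx v))) i)"
  proof -
   obtain c where c: "c > 0" "(%i. SUM V | nerve_map k x V ~= 0. nerve_map k x V * b V i) = (%i. c * y i)" using ray[OF Fx t] by blast
   have "nerve_map k x V = (SUM v:s. if ball_at k (J (vx v)) = V then w v else 0)" for V
    unfolding l(3)[symmetric] nerve_map_lift[OF l(1,2)] by (rule spm_apply[OF liftD(2)[OF l(1)] w0])
   from that[OF c(1) interpolation_ray[OF liftD(2)[OF l(1)] this c(2,1)]] show thesis .
  qed
  have sB: "b (ball_at k (J (vx v))) : B" if v: "v : s" for v
   using bB(1) ball_at_in[OF lift_vertex(3)[OF l(1) v] k] lift_vertex(4)[OF l(1) v l(2)] by blast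
  have "n < card {v : s. w v / c ~= 0}" by (rule generic[OF liftD(2)[OF l(1)] sB c(2)])
  also have "... <= card s" by (intro card_mono liftD(2)[OF l(1)]) auto
  finally have s: "s : K" "card s = Suc n" using dim_le[OF liftD(1)[OF l(1)]] liftD(1)[OF l(1)] by auto
  let ?a = "aff n (%i. lst s ! i)" and ?t = "%i. if i <= n then w (lst s ! i) else 0"
  note t = aff_surj[OF enum[OF s] l(2)]
  let ?E = "smp n J ?a"
  note L = lifted_simplex[OF l(1) s(2)]
  note cc = ct_coefficient[OF s L]
  have xt: "x = ?E ?t" unfolding smp_apply[OF t(1)] t(2) l(3) ..
  have "?t : itr n" by (rule interior[OF cc(2) t(1)]) (use x xt in simp)
  thus ?thesis using cc s L(2) xt by blast
 qed
 obtain c0 where c0: "rcy n ?Y (Mt - C) c0" "aa = hcl n ?Y (Mt - C) c0"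
  using aa(1) by (auto simp: carrier_relative_homology_group)
 have "ALL V:U. EX c. compact c & c <= Mt & V <= c" by (intro ballI cover_compact[where i=k]) (simp add: U_def)
 from bchoice[OF this] obtain cc where cc: "ALL V:U. compact (cc V) & cc V <= Mt & V <= cc V" by (elim exE) (rule that)
 let ?C = "UN V:U. cc V"
 have C': "compact ?C" "?C <= Mt" using cc U by (auto intro!: compact_UN)
 \<comment> \<open>The simplices of the nerve all of whose vertices meet \<open>?C\<close>, a
   compact set that contains the members of U. All preimages of y under F lie there: a simplex
   without vertex in U is mapped to a, and otherwise all vertices meet the one in U.\<close>
 define Q where "Q = \<Union>(spts ` {t : nerve (\<U> k). t <= {V : \<U> k. V Int ?C ~= {}}})"
 have "finite {t : nerve (\<U> k). t <= {V : \<U> k. V Int ?C ~= {}}}"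
  by (rule finite_subset[OF _ finite_Pow_iff[THEN iffD2, OF finite_cover_meeting[OF C', of k]]]) blast
 hence Q: "compactin (nspc k) Q"
  unfolding Q_def by (intro compactin_Union) (auto intro: compact_spts_rlz[OF cplx_nerve])
 have FQ: "w : Q" if w: "w : tps (nspc k)" "F w = y" for w
 proof -
  obtain t where t: "t : nerve (\<U> k)" "w : spts t" using Nt[OF w(1)] by blast
  obtain x where x: "!!V. V : t ==> x : V" "t <= \<U> k" using nerveD[OF t(1)] by blast
  have "EX V:t. V : U"
  proof (rule ccontr)
   assume "~ ?thesis"
   hence "b V = a" if "V : t" for V using bB(2)[of V x] x that by blast
   hence "G w = (%i. sum w t * a i)" unfolding Gs[OF t] sum_distrib_right by (intro ext sum.cong) auto
   hence "G w = a" using t(2) by (simp add: simplex_points_def)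
   thus False using w(2) ya unit_sph[OF a] by (simp add: F_def)
  qed
  then obtain V where V: "V : t" "V : U" by blast
  have "V' : \<U> k & V' Int ?C ~= {}" if "V' : t" for V' using x(1)[OF that] x(1)[OF V(1)] cc V(2) x(2) that by blast
  thus ?thesis unfolding Q_def using t by blast
 qed
 obtain Cq where Cq: "compact Cq" "Cq <= Mt" "!!V w. w : Q ==> w V ~= 0 ==> V <= Cq" using compact_nerve_vertices[OF Q] by metis
 have meeting: "finite {E. ct E ~= 0 & E ` stds n Int C' ~= {}}" if "compact C'" "C' <= Mt" for C'
  using ct_lf that unfolding lf_chains_def by (simp add: compactin_subtopology)
 define R1 where "R1 = {E. ct E ~= 0 & E ` stds n Int Cq ~= {}}"
 have R1: "finite R1" "!!E. E : R1 ==> ct E ~= 0" unfolding R1_def using meeting[OF Cq(1,2)] by auto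
 have R1I: "E : R1" if E: "ct E ~= 0" "?A E ` stds n Int Q ~= {}" for E
 proof -
  from aff_meets[OF E(2)] obtain j w where "j <= n" "w : Q" "w (?q E j) ~= 0" by blast
  thus ?thesis using Cq(3)[of w "?q E j"] ball_at_nerve(2)[OF E(1) k, of j] E(1) unfolding R1_def by blast
 qed
 \<comment> \<open>The coefficients of \<open>ct\<close> are 1 and -1, so rounding only turns these
   rationals into integers.\<close>
 have fl: "of_int \<lfloor>ct E\<rfloor> = ct E" if E: "ct E ~= 0" for E
 proof -
  obtain s J where "lift s J" "card s = Suc n" "smp n p E = \<sigma> s" using ct_support[OF E] by metis
  thus ?thesis using ct_coefficient(1)[OF liftD(1) _ ct_singular[OF E]] by simp
 qed
 have "EX N>0. rbd n (nspc k) (tps (nspc k) - Q)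
   (fcm N (SUM E:R1. fcm \<lfloor>ct E\<rfloor> (fof (?A E))))"
 proof (rule qboundary_relboundary[OF e(1) Q R1(1)])
  show "ssx n (nspc k) (?A E)" if "E : R1" for E
   by (rule ssx_aff[OF cplx_nerve ball_at_nerve(1)[OF R1(2)[OF that] k]])
  fix u assume u: "u ` stds n Int Q ~= {}"
  hence "{E. ct E ~= 0 & ?A E = u} <= R1" using R1I by blast
  thus "qbd (Suc n) e u = (SUM E:R1. if ?A E = u then of_int \<lfloor>ct E\<rfloor> else 0)"
   unfolding e(2) vchain_def by (subst gpush_on_superset[OF R1(1)], assumption, intro sum.cong refl) (simp only: fl[OF R1(2)])
 qed
 then obtain N where N: "N > 0" "rbd n (nspc k) (tps (nspc k) - Q)
   (fcm N (SUM E:R1. fcm \<lfloor>ct E\<rfloor> (fof (?A E))))" by blast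
 \<comment> \<open>The finite integral part of the lifted cycle that can meet the preimages of
   y.\<close>
 define c1 where "c1 = (SUM E:R1. fcm \<lfloor>ct E\<rfloor> (fof E))"
 let ?Z = "sph n - {y}"
 have "smp n F (?A E) = smp n f' E" if "E : R1" for E
  unfolding simplex_map_def by (rule restrict_ext) (simp add: f'_def nerve_map_ct[OF R1(2)[OF that]])
 hence push: "chain_map n F (fcm N (SUM E:R1. fcm \<lfloor>ct E\<rfloor> (fof (?A E)))) = fcm N (chain_map n f' c1)"
  unfolding c1_def by (simp add: chain_map_sum R1(1) o_def)
 have "F : tps (nspc k) - Q \<rightarrow> ?Z" using F_cont FQ unfolding nsphere_eq by (auto simp: cmp_coords)
 from singular_relboundary_chain_map[OF N(2) F_cont this]
 have b1: "rbd n ?S ?Z (fcm N (chain_map n f' c1))" unfolding push .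
 have f'Z: "f' : Mt - P \<rightarrow> ?Z" using f'_cont unfolding nsphere_eq P_def by (auto simp: cmp_coords)
 have clP: "closedin ?Y {x}" if "x : P" for x using closedin_Hausdorff_singleton[OF Hausdorff_Mt] that by (simp add: P_def)
 have "P <= (UN E:{E. ct E ~= 0 & E ` stds n Int C ~= {}}. E ` stds n Int P)"
 proof
  fix x assume x: "x : P"
  obtain E t where E: "ct E ~= 0" "t : itr n" "x = E t" using P_ct[OF x] by metis
  hence "x : E ` stds n" using itr_sub by blast
  thus "x : (UN E:{E. ct E ~= 0 & E ` stds n Int C ~= {}}. E ` stds n Int P)"
   using E(1) x P_C[OF x] by (intro UN_I[of E]) auto
 qed
 moreover have "finite (E ` stds n Int P)" if "ct E ~= 0" for E
  by (rule finite_subsingleton) (use single[OF that] in blast)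
 ultimately have finP: "finite P" by (rule finite_subset[OF _ finite_UN_I[OF meeting[OF CM(2,1)]]]) simp
 have cyc1: "rcy n ?Y (Mt - P) c1"
  unfolding c1_def
 proof (intro singular_relcycle_sum singular_relcycle_cmul)
  fix E assume "E : R1"
  hence E: "ct E ~= 0" by (rule R1(2))
  show "rcy n ?Y (Mt - P) (fof E)"
   using simplex_relcycle[OF ct_singular[OF E], of P] interior[OF E] by simp
 qed
 \<comment> \<open>Both chains represent the orientation along P: c0 by the definition of the
   degree, c1 because at each point exactly one of its simplices contributes, with the sign of
   \<open>lift_orientation_simplex\<close>. As P is finite, this can be checked point by
   point.\<close>
 have "rbd n ?Y (tps ?Y - P) (c0 - c1)"
 proof (rule relboundary_finite[OF finP clP])
  show "rcy n ?Y (tps ?Y - P) (c0 - c1)"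
   using singular_relcycle_diff[OF relcycle_mono[OF c0(1), of "Mt - P"] cyc1] P_C by auto
  fix x assume x: "x : P"
  obtain E t s where E: "ct E ~= 0" "t : itr n" "x = E t" "s : K" "card s = Suc n" "smp n p E = \<sigma> s"
   "ct E = of_int (sgn_of s)" using P_ct[OF x] by blast
  have tD: "t : stds n" using E(2) itr_sub by blast
  have xM: "x : Mt" using x by (simp add: P_def)
  have "F (?A E t) = y" using x nerve_map_ct[OF E(1) tD] unfolding P_def f'_def E(3) by simp
  moreover have "?A E t : tps (nspc k)" using nm_top[OF xM] nerve_map_ct[OF E(1) tD] E(3) by simp
  ultimately have "?A E t : Q" using FQ by blast
  hence ad: "E : R1" using R1I[OF E(1)] tD by blast
  let ?w = "fcm (sgn_of s) (fof E)"
  have "hom_induced (int n) ?Y (Mt - C) ?Y (Mt - {x}) id aa = hcl n ?Y (Mt - {x}) c0"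
   unfolding c0(2) using hom_id_hcl[of n ?Y UNIV "Mt - C" c0 "Mt - {x}"] c0(1) P_C[OF x] by auto
  hence "hcl n ?Y (Mt - {x}) c0 = hcl n ?Y (Mt - {x}) ?w"
   using aa(2) P_C[OF x] lift_orientation_simplex(2)[OF E(1,6,4,5,2)] E(3) by simp
  hence "homologous_rel n ?Y (Mt - {x}) c0 ?w" by (simp only: homologous_rel_set_eq)
  hence "rbd n ?Y (Mt - {x}) (c0 - ?w)" by (simp only: homologous_rel_def)
  moreover have "rbd n ?Y (Mt - {x}) (c1 - ?w)"
  proof -
   have "c1 - ?w = (SUM I:R1 - {E}. fcm \<lfloor>ct I\<rfloor> (fof I))"
    unfolding c1_def sum.remove[OF R1(1) ad] by (simp add: E(7))
   moreover have "singular_chain n (sbt ?Y (Mt - {x})) (SUM I:R1 - {E}. fcm \<lfloor>ct I\<rfloor> (fof I))"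
   proof (intro singular_chain_sum singular_chain_cmul)
    fix I assume "I : R1 - {E}"
    hence I: "ct I ~= 0" "I ~= E" using R1(2) by auto
    have "I ` stds n <= Mt - {x}"
     using ct_interior_unique[OF E(1) I(1) E(2)] I(2) E(3) ct_singular[OF I(1)] unfolding ssx_iff by blast
    thus "singular_chain n (sbt ?Y (Mt - {x})) (fof I)"
     unfolding singular_chain_of by (intro singular_simplex_subtopology[THEN iffD2] conjI ct_singular[OF I(1)])
   qed
   ultimately show ?thesis unfolding singular_relboundary
    by (rule_tac exI[of _ 0], rule_tac exI[of _ "c1 - ?w"]) simp
  qed
  ultimately have "rbd n ?Y (Mt - {x}) ((c0 - ?w) - (c1 - ?w))" by (rule singular_relboundary_diff)
  thus "rbd n ?Y (tps ?Y - {x}) (c0 - c1)" by simp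
 qed
 hence b2: "rbd n ?S ?Z (chain_map n f' c0 - chain_map n f' c1)"
  using singular_relboundary_chain_map[OF _ f'_cont] f'Z by (simp flip: chain_map_diff)
 \<comment> \<open>The homotopy keeps the complement of C in the open half sphere around a and hence
   off y; so it applies to c0, whose boundary lies in that complement.\<close>
 have "homotopic_with (%h. h : Mt - C \<rightarrow> ?Z) ?Y (tos (sph n)) (%x. unit n (f x)) (%x. unit n (G (nerve_map k x)))"
 proof (rule sphere_homotopic)
  show "cmp ?Y eur (%x. f x i)" for i using f unfolding nsphere_eq by (simp add: cmp_coords)
  show "cmp ?Y eur (%x. G (nerve_map k x) i)" for i
   using continuous_map_compose[OF nm G_cont[of i]] by (simp add: o_def)
  let ?h = "%x u i. (1 - u) * f x i + u * G (nerve_map k x) i"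
  have pos: "0 < ip n (?h x u) (f x)" if x: "x : Mt" and u: "u : {0..1}" for x u
  proof -
   have "ip n (?h x u) (f x) = (1 - u) * ip n (f x) (f x) + u * ip n (G (nerve_map k x)) (f x)"
    by (simp add: distrib_right sum.distrib sum_distrib_left mult.assoc)
   also have "... = (1 - u) + u * ip n (G (nerve_map k x)) (f x)" using fS[OF x] by simp
   also have "... > 0" using Gf[OF x] u by (cases "u = 0") (auto intro: add_nonneg_pos)
   finally show ?thesis .
  qed
  have S: "0 < ip n (?h x u) (?h x u) & unit n (?h x u) : sph n" if x: "x : Mt" and u: "u : {0..1}" for x u
  proof
   show p: "0 < ip n (?h x u) (?h x u)" by (rule ip_pos[where b="f x"]) (use pos[OF x u] in simp)
   obtain t where t: "t : nerve (\<U> k)" "nerve_map k x : spts t" using Nt[OF nm_top[OF x]] by blast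
   show "unit n (?h x u) : sph n" by (rule unit_in_sph[OF p]) (use fS[OF x] G0[OF t] in simp)
  qed
  thus "0 < ip n (?h x u) (?h x u) & unit n (?h x u) : sph n" if "x : tps ?Y" "u : {0..1}" for x u using that by simp
  show "unit n (?h x u) : ?Z" if x: "x : Mt - C" and u: "u : {0..1}" for x u
  proof -
   have "0 < ip n (unit n (?h x u)) a" using unit_ip[OF pos[of x u]] x u foff[of x] by simp
   hence "unit n (?h x u) ~= y" using y(2) by (metis not_less)
   thus ?thesis using S[of x u] x u by blast
  qed
 qed
 hence "homotopic_with (%h. h : Mt - C \<rightarrow> ?Z) ?Y ?S f f'"
  unfolding nsphere_eq by (rule homotopic_with_eq) (simp add: unit_sph[OF fS], simp add: f'_def F_def, rule Pi_cong, simp)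
 hence b3: "rbd n ?S ?Z (chain_map n f c0 - chain_map n f' c0)" by (rule homotopic_relboundary[OF _ c0(1)])
 let ?z = "chain_map n f c0" and ?H = "relative_homology_group (int n) ?S {a}"
 \<comment> \<open>Three comparisons are added up: f with f' on c0, c0 with c1 under f', and N times
   the image of c1, which bounds by way of the nerve.\<close>
 have "rbd n ?S ?Z (fcm N ((?z - chain_map n f' c0) + (chain_map n f' c0 - chain_map n f' c1)) + fcm N (chain_map n f' c1))"
  by (intro singular_relboundary_add singular_relboundary_cmul b1 b2 b3)
 hence bd: "rbd n ?S ?Z (fcm N ?z)" by (simp flip: frag_cmul_distrib2)
 have fa': "f : Mt - C \<rightarrow> {a}" using foff by auto
 have z: "rcy n ?S {a} ?z" by (rule singular_relcycle_chain_map[OF c0(1) f fa'])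
 have "rbd n ?S {a} (fcm N ?z)"
  by (rule punctured_relboundary[OF y(1) a ya singular_relcycle_cmul[OF z] bd])
 hence "hcl n ?S {a} ?z [^]\<^bsub>?H\<^esub> N = \<one>\<^bsub>?H\<^esub>"
  unfolding hcl_pow[OF z] by (simp add: one_relative_homology_group homologous_rel_set_eq_relboundary)
 moreover have "hcl n ?S {a} ?z = s [^]\<^bsub>?H\<^esub> k0"
  using s(3) hom_induced_chain_map[OF f fa' c0(1)] unfolding c0(2) by simp
 ultimately have "s [^]\<^bsub>?H\<^esub> (k0 * N) = \<one>\<^bsub>?H\<^esub>" using s(1) by (simp add: group.int_pow_pow)
 hence "k0 * N = 0" by (rule sphere_generator_infinite[OF a s(1,2)])
 thus False using k0 N(1) by simp
qed

end

theorem theorem1p2: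
  fixes n m :: nat
    and M :: "'a::topological_space set" and A :: "'a chart set" and \<omega> :: "'a \<Rightarrow> 'a chain set"
    and g :: "'a chart \<Rightarrow> 'a \<Rightarrow> nat \<Rightarrow> nat \<Rightarrow> real"
    and Mt :: "'b::topological_space set" and p :: "'b \<Rightarrow> 'a" and d :: "'b \<Rightarrow> 'b \<Rightarrow> real"
    and K :: "'v::linorder set set" and h :: "('v \<Rightarrow> real) \<Rightarrow> 'a"
    and \<U> :: "nat \<Rightarrow> 'b set set" and r :: "nat \<Rightarrow> 'b set \<Rightarrow> 'b set"
  assumes manifold: "closed_oriented_manifold n M A \<omega>"
    and metric: "riemannian_metric n A g"
    and covering: "universal_covering Mt p M"
    and triangulated: "triangulation_of K h (top_of_set M)"
    and d: "d = riem_dist n A g Mt p"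
    and coarsening: "coarsening_sequence (top_of_set Mt) d \<U>"
    and refinement: "refinement_maps \<U> r"
    and balls: "\<U> m = ball_cover K h (top_of_set Mt) p d"
  shows "(universally_enlargeable n M A \<omega> g Mt p \<longrightarrow>
            macroscopically_large n (top_of_set M) \<omega> K h (top_of_set Mt) p d \<U> r m) \<and>
         (macroscopically_large n (top_of_set M) \<omega> K h (top_of_set Mt) p d \<U> r m \<longrightarrow>
            (\<forall>x0 \<theta> (E :: 'e::topological_space set) q (B :: 'f::topological_space set) \<rho> c.
               x0 \<in> M \<and>
               principal_bundle (fundamental_group M x0) Mt p M \<theta> \<and>
               classifying_space (fundamental_group M x0) E q B \<rho> \<and>
               classifying_map (fundamental_group M x0) Mt p M \<theta> E q B \<rho> c \<longrightarrow>
               qhomology_map n (finite_chains (top_of_set B)) c (fundamental_class n (top_of_set M) \<omega> K h)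
                 \<noteq> \<one>\<^bsub>qhomology_group (finite_chains (top_of_set B)) n\<^esub>))"
proof -
  interpret macro n M A \<omega> K h g Mt p \<U> r m
    by unfold_locales (use assms in simp_all)
  note large = macroscopically_large_iff[folded d]
  show ?thesis
    unfolding large
  proof (intro conjI impI allI notI)
    fix k assume "universally_enlargeable n M A \<omega> g Mt p" "m \<le> k"
      "vchain (ball_at k) \<in> qboundary (Suc n) ` lf_chains (nspc k) (Suc n)"
    then show False using enlargeable_not_boundary by (metis imageE)
  next
    fix x0 \<theta> q \<rho> c and E :: "'e set" and B :: "'f set"
    assume "\<forall>k\<ge>m. vchain (ball_at k) \<notin> qboundary (Suc n) ` lf_chains (nspc k) (Suc n)"
      and bundles: "x0 \<in> M \<and> principal_bundle (fundamental_group M x0) Mt p M \<theta> \<and>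
        classifying_space (fundamental_group M x0) E q B \<rho> \<and> classifying_map (fundamental_group M x0) Mt p M \<theta> E q B \<rho> c"
      and "qhomology_map n (finite_chains (top_of_set B)) c (fundamental_class n (top_of_set M) \<omega> K h)
        = \<one>\<^bsub>qhomology_group (finite_chains (top_of_set B)) n\<^esub>"
    then show False
      using inessential_boundary[of "fundamental_group M x0" \<theta> E q B \<rho> c] unfolding classifying_space_def by blast
  qed
qed

end
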